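(* Assume the following. (1) For every $i\in I$ there is a probability measure $\mu_i$ on $E_i$ such that for all $h\in\mathcal A_i$ and all $x_i\in E_i$, $\lim_{t\to\infty}\frac1t\int_0^t h(X_s)\,ds=\mu_i(h)$ $\mathbf P_{x_i}$-almost surely. (2) For every $t\ge 0$ and $x\in E$, the family $\big(\frac1n\int_0^{nt}b(X_s)\,ds\big)_{n\ge1}$ is uniformly integrable under $\mathbf P_x$. (3) For all $j\in I$, $y\in\mathbb R^d$, $x_j\in E_j$ and $S>0$, $\ \sup_{t>0}\mathbf E_{x_j}\Big[\Big|\frac1S\int_t^{t+S}F_j(y,X_{ns})\,ds-\bar F_j(y)\Big|\Big]\to0$ as $n\to\infty$. (4) For all $j\in I$, $M_j:=\sup_{x\in E_j}|F_j(0,x)|<\infty$. (5) For all $j\in I$, $L_j:=\sup_{x\in E_j}\|F_j(\cdot,x)\|_{\mathrm{Lip}}<\infty$. Let $N\ge1$ and $0<t_1<\cdots<t_N$. Then, for all $x\in E$, $z\in\mathbb R^d$, $k\ge1$ and $f_1,\ldots,f_N\in C_b^1(\mathbb R^d)$, $$\mathbf E_x\big[f_1(\mathbf Z_{t_1}^{n,z})\cdots f_N(\mathbf Z_{t_N}^{n,z})\,\mathbf 1_{\{t_N\le\tau_k^n\}}\big]\underset{n\to\infty}{\longrightarrow}\mathbf E_x\big[f_1(\bar{\mathbf Z}_{t_1}^z)\cdots f_N(\bar{\mathbf Z}_{t_N}^z)\,\mathbf 1_{\{t_N\le\tau_k\}}\big].$$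
   Context: State space. $(I,\mathcal I)$ is a measurable space, $(E_i,\mathcal E_i)_{i\in I}$ are measurable spaces, $E=\bigsqcup_{i\in I}E_i$ has the $\sigma$-algebra of sets $S$ with $S\cap E_i\in\mathcal E_i$ for all $i$, and $\phi:E\to I$ is the index map, $\phi(x)=i$ iff $x\in E_i$. All maps and kernels below are implicitly measurable so that the objects are well defined. Base process. $X=(X_t)_{t\ge0}$ is a progressively measurable $E$-valued process with a family of laws $(\mathbf P_x)_{x\in E}$ ($X$ starts from $x$ under $\mathbf P_x$), not necessarily Markov, with $\mathbf P_{x}(X_t\in E_i\ \forall t\ge0)=1$ for all $i\in I$, $x\in E_i$. Data. $G:\mathbb R_+\to[0,1]$ is an absolutely continuous cumulative distribution function; $b:E\to[0,\infty)$ is measurable with $\int_{0+}b(X_t)\,dt<\infty$ $\mathbf P_x$-a.s. for all $x$; $\pi$ is a probability transition kernel from $E$ to $E$. Accelerated process. For $n\ge1$, the process $\mathbf X^n$ on $E\cup\{\Delta\}$ ($\Delta$ a cemetery) with transition times $0=\tau_0^n<\tau_1^n<\cdots$ is built by piecing out: given $\mathbf X^n_{\tau_k^n}=y$, and independently of the past, $(\mathbf X^n_{\tau_k^n+t})_{0\le t<\tau_{k+1}^n-\tau_k^n}$ is distributed as $(X_{nt})_{0\le t<\sigma^n}$ under $\mathbf P_y$, where $\sigma^n=\inf\{t\ge0: G(\int_0^t b(X_{ns})\,ds)\ge U\}$ with $U$ uniform on $[0,1]$ independent of $X$ ($\inf\emptyset=\infty$); at time $\tau_{k+1}^n<\infty$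 the new position is drawn from $\pi(\mathbf X^n_{\tau_{k+1}^n-},\cdot)$, where $\mathbf X^n_{\tau_{k+1}^n-}$ is the position $X_{n\sigma^n}$ reached by that piece. The process is sent to $\Delta$ at $\tau_\infty^n=\lim_k\tau_k^n$. Set $\mathbf I_t^n=\phi(\mathbf X_t^n)$. Under $\mathbf P_x$, $\mathbf X^n$ starts from $x$. Slow equation. $(F_i)_{i\in I}$ are measurable functions $\mathbb R^d\times E\to\mathbb R^d$; $\mathbf Z^{n,z}$ is the continuous adapted solution (up to $\tau_\infty^n$) of $\frac{d}{dt}\mathbf Z_t^{n,z}=F_{\mathbf I_t^n}(\mathbf Z_t^{n,z},\mathbf X_t^n)$, $\mathbf Z_0^{n,z}=z$ (integral form). Limit. $\mathcal A_i$ is the set of $f\in L^1(\mu_i)$ with $\mathbf P_x(\int_0^t|f(X_s)|\,ds<\infty)=1$ for all $x\in E_i$, $t\ge0$; $\mu_i(h)=\int h\,d\mu_i$; $\bar F_i(z)=\int_{E_i}F_i(z,x)\,\mu_i(dx)$. The limiting index process $(\mathbf I_t)$ is an $I$-valued pure jump semi-Markov process with transition times $0=\tau_0<\tau_1<\cdots$: given $\mathbf I_{\tau_k}=j$ and independently of the past, $\tau_{k+1}-\tau_k$ is distributed as $\inf\{t>0:G(t\mu_j(b))\ge U\}$, $U$ uniform on $[0,1]$ ($=\infty$ if $\mu_j(b)=0$), and, if $\mu_j(b)>0$, independently the next state has law $P(j,J)=\int_{E_j}\frac{\mu_j(dx)}{\mu_j(b)}b(x)\,\pi(x,\phi^{-1}(J))$,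 $J\in\mathcal I$. It is sent to a cemetery at $\tau_\infty=\lim_k\tau_k$. Under $\mathbf P_x$, $\mathbf I_0=\phi(x)$. $\bar{\mathbf Z}^z$ solves (up to $\tau_\infty$) $\frac{d}{dt}\bar{\mathbf Z}_t^z=\bar F_{\mathbf I_t}(\bar{\mathbf Z}_t^z)$, $\bar{\mathbf Z}_0^z=z$. $C_b^1(\mathbb R^d)$: bounded $C^1$ real functions with bounded gradient. $\|\cdot\|_{\mathrm{Lip}}$ is the Lipschitz constant. *)

theory Defs
  imports "HOL-Probability.Probability"
begin

section \<open>State space and base process\<close>

definition disj_union :: "'i measure \<Rightarrow> ('i \<Rightarrow> 'e measure) \<Rightarrow> 'e measure" where
  "disj_union I Ei = sigma (\<Union>i\<in>space I. space (Ei i))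
     {S. S \<subseteq> (\<Union>i\<in>space I. space (Ei i)) \<and> (\<forall>i\<in>space I. S \<inter> space (Ei i) \<in> sets (Ei i))}"

text \<open>The generating family above is already a \<open>\<sigma>\<close>-algebra, so no further sets are added.\<close>

lemma space_disj_union: "space (disj_union I Ei) = (\<Union>i\<in>space I. space (Ei i))"
  unfolding disj_union_def by (rule space_measure_of) blast

lemma sets_disj_union:
  "sets (disj_union I Ei) =
     {S. S \<subseteq> (\<Union>i\<in>space I. space (Ei i)) \<and> (\<forall>i\<in>space I. S \<inter> space (Ei i) \<in> sets (Ei i))}"
  (is "_ = ?A")
proof -
  let ?X = "\<Union>i\<in>space I. space (Ei i)"
  have "sigma_algebra ?X ?A"
  proof (rule sigma_algebra_iff2[THEN iffD2], intro conjI ballI allI impI)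
    show "?A \<subseteq> Pow ?X" by blast
    show "{} \<in> ?A" by simp
  next
    fix S assume S: "S \<in> ?A"
    have "(?X - S) \<inter> space (Ei i) = space (Ei i) - S \<inter> space (Ei i)" if "i \<in> space I" for i
      using that by blast
    then show "?X - S \<in> ?A" using S by auto
  next
    fix A :: "nat \<Rightarrow> _" assume A: "range A \<subseteq> ?A"
    have "(\<Union>k. A k) \<inter> space (Ei i) \<in> sets (Ei i)" if i: "i \<in> space I" for i
    proof -
      have "A k \<inter> space (Ei i) \<in> sets (Ei i)" for k
        using A i by blast
      then have "(\<Union>k. A k \<inter> space (Ei i)) \<in> sets (Ei i)" by blast
      moreover have "(\<Union>k. A k) \<inter> space (Ei i) = (\<Union>k. A k \<inter> space (Ei i))" by blast
      ultimately show ?thesis by metis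
    qed
    moreover have "(\<Union>k. A k) \<subseteq> ?X" using A by blast
    ultimately show "(\<Union>k. A k) \<in> ?A" by blast
  qed
  then show ?thesis unfolding disj_union_def
    by (simp add: sigma_algebra.sets_measure_of_eq)
qed

text \<open>The components are taken as disjoint subsets of one type, so that \<open>E\<close> is literally their
  union; \<open>\<phi>\<close> is the index map.\<close>

definition state_space ::
  "'i measure \<Rightarrow> ('i \<Rightarrow> 'e measure) \<Rightarrow> 'e measure \<Rightarrow> ('e \<Rightarrow> 'i) \<Rightarrow> bool" where
  "state_space I Ei E \<phi> \<longleftrightarrow>
     disjoint_family_on (\<lambda>i. space (Ei i)) (space I) \<and>
     E = disj_union I Ei \<and>
     (\<forall>i\<in>space I. \<forall>x\<in>space (Ei i). \<phi> x = i)"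

definition progressively_measurable ::
  "(real \<Rightarrow> 'o measure) \<Rightarrow> 'e measure \<Rightarrow> (real \<Rightarrow> 'o \<Rightarrow> 'e) \<Rightarrow> bool" where
  "progressively_measurable \<F> E X \<longleftrightarrow>
     (\<forall>t\<ge>0. (\<lambda>(s, \<omega>). X s \<omega>) \<in> restrict_space borel {0..t} \<Otimes>\<^sub>M \<F> t \<rightarrow>\<^sub>M E)"

text \<open>\<open>Om\<close> only serves as a measurable space; the laws are \<open>P x\<close>. The filtration is indexed by
  all reals because that is the library's notion; only times \<open>t \<ge> 0\<close> play a role.\<close>

definition base_process ::
  "'i measure \<Rightarrow> ('i \<Rightarrow> 'e measure) \<Rightarrow> 'e measure \<Rightarrow> 'o measure \<Rightarrow> (real \<Rightarrow> 'o measure)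
     \<Rightarrow> (real \<Rightarrow> 'o \<Rightarrow> 'e) \<Rightarrow> ('e \<Rightarrow> 'o measure) \<Rightarrow> bool" where
  "base_process I Ei E Om \<F> X P \<longleftrightarrow>
     filtration (space Om) \<F> \<and> (\<forall>t. subalgebra Om (\<F> t)) \<and>
     progressively_measurable \<F> E X \<and>
     P \<in> E \<rightarrow>\<^sub>M prob_algebra Om \<and>
     (\<forall>x\<in>space E. AE \<omega> in P x. X 0 \<omega> = x) \<and>
     (\<forall>i\<in>space I. \<forall>x\<in>space (Ei i). AE \<omega> in P x. \<forall>t\<ge>0. X t \<omega> \<in> space (Ei i))"

section \<open>Jump mechanism\<close>

text \<open>\<open>G\<close> is the distribution function of a law on \<open>[0,\<infinity>)\<close> that has a Lebesgue density; only
  the values \<open>G t\<close> with \<open>t \<ge> 0\<close> are used.\<close>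

definition abs_cont_cdf :: "(real \<Rightarrow> real) \<Rightarrow> bool" where
  "abs_cont_cdf G \<longleftrightarrow>
     (\<exists>\<nu>. real_distribution \<nu> \<and> absolutely_continuous lborel \<nu> \<and> measure \<nu> {..<0} = 0 \<and>
          (\<forall>t\<ge>0. G t = cdf \<nu> t))"

definition ext_cdf :: "(real \<Rightarrow> real) \<Rightarrow> ennreal \<Rightarrow> real" where
  "ext_cdf G a = (if a = \<infinity> then 1 else G (enn2real a))"

abbreviation unif01 :: "real measure" where
  "unif01 \<equiv> uniform_measure lborel {0..1}"

definition firing_time ::
  "(real \<Rightarrow> real) \<Rightarrow> ('e \<Rightarrow> real) \<Rightarrow> (real \<Rightarrow> 'o \<Rightarrow> 'e) \<Rightarrow> nat \<Rightarrow> 'o \<Rightarrow> real \<Rightarrow> ennreal" where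
  "firing_time G b X n \<omega> u =
     (INF t\<in>{t. 0 \<le> t \<and>
                ext_cdf G (\<integral>\<^sup>+s\<in>{0..t}. ennreal (b (X (real n * s) \<omega>)) \<partial>lborel) \<ge> u}. ennreal t)"

section \<open>Piecing out\<close>

text \<open>\<open>S k\<close> is the length of the \<open>k\<close>-th piece. A pieced-out path runs through
  \<open>pc k\<close> on \<open>[\<tau>\<^sub>k, \<tau>\<^sub>k\<^sub>+\<^sub>1)\<close>; the cemetery is \<open>None\<close>.\<close>

definition jump_time :: "(nat \<Rightarrow> 'w \<Rightarrow> ennreal) \<Rightarrow> nat \<Rightarrow> 'w \<Rightarrow> ennreal" where
  "jump_time S k w = (\<Sum>l<k. S l w)"

definition lifetime :: "(nat \<Rightarrow> 'w \<Rightarrow> ennreal) \<Rightarrow> 'w \<Rightarrow> ennreal" where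
  "lifetime S w = (SUP k. jump_time S k w)"

definition pieced ::
  "(nat \<Rightarrow> 'w \<Rightarrow> ennreal) \<Rightarrow> (nat \<Rightarrow> real \<Rightarrow> 'w \<Rightarrow> 's) \<Rightarrow> real \<Rightarrow> 'w \<Rightarrow> 's option" where
  "pieced S pc t w =
     (if ennreal t < lifetime S w
      then (let k = (LEAST k. ennreal t < jump_time S (Suc k) w)
            in Some (pc k (t - enn2real (jump_time S k w)) w))
      else None)"

text \<open>\<open>\<sigma>(V\<^sub>l, l < p; R\<^sub>l, l < q)\<close>\<close>

definition history ::
  "'w measure \<Rightarrow> 'a measure \<Rightarrow> (nat \<Rightarrow> 'w \<Rightarrow> 'a) \<Rightarrow> nat
     \<Rightarrow> 'c measure \<Rightarrow> (nat \<Rightarrow> 'w \<Rightarrow> 'c) \<Rightarrow> nat \<Rightarrow> 'w measure" where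
  "history M A V p C R q = sigma (space M)
     ({V l -` B \<inter> space M | l B. l < p \<and> B \<in> sets A} \<union>
      {R l -` D \<inter> space M | l D. l < q \<and> D \<in> sets C})"

text \<open>On the event \<open>Q\<close>, the conditional law of \<open>R\<close> given \<open>H\<close> is \<open>\<kappa>\<close>.\<close>

definition cond_law_on ::
  "'w measure \<Rightarrow> 'w measure \<Rightarrow> ('w \<Rightarrow> bool) \<Rightarrow> ('w \<Rightarrow> 'c) \<Rightarrow> 'c measure
     \<Rightarrow> ('w \<Rightarrow> 'c set \<Rightarrow> ennreal) \<Rightarrow> bool" where
  "cond_law_on M H Q R N \<kappa> \<longleftrightarrow>
     R \<in> M \<rightarrow>\<^sub>M N \<and>
     (\<forall>D\<in>sets N. AE w in M. Q w \<longrightarrow>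
        nn_cond_exp M H (indicator (R -` D \<inter> space M)) w = \<kappa> w D)"

section \<open>The accelerated process\<close>

text \<open>\<open>Y k\<close> is the position at the \<open>k\<close>-th transition time. The \<open>k\<close>-th piece is read off a
  sample point \<open>W k\<close> of the base process drawn from \<open>P (Y k)\<close> and an independent uniform
  variable \<open>U k\<close>; the piece is \<open>t \<mapsto> X (n t) (W k)\<close> up to the
  firing time. Nothing is required of the variables belonging to pieces that are never reached
  (starting at time \<open>\<infinity>\<close>).\<close>

definition piece_len ::
  "(real \<Rightarrow> real) \<Rightarrow> ('e \<Rightarrow> real) \<Rightarrow> (real \<Rightarrow> 'o \<Rightarrow> 'e) \<Rightarrow> nat
     \<Rightarrow> (nat \<Rightarrow> 'w \<Rightarrow> 'o) \<Rightarrow> (nat \<Rightarrow> 'w \<Rightarrow> real) \<Rightarrow> nat \<Rightarrow> 'w \<Rightarrow> ennreal" where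
  "piece_len G b X n W U k w = firing_time G b X n (W k w) (U k w)"

definition accelerated ::
  "'e measure \<Rightarrow> 'o measure \<Rightarrow> (real \<Rightarrow> 'o \<Rightarrow> 'e) \<Rightarrow> ('e \<Rightarrow> 'o measure)
     \<Rightarrow> (real \<Rightarrow> real) \<Rightarrow> ('e \<Rightarrow> real) \<Rightarrow> ('e \<Rightarrow> 'e measure) \<Rightarrow> nat \<Rightarrow> 'e
     \<Rightarrow> 'w measure \<Rightarrow> (nat \<Rightarrow> 'w \<Rightarrow> 'e) \<Rightarrow> (nat \<Rightarrow> 'w \<Rightarrow> 'o) \<Rightarrow> (nat \<Rightarrow> 'w \<Rightarrow> real) \<Rightarrow> bool" where
  "accelerated E Om X P G b \<pi> n x M Y W U \<longleftrightarrow>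
     (let S = piece_len G b X n W U;
          R = (\<lambda>k w. (W k w, U k w));
          N = Om \<Otimes>\<^sub>M borel
      in prob_space M \<and>
         (\<forall>k. Y k \<in> M \<rightarrow>\<^sub>M E) \<and>
         (AE w in M. Y 0 w = x) \<and>
         (\<forall>k. cond_law_on M (history M E Y (Suc k) N R k)
                (\<lambda>w. jump_time S k w < \<infinity>) (R k) N
                (\<lambda>w. emeasure (P (Y k w) \<Otimes>\<^sub>M unif01))) \<and>
         (\<forall>k. cond_law_on M (history M E Y (Suc k) N R (Suc k))
                (\<lambda>w. jump_time S (Suc k) w < \<infinity>) (Y (Suc k)) E
                (\<lambda>w. emeasure (\<pi> (X (real n * enn2real (S k w)) (W k w))))))"

definition accel_path ::
  "(real \<Rightarrow> real) \<Rightarrow> ('e \<Rightarrow> real) \<Rightarrow> (real \<Rightarrow> 'o \<Rightarrow> 'e) \<Rightarrow> nat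
     \<Rightarrow> (nat \<Rightarrow> 'w \<Rightarrow> 'o) \<Rightarrow> (nat \<Rightarrow> 'w \<Rightarrow> real) \<Rightarrow> real \<Rightarrow> 'w \<Rightarrow> 'e option" where
  "accel_path G b X n W U =
     pieced (piece_len G b X n W U) (\<lambda>k s w. X (real n * s) (W k w))"

section \<open>The limiting semi-Markov index process\<close>

definition mean_rate :: "('i \<Rightarrow> 'e measure) \<Rightarrow> ('e \<Rightarrow> real) \<Rightarrow> 'i \<Rightarrow> real" where
  "mean_rate \<mu> b j = (\<integral>x. b x \<partial>\<mu> j)"

definition holding_time :: "(real \<Rightarrow> real) \<Rightarrow> real \<Rightarrow> real \<Rightarrow> ennreal" where
  "holding_time G r u = (if r = 0 then \<infinity> else INF t\<in>{t. 0 < t \<and> G (t * r) \<ge> u}. ennreal t)"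

definition jump_prob ::
  "'e measure \<Rightarrow> ('e \<Rightarrow> 'i) \<Rightarrow> ('i \<Rightarrow> 'e measure) \<Rightarrow> ('e \<Rightarrow> real) \<Rightarrow> ('e \<Rightarrow> 'e measure)
     \<Rightarrow> 'i \<Rightarrow> 'i set \<Rightarrow> ennreal" where
  "jump_prob E \<phi> \<mu> b \<pi> j J =
     (\<integral>\<^sup>+x. ennreal (b x / mean_rate \<mu> b j) * emeasure (\<pi> x) (\<phi> -` J \<inter> space E) \<partial>\<mu> j)"

text \<open>\<open>J k\<close> is the \<open>k\<close>-th state and \<open>T k\<close> its holding time. Conditioning the next state on
  \<open>T k\<close> as well expresses its independence of the holding time.\<close>

definition semi_markov ::
  "'i measure \<Rightarrow> 'e measure \<Rightarrow> ('e \<Rightarrow> 'i) \<Rightarrow> (real \<Rightarrow> real) \<Rightarrow> ('e \<Rightarrow> real) \<Rightarrow> ('e \<Rightarrow> 'e measure)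
     \<Rightarrow> ('i \<Rightarrow> 'e measure) \<Rightarrow> 'e \<Rightarrow> 'v measure \<Rightarrow> (nat \<Rightarrow> 'v \<Rightarrow> 'i) \<Rightarrow> (nat \<Rightarrow> 'v \<Rightarrow> ennreal) \<Rightarrow> bool"
where
  "semi_markov I E \<phi> G b \<pi> \<mu> x M J T \<longleftrightarrow>
     prob_space M \<and>
     (\<forall>k. J k \<in> M \<rightarrow>\<^sub>M I) \<and>
     (AE v in M. J 0 v = \<phi> x) \<and>
     (\<forall>k. cond_law_on M (history M I J (Suc k) borel T k)
            (\<lambda>v. jump_time T k v < \<infinity>) (T k) borel
            (\<lambda>v. emeasure (distr unif01 borel (holding_time G (mean_rate \<mu> b (J k v)))))) \<and>
     (\<forall>k. cond_law_on M (history M I J (Suc k) borel T (Suc k))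
            (\<lambda>v. jump_time T k v < \<infinity> \<and> mean_rate \<mu> b (J k v) > 0) (J (Suc k)) I
            (\<lambda>v. jump_prob E \<phi> \<mu> b \<pi> (J k v)))"

definition index_path ::
  "(nat \<Rightarrow> 'v \<Rightarrow> 'i) \<Rightarrow> (nat \<Rightarrow> 'v \<Rightarrow> ennreal) \<Rightarrow> real \<Rightarrow> 'v \<Rightarrow> 'i option" where
  "index_path J T = pieced T (\<lambda>k s. J k)"

section \<open>Slow variables\<close>

text \<open>Integral form of \<open>dZ\<^sub>t/dt = V\<^sub>t(Z\<^sub>t)\<close>, \<open>Z\<^sub>0 = z\<close>, on \<open>[0, L)\<close> for almost every sample point;
  \<open>Z\<close> is unconstrained from the time \<open>L\<close> on.\<close>

definition solves_upto ::
  "'w measure \<Rightarrow> ('w \<Rightarrow> ennreal) \<Rightarrow> (real \<Rightarrow> 'w \<Rightarrow> real^'d \<Rightarrow> real^'d) \<Rightarrow> real^'d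
     \<Rightarrow> (real \<Rightarrow> 'w \<Rightarrow> real^'d) \<Rightarrow> bool" where
  "solves_upto M L V z Z \<longleftrightarrow>
     (AE w in M.
        continuous_on {t. 0 \<le> t \<and> ennreal t < L w} (\<lambda>t. Z t w) \<and>
        (\<forall>t. 0 \<le> t \<and> ennreal t < L w \<longrightarrow>
           set_integrable lborel {0..t} (\<lambda>s. V s w (Z s w)) \<and>
           Z t w = z + set_lebesgue_integral lborel {0..t} (\<lambda>s. V s w (Z s w))))"

text \<open>The time-dependent field \<open>y \<mapsto> F\<^bsub>\<phi>(\<xi>\<^sub>t)\<^esub>(y, \<xi>\<^sub>t)\<close>; it is only evaluated before the lifetime,
  where \<open>\<xi>\<close> is not in the cemetery.\<close>

definition slow_field ::
  "('i \<Rightarrow> real^'d \<Rightarrow> 'e \<Rightarrow> real^'d) \<Rightarrow> ('e \<Rightarrow> 'i) \<Rightarrow> (real \<Rightarrow> 'w \<Rightarrow> 'e option)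
     \<Rightarrow> real \<Rightarrow> 'w \<Rightarrow> real^'d \<Rightarrow> real^'d" where
  "slow_field F \<phi> \<xi> t w y = F (the (map_option \<phi> (\<xi> t w))) y (the (\<xi> t w))"

definition avg_field ::
  "('i \<Rightarrow> real^'d \<Rightarrow> 'e \<Rightarrow> real^'d) \<Rightarrow> ('i \<Rightarrow> 'e measure) \<Rightarrow> 'i \<Rightarrow> real^'d \<Rightarrow> real^'d" where
  "avg_field F \<mu> i y = (\<integral>x. F i y x \<partial>\<mu> i)"

text \<open>\<open>Z\<close> is adapted to a filtration \<open>\<H>\<close> to which \<open>\<xi>\<close> (with values in \<open>E\<close> plus cemetery) is
  adapted.\<close>

definition adapted_with ::
  "'w measure \<Rightarrow> (real \<Rightarrow> 'w measure) \<Rightarrow> 'e measure \<Rightarrow> (real \<Rightarrow> 'w \<Rightarrow> 'e option)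
     \<Rightarrow> (real \<Rightarrow> 'w \<Rightarrow> real^'d) \<Rightarrow> bool" where
  "adapted_with M \<H> E \<xi> Z \<longleftrightarrow>
     filtration (space M) \<H> \<and> (\<forall>t. subalgebra M (\<H> t)) \<and>
     (\<forall>t\<ge>0. \<forall>S\<in>sets E. {w\<in>space M. \<xi> t w \<in> Some ` S} \<in> sets (\<H> t)) \<and>
     (\<forall>t\<ge>0. Z t \<in> borel_measurable (\<H> t))"

section \<open>Hypotheses and test functions\<close>

definition class_A ::
  "'e measure \<Rightarrow> (real \<Rightarrow> 'o \<Rightarrow> 'e) \<Rightarrow> ('e \<Rightarrow> 'o measure) \<Rightarrow> 'e measure \<Rightarrow> ('e \<Rightarrow> real) set" where
  "class_A Ei X P \<mu>i =
     {h. integrable \<mu>i h \<and>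
         (\<forall>x\<in>space Ei. \<forall>t\<ge>0. AE \<omega> in P x. (\<integral>\<^sup>+s\<in>{0..t}. ennreal \<bar>h (X s \<omega>)\<bar> \<partial>lborel) < \<infinity>)}"

text \<open>Uniform integrability of a family of nonnegative, possibly infinite, random variables:
  \<open>lim\<^bsub>c\<rightarrow>\<infinity>\<^esub> sup\<^sub>n E[f\<^sub>n; f\<^sub>n > c] = 0\<close>.\<close>

definition unif_integrable :: "'o measure \<Rightarrow> 'n set \<Rightarrow> ('n \<Rightarrow> 'o \<Rightarrow> ennreal) \<Rightarrow> bool" where
  "unif_integrable M A f \<longleftrightarrow>
     (\<forall>n\<in>A. f n \<in> borel_measurable M) \<and>
     ((\<lambda>c::real. SUP n\<in>A. \<integral>\<^sup>+\<omega>\<in>{\<omega>. ennreal c < f n \<omega>}. f n \<omega> \<partial>M) \<longlongrightarrow> 0) at_top"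

definition C_b1 :: "(real^'d \<Rightarrow> real) set" where
  "C_b1 = {f. bounded (range f) \<and>
     (\<exists>g. (\<forall>y. GDERIV f y :> g y) \<and> continuous_on UNIV g \<and> bounded (range g))}"

end

theory Submission
 imports Defs
begin

text \<open>
 The slow variable is not a continuous functional of the fast process in any useful topology: the
 index space carries only a \<open>\<sigma>\<close>-algebra. The proof therefore never speaks of weak convergence of
 paths. It replaces every quantity by one that depends on finitely many jumps and on holding times
 rounded to a grid of mesh \<open>1/r\<close>, lets \<open>n\<close> tend to infinity for fixed \<open>r\<close>, and shows that the
 rounding costs little, uniformly for large \<open>n\<close>.

 \<^emph>\<open>One piece.\<close> Along a piece started in component \<open>i\<close>, the clock
 \<open>A\<^sub>n(t) = \<integral>\<^sub>0\<^sup>t b(X(n s)) ds\<close> converges to \<open>t \<mu>\<^sub>i(b)\<close> by the ergodic hypothesis. Given the path, the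
 firing time has density \<open>G'(A\<^sub>n(t)) b(X(n t))\<close>; the second factor makes the position at the firing
 time distributed, in the limit, according to \<open>\<mu>\<^sub>i\<close> weighted by \<open>b\<close>, independently of the time
 (\<open>hit_limit\<close>, \<open>firing_limit\<close>). The derivative \<open>G'\<close> need not be continuous; a layer-cake argument with a dominating
 measure upgrades convergence of distribution functions to convergence against bounded measurable
 functions (\<open>dominated_setwise_convergence\<close>).

 \<^emph>\<open>The chain.\<close> Induction over the jumps turns this into convergence of the joint law of the
 index chain and of the rounded holding times (\<open>chain_limit\<close>). The state of the induction may carry any
 measurable record of the past; here it is the polygon that the explicit Euler scheme with step
 \<open>1/r\<close> draws through the averaged fields, switching field at the rounded jump times.

 \<^emph>\<open>The slow variable.\<close> Both \<open>Z\<^sup>n\<close> and its limit are compared with this one polygon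
 (\<open>euler_error\<close>, \<open>piecewise_euler_error\<close>). For the limit the error tends to 0 pathwise. For \<open>Z\<^sup>n\<close> it is small
 unless some visited component has a large Lipschitz or growth constant, an event of small probability
 by tightness of the chain (\<open>tight\<close>), or unless the average of the field over some grid cell is off
 for one of finitely many velocities, an event whose probability vanishes by the averaging hypothesis
 (\<open>bad_vanish\<close>). Since \<open>{t\<^sub>N \<le> \<tau>\<^sub>k}\<close> is a disjoint union of events \<open>{\<tau>\<^sub>l < t\<^sub>N \<le> \<tau>\<^sub>l\<^sub>+\<^sub>1}\<close>, only finitely
 many pieces matter at a time. Rounding can misplace \<open>\<tau>\<^sub>l\<close> relative to \<open>t\<^sub>N\<close> only if \<open>\<tau>\<^sub>l\<close> is within
 a few grid cells of \<open>t\<^sub>N\<close>, and the limiting jump times have no atoms (\<open>AE_jump_time_neq\<close>).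
\<close>

section \<open>Setwise convergence of dominated measures\<close>

lemma nn_integral_layer_cake:
 assumes M: "sigma_finite_measure M" and g[measurable]: "g \<in> borel_measurable M"
 shows "(\<integral>\<^sup>+x. g x \<partial>M) =
  (\<integral>\<^sup>+s. emeasure M {x\<in>space M. ennreal s < g x} * indicator {0..} s \<partial>lborel)"
proof -
 interpret sigma_finite_measure M by fact
 interpret P: pair_sigma_finite M lborel ..
 have inner: "(\<integral>\<^sup>+s. indicator {0..} s * indicator {s. ennreal s < y} s \<partial>lborel) = y" for y :: ennreal
 proof (cases y)
  case (real r)
  then have "{0..} \<inter> {s. ennreal s < y} = {0..<r}"
   by (auto simp: ennreal_less_iff)
  then show ?thesis using real
   by (simp add: indicator_inter_arith[symmetric])
 next
  case top
  have "of_nat n \<le> emeasure lborel {0::real..}" for n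
   using emeasure_mono[of "{0..real n}" "{0..}" lborel] by (auto simp: ennreal_of_nat_eq_real_of_nat)
  then have "emeasure lborel {0::real..} = \<top>"
   using ennreal_Ex_less_of_nat[of "emeasure lborel {0::real..}"] by (metis leD less_top)
  with top show ?thesis by (simp add: indicator_inter_arith[symmetric])
 qed
 have "(\<integral>\<^sup>+x. g x \<partial>M) = (\<integral>\<^sup>+x. (\<integral>\<^sup>+s. indicator {0..} s * indicator {s. ennreal s < g x} s \<partial>lborel) \<partial>M)"
  by (simp only: inner)
 also have "\<dots> = (\<integral>\<^sup>+x. (\<integral>\<^sup>+s. indicator {0..} s * indicator {p\<in>space (M \<Otimes>\<^sub>M lborel). ennreal (snd p) < g (fst p)} (x, s) \<partial>lborel) \<partial>M)"
  by (intro nn_integral_cong) (auto simp: space_pair_measure indicator_def)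
 also have "\<dots> = (\<integral>\<^sup>+s. (\<integral>\<^sup>+x. indicator {0..} s * indicator {p\<in>space (M \<Otimes>\<^sub>M lborel). ennreal (snd p) < g (fst p)} (x, s) \<partial>M) \<partial>lborel)"
  by (subst P.Fubini'[symmetric]) (auto simp: split_beta')
 also have "\<dots> = (\<integral>\<^sup>+s. (\<integral>\<^sup>+x. indicator {0..} s * indicator {x\<in>space M. ennreal s < g x} x \<partial>M) \<partial>lborel)"
  by (intro nn_integral_cong) (auto simp: space_pair_measure indicator_def)
 also have "\<dots> = (\<integral>\<^sup>+s. emeasure M {x\<in>space M. ennreal s < g x} * indicator {0..} s \<partial>lborel)"
  by (intro nn_integral_cong) (simp add: nn_integral_cmult mult.commute)
 finally show ?thesis .
qed

text \<open>Dominated measures have uniformly integrable densities, so the sets on which convergence holds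
 are closed under monotone limits. Hence half-lines suffice, by the \<open>\<pi>\<close>-\<open>\<lambda>\<close> theorem.\<close>

lemma dominated_setwise_convergence:
 fixes L :: "nat \<Rightarrow> real measure" and L0 D :: "real measure"
 assumes sets[simp]: "\<And>n. sets (L n) = sets borel" "sets L0 = sets borel" "sets D = sets borel"
  and fin: "finite_measure D"
  and dom: "\<And>n B. B \<in> sets borel \<Longrightarrow> emeasure (L n) B \<le> emeasure D B"
  and dom0: "\<And>B. B \<in> sets borel \<Longrightarrow> emeasure L0 B \<le> emeasure D B"
  and ray: "\<And>c. (\<lambda>n. emeasure (L n) {..c}) \<longlonglongrightarrow> emeasure L0 {..c}"
  and tot: "(\<lambda>n. emeasure (L n) UNIV) \<longlonglongrightarrow> emeasure L0 UNIV"
  and B: "B \<in> sets borel"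
 shows "(\<lambda>n. emeasure (L n) B) \<longlonglongrightarrow> emeasure L0 B"
proof -
 interpret D: finite_measure D by fact
 have [simp]: "space (L n) = UNIV" "space L0 = UNIV" "space D = UNIV" for n
  using sets[THEN sets_eq_imp_space_eq] by simp_all
 have Dfin: "emeasure D B < \<infinity>" for B using D.emeasure_finite[of B] by (simp add: less_top[symmetric])
 have Lfin: "emeasure (L n) B < \<infinity>" "emeasure L0 B < \<infinity>" if "B \<in> sets borel" for n B
  using dom[OF that] dom0[OF that] Dfin by (auto intro: le_less_trans)
 have B': "B \<in> sigma_sets UNIV (range (\<lambda>a::real. {..a}))"
  using B by (subst (asm) borel_eq_atMost) simp
 have sig: "A \<in> sets borel" if "A \<in> sigma_sets UNIV (range (\<lambda>a::real. {..a}))" for A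
  using that by (subst borel_eq_atMost) simp
 have subset_Pow: "range (\<lambda>a::real. {..a}) \<subseteq> Pow UNIV" by simp
 have int: "Int_stable (range (\<lambda>a::real. {..a}))"
  by (auto simp: Int_stable_def)
 show ?thesis
  using int subset_Pow B'
 proof (induction rule: sigma_sets_induct_disjoint)
  case (basic A) then show ?case using ray by auto
 next
  case empty then show ?case by simp
 next
  case (compl A)
  have A: "A \<in> sets borel" using compl(1) by (rule sig)
  have "emeasure (L n) (UNIV - A) = emeasure (L n) UNIV - emeasure (L n) A"
   "emeasure L0 (UNIV - A) = emeasure L0 UNIV - emeasure L0 A" for n
   using emeasure_compl[of A "L n"] emeasure_compl[of A L0] A Lfin[OF A] by (auto simp: less_top)
  moreover have "(\<lambda>n. emeasure (L n) UNIV - emeasure (L n) A) \<longlonglongrightarrow> emeasure L0 UNIV - emeasure L0 A"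
   using compl tot Lfin[of UNIV] Lfin[OF A]
   by (intro tendsto_diff_ennreal) auto
  ultimately show ?case by simp
 next
  case (union A)
  have A: "A i \<in> sets borel" for i using union(2) sig by auto
  have 1: "emeasure (L n) (\<Union>i. A i) = (\<integral>\<^sup>+i. emeasure (L n) (A i) \<partial>count_space UNIV)"
   "emeasure L0 (\<Union>i. A i) = (\<integral>\<^sup>+i. emeasure L0 (A i) \<partial>count_space UNIV)"
   "emeasure D (\<Union>i. A i) = (\<integral>\<^sup>+i. emeasure D (A i) \<partial>count_space UNIV)" for n
   using union(1) A by (simp_all add: nn_integral_count_space_nat suminf_emeasure image_subset_iff)
  have "(\<lambda>n. (\<integral>\<^sup>+i. emeasure (L n) (A i) \<partial>count_space UNIV)) \<longlonglongrightarrow> (\<integral>\<^sup>+i. emeasure L0 (A i) \<partial>count_space UNIV)"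
   using union(3) dom A Dfin[of "\<Union>i. A i"]
   by (intro nn_integral_dominated_convergence[where w="\<lambda>i. emeasure D (A i)"])
    (auto simp: 1(3)[symmetric])
  then show ?case by (simp only: 1)
 qed
qed

lemma dominated_setwise_convergence_nn_integral:
 fixes L :: "nat \<Rightarrow> real measure" and L0 D :: "real measure"
 assumes sets[simp, measurable_cong]: "\<And>n. sets (L n) = sets borel" "sets L0 = sets borel" "sets D = sets borel"
  and fin: "finite_measure D"
  and dom: "\<And>n B. B \<in> sets borel \<Longrightarrow> emeasure (L n) B \<le> emeasure D B"
  and dom0: "\<And>B. B \<in> sets borel \<Longrightarrow> emeasure L0 B \<le> emeasure D B"
  and ray: "\<And>c. (\<lambda>n. emeasure (L n) {..c}) \<longlonglongrightarrow> emeasure L0 {..c}"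
  and tot: "(\<lambda>n. emeasure (L n) UNIV) \<longlonglongrightarrow> emeasure L0 UNIV"
  and g[measurable]: "g \<in> borel_measurable borel" and gfin: "(\<integral>\<^sup>+x. g x \<partial>D) < \<infinity>"
 shows "(\<lambda>n. \<integral>\<^sup>+x. g x \<partial>L n) \<longlonglongrightarrow> (\<integral>\<^sup>+x. g x \<partial>L0)"
proof -
 interpret D: finite_measure D by fact
 have [simp]: "space (L n) = UNIV" "space L0 = UNIV" "space D = UNIV" for n
  using sets[THEN sets_eq_imp_space_eq] by simp_all
 have Dfin: "emeasure D B < \<infinity>" for B using D.emeasure_finite[of B] by (simp add: less_top[symmetric])
 have fL: "finite_measure (L n)" for n
  using dom[of UNIV n] Dfin[of UNIV] by (intro finite_measureI) (auto simp: top_unique)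
 have fL0: "finite_measure L0"
  using dom0[of UNIV] Dfin[of UNIV] by (intro finite_measureI) (auto simp: top_unique)
 have sf: "sigma_finite_measure (L n)" "sigma_finite_measure L0" "sigma_finite_measure D" for n
  using fL fL0 fin by (auto simp: finite_measure_def)
 have S: "{x. ennreal s < g x} \<in> sets borel" for s :: real
  by measurable
 have meas: "(\<lambda>s. emeasure M {x. ennreal s < g x} * indicator {0..} s) \<in> borel_measurable lborel"
  if "finite_measure M" "sets M = sets borel" for M
 proof -
  interpret M: finite_measure M by fact
  have [measurable_cong]: "sets M = sets borel" by fact
  have sp: "space M = UNIV" using sets_eq_imp_space_eq[OF that(2)] by simp
  have "(\<lambda>s. emeasure M {x\<in>space M. ennreal s < g x} * indicator {0..} s) \<in> borel_measurable lborel"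
   by measurable
  then show ?thesis by (simp add: sp)
 qed
 have lc: "(\<integral>\<^sup>+x. g x \<partial>M) = (\<integral>\<^sup>+s. emeasure M {x. ennreal s < g x} * indicator {0..} s \<partial>lborel)"
  if "finite_measure M" "sets M = sets borel" for M
 proof -
  have "sigma_finite_measure M" using that(1) by (simp add: finite_measure_def)
  moreover have "g \<in> borel_measurable M" using that(2) by (simp cong: measurable_cong_sets)
  ultimately show ?thesis
   using nn_integral_layer_cake[of M g] sets_eq_imp_space_eq[OF that(2)] by simp
 qed
 have "(\<lambda>n. \<integral>\<^sup>+s. emeasure (L n) {x. ennreal s < g x} * indicator {0..} s \<partial>lborel)
   \<longlonglongrightarrow> (\<integral>\<^sup>+s. emeasure L0 {x. ennreal s < g x} * indicator {0..} s \<partial>lborel)"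
 proof (rule nn_integral_dominated_convergence[where w="\<lambda>s. emeasure D {x. ennreal s < g x} * indicator {0..} s"])
  show "(\<integral>\<^sup>+s. emeasure D {x. ennreal s < g x} * indicator {0..} s \<partial>lborel) < \<infinity>"
   using lc[OF fin] gfin by simp
  have "(\<lambda>n. emeasure (L n) {x. ennreal s < g x} * indicator {0..} s)
    \<longlonglongrightarrow> emeasure L0 {x. ennreal s < g x} * indicator {0..} s" for s
  proof (cases "0 \<le> s")
   case True
   have "(\<lambda>n. emeasure (L n) {x. ennreal s < g x}) \<longlonglongrightarrow> emeasure L0 {x. ennreal s < g x}"
    by (rule dominated_setwise_convergence[where D=D]) (fact | rule S sets)+
   with True show ?thesis by simp
  qed simp
  then show "AE s in lborel. (\<lambda>n. emeasure (L n) {x. ennreal s < g x} * indicator {0..} s)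
    \<longlonglongrightarrow> emeasure L0 {x. ennreal s < g x} * indicator {0..} s" by simp
  show "AE s in lborel. emeasure (L n) {x. ennreal s < g x} * indicator {0..} s
    \<le> emeasure D {x. ennreal s < g x} * indicator {0..} s" for n
   by (intro AE_I2 mult_right_mono dom S) simp
 qed (intro meas fL fL0 fin sets)+
 then show ?thesis using lc fL fL0 by simp
qed

section \<open>Absolutely continuous clocks and their hitting times\<close>

definition cum :: "(real \<Rightarrow> real) \<Rightarrow> real \<Rightarrow> real" where
 "cum a t = enn2real (\<integral>\<^sup>+s\<in>{0..t}. ennreal (a s) \<partial>lborel)"

locale rate_path =
 fixes a :: "real \<Rightarrow> real"
 assumes a_measurable[measurable]: "a \<in> borel_measurable borel"
  and a_nonneg: "\<And>s. 0 \<le> a s"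
  and a_finite: "\<And>t. (\<integral>\<^sup>+s\<in>{0..t}. ennreal (a s) \<partial>lborel) < \<infinity>"
begin

lemma ennreal_cum: "ennreal (cum a t) = (\<integral>\<^sup>+s\<in>{0..t}. ennreal (a s) \<partial>lborel)"
 unfolding cum_def using a_finite[of t] by simp

lemma cum_nonneg[simp]: "0 \<le> cum a t"
 by (simp add: cum_def)

lemma cum_nonpos[simp]: "t \<le> 0 \<Longrightarrow> cum a t = 0"
proof -
 assume "t \<le> 0"
 then have "{0..t} \<subseteq> {0}" by auto
 then have "(\<integral>\<^sup>+s\<in>{0..t}. ennreal (a s) \<partial>lborel) \<le> (\<integral>\<^sup>+s\<in>{0}. ennreal (a s) \<partial>lborel)"
  by (intro nn_integral_mono) (auto split: split_indicator)
 also have "\<dots> = 0"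
  by (intro nn_integral_0_iff_AE[THEN iffD2] AE_I[where N="{0}"]) (auto split: split_indicator)
 finally show ?thesis by (simp add: cum_def)
qed

lemma mono_cum: "mono (cum a)"
proof (rule monoI)
 fix s t :: real assume "s \<le> t"
 then have "ennreal (cum a s) \<le> ennreal (cum a t)"
  unfolding ennreal_cum by (intro nn_integral_mono) (auto split: split_indicator)
 then show "cum a s \<le> cum a t" by simp
qed

definition N :: "real \<Rightarrow> real measure" where
 "N t = density lborel (\<lambda>s. ennreal (a s) * indicator {0..t} s)"

lemma sets_N[simp, measurable_cong]: "sets (N t) = sets borel" and space_N[simp]: "space (N t) = UNIV"
 by (simp_all add: N_def)

lemma emeasure_N_atMost: "emeasure (N t) {..c} = ennreal (cum a (min c t))"
proof -
 have "emeasure (N t) {..c} = (\<integral>\<^sup>+s. ennreal (a s) * indicator {0..t} s * indicator {..c} s \<partial>lborel)"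
  unfolding N_def by (subst emeasure_density) auto
 also have "\<dots> = (\<integral>\<^sup>+s\<in>{0..min c t}. ennreal (a s) \<partial>lborel)"
  by (intro nn_integral_cong) (auto split: split_indicator)
 finally show ?thesis by (simp add: ennreal_cum)
qed

lemma emeasure_N_UNIV: "emeasure (N t) UNIV = ennreal (cum a t)"
 unfolding N_def by (subst emeasure_density) (auto simp: ennreal_cum)

lemma finite_borel_measure_N: "finite_borel_measure (N t)"
 by (intro finite_borel_measure.intro finite_measureI finite_borel_measure_axioms.intro)
  (auto simp: emeasure_N_UNIV)

lemma cdf_N: "cdf (N t) c = cum a (min c t)"
 by (simp add: cdf_def measure_def emeasure_N_atMost)

lemma isCont_cum: "isCont (cum a) t"
proof -
 interpret finite_borel_measure "N (t + 1)" by (rule finite_borel_measure_N)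
 have "emeasure (N (t+1)) {t} = 0"
  unfolding N_def
  by (subst emeasure_density, simp, simp, intro nn_integral_0_iff_AE[THEN iffD2] AE_I[where N="{t}"])
   (auto split: split_indicator)
 then have "isCont (cdf (N (t+1))) t" by (simp add: isCont_cdf measure_def)
 moreover have "\<forall>\<^sub>F c in nhds t. cdf (N (t+1)) c = cum a c"
  using eventually_nhds_in_open[of "{..<t+1}" t] by (auto elim!: eventually_mono simp: cdf_N)
 ultimately show ?thesis by (simp add: isCont_cong)
qed

lemma continuous_cum: "continuous_on S (cum a)"
 using isCont_cum by (simp add: continuous_at_imp_continuous_on)

lemma cum_measurable[measurable]: "cum a \<in> borel_measurable borel"
 by (rule borel_measurable_mono[OF mono_cum])

text \<open>Change of variables for an absolutely continuous, possibly non-injective clock.\<close>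

text \<open>The clock maps the measure \<open>a ds\<close> on \<open>[0, t]\<close> to Lebesgue measure: both give half-lines the same
 mass. No injectivity or differentiability of the clock enters.\<close>

lemma distr_N_cum:
 "distr (N t) borel (cum a) = density lborel (indicator {0..cum a t})"
proof (rule cdf_unique')
 interpret NN: finite_borel_measure "N t" by (rule finite_borel_measure_N)
 show "finite_borel_measure (distr (N t) borel (cum a))"
  by (intro finite_borel_measure.intro finite_borel_measure_axioms.intro NN.finite_measure_distr) auto
 show "finite_borel_measure (density lborel (indicator {0..cum a t}))"
  by (intro finite_borel_measure.intro finite_borel_measure_axioms.intro finite_measureI)
   (auto simp: emeasure_density)
 show "cdf (distr (N t) borel (cum a)) = cdf (density lborel (indicator {0..cum a t}))"
 proof
  fix c
  have R: "emeasure (density lborel (indicator {0..cum a t})) {..c} = emeasure lborel {0..min c (cum a t)}"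
   by (subst emeasure_density) (auto simp: indicator_inter_arith[symmetric] intro!: arg_cong[where f="emeasure lborel"])
  have L: "emeasure (distr (N t) borel (cum a)) {..c} = emeasure (N t) {s. cum a s \<le> c}"
   by (subst emeasure_distr) (auto simp: vimage_def)
  have "emeasure (N t) {s. cum a s \<le> c} = ennreal (max 0 (min c (cum a t)))"
  proof -
   consider "c < 0" | "0 \<le> c" "cum a t \<le> c" | "0 \<le> c" "c < cum a t" by linarith
   then show ?thesis
   proof cases
    case 1
    then have "{s. cum a s \<le> c} = {}" by (auto simp: not_le intro: less_le_trans)
    then show ?thesis using 1 by (simp add: max_def)
   next
    case 2
    have "emeasure (N t) {s. cum a s \<le> c} = emeasure (N t) UNIV"
    proof (rule emeasure_eq_AE)
     show "AE x in N t. (x \<in> {s. cum a s \<le> c}) = (x \<in> UNIV)"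
      unfolding N_def using monoD[OF mono_cum, of _ t] 2
      by (subst AE_density) (auto split: split_indicator intro!: AE_I2 intro: order_trans)
    qed measurable
    then show ?thesis using 2 by (simp add: emeasure_N_UNIV min_def)
   next
    case 3
    have t: "0 \<le> t" using 3 cum_nonpos[of t] by (cases "0 \<le> t") auto
    let ?S = "{s\<in>{0..t}. cum a s \<le> c}"
    have "closed {s. cum a s \<le> c}"
     by (intro closed_Collect_le continuous_cum continuous_intros)
    then have "compact ({0..t} \<inter> {s. cum a s \<le> c})"
     by (intro compact_Int_closed) auto
    moreover have "?S = {0..t} \<inter> {s. cum a s \<le> c}" by blast
    ultimately have comp: "compact ?S" by (simp only:)
    have "0 \<in> ?S" using t 3 by simp
    then have "?S \<noteq> {}" by blast
    from compact_attains_sup[OF comp this]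
    obtain s where s: "s \<in> ?S" "\<And>s'. s' \<in> ?S \<Longrightarrow> s' \<le> s"
     by blast
    have "cum a s = c"
    proof (rule ccontr)
     assume "cum a s \<noteq> c"
     then have "\<exists>y\<ge>s. y \<le> t \<and> cum a y = c"
      using s(1) 3 by (intro IVT' continuous_cum) auto
     then obtain y where "s \<le> y" "y \<le> t" "cum a y = c" by auto
     with s(2)[of y] s(1) \<open>cum a s \<noteq> c\<close> show False by auto
    qed
    have "emeasure (N t) {s. cum a s \<le> c} = emeasure (N t) {..s}"
    proof (rule emeasure_eq_AE)
     have "cum a s' \<le> c \<longleftrightarrow> s' \<le> s" if "s' \<in> {0..t}" for s'
      using s(2)[of s'] that monoD[OF mono_cum, of s' s] \<open>cum a s = c\<close> by auto
     then show "AE x in N t. (x \<in> {s. cum a s \<le> c}) = (x \<in> {..s})"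
      unfolding N_def by (subst AE_density) (auto split: split_indicator intro!: AE_I2)
    qed (auto, measurable)
    also have "\<dots> = ennreal c"
     using s(1) \<open>cum a s = c\<close> by (simp add: emeasure_N_atMost min_def)
    finally show ?thesis using 3 by simp
   qed
  qed
  then show "cdf (distr (N t) borel (cum a)) c = cdf (density lborel (indicator {0..cum a t})) c"
   by (simp add: cdf_def measure_def L R max_def)
 qed
qed

lemma nn_integral_cum:
 assumes [measurable]: "f \<in> borel_measurable borel"
 shows "(\<integral>\<^sup>+s. f (cum a s) * (ennreal (a s) * indicator {0..t} s) \<partial>lborel) = (\<integral>\<^sup>+x\<in>{0..cum a t}. f x \<partial>lborel)"
proof -
 have "(\<integral>\<^sup>+s. f (cum a s) * (ennreal (a s) * indicator {0..t} s) \<partial>lborel) = (\<integral>\<^sup>+s. f (cum a s) \<partial>N t)"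
  unfolding N_def by (subst nn_integral_density) (auto simp: ac_simps)
 also have "\<dots> = (\<integral>\<^sup>+x. f x \<partial>distr (N t) borel (cum a))"
  by (subst nn_integral_distr) auto
 also have "\<dots> = (\<integral>\<^sup>+x\<in>{0..cum a t}. f x \<partial>lborel)"
  unfolding distr_N_cum by (subst nn_integral_density) (auto simp: ac_simps)
 finally show ?thesis .
qed

end

definition hit :: "(real \<Rightarrow> real) \<Rightarrow> real \<Rightarrow> ennreal" where
 "hit C u = (INF t\<in>{t. 0 \<le> t \<and> u \<le> C t}. ennreal t)"

lemma hit_mono: "u \<le> v \<Longrightarrow> hit C u \<le> hit C v"
 unfolding hit_def by (intro INF_superset_mono) auto

lemma hit_less_D:
 assumes "mono C" "hit C u < ennreal t" shows "u \<le> C t"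
proof -
 obtain s where "0 \<le> s" "u \<le> C s" "ennreal s < ennreal t"
  using assms(2) unfolding hit_def INF_less_iff by auto
 then have "s \<le> t" by (simp add: ennreal_less_iff)
 then show ?thesis using monoD[OF assms(1)] \<open>u \<le> C s\<close> by (meson order_trans)
qed

lemma hit_lessI:
 assumes C: "\<And>t. isCont C t" and t: "0 < t" "u < C t" shows "hit C u < ennreal t"
proof -
 have "(C \<longlongrightarrow> C t) (at_left t)"
  using C[of t] by (simp add: isCont_def filterlim_at_split)
 then have "\<forall>\<^sub>F s in at_left t. u < C s" using t(2) by (rule order_tendstoD)
 moreover have "\<forall>\<^sub>F s in at_left t. s \<in> {0<..<t}"
  using t(1) by (rule eventually_at_left_real)
 ultimately have "\<forall>\<^sub>F s in at_left t. u < C s \<and> s \<in> {0<..<t}" by (rule eventually_conj)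
 then obtain s where s: "0 < s" "s < t" "u < C s"
  using eventually_happens[of _ "at_left t"] by (auto simp: trivial_limit_at_left_real)
 have "hit C u \<le> ennreal s"
  unfolding hit_def using s by (intro INF_lower) auto
 also have "\<dots> < ennreal t" using s by (simp add: ennreal_less_iff)
 finally show ?thesis .
qed

lemma hit_le_iff:
 assumes C: "mono C" "\<And>t. isCont C t" and t: "0 \<le> t"
 shows "hit C u \<le> ennreal t \<longleftrightarrow> u \<le> C t"
proof
 assume "u \<le> C t" then show "hit C u \<le> ennreal t"
  unfolding hit_def using t by (intro INF_lower) auto
next
 assume h: "hit C u \<le> ennreal t"
 have "\<forall>\<^sub>F s in at_right t. u \<le> C s"
 proof -
  have "u \<le> C s" if "t < s" for s
   using h that t by (intro hit_less_D[OF C(1)]) (auto intro: le_less_trans simp: ennreal_less_iff)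
  then show ?thesis by (simp add: eventually_at_filter)
 qed
 moreover have "(C \<longlongrightarrow> C t) (at_right t)"
  using C(2)[of t] by (simp add: isCont_def filterlim_at_split)
 ultimately show "u \<le> C t"
  by (intro tendsto_lowerbound[of C "C t" "at_right t" u]) auto
qed

lemma hit_measurable[measurable]: "hit C \<in> borel_measurable borel"
proof (rule borel_measurableI_less)
 fix y
 have "mono (\<lambda>u. - indicator {u. hit C u < y} u :: real)"
  by (auto intro!: monoI split: split_indicator dest: le_less_trans[OF hit_mono])
 then have [measurable]: "(\<lambda>u. - indicator {u. hit C u < y} u :: real) \<in> borel_measurable borel"
  by (rule borel_measurable_mono)
 have "{u. - indicator {u. hit C u < y} u = (- 1 :: real)} \<in> sets borel" by measurable
 also have "{u. - indicator {u. hit C u < y} u = (- 1 :: real)} = {u \<in> space borel. hit C u < y}"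
  by (auto split: split_indicator)
 finally show "{u \<in> space borel. hit C u < y} \<in> sets borel" .
qed

lemma emeasure_unif01_atMost: "0 \<le> c \<Longrightarrow> c \<le> 1 \<Longrightarrow> emeasure unif01 {..c} = ennreal c"
proof -
 assume c: "0 \<le> c" "c \<le> 1"
 have "{0..1} \<inter> {..c} = {0..c}" using c by auto
 then show ?thesis using c by (simp add: emeasure_uniform_measure divide_ennreal ennreal_1[symmetric] del: ennreal_1)
qed

lemma prob_space_unif01: "prob_space unif01"
 by (rule prob_space_uniform_measure) auto

lemma sets_unif01[simp, measurable_cong]: "sets unif01 = sets borel" by simp

lemma AE_unif01: "AE u in unif01. 0 < u \<and> u < 1"
proof -
 have "AE u in lborel. u \<noteq> 0 \<and> u \<noteq> (1::real)"
  using AE_lborel_singleton[of 0] AE_lborel_singleton[of 1] by eventually_elim auto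
 then have "AE u in lborel. u \<in> {0..1} \<longrightarrow> 0 < u \<and> u < (1::real)"
  by eventually_elim auto
 then show ?thesis by (intro AE_uniform_measureI) auto
qed

lemma AE_unif01_singleton: "AE u in unif01. u \<noteq> c"
proof -
 have "AE u in lborel. u \<in> {0..1} \<longrightarrow> u \<noteq> c"
  using AE_lborel_singleton[of c] by eventually_elim auto
 then show ?thesis by (intro AE_uniform_measureI) auto
qed

text \<open>A continuous increasing clock \<open>C\<close> is the distribution function of its own hitting time of a
 uniform level, with mass \<open>1 - C(\<infinity>)\<close> at infinity.\<close>

lemma emeasure_hit_less:
 assumes C: "mono C" "\<And>t. isCont C t" "\<And>t. 0 \<le> C t" "\<And>t. C t \<le> 1" "C 0 = 0" and t: "0 \<le> t"
 shows "emeasure unif01 {u. hit C u < ennreal t} = ennreal (C t)"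
proof (cases "t = 0")
 case False
 have "emeasure unif01 {u. hit C u < ennreal t} = emeasure unif01 {..C t}"
 proof (rule emeasure_eq_AE)
  show "AE u in unif01. (u \<in> {u. hit C u < ennreal t}) = (u \<in> {..C t})"
   using AE_unif01_singleton[of "C t"]
  proof eventually_elim
   case (elim u)
   show ?case
   proof
    assume "u \<in> {u. hit C u < ennreal t}"
    then show "u \<in> {..C t}" using hit_less_D[OF C(1)] by simp
   next
    assume "u \<in> {..C t}"
    then show "u \<in> {u. hit C u < ennreal t}" using elim hit_lessI[OF C(2), of t u] t False by simp
   qed
  qed
  show "{u. hit C u < ennreal t} \<in> sets unif01" by simp measurable
 qed simp
 also have "\<dots> = ennreal (C t)" by (rule emeasure_unif01_atMost[OF C(3)[of t] C(4)[of t]])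
 finally show ?thesis .
qed (simp add: C)

lemma finite_borel_measureI:
 assumes "sets M = sets borel" "emeasure M UNIV \<noteq> \<infinity>"
 shows "finite_borel_measure M"
proof -
 have "space M = UNIV" using sets_eq_imp_space_eq[OF assms(1)] by simp
 then show ?thesis
  using assms by (intro finite_borel_measure.intro finite_borel_measure_axioms.intro finite_measureI) auto
qed

lemma enn2real_le_iff_bounded:
 fixes x :: ennreal
 assumes "0 \<le> c"
 shows "c < t \<Longrightarrow> x < ennreal t \<and> enn2real x \<le> c \<longleftrightarrow> x \<le> ennreal c"
  and "t \<le> c \<Longrightarrow> x < ennreal t \<and> enn2real x \<le> c \<longleftrightarrow> x < ennreal t"
proof -
 have fin: "enn2real x \<le> c \<longleftrightarrow> x \<le> ennreal c" if "x < ennreal t"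
 proof -
  have "x < top" using that ennreal_less_top by (rule less_trans)
  then have "x = ennreal (enn2real x)" by simp
  then show ?thesis using ennreal_le_iff[OF assms, of "enn2real x"] by simp
 qed
 show "x < ennreal t \<and> enn2real x \<le> c \<longleftrightarrow> x \<le> ennreal c" if "c < t"
 proof -
  have "ennreal c < ennreal t" using that assms by (simp add: ennreal_less_iff)
  then have "x \<le> ennreal c \<Longrightarrow> x < ennreal t" by (rule order.strict_trans1[rotated])
  then show ?thesis using fin by blast
 qed
 show "x < ennreal t \<and> enn2real x \<le> c \<longleftrightarrow> x < ennreal t" if "t \<le> c"
 proof -
  have "ennreal t \<le> ennreal c" using that by (rule ennreal_leI)
  then have "x < ennreal t \<Longrightarrow> x \<le> ennreal c" by (meson less_imp_le order.trans)
  then show ?thesis using fin by blast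
 qed
qed

text \<open>Only the density on the half-line matters because clocks are nonnegative.\<close>

locale jump_cdf =
 fixes G :: "real \<Rightarrow> real" and g :: "real \<Rightarrow> ennreal"
 assumes g_measurable[measurable]: "g \<in> borel_measurable borel"
  and G_eq: "\<And>c. 0 \<le> c \<Longrightarrow> ennreal (G c) = (\<integral>\<^sup>+x\<in>{0..c}. g x \<partial>lborel)"
  and g_total: "(\<integral>\<^sup>+x\<in>{0..}. g x \<partial>lborel) = 1"
  and G_nonneg: "\<And>c. 0 \<le> c \<Longrightarrow> 0 \<le> G c"
begin

lemma G_le_1: "0 \<le> c \<Longrightarrow> G c \<le> 1"
proof -
 assume c: "0 \<le> c"
 have "ennreal (G c) \<le> 1"
  unfolding G_eq[OF c] g_total[symmetric] by (intro nn_integral_mono) (auto split: split_indicator)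
 then show ?thesis by simp
qed

definition g' :: "real \<Rightarrow> real" where "g' x = enn2real (g x) * indicator {0..} x"

lemma AE_g_finite: "AE x in lborel. 0 \<le> x \<longrightarrow> g x = ennreal (g' x)"
proof -
 have "AE x in lborel. g x * indicator {0..} x \<noteq> \<infinity>"
  by (rule nn_integral_PInf_AE) (auto simp: g_total)
 then show ?thesis
  by eventually_elim (auto simp: g'_def less_top split: split_indicator)
qed

sublocale g': rate_path g'
proof
 show [measurable]: "g' \<in> borel_measurable borel" unfolding g'_def by measurable
 show "0 \<le> g' s" for s by (simp add: g'_def)
 show "(\<integral>\<^sup>+s\<in>{0..t}. ennreal (g' s) \<partial>lborel) < \<infinity>" for t
 proof -
  have "(\<integral>\<^sup>+s\<in>{0..t}. ennreal (g' s) \<partial>lborel) \<le> (\<integral>\<^sup>+x\<in>{0..}. g x \<partial>lborel)"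
   by (intro nn_integral_mono) (auto simp: g'_def ennreal_enn2real_if split: split_indicator)
  also have "\<dots> < \<infinity>" unfolding g_total by simp
  finally show ?thesis .
 qed
qed

lemma G_eq_cum: "0 \<le> c \<Longrightarrow> G c = cum g' c"
proof -
 assume c: "0 \<le> c"
 have "ennreal (G c) = (\<integral>\<^sup>+x\<in>{0..c}. ennreal (g' x) \<partial>lborel)"
  unfolding G_eq[OF c] using AE_g_finite
  by (intro nn_integral_cong_AE) (auto split: split_indicator elim!: eventually_mono)
 then show ?thesis using G_nonneg[OF c] by (simp add: g'.ennreal_cum[symmetric])
qed

lemma G_0: "G 0 = 0" using G_eq_cum[of 0] by simp

end

lemma abs_cont_cdf_jump_cdf:
 assumes "abs_cont_cdf G" shows "\<exists>g. jump_cdf G g"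
proof -
 from assms obtain \<nu> where \<nu>: "real_distribution \<nu>" "absolutely_continuous lborel \<nu>"
  "measure \<nu> {..<0} = 0" "\<forall>t\<ge>0. G t = cdf \<nu> t" unfolding abs_cont_cdf_def by auto
 interpret real_distribution \<nu> by fact
 obtain g where g: "g \<in> borel_measurable lborel" "density lborel g = \<nu>"
  using sigma_finite_measure.Radon_Nikodym[OF sigma_finite_lborel \<nu>(2)] by auto
 have g'[measurable]: "g \<in> borel_measurable borel" using g(1) by simp
 have neg: "emeasure \<nu> {..<0} = 0" using \<nu>(3) by (simp add: emeasure_eq_measure)
 have e: "(\<integral>\<^sup>+x\<in>{0..} \<inter> B. g x \<partial>lborel) = emeasure \<nu> B" if "B \<in> sets borel" for B
 proof -
  have "emeasure \<nu> B = emeasure \<nu> (B \<inter> {..<0}) + emeasure \<nu> ({0..} \<inter> B)"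
   using that by (subst plus_emeasure) (auto intro!: arg_cong[where f="emeasure \<nu>"])
  also have "emeasure \<nu> (B \<inter> {..<0}) = 0"
   using neg emeasure_mono[of "B \<inter> {..<0}" "{..<0}" \<nu>] by simp
  also have "0 + emeasure \<nu> ({0..} \<inter> B) = (\<integral>\<^sup>+x\<in>{0..} \<inter> B. g x \<partial>lborel)"
   unfolding g(2)[symmetric] using that g(1) by (subst emeasure_density) auto
  finally show ?thesis by simp
 qed
 have "jump_cdf G g"
 proof
  show "0 \<le> G c" if "0 \<le> c" for c using \<nu>(4) that by (simp add: cdf_nonneg)
  show "ennreal (G c) = (\<integral>\<^sup>+x\<in>{0..c}. g x \<partial>lborel)" if "0 \<le> c" for c
  proof -
   have "{0..} \<inter> {..c} = {0..c}" by auto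
   then show ?thesis using e[of "{..c}"] \<nu>(4) that by (simp add: cdf_def emeasure_eq_measure)
  qed
  show "(\<integral>\<^sup>+x\<in>{0..}. g x \<partial>lborel) = 1"
   using e[of UNIV] emeasure_space_1 by simp
 qed (rule g')
 then show ?thesis by blast
qed

locale jump_clock = jump_cdf G g + rate_path a for G g a
begin

definition C :: "real \<Rightarrow> real" where "C t = G (cum a t)"

lemma C_eq: "C = (\<lambda>t. cum g' (cum a t))"
 by (rule ext) (simp only: C_def G_eq_cum[OF cum_nonneg])

lemma mono_C: "mono C"
 unfolding C_eq using g'.mono_cum mono_cum by (auto simp: mono_def)

lemma isCont_C: "isCont C t"
 unfolding C_eq by (rule isCont_o2[OF isCont_cum g'.isCont_cum])

lemma C_0: "t \<le> 0 \<Longrightarrow> C t = 0" by (simp add: C_def G_0)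

lemma C_nonneg: "0 \<le> C t" and C_le_1: "C t \<le> 1"
 by (simp_all add: C_def G_nonneg G_le_1)

text \<open>The law of the firing time has density \<open>g (A s) a s\<close>.\<close>

lemma nn_integral_hit:
 assumes t: "0 \<le> t" and [measurable]: "f \<in> borel_measurable borel"
 shows "(\<integral>\<^sup>+u. f (enn2real (hit C u)) * indicator {u. hit C u < ennreal t} u \<partial>unif01) =
  (\<integral>\<^sup>+s. f s * (g (cum a s) * (ennreal (a s) * indicator {0..t} s)) \<partial>lborel)"
proof -
 define V where "V = unif01"
 interpret U: prob_space V unfolding V_def by (rule prob_space_unif01)
 have sets_V[simp, measurable_cong]: "sets V = sets borel" and space_V[simp]: "space V = UNIV"
  by (simp_all add: V_def)
 have V_atMost: "emeasure V {..C c} = ennreal (C c)" for c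
  unfolding V_def by (rule emeasure_unif01_atMost[OF C_nonneg C_le_1])
 have V_hit: "emeasure V {u. hit C u < ennreal t} = ennreal (C t)"
  unfolding V_def by (rule emeasure_hit_less[OF mono_C isCont_C C_nonneg C_le_1 C_0 t]) simp
 let ?N1 = "distr (density V (indicator {u. hit C u < ennreal t})) borel (\<lambda>u. enn2real (hit C u))"
 let ?N2 = "density lborel (\<lambda>s. g (cum a s) * (ennreal (a s) * indicator {0..t} s))"
 have Ceq: "ennreal (C c) = (\<integral>\<^sup>+s. g (cum a s) * (ennreal (a s) * indicator {0..c} s) \<partial>lborel)" for c
  by (subst nn_integral_cum) (auto simp: C_def G_eq)
 have e2: "emeasure ?N2 {..c} = ennreal (C (min c t))" for c
  unfolding Ceq by (subst emeasure_density) (auto intro!: nn_integral_cong split: split_indicator)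
 have e2': "emeasure ?N2 UNIV = ennreal (C t)"
  unfolding Ceq by (subst emeasure_density) auto
 have e1: "emeasure ?N1 B = emeasure V {u. hit C u < ennreal t \<and> enn2real (hit C u) \<in> B}"
  if [measurable]: "B \<in> sets borel" for B
 proof -
  have m[measurable]: "(\<lambda>u. enn2real (hit C u)) \<in> borel_measurable borel" by measurable
  have S[measurable]: "{u. hit C u < ennreal t \<and> enn2real (hit C u) \<in> B} \<in> sets V"
   unfolding sets_V by measurable
  have B: "(\<lambda>u. enn2real (hit C u)) -` B \<inter> space V \<in> sets V"
   using measurable_sets_borel[OF m that] by simp
  have "emeasure ?N1 B = emeasure (density V (indicator {u. hit C u < ennreal t})) ((\<lambda>u. enn2real (hit C u)) -` B \<inter> space V)"
   by (subst emeasure_distr) auto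
  also have "\<dots> = (\<integral>\<^sup>+u. indicator {u. hit C u < ennreal t} u * indicator ((\<lambda>u. enn2real (hit C u)) -` B \<inter> space V) u \<partial>V)"
   by (rule emeasure_density[OF _ B]) measurable
  also have "\<dots> = (\<integral>\<^sup>+u. indicator {u. hit C u < ennreal t \<and> enn2real (hit C u) \<in> B} u \<partial>V)"
   by (intro nn_integral_cong) (simp split: split_indicator)
  finally show ?thesis using S by simp
 qed
 have borel_UNIV: "UNIV \<in> sets borel" by simp
 have "?N1 = ?N2"
 proof (rule cdf_unique')
  have "emeasure ?N1 UNIV \<noteq> \<infinity>"
   by (simp only: e1[OF borel_UNIV] infinity_ennreal_def U.emeasure_finite not_False_eq_True)
  then show "finite_borel_measure ?N1" by (rule finite_borel_measureI[OF sets_distr])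
  have "emeasure ?N2 UNIV \<noteq> \<infinity>" unfolding e2' by simp
  then show "finite_borel_measure ?N2"
   by (rule finite_borel_measureI[rotated]) simp
  show "cdf ?N1 = cdf ?N2"
  proof
   fix c
   have "emeasure V {u. hit C u < ennreal t \<and> enn2real (hit C u) \<in> {..c}} = ennreal (C (min c t))"
   proof -
    consider "c < 0" | "0 \<le> c" "c < t" | "t \<le> c" by linarith
    then show ?thesis
    proof cases
     case 1
     then have empty: "{u. hit C u < ennreal t \<and> enn2real (hit C u) \<in> {..c}} = {}"
      by (auto simp: not_le intro: less_le_trans)
     show ?thesis unfolding empty using 1 C_0[of "min c t"] by simp
    next
     case 2
     have "hit C u < ennreal t \<and> enn2real (hit C u) \<in> {..c} \<longleftrightarrow> u \<le> C c" for u
     proof -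
      have "hit C u < ennreal t \<and> enn2real (hit C u) \<in> {..c} \<longleftrightarrow> hit C u \<le> ennreal c"
       using enn2real_le_iff_bounded(1)[OF 2] by simp
      then show ?thesis using hit_le_iff[OF mono_C isCont_C 2(1)] by simp
     qed
     then show ?thesis using 2 V_atMost[of c] unfolding atMost_def[symmetric]
      by (simp add: min_def atMost_def)
    next
     case 3
     have "hit C u < ennreal t \<and> enn2real (hit C u) \<in> {..c} \<longleftrightarrow> hit C u < ennreal t" for u
      using enn2real_le_iff_bounded(2)[OF order_trans[OF t 3] 3] by simp
     then show ?thesis using 3 V_hit
      by (simp add: min_def)
    qed
   qed
   then have "emeasure ?N1 {..c} = emeasure ?N2 {..c}" by (simp only: e2 e1[OF atMost_borel])
   then show "cdf ?N1 c = cdf ?N2 c" by (simp only: cdf_def measure_def)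
  qed
 qed
 have "(\<integral>\<^sup>+u. f (enn2real (hit C u)) * indicator {u. hit C u < ennreal t} u \<partial>V) = (\<integral>\<^sup>+s. f s \<partial>?N1)"
  by (subst nn_integral_distr, simp, simp, subst nn_integral_density) (auto simp: ac_simps)
 also have "\<dots> = (\<integral>\<^sup>+s. f s \<partial>?N2)" by (simp only: \<open>?N1 = ?N2\<close>)
 also have "\<dots> = (\<integral>\<^sup>+s. f s * (g (cum a s) * (ennreal (a s) * indicator {0..t} s)) \<partial>lborel)"
  by (subst nn_integral_density) (auto simp: ac_simps)
 finally show ?thesis unfolding V_def .
qed

end

context jump_cdf begin

section \<open>Firing time and mark of one piece\<close>

text \<open>The mark \<open>r\<^sub>n\<close> read off at the firing time is integrated against \<open>g(A\<^sub>n(s)) a\<^sub>n(s) ds\<close>. Under the change of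
 variables \<open>x = A\<^sub>n(s)\<close> the measures \<open>r\<^sub>n a\<^sub>n ds\<close> become dominated by Lebesgue measure and converge on half-lines to
 \<open>\<kappa>/\<beta> dx\<close>, hence setwise, which is enough to integrate the merely measurable \<open>g\<close>. For \<open>\<beta> = 0\<close> both sides vanish.\<close>

lemma hit_limit:
 fixes a r :: "nat \<Rightarrow> real \<Rightarrow> real"
 assumes rp: "\<And>n. rate_path (a n)"
  and r[measurable]: "\<And>n. r n \<in> borel_measurable borel" and r01: "\<And>n s. 0 \<le> r n s" "\<And>n s. r n s \<le> 1"
  and A: "\<And>t. 0 \<le> t \<Longrightarrow> (\<lambda>n. cum (a n) t) \<longlonglongrightarrow> t * \<beta>"
  and B: "\<And>t. 0 \<le> t \<Longrightarrow> (\<lambda>n. cum (\<lambda>s. a n s * r n s) t) \<longlonglongrightarrow> t * \<kappa>"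
  and t: "0 \<le> t"
 shows "(\<lambda>n. \<integral>\<^sup>+u. ennreal (r n (enn2real (hit (\<lambda>t. G (cum (a n) t)) u)))
    * indicator {u. hit (\<lambda>t. G (cum (a n) t)) u < ennreal t} u \<partial>unif01)
   \<longlonglongrightarrow> ennreal (\<kappa> / \<beta> * G (t * \<beta>))" (is "?I \<longlonglongrightarrow> _")
proof -
 have jc: "jump_clock G g (a n)" for n
  by (intro jump_clock.intro jump_cdf_axioms rp)
 have Cn: "jump_clock.C G (a n) = (\<lambda>t. G (cum (a n) t))" for n
  by (rule ext) (rule jump_clock.C_def[OF jc])
 have [measurable]: "a n \<in> borel_measurable borel" for n
  using rp by (rule rate_path.a_measurable)
 have a0: "0 \<le> a n s" for n s using rp by (rule rate_path.a_nonneg)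
 have cm[measurable]: "cum (a n) \<in> borel_measurable borel" for n
  using rp by (rule rate_path.cum_measurable)
 have ar: "a n s * r n s \<le> a n s" for n s
  using r01(2)[of n s] a0[of n s] by (rule mult_left_le)
 have rp': "rate_path (\<lambda>s. a n s * r n s)" for n
 proof
  show "(\<integral>\<^sup>+s\<in>{0..t}. ennreal (a n s * r n s) \<partial>lborel) < \<infinity>" for t
  proof -
   have "(\<integral>\<^sup>+s\<in>{0..t}. ennreal (a n s * r n s) \<partial>lborel) \<le> (\<integral>\<^sup>+s\<in>{0..t}. ennreal (a n s) \<partial>lborel)"
    using ar by (intro nn_integral_mono mult_right_mono) (auto intro: ennreal_leI)
   also have "\<dots> < \<infinity>" using rp by (rule rate_path.a_finite)
   finally show ?thesis .
  qed
 qed (use a0 r01 in auto)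
 have cum_nn: "0 \<le> cum (a n) s" "0 \<le> cum (\<lambda>s. a n s * r n s) s" for n s by (simp_all add: cum_def)
 have cum_le: "cum (\<lambda>s. a n s * r n s) s \<le> cum (a n) s" for n s
 proof -
  have "ennreal (cum (\<lambda>s. a n s * r n s) s) \<le> ennreal (cum (a n) s)"
   unfolding rate_path.ennreal_cum[OF rp] rate_path.ennreal_cum[OF rp']
   using ar by (intro nn_integral_mono mult_right_mono) (auto intro: ennreal_leI)
  then show ?thesis using cum_nn by simp
 qed
 have \<beta>: "0 \<le> \<beta>" using A[of 1] cum_nn by (intro LIMSEQ_le_const[of "\<lambda>n. cum (a n) 1"]) auto
 have \<kappa>: "0 \<le> \<kappa>" using B[of 1] cum_nn
  by (intro LIMSEQ_le_const[of "\<lambda>n. cum (\<lambda>s. a n s * r n s) 1"]) auto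
 have \<kappa>\<beta>: "\<kappa> \<le> \<beta>" using LIMSEQ_le[OF B[of 1] A[of 1]] cum_le by auto
 show ?thesis
 proof (cases "\<beta> = 0")
  case True
  have up: "?I n \<le> ennreal (G (cum (a n) t))" for n
  proof -
   have "?I n \<le> (\<integral>\<^sup>+u. indicator {u. hit (\<lambda>t. G (cum (a n) t)) u < ennreal t} u \<partial>unif01)"
    using r01(2) by (intro nn_integral_mono) (auto split: split_indicator)
   also have "\<dots> = emeasure unif01 {u. hit (\<lambda>t. G (cum (a n) t)) u < ennreal t}"
    by (intro nn_integral_indicator) (unfold sets_unif01, measurable)
   also have "\<dots> = ennreal (G (cum (a n) t))"
    using emeasure_hit_less[OF jump_clock.mono_C[OF jc] jump_clock.isCont_C[OF jc] jump_clock.C_nonneg[OF jc]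
      jump_clock.C_le_1[OF jc] jump_clock.C_0[OF jc order_refl] t]
    unfolding Cn .
   finally show ?thesis .
  qed
  have "(\<lambda>n. cum g' (cum (a n) t)) \<longlonglongrightarrow> cum g' 0"
   using A[OF t] True by (intro isCont_tendsto_compose[OF g'.isCont_cum]) simp
  then have "(\<lambda>n. G (cum (a n) t)) \<longlonglongrightarrow> 0"
   using cum_nn by (simp add: G_eq_cum)
  then have lim: "(\<lambda>n. ennreal (G (cum (a n) t))) \<longlonglongrightarrow> 0"
   using tendsto_ennrealI by fastforce
  have "?I \<longlonglongrightarrow> 0"
   by (rule tendsto_sandwich[OF _ _ tendsto_const lim]) (use up in auto)
  then show ?thesis using True by simp
 next
  case False
  then have \<beta>0: "0 < \<beta>" using \<beta> by simp
  define L where "L n = distr (rate_path.N (\<lambda>s. a n s * r n s) t) borel (cum (a n))" for n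
  define L0 where "L0 = density lborel (\<lambda>x. ennreal (\<kappa> / \<beta>) * indicator {0..t * \<beta>} x)"
  define D where "D = density lborel (indicator {0..t * \<beta> + 1} :: real \<Rightarrow> ennreal)"
  note Nd = rate_path.N_def[OF rp'] rate_path.N_def[OF rp]
  have [simp]: "sets (L n) = sets borel" "sets L0 = sets borel" "sets D = sets borel" for n
   by (simp_all add: L_def L0_def D_def)
  have L_em: "emeasure (L n) S = (\<integral>\<^sup>+s. ennreal (a n s * r n s) * indicator {0..t} s * indicator {s. cum (a n) s \<in> S} s \<partial>lborel)"
   if [measurable]: "S \<in> sets borel" for n S
  proof -
   have m: "cum (a n) -` S \<in> sets borel" using measurable_sets_borel[OF cm that] by simp
   have "emeasure (L n) S = emeasure (rate_path.N (\<lambda>s. a n s * r n s) t) (cum (a n) -` S)"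
    unfolding L_def by (subst emeasure_distr) (simp_all add: Nd)
   also have "\<dots> = (\<integral>\<^sup>+s. ennreal (a n s * r n s) * indicator {0..t} s * indicator (cum (a n) -` S) s \<partial>lborel)"
    unfolding Nd using m by (subst emeasure_density) auto
   finally show ?thesis by (simp add: vimage_def)
  qed
  have dom': "emeasure (L n) S \<le> emeasure lborel ({0..cum (a n) t} \<inter> S)" if [measurable]: "S \<in> sets borel" for n S
  proof -
   have "emeasure (L n) S \<le> (\<integral>\<^sup>+s. indicator S (cum (a n) s) * (ennreal (a n s) * indicator {0..t} s) \<partial>lborel)"
    unfolding L_em[OF that] using ar
    by (intro nn_integral_mono) (auto split: split_indicator intro: ennreal_leI)
   also have "\<dots> = (\<integral>\<^sup>+x\<in>{0..cum (a n) t}. indicator S x \<partial>lborel)"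
    by (rule rate_path.nn_integral_cum[OF rp]) measurable
   also have "\<dots> = (\<integral>\<^sup>+x. indicator ({0..cum (a n) t} \<inter> S) x \<partial>lborel)"
    by (intro nn_integral_cong) (auto split: split_indicator)
   finally show ?thesis by simp
  qed
  have D_em: "emeasure D S = emeasure lborel ({0..t * \<beta> + 1} \<inter> S)" if "S \<in> sets borel" for S
   unfolding D_def using that by (subst emeasure_density) (auto simp: indicator_inter_arith[symmetric])
  have L0_em: "emeasure L0 S = ennreal (\<kappa> / \<beta>) * emeasure lborel ({0..t * \<beta>} \<inter> S)" if "S \<in> sets borel" for S
   unfolding L0_def using that
   by (subst emeasure_density) (auto simp: indicator_inter_arith[symmetric] mult.assoc nn_integral_cmult)
  have "\<forall>\<^sub>F n in sequentially. cum (a n) t < t * \<beta> + 1"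
   using A[OF t] by (rule order_tendstoD) simp
  then obtain n0 where n0: "\<And>n. n \<ge> n0 \<Longrightarrow> cum (a n) t < t * \<beta> + 1"
   by (auto simp: eventually_sequentially)
  have dom: "emeasure (L (n + n0)) S \<le> emeasure D S" if "S \<in> sets borel" for n S
  proof -
   have "emeasure lborel ({0..cum (a (n + n0)) t} \<inter> S) \<le> emeasure lborel ({0..t * \<beta> + 1} \<inter> S)"
    using that n0[of "n + n0"] by (intro emeasure_mono) auto
   with dom'[OF that, of "n + n0"] show ?thesis unfolding D_em[OF that] by (rule order_trans)
  qed
  have \<kappa>\<beta>': "\<kappa> / \<beta> \<le> 1" using \<kappa>\<beta> \<beta>0 by simp
  have dom0: "emeasure L0 S \<le> emeasure D S" if "S \<in> sets borel" for S
  proof -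
   have "emeasure L0 S \<le> 1 * emeasure lborel ({0..t * \<beta>} \<inter> S)"
    unfolding L0_em[OF that] using \<kappa>\<beta>' by (intro mult_right_mono) auto
   also have "\<dots> \<le> emeasure D S"
    unfolding D_em[OF that] using that by (simp, intro emeasure_mono) auto
   finally show ?thesis .
  qed
  have tot': "emeasure (L n) UNIV = ennreal (cum (\<lambda>s. a n s * r n s) t)" for n
   by (subst L_em) (auto simp: rate_path.ennreal_cum[OF rp'])
  have tb: "0 \<le> t * \<beta>" using t \<beta> by simp
  have tot: "(\<lambda>n. emeasure (L n) UNIV) \<longlonglongrightarrow> emeasure L0 UNIV"
   unfolding tot' using tendsto_ennrealI[OF B[OF t]] \<beta>0 tb \<kappa>
   by (simp add: L0_em ennreal_mult[symmetric] mult.commute)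
  have ray: "(\<lambda>n. emeasure (L n) {..c}) \<longlonglongrightarrow> emeasure L0 {..c}" for c
  proof (cases "c < 0")
   case True
   have "emeasure (L n) {..c} = 0" for n
   proof -
    have "{s. cum (a n) s \<in> {..c}} = {}" using True cum_nn(1)[of n] by (auto simp: not_le intro: less_le_trans)
    then show ?thesis by (subst L_em) auto
   qed
   moreover have "{0..t * \<beta>} \<inter> {..c} = {}" using True by auto
   ultimately show ?thesis by (simp add: L0_em)
  next
   case False
   then have c: "0 \<le> c" by simp
   define \<theta> where "\<theta> = min (c / \<beta>) t"
   define m where "m n = enn2real (emeasure (L n) {..c})" for n
   have Lfin: "emeasure (L n) {..c} = ennreal (m n)" for n
   proof -
    have "emeasure (L n) {..c} \<le> emeasure (L n) UNIV" by (intro emeasure_mono) auto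
    also have "\<dots> < top" by (simp add: tot')
    finally show ?thesis unfolding m_def by simp
   qed
   have m0: "0 \<le> m n" for n by (simp add: m_def)
   have low: "cum (\<lambda>s. a n s * r n s) s1 \<le> m n" if "cum (a n) s1 \<le> c" "s1 \<le> t" for n s1
   proof -
    have "cum (a n) s \<le> c" if "s \<le> s1" for s
     using \<open>cum (a n) s1 \<le> c\<close> monoD[OF rate_path.mono_cum[OF rp] that, of n] by simp
    then have "ennreal (cum (\<lambda>s. a n s * r n s) s1) \<le> ennreal (m n)"
     unfolding Lfin[symmetric] rate_path.ennreal_cum[OF rp'] using \<open>s1 \<le> t\<close>
     by (subst L_em) (auto intro!: nn_integral_mono split: split_indicator)
    then show ?thesis using m0 by simp
   qed
   have upp: "m n \<le> cum (\<lambda>s. a n s * r n s) s2" if "c < cum (a n) s2 \<or> s2 = t" for n s2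
   proof -
    have "s \<le> s2" if "s \<le> t" "cum (a n) s \<le> c" for s
     using that \<open>c < cum (a n) s2 \<or> s2 = t\<close> monoD[OF rate_path.mono_cum[OF rp], of s2 s n] by linarith
    then have "ennreal (m n) \<le> ennreal (cum (\<lambda>s. a n s * r n s) s2)"
     unfolding Lfin[symmetric] rate_path.ennreal_cum[OF rp']
     by (subst L_em) (auto intro!: nn_integral_mono split: split_indicator)
    then show ?thesis using cum_nn by simp
   qed
   have "m \<longlonglongrightarrow> \<kappa> * \<theta>"
   proof (rule order_tendstoI)
    fix x assume x: "x < \<kappa> * \<theta>"
    show "\<forall>\<^sub>F n in sequentially. x < m n"
    proof (cases "x < 0")
     case True
     then have "x < m n" for n using m0[of n] by linarith
     then show ?thesis by simp
    next
     case False
     then have k: "0 < \<kappa>" using x \<kappa> by (cases "\<kappa> = 0") auto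
     then have "x / \<kappa> < \<theta>" using x by (simp add: field_simps)
     then obtain s1 where s1: "x / \<kappa> < s1" "s1 < \<theta>" using dense by blast
     have "0 \<le> x / \<kappa>" using False k by simp
     then have s10: "0 \<le> s1" using s1(1) by linarith
     have "s1 * \<beta> < c" using s1(2) \<beta>0 by (simp add: \<theta>_def field_simps)
     then have "\<forall>\<^sub>F n in sequentially. cum (a n) s1 < c" using A[OF s10] by (rule order_tendstoD(2)[rotated])
     moreover have "x < s1 * \<kappa>" using s1(1) k by (simp add: field_simps)
     then have "\<forall>\<^sub>F n in sequentially. x < cum (\<lambda>s. a n s * r n s) s1" using B[OF s10] by (rule order_tendstoD(1)[rotated])
     ultimately show ?thesis
     proof eventually_elim
      case (elim n)
      then show ?case using low[of n s1] s1(2) by (simp add: \<theta>_def)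
     qed
    qed
   next
    fix x assume x: "\<kappa> * \<theta> < x"
    obtain s2 where s2: "\<kappa> * s2 < x" "(s2 = t \<or> \<theta> < s2)" "0 \<le> s2" "s2 = t \<or> \<theta> = c / \<beta>"
    proof (cases "\<theta> = t")
     case True then show ?thesis using that[of t] x t by simp
    next
     case False
     then have th: "\<theta> = c / \<beta>" by (auto simp: \<theta>_def min_def split: if_splits)
     have "0 \<le> \<theta>" using th c \<beta>0 by simp
     show ?thesis
     proof (cases "\<kappa> = 0")
      case True then show ?thesis using that[of "\<theta> + 1"] x th \<open>0 \<le> \<theta>\<close> by simp
     next
      case False
      then have k: "0 < \<kappa>" using \<kappa> by simp
      then have "\<theta> < x / \<kappa>" using x by (simp add: field_simps)
      then obtain s2 where "\<theta> < s2" "s2 < x / \<kappa>" using dense by blast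
      then show ?thesis using that[of s2] k th \<open>0 \<le> \<theta>\<close> by (simp add: field_simps)
     qed
    qed
    have e1: "\<forall>\<^sub>F n in sequentially. cum (\<lambda>s. a n s * r n s) s2 < x"
     using s2(1) by (intro order_tendstoD(2)[OF B[OF s2(3)]]) (simp add: mult.commute)
    have e2: "\<forall>\<^sub>F n in sequentially. c < cum (a n) s2 \<or> s2 = t"
    proof (cases "s2 = t")
     case False
     then have "c < s2 * \<beta>" using s2 \<beta>0 by (metis pos_divide_less_eq)
     from order_tendstoD(1)[OF A[OF s2(3)] this] show ?thesis by (auto elim: eventually_mono)
    qed simp
    from e1 e2 show "\<forall>\<^sub>F n in sequentially. m n < x"
     by eventually_elim (auto intro: le_less_trans[OF upp])
   qed
   then have "(\<lambda>n. emeasure (L n) {..c}) \<longlonglongrightarrow> ennreal (\<kappa> * \<theta>)"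
    unfolding Lfin by (rule tendsto_ennrealI)
   also have "ennreal (\<kappa> * \<theta>) = emeasure L0 {..c}"
   proof -
    have "{0..t * \<beta>} \<inter> {..c} = {0..\<theta> * \<beta>}"
     using \<beta>0 by (auto simp: \<theta>_def min_def field_simps)
    moreover have "0 \<le> \<theta>" using c t \<beta>0 by (simp add: \<theta>_def)
    ultimately show ?thesis using \<beta>0 \<kappa> by (simp add: L0_em ennreal_mult[symmetric])
   qed
   finally show ?thesis .
  qed
  have lim: "(\<lambda>n. \<integral>\<^sup>+x. g x \<partial>L (n + n0)) \<longlonglongrightarrow> (\<integral>\<^sup>+x. g x \<partial>L0)"
  proof (rule dominated_setwise_convergence_nn_integral[where D=D])
   show "finite_measure D"
   proof (rule finite_measureI)
    show "emeasure D (space D) \<noteq> \<infinity>"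
     using tb by (simp add: D_def emeasure_density)
   qed
   show "(\<lambda>n. emeasure (L (n + n0)) {..c}) \<longlonglongrightarrow> emeasure L0 {..c}" for c
    using ray by (rule LIMSEQ_ignore_initial_segment)
   show "(\<lambda>n. emeasure (L (n + n0)) UNIV) \<longlonglongrightarrow> emeasure L0 UNIV"
    using tot by (rule LIMSEQ_ignore_initial_segment)
   have "(\<integral>\<^sup>+x. g x \<partial>D) = (\<integral>\<^sup>+x\<in>{0..t * \<beta> + 1}. g x \<partial>lborel)"
    unfolding D_def by (subst nn_integral_density) (auto simp: ac_simps)
   also have "\<dots> < \<infinity>" using G_eq[of "t * \<beta> + 1"] tb by (simp flip: G_eq)
   finally show "(\<integral>\<^sup>+x. g x \<partial>D) < \<infinity>" .
  qed (simp_all add: dom dom0)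
  have "(\<integral>\<^sup>+x. g x \<partial>L0) = ennreal (\<kappa> / \<beta>) * (\<integral>\<^sup>+x\<in>{0..t * \<beta>}. g x \<partial>lborel)"
   unfolding L0_def by (subst nn_integral_density) (auto simp: ac_simps nn_integral_cmult[symmetric])
  also have "\<dots> = ennreal (\<kappa> / \<beta> * G (t * \<beta>))"
   using \<beta>0 \<kappa> tb G_nonneg[OF tb] by (simp add: ennreal_mult[symmetric] flip: G_eq)
  finally have L0g: "(\<integral>\<^sup>+x. g x \<partial>L0) = ennreal (\<kappa> / \<beta> * G (t * \<beta>))" .
  have Lg: "(\<integral>\<^sup>+x. g x \<partial>L n) = ?I n" for n
  proof -
   have "(\<integral>\<^sup>+x. g x \<partial>L n) = (\<integral>\<^sup>+s. g (cum (a n) s) \<partial>rate_path.N (\<lambda>s. a n s * r n s) t)"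
    unfolding L_def by (subst nn_integral_distr) (simp_all add: Nd)
   also have "\<dots> = (\<integral>\<^sup>+s. ennreal (r n s) * (g (cum (a n) s) * (ennreal (a n s) * indicator {0..t} s)) \<partial>lborel)"
    unfolding Nd using a0 r01 by (subst nn_integral_density) (auto simp: ennreal_mult ac_simps)
   also have "\<dots> = ?I n"
    by (subst jump_clock.nn_integral_hit[OF jc t, symmetric]) (simp_all add: Cn)
   finally show ?thesis .
  qed
  show ?thesis using LIMSEQ_offset[OF lim] unfolding L0g Lg .
 qed
qed

end

section \<open>Disintegration along the history\<close>

text \<open>From indicators of measurable sets, for which the claim is the definition of the conditional law, to
 functions of past and present by monotone classes.\<close>

lemma cond_law_on_nn_integral:
 fixes K :: "'a \<Rightarrow> 'c measure"
 assumes M: "prob_space M" and sub: "subalgebra M H"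
  and Q: "{w\<in>space M. Q w} \<in> sets H"
  and V: "V \<in> H \<rightarrow>\<^sub>M A" and K[measurable]: "K \<in> A \<rightarrow>\<^sub>M subprob_algebra N"
  and c: "cond_law_on M H Q R N \<kappa>"
  and \<kappa>: "\<And>w D. w \<in> space M \<Longrightarrow> Q w \<Longrightarrow> D \<in> sets N \<Longrightarrow> \<kappa> w D = emeasure (K (V w)) D"
  and \<Phi>[measurable]: "(\<lambda>(a, r). \<Phi> a r) \<in> borel_measurable (A \<Otimes>\<^sub>M N)"
 shows "(\<integral>\<^sup>+w. indicator {w\<in>space M. Q w} w * \<Phi> (V w) (R w) \<partial>M) =
  (\<integral>\<^sup>+w. indicator {w\<in>space M. Q w} w * (\<integral>\<^sup>+r. \<Phi> (V w) r \<partial>K (V w)) \<partial>M)"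
proof -
 interpret M: prob_space M by fact
 interpret finite_measure_subalgebra M H
  by (intro finite_measure_subalgebra.intro finite_measure_subalgebra_axioms.intro sub M.finite_measure_axioms)
 have R[measurable]: "R \<in> M \<rightarrow>\<^sub>M N" using c by (simp add: cond_law_on_def)
 have VM[measurable]: "V \<in> M \<rightarrow>\<^sub>M A" by (rule measurable_from_subalg[OF sub V])
 have QM[measurable]: "{w\<in>space M. Q w} \<in> sets M" using Q sub by (auto simp: subalgebra_def)
 let ?q = "indicator {w\<in>space M. Q w} :: _ \<Rightarrow> ennreal"
 let ?P = "\<lambda>a. distr (K a) (A \<Otimes>\<^sub>M N) (\<lambda>r. (a, r))"
 define \<rho> where "\<rho> = distr (density M ?q) A V"
 define \<mu>1 where "\<mu>1 = distr (density M ?q) (A \<Otimes>\<^sub>M N) (\<lambda>w. (V w, R w))"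
 define \<mu>2 where "\<mu>2 = \<rho> \<bind> ?P"
 have P[measurable]: "?P \<in> A \<rightarrow>\<^sub>M subprob_algebra (A \<Otimes>\<^sub>M N)"
  by (rule measurable_distr2[where M=N]) measurable
 have P': "?P \<in> \<rho> \<rightarrow>\<^sub>M subprob_algebra (A \<Otimes>\<^sub>M N)"
  using P unfolding \<rho>_def by (simp cong: measurable_cong_sets)
 have Kset: "sets (K a) = sets N" if "a \<in> space A" for a
  using measurable_space[OF K that] by (simp add: space_subprob_algebra)
 have Kmeas: "(\<lambda>r. (a, r)) \<in> K a \<rightarrow>\<^sub>M A \<Otimes>\<^sub>M N" if "a \<in> space A" for a
  using that Kset[OF that] by (simp cong: measurable_cong_sets)
 have int2: "(\<integral>\<^sup>+x. f x \<partial>\<mu>2) = (\<integral>\<^sup>+w. ?q w * (\<integral>\<^sup>+r. f (V w, r) \<partial>K (V w)) \<partial>M)"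
  if f[measurable]: "f \<in> borel_measurable (A \<Otimes>\<^sub>M N)" for f
 proof -
  have m: "(\<lambda>a. \<integral>\<^sup>+r. f (a, r) \<partial>K a) \<in> borel_measurable A"
   by (rule nn_integral_measurable_subprob_algebra2[where N=N]) measurable
  have "(\<integral>\<^sup>+x. f x \<partial>\<mu>2) = (\<integral>\<^sup>+a. (\<integral>\<^sup>+x. f x \<partial>?P a) \<partial>\<rho>)"
   unfolding \<mu>2_def by (rule nn_integral_bind[OF f P'])
  also have "\<dots> = (\<integral>\<^sup>+a. (\<integral>\<^sup>+r. f (a, r) \<partial>K a) \<partial>\<rho>)"
  proof (rule nn_integral_cong)
   fix a assume "a \<in> space \<rho>"
   then have "a \<in> space A" by (simp add: \<rho>_def)
   then show "(\<integral>\<^sup>+x. f x \<partial>?P a) = (\<integral>\<^sup>+r. f (a, r) \<partial>K a)"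
    using Kmeas by (subst nn_integral_distr) auto
  qed
  also have "\<dots> = (\<integral>\<^sup>+w. (\<integral>\<^sup>+r. f (V w, r) \<partial>K (V w)) \<partial>density M ?q)"
   unfolding \<rho>_def using m by (subst nn_integral_distr) auto
  also have "\<dots> = (\<integral>\<^sup>+w. ?q w * (\<integral>\<^sup>+r. f (V w, r) \<partial>K (V w)) \<partial>M)"
   using measurable_compose[OF VM m] by (subst nn_integral_density) auto
  finally show ?thesis .
 qed
 have int1: "(\<integral>\<^sup>+x. f x \<partial>\<mu>1) = (\<integral>\<^sup>+w. ?q w * f (V w, R w) \<partial>M)"
  if f[measurable]: "f \<in> borel_measurable (A \<Otimes>\<^sub>M N)" for f
  unfolding \<mu>1_def by (subst nn_integral_distr, simp, simp, subst nn_integral_density) auto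
 have sets1[simp]: "sets \<mu>1 = sets (A \<Otimes>\<^sub>M N)" by (simp add: \<mu>1_def)
 have eq_rect: "emeasure \<mu>1 (a \<times> d) = emeasure \<mu>2 (a \<times> d)" and
  sets2: "sets \<mu>2 = sets (A \<Otimes>\<^sub>M N)" if a[measurable]: "a \<in> sets A" and d[measurable]: "d \<in> sets N" for a d
 proof -
  have "space M \<noteq> {}" by (rule M.not_empty)
  then have "space \<rho> \<noteq> {}" using measurable_space[OF VM] by (auto simp: \<rho>_def)
  then show sets2: "sets \<mu>2 = sets (A \<Otimes>\<^sub>M N)"
   unfolding \<mu>2_def by (intro sets_bind[where N="A \<Otimes>\<^sub>M N"]) (auto simp: \<rho>_def)
  have [measurable]: "(\<lambda>w. ?q w * indicator a (V w)) \<in> borel_measurable H"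
   using measurable_sets[OF V a] Q V by measurable
  have "emeasure \<mu>1 (a \<times> d) = (\<integral>\<^sup>+w. ?q w * indicator (a \<times> d) (V w, R w) \<partial>M)"
   using int1[of "indicator (a \<times> d)"] by simp
  also have "\<dots> = (\<integral>\<^sup>+w. (?q w * indicator a (V w)) * indicator (R -` d \<inter> space M) w \<partial>M)"
   by (intro nn_integral_cong) (auto split: split_indicator)
  also have "\<dots> = (\<integral>\<^sup>+w. (?q w * indicator a (V w)) * nn_cond_exp M H (indicator (R -` d \<inter> space M)) w \<partial>M)"
   by (rule nn_cond_exp_intg[symmetric]) auto
  also have "\<dots> = (\<integral>\<^sup>+w. ?q w * (indicator a (V w) * emeasure (K (V w)) d) \<partial>M)"
  proof (rule nn_integral_cong_AE)
   have "AE w in M. Q w \<longrightarrow> nn_cond_exp M H (indicator (R -` d \<inter> space M)) w = \<kappa> w d"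
    using c d by (simp add: cond_law_on_def)
   with AE_space show "AE w in M. ?q w * indicator a (V w) * nn_cond_exp M H (indicator (R -` d \<inter> space M)) w
     = ?q w * (indicator a (V w) * emeasure (K (V w)) d)"
    by eventually_elim (auto split: split_indicator simp: \<kappa>[OF _ _ d])
  qed
  also have "\<dots> = (\<integral>\<^sup>+w. ?q w * (\<integral>\<^sup>+r. indicator (a \<times> d) (V w, r) \<partial>K (V w)) \<partial>M)"
  proof (rule nn_integral_cong)
   fix w assume "w \<in> space M"
   then have "V w \<in> space A" using measurable_space[OF VM] by simp
   then have "d \<in> sets (K (V w))" using Kset by simp
   then have "(\<integral>\<^sup>+r. indicator (a \<times> d) (V w, r) \<partial>K (V w)) = indicator a (V w) * emeasure (K (V w)) d"
    by (simp add: indicator_times nn_integral_cmult)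
   then show "?q w * (indicator a (V w) * emeasure (K (V w)) d) = ?q w * (\<integral>\<^sup>+r. indicator (a \<times> d) (V w, r) \<partial>K (V w))"
    by simp
  qed
  also have "\<dots> = emeasure \<mu>2 (a \<times> d)"
   using int2[of "indicator (a \<times> d)"] sets2 by simp
  finally show "emeasure \<mu>1 (a \<times> d) = emeasure \<mu>2 (a \<times> d)" .
 qed
 have "\<mu>1 = \<mu>2"
 proof (rule measure_eqI_generator_eq[OF Int_stable_pair_measure_generator[of A N], where A="\<lambda>_. space A \<times> space N" and \<Omega>="space A \<times> space N"])
  show "sets \<mu>1 = sigma_sets (space A \<times> space N) {a \<times> b |a b. a \<in> sets A \<and> b \<in> sets N}"
   by (simp add: sets_pair_measure)
  show "sets \<mu>2 = sigma_sets (space A \<times> space N) {a \<times> b |a b. a \<in> sets A \<and> b \<in> sets N}"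
   using sets2[of "{}" "{}"] by (simp add: sets_pair_measure)
  show "emeasure \<mu>1 X = emeasure \<mu>2 X" if "X \<in> {a \<times> b |a b. a \<in> sets A \<and> b \<in> sets N}" for X
   using that eq_rect by auto
  show "emeasure \<mu>1 (space A \<times> space N) \<noteq> \<infinity>" for i :: nat
  proof -
   have "emeasure \<mu>1 (space A \<times> space N) \<le> (\<integral>\<^sup>+w. 1 \<partial>M)"
    using int1[of "indicator (space A \<times> space N)"]
    by (simp del: nn_integral_const) (intro nn_integral_mono, auto split: split_indicator)
   then show ?thesis by (auto simp: M.emeasure_space_1 top_unique)
  qed
 qed (auto dest: sets.sets_into_space)
 then show ?thesis
  using int1[of "\<lambda>(a, r). \<Phi> a r"] int2[of "\<lambda>(a, r). \<Phi> a r"] by simp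
qed

lemma
 assumes V: "\<And>l. l < p \<Longrightarrow> V l \<in> M \<rightarrow>\<^sub>M A" and R: "\<And>l. l < q \<Longrightarrow> R l \<in> M \<rightarrow>\<^sub>M C"
 shows subalgebra_history: "subalgebra M (history M A V p C R q)"
  and measurable_history_state: "l < p \<Longrightarrow> V l \<in> history M A V p C R q \<rightarrow>\<^sub>M A"
  and measurable_history_mark: "l < q \<Longrightarrow> R l \<in> history M A V p C R q \<rightarrow>\<^sub>M C"
proof -
 let ?G = "{V l -` B \<inter> space M | l B. l < p \<and> B \<in> sets A} \<union> {R l -` D \<inter> space M | l D. l < q \<and> D \<in> sets C}"
 have G: "?G \<subseteq> sets M" using V R by (auto intro: measurable_sets)
 then have P: "?G \<subseteq> Pow (space M)" using sets.sets_into_space by blast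
 have sp: "space (history M A V p C R q) = space M"
  and st: "sets (history M A V p C R q) = sigma_sets (space M) ?G"
  unfolding history_def using P by (simp_all add: space_measure_of sets_measure_of)
 show "subalgebra M (history M A V p C R q)"
  unfolding subalgebra_def sp st using G by (simp add: sets.sigma_sets_subset)
 show "V l \<in> history M A V p C R q \<rightarrow>\<^sub>M A" if "l < p"
  using that measurable_space[OF V[OF that]]
  by (intro measurableI) (auto simp: sp st intro!: sigma_sets.Basic)
 show "R l \<in> history M A V p C R q \<rightarrow>\<^sub>M C" if "l < q"
  using that measurable_space[OF R[OF that]]
  by (intro measurableI) (auto simp: sp st intro!: sigma_sets.Basic)
qed

section \<open>The base process and the ergodic hypothesis\<close>

lemma cum_scale:
 assumes "0 < c" and [measurable]: "f \<in> borel_measurable borel"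
 shows "cum (\<lambda>s. f (c * s)) t = cum f (c * t) / c"
proof -
 have "(\<integral>\<^sup>+s\<in>{0..c * t}. ennreal (f s) \<partial>lborel) = ennreal c * (\<integral>\<^sup>+s. ennreal (f (0 + c * s)) * indicator {0..c * t} (0 + c * s) \<partial>lborel)"
  using assms(1) by (subst nn_integral_real_affine[of _ c 0]) auto
 also have "(\<integral>\<^sup>+s. ennreal (f (0 + c * s)) * indicator {0..c * t} (0 + c * s) \<partial>lborel) = (\<integral>\<^sup>+s\<in>{0..t}. ennreal (f (c * s)) \<partial>lborel)"
  using assms(1) by (intro nn_integral_cong) (auto split: split_indicator simp: zero_le_mult_iff)
 finally show ?thesis using assms(1) by (simp add: cum_def enn2real_mult)
qed

lemma rate_path_le:
 assumes g: "rate_path g" and "f \<in> borel_measurable borel" "\<And>s. 0 \<le> f s" "\<And>s. f s \<le> g s"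
 shows "rate_path f"
proof
 show "(\<integral>\<^sup>+s\<in>{0..t}. ennreal (f s) \<partial>lborel) < \<infinity>" for t
 proof -
  have "(\<integral>\<^sup>+s\<in>{0..t}. ennreal (f s) \<partial>lborel) \<le> (\<integral>\<^sup>+s\<in>{0..t}. ennreal (g s) \<partial>lborel)"
   using assms(4) by (intro nn_integral_mono mult_right_mono ennreal_leI) auto
  also have "\<dots> < \<infinity>" using g by (rule rate_path.a_finite)
  finally show ?thesis .
 qed
qed (fact assms)+

lemma cum_le_add:
 assumes f: "rate_path f" and g: "rate_path g" and k: "rate_path k" and le: "\<And>s. f s \<le> g s + k s"
 shows "cum f t \<le> cum g t + cum k t"
proof -
 note [measurable] = rate_path.a_measurable[OF f] rate_path.a_measurable[OF g] rate_path.a_measurable[OF k]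
 have "ennreal (cum f t) \<le> (\<integral>\<^sup>+s. ennreal (g s) * indicator {0..t} s + ennreal (k s) * indicator {0..t} s \<partial>lborel)"
  unfolding rate_path.ennreal_cum[OF f] using le rate_path.a_nonneg[OF g] rate_path.a_nonneg[OF k]
  by (intro nn_integral_mono) (auto split: split_indicator simp: ennreal_plus[symmetric] simp del: ennreal_plus intro!: ennreal_leI)
 also have "\<dots> = ennreal (cum g t) + ennreal (cum k t)"
  unfolding rate_path.ennreal_cum[OF g] rate_path.ennreal_cum[OF k] by (rule nn_integral_add) auto
 also have "\<dots> = ennreal (cum g t + cum k t)" by (simp add: cum_def)
 finally show ?thesis by (subst (asm) ennreal_le_iff) (auto simp: cum_def)
qed

text \<open>The hypotheses on the fast dynamics only; the slow equation enters later.\<close>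

locale base_model =
 fixes I :: "'i measure" and Ei :: "'i \<Rightarrow> 'e measure" and E :: "'e measure" and \<phi> :: "'e \<Rightarrow> 'i"
  and Om :: "'o measure" and \<F> :: "real \<Rightarrow> 'o measure"
  and X :: "real \<Rightarrow> 'o \<Rightarrow> 'e" and P :: "'e \<Rightarrow> 'o measure"
  and G :: "real \<Rightarrow> real" and b :: "'e \<Rightarrow> real" and \<pi> :: "'e \<Rightarrow> 'e measure"
  and \<mu> :: "'i \<Rightarrow> 'e measure"
 assumes state: "state_space I Ei E \<phi>"
  and base: "base_process I Ei E Om \<F> X P"
  and acG: "abs_cont_cdf G"
  and b_measurable[measurable]: "b \<in> borel_measurable E" and b_nonneg: "\<And>y. y \<in> space E \<Longrightarrow> 0 \<le> b y"
  and pi_measurable: "\<pi> \<in> E \<rightarrow>\<^sub>M prob_algebra E"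
  and mu_prob: "\<And>i. i \<in> space I \<Longrightarrow> prob_space (\<mu> i)"
  and sets_mu: "\<And>i. i \<in> space I \<Longrightarrow> sets (\<mu> i) = sets (Ei i)"
  and H1: "\<And>i h y. i \<in> space I \<Longrightarrow> h \<in> class_A (Ei i) X P (\<mu> i) \<Longrightarrow> y \<in> space (Ei i) \<Longrightarrow>
   AE \<omega> in P y. ((\<lambda>r. 1 / r * (LBINT s:{0..r}. h (X s \<omega>))) \<longlongrightarrow> (\<integral>e. h e \<partial>\<mu> i)) at_top"
  and H2: "\<And>r y. 0 \<le> r \<Longrightarrow> y \<in> space E \<Longrightarrow>
   unif_integrable (P y) {1::nat..}
    (\<lambda>n \<omega>. ennreal (1 / real n) * (\<integral>\<^sup>+s\<in>{0..real n * r}. ennreal (b (X s \<omega>)) \<partial>lborel))"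
begin

lemma space_E: "space E = (\<Union>i\<in>space I. space (Ei i))"
 and sets_E: "S \<in> sets E \<longleftrightarrow> S \<subseteq> space E \<and> (\<forall>i\<in>space I. S \<inter> space (Ei i) \<in> sets (Ei i))"
 using state by (auto simp: state_space_def space_disj_union sets_disj_union)

lemma phi_eq: "i \<in> space I \<Longrightarrow> e \<in> space (Ei i) \<Longrightarrow> \<phi> e = i"
 using state by (simp add: state_space_def)

lemma phi_space: "e \<in> space E \<Longrightarrow> \<phi> e \<in> space I"
 and in_Ei: "e \<in> space E \<Longrightarrow> e \<in> space (Ei (\<phi> e))"
 by (auto simp: space_E phi_eq)

lemma Ei_subset: "i \<in> space I \<Longrightarrow> space (Ei i) \<subseteq> space E"
 by (auto simp: space_E)

text \<open>The \<open>\<sigma>\<close>-algebra of the disjoint union imposes no condition across components, so functions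
 may be chosen on each component separately.\<close>

lemma glue_measurable:
 assumes f: "\<And>i. i \<in> space I \<Longrightarrow> f i \<in> E \<rightarrow>\<^sub>M N"
 shows "(\<lambda>e. f (\<phi> e) e) \<in> E \<rightarrow>\<^sub>M N"
proof (rule measurableI)
 show "f (\<phi> e) e \<in> space N" if "e \<in> space E" for e
  using measurable_space[OF f[OF phi_space[OF that]] that] .
 show "(\<lambda>e. f (\<phi> e) e) -` B \<inter> space E \<in> sets E" if B: "B \<in> sets N" for B
  unfolding sets_E
 proof (intro conjI ballI)
  fix i assume i: "i \<in> space I"
  have "f i -` B \<inter> space E \<inter> space (Ei i) \<in> sets (Ei i)"
   using measurable_sets[OF f[OF i] B] i unfolding sets_E by auto
  also have "f i -` B \<inter> space E \<inter> space (Ei i) = (\<lambda>e. f (\<phi> e) e) -` B \<inter> space E \<inter> space (Ei i)"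
   using phi_eq[OF i] by auto
  finally show "(\<lambda>e. f (\<phi> e) e) -` B \<inter> space E \<inter> space (Ei i) \<in> sets (Ei i)" .
 qed simp
qed

lemma phi_measurable[measurable]: "\<phi> \<in> E \<rightarrow>\<^sub>M I"
 using glue_measurable[of "\<lambda>i e. i" I] by simp

lemma space_mu: "i \<in> space I \<Longrightarrow> space (\<mu> i) = space (Ei i)"
 using sets_mu by (rule sets_eq_imp_space_eq)

lemma mu_measurable:
 assumes i: "i \<in> space I" and f: "f \<in> E \<rightarrow>\<^sub>M N"
 shows "f \<in> \<mu> i \<rightarrow>\<^sub>M N"
proof (rule measurableI)
 show "f x \<in> space N" if "x \<in> space (\<mu> i)" for x
  using that measurable_space[OF f] Ei_subset[OF i] by (auto simp: space_mu[OF i])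
 show "f -` A \<inter> space (\<mu> i) \<in> sets (\<mu> i)" if "A \<in> sets N" for A
 proof -
  have "f -` A \<inter> space E \<inter> space (Ei i) \<in> sets (Ei i)"
   using measurable_sets[OF f that] i unfolding sets_E by auto
  also have "f -` A \<inter> space E \<inter> space (Ei i) = f -` A \<inter> space (\<mu> i)"
   using Ei_subset[OF i] by (auto simp: space_mu[OF i])
  finally show ?thesis by (simp add: sets_mu[OF i])
 qed
qed

lemma Ei_nonempty: "i \<in> space I \<Longrightarrow> space (Ei i) \<noteq> {}"
 using prob_space.not_empty[OF mu_prob] space_mu by auto

lemma P_measurable: "P \<in> E \<rightarrow>\<^sub>M prob_algebra Om"
 using base by (simp add: base_process_def)

lemma P_prob: "y \<in> space E \<Longrightarrow> prob_space (P y)" and sets_P: "y \<in> space E \<Longrightarrow> sets (P y) = sets Om"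
 using measurable_space[OF P_measurable, of y] by (auto simp: space_prob_algebra)

lemma space_P: "y \<in> space E \<Longrightarrow> space (P y) = space Om"
 using sets_P by (rule sets_eq_imp_space_eq)

lemma pi_prob: "y \<in> space E \<Longrightarrow> prob_space (\<pi> y)" and sets_pi: "y \<in> space E \<Longrightarrow> sets (\<pi> y) = sets E"
 using measurable_space[OF pi_measurable, of y] by (auto simp: space_prob_algebra)

text \<open>the base process, frozen at negative times so as to be jointly measurable\<close>

definition XX :: "real \<Rightarrow> 'o \<Rightarrow> 'e" where "XX s \<omega> = X (max 0 s) \<omega>"

lemma XX_eq: "0 \<le> s \<Longrightarrow> XX s \<omega> = X s \<omega>" by (simp add: XX_def)

lemma XX_measurable: "(\<lambda>(s, \<omega>). XX s \<omega>) \<in> borel \<Otimes>\<^sub>M Om \<rightarrow>\<^sub>M E"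
proof -
 let ?Xn = "\<lambda>n (s, \<omega>). X (min (real n) (max 0 s)) \<omega>"
 have m: "?Xn n \<in> borel \<Otimes>\<^sub>M Om \<rightarrow>\<^sub>M E" for n
 proof -
  have sub: "subalgebra Om (\<F> (real n))" and
   pm: "(\<lambda>(s, \<omega>). X s \<omega>) \<in> restrict_space borel {0..real n} \<Otimes>\<^sub>M \<F> (real n) \<rightarrow>\<^sub>M E"
   using base by (auto simp: base_process_def progressively_measurable_def)
  have "(\<lambda>\<omega>. \<omega>) \<in> Om \<rightarrow>\<^sub>M \<F> (real n)"
   by (rule measurable_from_subalg[OF sub]) simp
  moreover have "(\<lambda>s. min (real n) (max 0 s)) \<in> borel \<rightarrow>\<^sub>M restrict_space borel {0..real n}"
   by (intro measurable_restrict_space2) auto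
  ultimately have "(\<lambda>p. (min (real n) (max 0 (fst p)), snd p)) \<in> borel \<Otimes>\<^sub>M Om \<rightarrow>\<^sub>M restrict_space borel {0..real n} \<Otimes>\<^sub>M \<F> (real n)"
   by (intro measurable_Pair measurable_compose[OF measurable_fst] measurable_compose[OF measurable_snd])
  from measurable_compose[OF this pm] show ?thesis by (simp add: split_beta')
 qed
 have eq: "?Xn n p = (case p of (s, \<omega>) \<Rightarrow> XX s \<omega>)" if "fst p \<le> real n" for n p
  using that by (cases p) (simp add: XX_def)
 show ?thesis
 proof (rule measurableI)
  show "(case p of (s, \<omega>) \<Rightarrow> XX s \<omega>) \<in> space E" if p: "p \<in> space (borel \<Otimes>\<^sub>M Om)" for p
  proof -
   obtain n where n: "fst p \<le> real n" using real_arch_simple by blast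
   show ?thesis using measurable_space[OF m p, of n] eq[OF n] by simp
  qed
  fix B assume B: "B \<in> sets E"
  have "(\<Union>n. ?Xn n -` B \<inter> space (borel \<Otimes>\<^sub>M Om) \<inter> {p\<in>space (borel \<Otimes>\<^sub>M Om). fst p \<le> real n}) \<in> sets (borel \<Otimes>\<^sub>M Om)"
   by (intro sets.countable_UN'' sets.Int measurable_sets[OF m B]) auto
  also have "(\<Union>n. ?Xn n -` B \<inter> space (borel \<Otimes>\<^sub>M Om) \<inter> {p\<in>space (borel \<Otimes>\<^sub>M Om). fst p \<le> real n})
    = (\<lambda>(s, \<omega>). XX s \<omega>) -` B \<inter> space (borel \<Otimes>\<^sub>M Om)" (is "?L = ?R")
  proof (intro equalityI subsetI)
   fix p assume "p \<in> ?L"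
   then obtain n where n: "?Xn n p \<in> B" "p \<in> space (borel \<Otimes>\<^sub>M Om)" "fst p \<le> real n" by blast
   then show "p \<in> ?R" using eq[OF n(3)] by simp
  next
   fix p assume p: "p \<in> ?R"
   obtain n where n: "fst p \<le> real n" using real_arch_simple by blast
   have "?Xn n p \<in> B" using eq[OF n] p by auto
   then show "p \<in> ?L" using n p by blast
  qed
  finally show "(\<lambda>(s, \<omega>). XX s \<omega>) -` B \<inter> space (borel \<Otimes>\<^sub>M Om) \<in> sets (borel \<Otimes>\<^sub>M Om)" .
 qed
qed

lemma XX_compose[measurable (raw)]:
 assumes "f \<in> borel_measurable N" "g \<in> N \<rightarrow>\<^sub>M Om"
 shows "(\<lambda>x. XX (f x) (g x)) \<in> N \<rightarrow>\<^sub>M E"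
 using measurable_compose[OF measurable_Pair[OF assms] XX_measurable] by simp

lemma XX_time[measurable]: "\<omega> \<in> space Om \<Longrightarrow> (\<lambda>s. XX s \<omega>) \<in> borel \<rightarrow>\<^sub>M E"
 by (rule XX_compose) auto

lemma XX_space: "\<omega> \<in> space Om \<Longrightarrow> XX s \<omega> \<in> space E"
 using measurable_space[OF XX_time, of \<omega> s] by simp

lemma AE_XX_in_Ei:
 assumes "i \<in> space I" "y \<in> space (Ei i)"
 shows "AE \<omega> in P y. \<forall>s. XX s \<omega> \<in> space (Ei i)"
proof -
 have "AE \<omega> in P y. \<forall>t\<ge>0. X t \<omega> \<in> space (Ei i)"
  using base assms by (simp add: base_process_def)
 then show ?thesis by eventually_elim (simp add: XX_def)
qed

end

lemma unif_integrable_bound: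
 assumes M: "prob_space M" and ui: "unif_integrable M A f"
 shows "\<exists>c\<ge>0. \<forall>n\<in>A. (\<integral>\<^sup>+\<omega>. f n \<omega> \<partial>M) \<le> ennreal c"
proof -
 interpret prob_space M by fact
 have m[measurable]: "f n \<in> borel_measurable M" if "n \<in> A" for n using ui that by (auto simp: unif_integrable_def)
 have "((\<lambda>c::real. SUP n\<in>A. \<integral>\<^sup>+\<omega>\<in>{\<omega>. ennreal c < f n \<omega>}. f n \<omega> \<partial>M) \<longlongrightarrow> 0) at_top"
  using ui by (simp add: unif_integrable_def)
 then have "\<forall>\<^sub>F c in at_top. (SUP n\<in>A. \<integral>\<^sup>+\<omega>\<in>{\<omega>. ennreal c < f n \<omega>}. f n \<omega> \<partial>M) < 1"
  by (rule order_tendstoD) simp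
 moreover have "\<forall>\<^sub>F c::real in at_top. 0 \<le> c" by (rule eventually_ge_at_top)
 ultimately have "\<forall>\<^sub>F c::real in at_top. (SUP n\<in>A. \<integral>\<^sup>+\<omega>\<in>{\<omega>. ennreal c < f n \<omega>}. f n \<omega> \<partial>M) < 1 \<and> 0 \<le> c"
  by (rule eventually_conj)
 then obtain c :: real where c: "(SUP n\<in>A. \<integral>\<^sup>+\<omega>\<in>{\<omega>. ennreal c < f n \<omega>}. f n \<omega> \<partial>M) < 1" "0 \<le> c"
  by (auto dest!: eventually_happens)
 have "(\<integral>\<^sup>+\<omega>. f n \<omega> \<partial>M) \<le> ennreal (c + 1)" if n: "n \<in> A" for n
 proof -
  note [measurable] = m[OF n]
  have tail: "(\<integral>\<^sup>+\<omega>\<in>{\<omega>. ennreal c < f n \<omega>}. f n \<omega> \<partial>M) \<le> 1"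
   using c(1) SUP_upper[OF n, of "\<lambda>n. \<integral>\<^sup>+\<omega>\<in>{\<omega>. ennreal c < f n \<omega>}. f n \<omega> \<partial>M"] by (meson less_imp_le order_trans)
  have eq: "(\<integral>\<^sup>+\<omega>\<in>{\<omega>. ennreal c < f n \<omega>}. f n \<omega> \<partial>M) = (\<integral>\<^sup>+\<omega>\<in>{\<omega>\<in>space M. ennreal c < f n \<omega>}. f n \<omega> \<partial>M)"
   by (intro nn_integral_cong) (auto split: split_indicator)
  have "(\<integral>\<^sup>+\<omega>. f n \<omega> \<partial>M) \<le> (\<integral>\<^sup>+\<omega>. ennreal c + f n \<omega> * indicator {\<omega>\<in>space M. ennreal c < f n \<omega>} \<omega> \<partial>M)"
   by (intro nn_integral_mono) (auto split: split_indicator simp: not_less)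
  also have "\<dots> = ennreal c + (\<integral>\<^sup>+\<omega>\<in>{\<omega>\<in>space M. ennreal c < f n \<omega>}. f n \<omega> \<partial>M)"
   by (subst nn_integral_add) (auto simp: emeasure_space_1)
  also have "\<dots> \<le> ennreal c + 1" using tail unfolding eq by (rule add_left_mono)
  finally show ?thesis using c(2) by (simp add: ennreal_plus)
 qed
 then show ?thesis using c(2) by (intro exI[of _ "c + 1"]) auto
qed

lemma rate_path_scale:
 assumes f: "rate_path f" and c: "0 \<le> c"
 shows "rate_path (\<lambda>s. f (c * s))"
proof (cases "c = 0")
 case True
 interpret rate_path f by fact
 show ?thesis using True a_nonneg by unfold_locales (auto simp: nn_integral_cmult_indicator ennreal_mult_less_top emeasure_lborel_Icc_eq)
next
 case False
 with c have c0: "0 < c" by simp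
 interpret rate_path f by fact
 show ?thesis
 proof
  show "(\<integral>\<^sup>+s\<in>{0..t}. ennreal (f (c * s)) \<partial>lborel) < \<infinity>" for t
  proof -
   have "(\<integral>\<^sup>+s\<in>{0..c * t}. ennreal (f s) \<partial>lborel) = ennreal c * (\<integral>\<^sup>+s. ennreal (f (0 + c * s)) * indicator {0..c * t} (0 + c * s) \<partial>lborel)"
    using c0 by (subst nn_integral_real_affine[of _ c 0]) auto
   also have "(\<integral>\<^sup>+s. ennreal (f (0 + c * s)) * indicator {0..c * t} (0 + c * s) \<partial>lborel) = (\<integral>\<^sup>+s\<in>{0..t}. ennreal (f (c * s)) \<partial>lborel)"
    using c0 by (intro nn_integral_cong) (auto split: split_indicator simp: zero_le_mult_iff)
   finally show ?thesis using a_finite[of "c * t"] c0 by (auto simp: ennreal_mult_less_top)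
  qed
 qed (use a_nonneg in auto)
qed

context base_model begin

lemma class_A_AE_rate_path:
 assumes i: "i \<in> space I" and h: "h \<in> class_A (Ei i) X P (\<mu> i)" and y: "y \<in> space (Ei i)"
  and [measurable]: "h \<in> borel_measurable E" and h0: "\<And>e. e \<in> space E \<Longrightarrow> 0 \<le> h e"
 shows "AE \<omega> in P y. rate_path (\<lambda>s. h (XX s \<omega>))"
proof -
 have yE: "y \<in> space E" using y Ei_subset[OF i] by auto
 have "AE \<omega> in P y. \<forall>k::nat. (\<integral>\<^sup>+s\<in>{0..real k}. ennreal \<bar>h (X s \<omega>)\<bar> \<partial>lborel) < \<infinity>"
  using h y by (auto simp: class_A_def AE_all_countable)
 with AE_space show ?thesis
 proof eventually_elim
  case (elim \<omega>)
  then have \<omega>: "\<omega> \<in> space Om" by (simp add: space_P[OF yE])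
  show ?case
  proof
   show "(\<lambda>s. h (XX s \<omega>)) \<in> borel_measurable borel"
    using \<omega> by measurable
   show "0 \<le> h (XX s \<omega>)" for s using h0 XX_space[OF \<omega>] by simp
   show "(\<integral>\<^sup>+s\<in>{0..t}. ennreal (h (XX s \<omega>)) \<partial>lborel) < \<infinity>" for t
   proof -
    obtain k where k: "t \<le> real k" using real_arch_simple by blast
    have "(\<integral>\<^sup>+s\<in>{0..t}. ennreal (h (XX s \<omega>)) \<partial>lborel) \<le> (\<integral>\<^sup>+s\<in>{0..real k}. ennreal \<bar>h (X s \<omega>)\<bar> \<partial>lborel)"
     using k by (intro nn_integral_mono) (auto split: split_indicator simp: XX_eq intro!: ennreal_leI)
    then show ?thesis using elim(2) by (auto intro: le_less_trans)
   qed
  qed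
 qed
qed

text \<open>Hypothesis H1 in terms of cumulated nonnegative functionals of the accelerated path.\<close>

lemma ergodic_cum:
 assumes i: "i \<in> space I" and h: "h \<in> class_A (Ei i) X P (\<mu> i)" and y: "y \<in> space (Ei i)"
  and [measurable]: "h \<in> borel_measurable E" and h0: "\<And>e. e \<in> space E \<Longrightarrow> 0 \<le> h e"
 shows "AE \<omega> in P y. \<forall>t\<ge>0. (\<lambda>n. cum (\<lambda>s. h (XX (real n * s) \<omega>)) t) \<longlonglongrightarrow> t * (\<integral>e. h e \<partial>\<mu> i)"
proof -
 have yE: "y \<in> space E" using y Ei_subset[OF i] by auto
 have rp: "AE \<omega> in P y. rate_path (\<lambda>s. h (XX s \<omega>))"
  by (rule class_A_AE_rate_path[OF i h y]) (auto intro: h0)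
 from H1[OF i h y] rp AE_space show ?thesis
 proof eventually_elim
  case (elim \<omega>)
  then have \<omega>: "\<omega> \<in> space Om" by (simp add: space_P[OF yE])
  interpret rate_path "\<lambda>s. h (XX s \<omega>)" by fact
  have [measurable]: "(\<lambda>s. XX s \<omega>) \<in> borel \<rightarrow>\<^sub>M E" by (rule XX_time[OF \<omega>])
  have lb: "(LBINT s:{0..r}. h (X s \<omega>)) = cum (\<lambda>s. h (XX s \<omega>)) r" for r
  proof -
   have "(LBINT s:{0..r}. h (X s \<omega>)) = (\<integral>s. h (XX s \<omega>) * indicator {0..r} s \<partial>lborel)"
    unfolding set_lebesgue_integral_def
    by (intro Bochner_Integration.integral_cong) (auto split: split_indicator simp: XX_eq)
   also have "\<dots> = enn2real (\<integral>\<^sup>+s. ennreal (h (XX s \<omega>) * indicator {0..r} s) \<partial>lborel)"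
    using a_nonneg by (intro integral_eq_nn_integral) auto
   also have "(\<integral>\<^sup>+s. ennreal (h (XX s \<omega>) * indicator {0..r} s) \<partial>lborel) = (\<integral>\<^sup>+s\<in>{0..r}. ennreal (h (XX s \<omega>)) \<partial>lborel)"
    by (intro nn_integral_cong) (auto split: split_indicator)
   finally show ?thesis by (simp add: cum_def)
  qed
  have lim: "((\<lambda>r. 1 / r * cum (\<lambda>s. h (XX s \<omega>)) r) \<longlongrightarrow> (\<integral>e. h e \<partial>\<mu> i)) at_top"
   using elim(1) unfolding lb .
  show ?case
  proof (intro allI impI)
   fix t :: real assume t: "0 \<le> t"
   show "(\<lambda>n. cum (\<lambda>s. h (XX (real n * s) \<omega>)) t) \<longlonglongrightarrow> t * (\<integral>e. h e \<partial>\<mu> i)"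
   proof (cases "t = 0")
    case True
    have "cum (\<lambda>s. h (XX (real n * s) \<omega>)) 0 = 0" for n
     using rate_path.cum_nonpos[OF rate_path_scale[OF rate_path_axioms, of "real n"], of 0] by simp
    then show ?thesis using True by simp
   next
    case False
    then have t0: "0 < t" using t by simp
    have "filterlim (\<lambda>n. real n * t) at_top sequentially"
     by (rule filterlim_at_top_mult_tendsto_pos[OF tendsto_const t0 filterlim_real_sequentially, THEN filterlim_cong[THEN iffD1, rotated -1]]) (auto simp: mult.commute)
    then have "(\<lambda>n. 1 / (real n * t) * cum (\<lambda>s. h (XX s \<omega>)) (real n * t)) \<longlonglongrightarrow> (\<integral>e. h e \<partial>\<mu> i)"
     by (rule filterlim_compose[OF lim])
    from tendsto_mult_left[OF this, of t]
    have "(\<lambda>n. t * (1 / (real n * t) * cum (\<lambda>s. h (XX s \<omega>)) (real n * t))) \<longlonglongrightarrow> t * (\<integral>e. h e \<partial>\<mu> i)" .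
    then show ?thesis
    proof (rule Lim_transform_eventually)
     show "\<forall>\<^sub>F n in sequentially. t * (1 / (real n * t) * cum (\<lambda>s. h (XX s \<omega>)) (real n * t)) = cum (\<lambda>s. h (XX (real n * s) \<omega>)) t"
      using eventually_gt_at_top[of 0]
     proof eventually_elim
      case (elim n)
      then have "cum (\<lambda>s. h (XX (real n * s) \<omega>)) t = cum (\<lambda>s. h (XX s \<omega>)) (real n * t) / real n"
       by (intro cum_scale) auto
      then show ?case using t0 elim by (simp add: field_simps)
     qed
    qed
   qed
  qed
 qed
qed

lemma class_A_bounded:
 assumes i: "i \<in> space I" and [measurable]: "h \<in> borel_measurable E"
  and h: "\<And>e. e \<in> space E \<Longrightarrow> 0 \<le> h e \<and> h e \<le> C"
 shows "h \<in> class_A (Ei i) X P (\<mu> i)"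
proof -
 interpret m: prob_space "\<mu> i" by (rule mu_prob[OF i])
 have C: "0 \<le> C" using Ei_nonempty[OF i] Ei_subset[OF i] h by fastforce
 have "integrable (\<mu> i) h"
  using h Ei_subset[OF i] mu_measurable[OF i assms(2)] space_mu[OF i]
  by (intro m.integrable_const_bound[where B=C] AE_I2) auto
 moreover have "AE \<omega> in P x. (\<integral>\<^sup>+s\<in>{0..t}. ennreal \<bar>h (X s \<omega>)\<bar> \<partial>lborel) < \<infinity>"
  if x: "x \<in> space (Ei i)" and t: "0 \<le> t" for x t
 proof (rule AE_mp[OF AE_space], rule AE_I2, rule impI)
  fix \<omega> assume "\<omega> \<in> space (P x)"
  then have \<omega>: "\<omega> \<in> space Om" using x Ei_subset[OF i] by (auto simp: space_P)
  have "(\<integral>\<^sup>+s\<in>{0..t}. ennreal \<bar>h (X s \<omega>)\<bar> \<partial>lborel) \<le> (\<integral>\<^sup>+s. ennreal C * indicator {0..t} s \<partial>lborel)"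
   using h[OF XX_space[OF \<omega>]] XX_eq[of _ \<omega>]
   by (intro nn_integral_mono) (auto split: split_indicator intro!: ennreal_leI simp flip: XX_eq)
  also have "\<dots> < \<infinity>" using t by (simp add: nn_integral_cmult_indicator ennreal_mult_less_top)
  finally show "(\<integral>\<^sup>+s\<in>{0..t}. ennreal \<bar>h (X s \<omega>)\<bar> \<partial>lborel) < \<infinity>" .
 qed
 ultimately show ?thesis by (simp add: class_A_def)
qed

text \<open>The ergodic hypothesis applies to \<open>min b c\<close>, which bounds \<open>\<mu>\<^sub>i(min b c)\<close> by the time averages of
 \<open>b\<close>; these are bounded in mean by uniform integrability. Monotone convergence in \<open>c\<close> concludes.\<close>

lemma mu_b_integrable:
 assumes i: "i \<in> space I" shows "integrable (\<mu> i) b"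
proof -
 interpret m: prob_space "\<mu> i" by (rule mu_prob[OF i])
 note [measurable] = mu_measurable[OF i b_measurable]
 obtain y where y: "y \<in> space (Ei i)" using Ei_nonempty[OF i] by auto
 then have yE: "y \<in> space E" using Ei_subset[OF i] by auto
 interpret Py: prob_space "P y" by (rule P_prob[OF yE])
 obtain C where C: "0 \<le> C" "\<And>n::nat. 1 \<le> n \<Longrightarrow> (\<integral>\<^sup>+\<omega>. ennreal (1 / real n) * (\<integral>\<^sup>+s\<in>{0..real n * 1}. ennreal (b (X s \<omega>)) \<partial>lborel) \<partial>P y) \<le> ennreal C"
  using unif_integrable_bound[OF P_prob[OF yE] H2[of 1 y]] yE by auto
 have trunc: "(\<integral>\<^sup>+e. ennreal (min (b e) (real m)) \<partial>\<mu> i) \<le> ennreal C" for m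
 proof -
  define h where "h e = min (b e) (real m)" for e
  have h[measurable]: "h \<in> borel_measurable E" unfolding h_def by measurable
  have h0: "0 \<le> h e \<and> h e \<le> real m" if "e \<in> space E" for e using b_nonneg[OF that] by (simp add: h_def)
  have hi: "0 \<le> h e" if "e \<in> space (\<mu> i)" for e using that h0 Ei_subset[OF i] by (auto simp: space_mu[OF i])
  have A: "h \<in> class_A (Ei i) X P (\<mu> i)" using class_A_bounded[OF i h h0] .
  then have int: "integrable (\<mu> i) h" by (simp add: class_A_def)
  have hb: "cum (\<lambda>s. h (XX (real n * s) \<omega>)) 1 \<ge> 0" for n \<omega> by (simp add: cum_def)
  define B where "B n \<omega> = ennreal (1 / real n) * (\<integral>\<^sup>+s\<in>{0..real n * 1}. ennreal (b (X s \<omega>)) \<partial>lborel)" for n \<omega>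
  have Bm: "B n \<in> borel_measurable (P y)" if "1 \<le> n" for n
   using H2[of 1 y] yE that unfolding unif_integrable_def B_def by auto
  have rpA: "AE \<omega> in P y. rate_path (\<lambda>s. h (XX s \<omega>))"
   by (rule class_A_AE_rate_path[OF i A y h]) (use h0 in auto)
  have ergA: "AE \<omega> in P y. \<forall>t\<ge>0. (\<lambda>n. cum (\<lambda>s. h (XX (real n * s) \<omega>)) t) \<longlonglongrightarrow> t * (\<integral>e. h e \<partial>\<mu> i)"
   by (rule ergodic_cum[OF i A y h]) (use h0 in auto)
  have le: "AE \<omega> in P y. \<forall>n\<ge>1. ennreal (cum (\<lambda>s. h (XX (real n * s) \<omega>)) 1) \<le> B n \<omega>"
   using rpA AE_space
  proof eventually_elim
   case (elim \<omega>)
   then have \<omega>: "\<omega> \<in> space Om" by (simp add: space_P[OF yE])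
   have rp: "rate_path (\<lambda>s. h (XX s \<omega>))" using elim h0 by simp
   show ?case
   proof (intro allI impI)
    fix n :: nat assume n: "1 \<le> n"
    have "cum (\<lambda>s. h (XX (real n * s) \<omega>)) 1 = 1 / real n * cum (\<lambda>s. h (XX s \<omega>)) (real n * 1)"
     using n rate_path.a_measurable[OF rp] by (subst cum_scale) auto
    then have "ennreal (cum (\<lambda>s. h (XX (real n * s) \<omega>)) 1) = ennreal (1 / real n) * (\<integral>\<^sup>+s\<in>{0..real n * 1}. ennreal (h (XX s \<omega>)) \<partial>lborel)"
     by (simp only: ennreal_mult' rate_path.ennreal_cum[OF rp] divide_nonneg_nonneg of_nat_0_le_iff zero_le_one)
    also have "\<dots> \<le> B n \<omega>" unfolding B_def
     by (intro mult_left_mono nn_integral_mono) (auto split: split_indicator simp: XX_eq h_def intro!: ennreal_leI)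
    finally show "ennreal (cum (\<lambda>s. h (XX (real n * s) \<omega>)) 1) \<le> B n \<omega>" .
   qed
  qed
  have "ennreal (\<integral>e. h e \<partial>\<mu> i) = (\<integral>\<^sup>+\<omega>. ennreal (\<integral>e. h e \<partial>\<mu> i) \<partial>P y)"
   by (simp add: Py.emeasure_space_1)
  also have "\<dots> \<le> (\<integral>\<^sup>+\<omega>. liminf (\<lambda>n. B (Suc n) \<omega>) \<partial>P y)"
  proof (rule nn_integral_mono_AE)
   show "AE \<omega> in P y. ennreal (\<integral>e. h e \<partial>\<mu> i) \<le> liminf (\<lambda>n. B (Suc n) \<omega>)"
    using le ergA
   proof eventually_elim
    case (elim \<omega>)
    have "(\<lambda>n. cum (\<lambda>s. h (XX (real n * s) \<omega>)) 1) \<longlonglongrightarrow> (\<integral>e. h e \<partial>\<mu> i)"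
     using elim(2)[rule_format, of 1] by simp
    then have "(\<lambda>n. ennreal (cum (\<lambda>s. h (XX (real (Suc n) * s) \<omega>)) 1)) \<longlonglongrightarrow> ennreal (\<integral>e. h e \<partial>\<mu> i)"
     by (intro tendsto_ennrealI) (rule LIMSEQ_Suc)
    then have "ennreal (\<integral>e. h e \<partial>\<mu> i) = liminf (\<lambda>n. ennreal (cum (\<lambda>s. h (XX (real (Suc n) * s) \<omega>)) 1))"
     by (intro lim_imp_Liminf[symmetric]) auto
    also have "\<dots> \<le> liminf (\<lambda>n. B (Suc n) \<omega>)"
     using elim(1) by (intro Liminf_mono always_eventually) auto
    finally show ?case .
   qed
  qed
  also have "\<dots> \<le> liminf (\<lambda>n. \<integral>\<^sup>+\<omega>. B (Suc n) \<omega> \<partial>P y)"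
   by (rule nn_integral_liminf) (use Bm in auto)
  also have "\<dots> \<le> liminf (\<lambda>n. ennreal C)"
   using C(2)[of "Suc _"] by (intro Liminf_mono always_eventually) (auto simp: B_def)
  also have "\<dots> = ennreal C" by (simp add: Liminf_const)
  finally show ?thesis
   using nn_integral_eq_integral[OF int AE_I2[OF hi]] by (simp add: h_def)
 qed
 have bi: "0 \<le> b e" if "e \<in> space (\<mu> i)" for e using that b_nonneg Ei_subset[OF i] by (auto simp: space_mu[OF i])
 have "(\<integral>\<^sup>+e. ennreal (b e) \<partial>\<mu> i) = (\<integral>\<^sup>+e. (SUP m. ennreal (min (b e) (real m))) \<partial>\<mu> i)"
 proof (rule nn_integral_cong)
  fix e assume "e \<in> space (\<mu> i)"
  obtain m where "b e \<le> real m" using real_arch_simple by blast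
  then have "ennreal (b e) \<le> (SUP m. ennreal (min (b e) (real m)))"
   by (intro SUP_upper2[of m]) auto
  moreover have "(SUP m. ennreal (min (b e) (real m))) \<le> ennreal (b e)"
   by (intro SUP_least ennreal_leI) auto
  ultimately show "ennreal (b e) = (SUP m. ennreal (min (b e) (real m)))" by (rule antisym)
 qed
 also have "\<dots> = (SUP m. \<integral>\<^sup>+e. ennreal (min (b e) (real m)) \<partial>\<mu> i)"
  by (rule nn_integral_monotone_convergence_SUP) (auto simp: incseq_def le_fun_def intro!: ennreal_leI)
 also have "\<dots> \<le> ennreal C" using trunc by (intro SUP_least)
 finally have "(\<integral>\<^sup>+e. ennreal (b e) \<partial>\<mu> i) < \<infinity>" by (auto intro: le_less_trans)
 then show ?thesis using bi
  by (intro integrableI_nonneg) auto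
qed

lemma class_A_le_b:
 assumes i: "i \<in> space I" and [measurable]: "h \<in> borel_measurable E"
  and h: "\<And>e. e \<in> space E \<Longrightarrow> 0 \<le> h e \<and> h e \<le> b e"
 shows "h \<in> class_A (Ei i) X P (\<mu> i)"
proof -
 have "integrable (\<mu> i) h"
  using h Ei_subset[OF i] mu_measurable[OF i assms(2)] space_mu[OF i]
  by (intro Bochner_Integration.integrable_bound[OF mu_b_integrable[OF i]] AE_I2) fastforce+
 moreover have "AE \<omega> in P x. (\<integral>\<^sup>+s\<in>{0..t}. ennreal \<bar>h (X s \<omega>)\<bar> \<partial>lborel) < \<infinity>"
  if x: "x \<in> space (Ei i)" and t: "0 \<le> t" for x t
 proof -
  have xE: "x \<in> space E" using x Ei_subset[OF i] by auto
  define B where "B n \<omega> = ennreal (1 / real n) * (\<integral>\<^sup>+s\<in>{0..real n * t}. ennreal (b (X s \<omega>)) \<partial>lborel)" for n :: nat and \<omega>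
  have ui: "unif_integrable (P x) {1..} B"
   unfolding B_def by (rule H2[OF t xE])
  have "\<forall>n\<in>{1..}. B n \<in> borel_measurable (P x)"
   using ui unfolding unif_integrable_def by (rule conjunct1)
  then have B: "B 1 \<in> borel_measurable (P x)" by (rule bspec) simp
  obtain C where "\<forall>n\<in>{1..}. (\<integral>\<^sup>+\<omega>. B n \<omega> \<partial>P x) \<le> ennreal C"
   using unif_integrable_bound[OF P_prob[OF xE] ui] by blast
  then have "(\<integral>\<^sup>+\<omega>. B 1 \<omega> \<partial>P x) \<le> ennreal C" by (rule bspec) simp
  then have "(\<integral>\<^sup>+\<omega>. B 1 \<omega> \<partial>P x) \<noteq> \<infinity>" by (auto simp: top_unique)
  with B have "AE \<omega> in P x. B 1 \<omega> \<noteq> \<infinity>" by (rule nn_integral_PInf_AE)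
  with AE_space show ?thesis
  proof eventually_elim
   case (elim \<omega>)
   then have \<omega>: "\<omega> \<in> space Om" by (simp add: space_P[OF xE])
   have "(\<integral>\<^sup>+s\<in>{0..t}. ennreal \<bar>h (X s \<omega>)\<bar> \<partial>lborel) \<le> B 1 \<omega>" unfolding B_def
   proof (simp, rule nn_integral_mono)
    fix s
    show "ennreal \<bar>h (X s \<omega>)\<bar> * indicator {0..t} s \<le> ennreal (b (X s \<omega>)) * indicator {0..t} s"
     using h[OF XX_space[OF \<omega>, of s]] by (auto split: split_indicator simp: XX_eq intro!: ennreal_leI)
   qed
   then show ?case using elim(2) by (auto simp: less_top top_unique)
  qed
 qed
 ultimately show ?thesis by (simp add: class_A_def)
qed

end

context base_model begin

lemma AE_b_rate_path:
 assumes "i \<in> space I" "y \<in> space (Ei i)"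
 shows "AE \<omega> in P y. rate_path (\<lambda>s. b (XX s \<omega>))"
 by (rule class_A_AE_rate_path[OF assms(1) class_A_le_b[OF assms(1)] assms(2)]) (auto intro: b_nonneg)

text \<open>The test functions may vary with \<open>n\<close>: they are squeezed between the running infima and suprema
 \<open>inf\<^sub>m\<^sub>\<ge>\<^sub>k h\<^sub>m\<close> and \<open>sup\<^sub>m\<^sub>\<ge>\<^sub>k h\<^sub>m\<close>, to which the ergodic hypothesis applies for every \<open>k\<close>. This lets the
 induction over jumps pass the limit through the next piece.\<close>

lemma ergodic_varying:
 assumes i: "i \<in> space I" and y: "y \<in> space (Ei i)"
  and hn[measurable]: "\<And>n. hn n \<in> borel_measurable E" and hnb: "\<And>n e. e \<in> space E \<Longrightarrow> 0 \<le> hn n e \<and> hn n e \<le> b e"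
  and h[measurable]: "h \<in> borel_measurable E" and hb: "\<And>e. e \<in> space E \<Longrightarrow> 0 \<le> h e \<and> h e \<le> b e"
  and lim: "\<And>e. e \<in> space E \<Longrightarrow> (\<lambda>n. hn n e) \<longlonglongrightarrow> h e"
 shows "AE \<omega> in P y. \<forall>t\<ge>0. (\<lambda>n. cum (\<lambda>s. hn n (XX (real n * s) \<omega>)) t) \<longlonglongrightarrow> t * (\<integral>e. h e \<partial>\<mu> i)"
proof -
 have yE: "y \<in> space E" using y Ei_subset[OF i] by auto
 define D where "D m e = enn2real (SUP n\<in>{m..}. ennreal \<bar>hn n e - h e\<bar>)" for m :: nat and e
 have Dm[measurable]: "D m \<in> borel_measurable E" for m unfolding D_def by measurable
 have abs_le: "\<bar>hn n e - h e\<bar> \<le> b e" if "e \<in> space E" for n e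
  using hnb[OF that, of n] hb[OF that] by (simp add: abs_le_iff)
 have D_le_b: "0 \<le> D m e \<and> D m e \<le> b e" if e: "e \<in> space E" for m e
 proof -
  have "(SUP n\<in>{m..}. ennreal \<bar>hn n e - h e\<bar>) \<le> ennreal (b e)"
   using abs_le[OF e] by (intro SUP_least ennreal_leI)
  then show ?thesis unfolding D_def using b_nonneg[OF e] by (auto intro: enn2real_leI)
 qed
 have le_D: "\<bar>hn n e - h e\<bar> \<le> D m e" if e: "e \<in> space E" and "m \<le> n" for m n e
 proof -
  have S: "(SUP n\<in>{m..}. ennreal \<bar>hn n e - h e\<bar>) \<le> ennreal (b e)"
   using abs_le[OF e] by (intro SUP_least ennreal_leI)
  have "ennreal \<bar>hn n e - h e\<bar> \<le> (SUP n\<in>{m..}. ennreal \<bar>hn n e - h e\<bar>)"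
   using that(2) by (intro SUP_upper) auto
  also have "\<dots> = ennreal (D m e)"
   unfolding D_def using S by (metis ennreal_enn2real ennreal_less_top order.strict_trans1)
  finally show ?thesis using D_le_b[OF e, of m] by simp
 qed
 have D0: "(\<lambda>m. D m e) \<longlonglongrightarrow> 0" if e: "e \<in> space E" for e
 proof (rule LIMSEQ_I)
  fix r :: real assume r: "0 < r"
  obtain m0 where m0: "\<And>n. n \<ge> m0 \<Longrightarrow> norm (hn n e - h e) < r / 2"
   using LIMSEQ_D[OF lim[OF e], of "r/2"] r by auto
  have "norm (D m e - 0) < r" if "m \<ge> m0" for m
  proof -
   have "(SUP n\<in>{m..}. ennreal \<bar>hn n e - h e\<bar>) \<le> ennreal (r/2)"
    using m0 that by (intro SUP_least ennreal_leI) (auto simp: less_imp_le)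
   then have "D m e \<le> r/2" unfolding D_def using r by (intro enn2real_leI) auto
   then show ?thesis using r D_le_b[OF e, of m] by simp
  qed
  then show "\<exists>no. \<forall>m\<ge>no. norm (D m e - 0) < r" by blast
 qed
 have DI: "(\<lambda>m. \<integral>e. D m e \<partial>\<mu> i) \<longlonglongrightarrow> (\<integral>e. 0 \<partial>\<mu> i)"
 proof (rule integral_dominated_convergence[where w=b])
  show "AE e in \<mu> i. (\<lambda>m. D m e) \<longlonglongrightarrow> 0"
   using D0 Ei_subset[OF i] by (intro AE_I2) (auto simp: space_mu[OF i])
  show "AE e in \<mu> i. norm (D m e) \<le> b e" for m
   using D_le_b Ei_subset[OF i] by (intro AE_I2) (auto simp: space_mu[OF i])
  show "D m \<in> borel_measurable (\<mu> i)" for m by (rule mu_measurable[OF i Dm])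
 qed (auto intro: mu_b_integrable[OF i])
 have 1: "AE \<omega> in P y. \<forall>m. \<forall>t\<ge>0. (\<lambda>n. cum (\<lambda>s. D m (XX (real n * s) \<omega>)) t) \<longlonglongrightarrow> t * (\<integral>e. D m e \<partial>\<mu> i)"
  unfolding AE_all_countable using D_le_b
  by (intro allI ergodic_cum[OF i class_A_le_b[OF i] y]) auto
 have 2: "AE \<omega> in P y. \<forall>t\<ge>0. (\<lambda>n. cum (\<lambda>s. h (XX (real n * s) \<omega>)) t) \<longlonglongrightarrow> t * (\<integral>e. h e \<partial>\<mu> i)"
  using hb by (intro ergodic_cum[OF i class_A_le_b[OF i] y]) auto
 from 1 2 AE_b_rate_path[OF i y] AE_space show ?thesis
 proof eventually_elim
  case (elim \<omega>)
  then have \<omega>: "\<omega> \<in> space Om" by (simp add: space_P[OF yE])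
  note XE = XX_space[OF \<omega>]
  have [measurable]: "(\<lambda>s. XX s \<omega>) \<in> borel \<rightarrow>\<^sub>M E" by (rule XX_time[OF \<omega>])
  have rb: "rate_path (\<lambda>s. b (XX (real n * s) \<omega>))" for n
   using rate_path_scale[OF elim(3), of "real n"] by simp
  have r1: "rate_path (\<lambda>s. hn n (XX (real n * s) \<omega>))" for n
   using hnb[OF XE] by (intro rate_path_le[OF rb[of n]]) auto
  have r2: "rate_path (\<lambda>s. h (XX (real n * s) \<omega>))" for n
   using hb[OF XE] by (intro rate_path_le[OF rb[of n]]) auto
  have r3: "rate_path (\<lambda>s. D m (XX (real n * s) \<omega>))" for n m
   using D_le_b[OF XE] by (intro rate_path_le[OF rb[of n]]) auto
  show ?case
  proof (intro allI impI)
   fix t :: real assume t: "0 \<le> t"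
   let ?l = "t * (\<integral>e. h e \<partial>\<mu> i)"
   have ab: "\<bar>cum (\<lambda>s. hn n (XX (real n * s) \<omega>)) t - cum (\<lambda>s. h (XX (real n * s) \<omega>)) t\<bar>
     \<le> cum (\<lambda>s. D m (XX (real n * s) \<omega>)) t" if "m \<le> n" for m n
   proof -
    have "hn n (XX (real n * s) \<omega>) \<le> h (XX (real n * s) \<omega>) + D m (XX (real n * s) \<omega>)"
     "h (XX (real n * s) \<omega>) \<le> hn n (XX (real n * s) \<omega>) + D m (XX (real n * s) \<omega>)" for s
     using le_D[OF XE that, of "real n * s"] by linarith+
    then show ?thesis
     using cum_le_add[OF r1[of n] r2[of n] r3[of m n], of t] cum_le_add[OF r2[of n] r1[of n] r3[of m n], of t]
     by (simp add: abs_le_iff)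
   qed
   show "(\<lambda>n. cum (\<lambda>s. hn n (XX (real n * s) \<omega>)) t) \<longlonglongrightarrow> ?l"
   proof (rule LIMSEQ_I)
    fix r :: real assume r: "0 < r"
    have "(\<lambda>m. t * (\<integral>e. D m e \<partial>\<mu> i)) \<longlonglongrightarrow> t * 0" using tendsto_mult_left[OF DI] by simp
    then have "\<forall>\<^sub>F m in sequentially. t * (\<integral>e. D m e \<partial>\<mu> i) < r / 2" using r by (intro order_tendstoD) auto
    then obtain m where m: "t * (\<integral>e. D m e \<partial>\<mu> i) < r / 2" by (auto simp: eventually_sequentially)
    have "\<forall>\<^sub>F n in sequentially. cum (\<lambda>s. D m (XX (real n * s) \<omega>)) t < r / 2"
     using elim(1)[rule_format, OF t] m by (rule order_tendstoD)
    moreover have "\<forall>\<^sub>F n in sequentially. norm (cum (\<lambda>s. h (XX (real n * s) \<omega>)) t - ?l) < r / 2"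
     using tendstoD[OF elim(2)[rule_format, OF t], of "r / 2"] r by (simp add: dist_norm)
    ultimately have "\<forall>\<^sub>F n in sequentially. norm (cum (\<lambda>s. hn n (XX (real n * s) \<omega>)) t - ?l) < r"
     using eventually_ge_at_top[of m]
    proof eventually_elim
     case (elim n)
     have "norm (cum (\<lambda>s. hn n (XX (real n * s) \<omega>)) t - ?l)
       \<le> \<bar>cum (\<lambda>s. hn n (XX (real n * s) \<omega>)) t - cum (\<lambda>s. h (XX (real n * s) \<omega>)) t\<bar> + \<bar>cum (\<lambda>s. h (XX (real n * s) \<omega>)) t - ?l\<bar>"
      by simp
     also have "\<dots> < r / 2 + r / 2" using ab[OF elim(3)] elim(1,2) by (intro add_strict_mono) auto
     finally show ?case by simp
    qed
    then show "\<exists>no. \<forall>n\<ge>no. norm (cum (\<lambda>s. hn n (XX (real n * s) \<omega>)) t - ?l) < r"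
     by (simp add: eventually_sequentially)
   qed
  qed
 qed
qed

definition \<sigma> :: "nat \<Rightarrow> 'o \<Rightarrow> real \<Rightarrow> ennreal" where
 "\<sigma> n \<omega> u = firing_time G b X n \<omega> u"

lemma sigma_eq_hit:
 assumes rp: "rate_path (\<lambda>s. b (XX s \<omega>))"
 shows "\<sigma> n \<omega> u = hit (\<lambda>t. G (cum (\<lambda>s. b (XX (real n * s) \<omega>)) t)) u"
proof -
 have rpn: "rate_path (\<lambda>s. b (XX (real n * s) \<omega>))" using rate_path_scale[OF rp, of "real n"] by simp
 have "ext_cdf G (\<integral>\<^sup>+s\<in>{0..t}. ennreal (b (X (real n * s) \<omega>)) \<partial>lborel) = G (cum (\<lambda>s. b (XX (real n * s) \<omega>)) t)" for t
 proof -
  have "(\<integral>\<^sup>+s\<in>{0..t}. ennreal (b (X (real n * s) \<omega>)) \<partial>lborel) = (\<integral>\<^sup>+s\<in>{0..t}. ennreal (b (XX (real n * s) \<omega>)) \<partial>lborel)"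
   by (intro nn_integral_cong) (auto split: split_indicator simp: XX_eq)
  also have "\<dots> = ennreal (cum (\<lambda>s. b (XX (real n * s) \<omega>)) t)"
   by (rule rate_path.ennreal_cum[OF rpn, symmetric])
  finally show ?thesis by (simp add: ext_cdf_def cum_def)
 qed
 then show ?thesis by (simp add: \<sigma>_def firing_time_def hit_def)
qed

lemma sigma_measurable: "(\<lambda>(\<omega>, u). \<sigma> n \<omega> u) \<in> borel_measurable (Om \<Otimes>\<^sub>M borel)"
proof -
 obtain g where "jump_cdf G g" using abs_cont_cdf_jump_cdf[OF acG] ..
 then interpret jump_cdf G g .
 define A where "A \<omega> t = (\<integral>\<^sup>+s\<in>{0..t}. ennreal (b (XX (real n * s) \<omega>)) \<partial>lborel)" for \<omega> t
 have A_eq: "(\<integral>\<^sup>+s\<in>{0..t}. ennreal (b (X (real n * s) \<omega>)) \<partial>lborel) = A \<omega> t" for \<omega> t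
  unfolding A_def by (intro nn_integral_cong) (auto split: split_indicator simp: XX_eq)
 have A_mono: "s \<le> t \<Longrightarrow> A \<omega> s \<le> A \<omega> t" for s t \<omega>
  unfolding A_def by (intro nn_integral_mono) (auto split: split_indicator)
 have A_meas[measurable]: "(\<lambda>\<omega>. A \<omega> t) \<in> borel_measurable Om" for t
  unfolding A_def by measurable
 have ext: "ext_cdf G a = (if a = \<infinity> then 1 else cum g' (enn2real a))" for a
  by (simp add: ext_cdf_def G_eq_cum)
 have ext_meas[measurable]: "ext_cdf G \<in> borel_measurable borel"
  unfolding ext[abs_def] by measurable
 have ext_mono: "ext_cdf G a \<le> ext_cdf G c" if "a \<le> c" for a c
  using that G_le_1[of "enn2real a"] monoD[OF g'.mono_cum enn2real_mono[OF that]]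
  by (auto simp: ext G_eq_cum top_unique less_top)
 show ?thesis
 proof (rule borel_measurableI_less)
  fix c :: ennreal
  have iff: "\<sigma> n \<omega> u < c \<longleftrightarrow> (\<exists>q::rat. 0 \<le> q \<and> ennreal (real_of_rat q) < c \<and> u \<le> ext_cdf G (A \<omega> (real_of_rat q)))" for \<omega> u
  proof
   assume "\<sigma> n \<omega> u < c"
   then obtain t where t: "0 \<le> t" "u \<le> ext_cdf G (A \<omega> t)" "ennreal t < c"
    unfolding \<sigma>_def firing_time_def A_eq INF_less_iff by auto
   obtain d where d: "ennreal t < d" "d < c" using dense[OF t(3)] by blast
   then have d': "d = ennreal (enn2real d)" by (metis ennreal_enn2real top.extremum_strict less_top)
   then have "t < enn2real d" using d(1) t(1) by (metis ennreal_less_iff)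
   then obtain q where q: "t < real_of_rat q" "real_of_rat q < enn2real d" using of_rat_dense by blast
   have "ennreal (real_of_rat q) < c"
    using q t d(2) d' by (metis ennreal_leI less_imp_le order.strict_trans1)
   moreover have "u \<le> ext_cdf G (A \<omega> (real_of_rat q))"
    using t(2) ext_mono[OF A_mono[of t "real_of_rat q" \<omega>]] q(1) by linarith
   moreover have "0 \<le> q" using q t by (metis le_less_trans less_imp_le zero_less_of_rat_iff)
   ultimately show "\<exists>q::rat. 0 \<le> q \<and> ennreal (real_of_rat q) < c \<and> u \<le> ext_cdf G (A \<omega> (real_of_rat q))" by blast
  next
   assume "\<exists>q::rat. 0 \<le> q \<and> ennreal (real_of_rat q) < c \<and> u \<le> ext_cdf G (A \<omega> (real_of_rat q))"
   then obtain q :: rat where q: "0 \<le> q" "ennreal (real_of_rat q) < c" "u \<le> ext_cdf G (A \<omega> (real_of_rat q))" by blast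
   have "\<sigma> n \<omega> u \<le> ennreal (real_of_rat q)"
    unfolding \<sigma>_def firing_time_def A_eq using q by (intro INF_lower) auto
   then show "\<sigma> n \<omega> u < c" using q(2) by (rule order.strict_trans1)
  qed
  have "{p\<in>space (Om \<Otimes>\<^sub>M borel). \<exists>q::rat. 0 \<le> q \<and> ennreal (real_of_rat q) < c \<and> snd p \<le> ext_cdf G (A (fst p) (real_of_rat q))} \<in> sets (Om \<Otimes>\<^sub>M borel)"
   by measurable
  then show "{p\<in>space (Om \<Otimes>\<^sub>M borel). (case p of (\<omega>, u) \<Rightarrow> \<sigma> n \<omega> u) < c} \<in> sets (Om \<Otimes>\<^sub>M borel)"
   by (simp add: iff split_beta')
 qed
qed

lemma sigma_compose[measurable (raw)]:
 assumes "f \<in> N \<rightarrow>\<^sub>M Om" "g \<in> borel_measurable N"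
 shows "(\<lambda>x. \<sigma> n (f x) (g x)) \<in> borel_measurable N"
 using measurable_compose[OF measurable_Pair[OF assms] sigma_measurable] by simp

text \<open>\<open>law y\<close> drives one piece started from \<open>y\<close>.\<close>

definition law :: "'e \<Rightarrow> ('o \<times> real) measure" where "law y = P y \<Otimes>\<^sub>M unif01"

lemma sets_law: "y \<in> space E \<Longrightarrow> sets (law y) = sets (Om \<Otimes>\<^sub>M borel)"
 unfolding law_def by (intro sets_pair_measure_cong) (auto simp: sets_P)

lemma space_law: "y \<in> space E \<Longrightarrow> space (law y) = space (Om \<Otimes>\<^sub>M borel)"
 by (rule sets_eq_imp_space_eq[OF sets_law])

lemma prob_law: "y \<in> space E \<Longrightarrow> prob_space (law y)"
 unfolding law_def by (intro prob_space_pair P_prob prob_space_unif01)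

lemma law_measurable: "law \<in> E \<rightarrow>\<^sub>M prob_algebra (Om \<Otimes>\<^sub>M borel)"
proof (rule measurable_prob_algebraI)
 have "(\<lambda>_. unif01) \<in> E \<rightarrow>\<^sub>M subprob_algebra borel"
  by (intro measurable_const) (simp add: space_subprob_algebra prob_space_imp_subprob_space prob_space_unif01)
 then show "law \<in> E \<rightarrow>\<^sub>M subprob_algebra (Om \<Otimes>\<^sub>M borel)"
  unfolding law_def[abs_def] by (intro measurable_pair_measure measurable_prob_algebraD[OF P_measurable])
qed (rule prob_law)

definition \<beta> :: "'i \<Rightarrow> real" where "\<beta> j = mean_rate \<mu> b j"

lemma beta_eq: "\<beta> j = (\<integral>e. b e \<partial>\<mu> j)" by (simp add: \<beta>_def mean_rate_def)

lemma beta_nonneg: "j \<in> space I \<Longrightarrow> 0 \<le> \<beta> j"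
 unfolding beta_eq using b_nonneg Ei_subset[of j] by (intro Bochner_Integration.integral_nonneg_AE AE_I2) (auto simp: space_mu)

text \<open>Integrates \<open>hit_limit\<close> over the path; the almost sure limits of the two clocks come from
 \<open>ergodic_varying\<close>, with \<open>\<kappa> = \<mu>\<^sub>i(b q)\<close>.\<close>

lemma firing_limit:
 assumes i: "i \<in> space I" and y: "y \<in> space (Ei i)"
  and qn[measurable]: "\<And>n. qn n \<in> borel_measurable E" and qn1: "\<And>n e. e \<in> space E \<Longrightarrow> 0 \<le> qn n e \<and> qn n e \<le> 1"
  and q[measurable]: "q \<in> borel_measurable E"
  and lim: "\<And>e. e \<in> space E \<Longrightarrow> (\<lambda>n. qn n e) \<longlonglongrightarrow> q e"
  and t: "0 \<le> t"
 shows "(\<lambda>n. \<integral>\<^sup>+p. ennreal (qn n (XX (real n * enn2real (\<sigma> n (fst p) (snd p))) (fst p))) * indicator {p. \<sigma> n (fst p) (snd p) < ennreal t} p \<partial>law y)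
  \<longlonglongrightarrow> ennreal ((\<integral>e. b e * q e \<partial>\<mu> i) / \<beta> i * G (t * \<beta> i))"
proof -
 obtain g where "jump_cdf G g" using abs_cont_cdf_jump_cdf[OF acG] ..
 then interpret jump_cdf G g .
 have yE: "y \<in> space E" using y Ei_subset[OF i] by auto
 have [measurable_cong]: "sets (P y) = sets Om" by (rule sets_P[OF yE])
 interpret Py: prob_space "P y" by (rule P_prob[OF yE])
 interpret U: prob_space unif01 by (rule prob_space_unif01)
 have q1: "0 \<le> q e \<and> q e \<le> 1" if "e \<in> space E" for e
  using LIMSEQ_le_const[OF lim[OF that], of 0] LIMSEQ_le_const2[OF lim[OF that], of 1] qn1[OF that] by auto
 have e1: "AE \<omega> in P y. \<forall>t\<ge>0. (\<lambda>n. cum (\<lambda>s. b (XX (real n * s) \<omega>)) t) \<longlonglongrightarrow> t * (\<integral>e. b e \<partial>\<mu> i)"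
  using b_nonneg by (intro ergodic_varying[OF i y]) auto
 have e2: "AE \<omega> in P y. \<forall>t\<ge>0. (\<lambda>n. cum (\<lambda>s. b (XX (real n * s) \<omega>) * qn n (XX (real n * s) \<omega>)) t) \<longlonglongrightarrow> t * (\<integral>e. b e * q e \<partial>\<mu> i)"
 proof (rule ergodic_varying[OF i y, where hn="\<lambda>n e. b e * qn n e"])
  show "0 \<le> b e * qn n e \<and> b e * qn n e \<le> b e" if "e \<in> space E" for n e
   using b_nonneg[OF that] qn1[OF that, of n] by (auto intro: mult_left_le)
  show "0 \<le> b e * q e \<and> b e * q e \<le> b e" if "e \<in> space E" for e
   using b_nonneg[OF that] q1[OF that] by (auto intro: mult_left_le)
  show "(\<lambda>n. b e * qn n e) \<longlonglongrightarrow> b e * q e" if "e \<in> space E" for e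
   by (intro tendsto_mult_left lim that)
 qed auto
 let ?f = "\<lambda>n \<omega> u. ennreal (qn n (XX (real n * enn2real (\<sigma> n \<omega> u)) \<omega>)) * indicator {p. \<sigma> n (fst p) (snd p) < ennreal t} (\<omega>, u)"
 let ?L = "ennreal ((\<integral>e. b e * q e \<partial>\<mu> i) / \<beta> i * G (t * \<beta> i))"
 have fm: "(\<lambda>(\<omega>, u). ?f n \<omega> u) \<in> borel_measurable (Om \<Otimes>\<^sub>M borel)" for n
 proof -
  have "(\<lambda>p. ennreal (qn n (XX (real n * enn2real (\<sigma> n (fst p) (snd p))) (fst p))) * indicator {..<ennreal t} (\<sigma> n (fst p) (snd p))) \<in> borel_measurable (Om \<Otimes>\<^sub>M borel)"
   by measurable
  then show ?thesis by (simp add: split_beta' indicator_def)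
 qed
 have fle: "?f n \<omega> u \<le> 1" if "\<omega> \<in> space Om" for n \<omega> u
  using qn1[OF XX_space[OF that]] by (auto split: split_indicator)
 have "(\<lambda>n. \<integral>\<^sup>+\<omega>. (\<integral>\<^sup>+u. ?f n \<omega> u \<partial>unif01) \<partial>P y) \<longlonglongrightarrow> (\<integral>\<^sup>+\<omega>. ?L \<partial>P y)"
 proof (rule nn_integral_dominated_convergence[where w="\<lambda>_. 1"])
  show "(\<lambda>\<omega>. \<integral>\<^sup>+u. ?f n \<omega> u \<partial>unif01) \<in> borel_measurable (P y)" for n
   using fm by (intro U.borel_measurable_nn_integral) (simp cong: measurable_cong_sets)
  show "AE \<omega> in P y. (\<integral>\<^sup>+u. ?f n \<omega> u \<partial>unif01) \<le> 1" for n
  proof (rule AE_I2)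
   fix \<omega> assume "\<omega> \<in> space (P y)"
   then have "\<omega> \<in> space Om" by (simp add: space_P[OF yE])
   then have "(\<integral>\<^sup>+u. ?f n \<omega> u \<partial>unif01) \<le> (\<integral>\<^sup>+u. 1 \<partial>unif01)" using fle by (intro nn_integral_mono) auto
   then show "(\<integral>\<^sup>+u. ?f n \<omega> u \<partial>unif01) \<le> 1" using U.emeasure_space_1 by (simp only: nn_integral_const mult_1)
  qed
  show "(\<integral>\<^sup>+\<omega>. 1 \<partial>P y) < \<infinity>" by (simp add: Py.emeasure_space_1)
  from e1 e2 AE_b_rate_path[OF i y] AE_space
  show "AE \<omega> in P y. (\<lambda>n. \<integral>\<^sup>+u. ?f n \<omega> u \<partial>unif01) \<longlonglongrightarrow> ?L"
  proof eventually_elim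
   case (elim \<omega>)
   then have \<omega>: "\<omega> \<in> space Om" by (simp add: space_P[OF yE])
   have [measurable]: "(\<lambda>s. XX s \<omega>) \<in> borel \<rightarrow>\<^sub>M E" by (rule XX_time[OF \<omega>])
   have "(\<lambda>n. \<integral>\<^sup>+u. ennreal (qn n (XX (real n * enn2real (hit (\<lambda>t. G (cum (\<lambda>s. b (XX (real n * s) \<omega>)) t)) u)) \<omega>))
      * indicator {u. hit (\<lambda>t. G (cum (\<lambda>s. b (XX (real n * s) \<omega>)) t)) u < ennreal t} u \<partial>unif01)
     \<longlonglongrightarrow> ennreal ((\<integral>e. b e * q e \<partial>\<mu> i) / (\<integral>e. b e \<partial>\<mu> i) * G (t * (\<integral>e. b e \<partial>\<mu> i)))"
    using elim(1,2) qn1[OF XX_space[OF \<omega>]] rate_path_scale[OF elim(3), of "real _"]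
    by (intro hit_limit[where a="\<lambda>n s. b (XX (real n * s) \<omega>)" and r="\<lambda>n s. qn n (XX (real n * s) \<omega>)"] t) auto
   then show ?case by (simp add: sigma_eq_hit[OF elim(3)] beta_eq indicator_def)
  qed
 qed simp_all
 also have "(\<lambda>n. \<integral>\<^sup>+\<omega>. (\<integral>\<^sup>+u. ?f n \<omega> u \<partial>unif01) \<partial>P y) = (\<lambda>n. \<integral>\<^sup>+p. (case p of (\<omega>, u) \<Rightarrow> ?f n \<omega> u) \<partial>law y)"
 proof
  fix n
  have "(\<lambda>(\<omega>, u). ?f n \<omega> u) \<in> borel_measurable (P y \<Otimes>\<^sub>M unif01)"
   using fm by (simp cong: measurable_cong_sets sets_pair_measure_cong)
  from U.nn_integral_fst[OF this]
  show "(\<integral>\<^sup>+\<omega>. (\<integral>\<^sup>+u. ?f n \<omega> u \<partial>unif01) \<partial>P y) = (\<integral>\<^sup>+p. (case p of (\<omega>, u) \<Rightarrow> ?f n \<omega> u) \<partial>law y)"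
   by (simp add: law_def)
 qed
 finally show ?thesis by (simp add: split_beta' Py.emeasure_space_1)
qed

end

section \<open>Rounded holding times and the one-step recursion\<close>

definition cell :: "nat \<Rightarrow> ennreal \<Rightarrow> nat" where
 "cell r s = nat \<lfloor>real r * enn2real s\<rfloor>"

lemma cell_measurable[measurable]: "cell r \<in> borel \<rightarrow>\<^sub>M count_space UNIV"
 unfolding cell_def[abs_def] by measurable

lemma cell_eq_iff:
 assumes r: "0 < r" and x: "x < \<top>"
 shows "cell r x = c \<longleftrightarrow> x < ennreal (real (Suc c) / real r) \<and> \<not> x < ennreal (real c / real r)"
proof -
 define v where "v = enn2real x"
 have xv: "x = ennreal v" and v: "0 \<le> v" using x by (simp_all add: v_def)
 have "cell r x = c \<longleftrightarrow> \<lfloor>real r * v\<rfloor> = int c"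
  using v by (auto simp: cell_def v_def)
 also have "\<dots> \<longleftrightarrow> real c \<le> real r * v \<and> real r * v < real c + 1" by (simp add: floor_eq_iff)
 also have "\<dots> \<longleftrightarrow> v < real (Suc c) / real r \<and> \<not> v < real c / real r"
  using r by (auto simp: field_simps)
 finally show ?thesis using v by (simp add: xv ennreal_less_iff)
qed

text \<open>A function of the rounded time telescopes into distribution functions, the only functionals of the
 firing time whose limit is known.\<close>

lemma cell_sum:
 fixes f :: "nat \<Rightarrow> ennreal"
 assumes r: "0 < r" and f: "\<And>c. f c \<le> 1"
 shows "indicator {..<ennreal (real Q / real r)} x * f (cell r x) =
  (\<Sum>c<Q. f c * indicator {..<ennreal (real (Suc c) / real r)} x - f c * indicator {..<ennreal (real c / real r)} x)"
proof (cases "x < ennreal (real Q / real r)")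
 case True
 then have x: "x < \<top>" using ennreal_less_top by (rule less_trans)
 have cQ: "cell r x < Q"
 proof (rule ccontr)
  assume "\<not> cell r x < Q"
  then have "ennreal (real Q / real r) \<le> ennreal (real (cell r x) / real r)"
   by (intro ennreal_leI divide_right_mono) auto
  with True have "x < ennreal (real (cell r x) / real r)" by (rule order.strict_trans2)
  then show False using cell_eq_iff[OF r x, of "cell r x"] by simp
 qed
 have "f c * indicator {..<ennreal (real (Suc c) / real r)} x - f c * indicator {..<ennreal (real c / real r)} x
   = (if c = cell r x then f c else 0)" for c
 proof -
  have fin: "f c - f c = 0" using f[of c] by (intro diff_eq_0_ennreal) (auto intro: le_less_trans)
  have mono: "x < ennreal (real c / real r) \<Longrightarrow> x < ennreal (real (Suc c) / real r)"
   by (erule order.strict_trans2) (intro ennreal_leI divide_right_mono, auto)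
  show ?thesis using cell_eq_iff[OF r x, of c] fin mono by (auto split: split_indicator simp del: of_nat_Suc)
 qed
 then show ?thesis using True cQ by (simp add: sum.delta' del: of_nat_Suc)
next
 case False
 have "\<not> x < ennreal (real c / real r)" if "c \<le> Q" for c
 proof -
  have "ennreal (real c / real r) \<le> ennreal (real Q / real r)"
   using that by (intro ennreal_leI divide_right_mono) auto
  then show ?thesis using False by (meson order.strict_trans2)
 qed
 then show ?thesis using False by (simp del: of_nat_Suc)
qed

lemma nn_integral_cell:
 fixes f :: "nat \<Rightarrow> 'a \<Rightarrow> ennreal"
 assumes r: "0 < r" and N: "prob_space N" and [measurable]: "x \<in> borel_measurable N" "\<And>c. f c \<in> borel_measurable N"
  and f: "\<And>c p. p \<in> space N \<Longrightarrow> f c p \<le> 1"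
 shows "(\<integral>\<^sup>+p. indicator {..<ennreal (real Q / real r)} (x p) * f (cell r (x p)) p \<partial>N) =
  (\<Sum>c<Q. (\<integral>\<^sup>+p. f c p * indicator {..<ennreal (real (Suc c) / real r)} (x p) \<partial>N)
     - (\<integral>\<^sup>+p. f c p * indicator {..<ennreal (real c / real r)} (x p) \<partial>N))"
proof -
 interpret prob_space N by fact
 have "(\<integral>\<^sup>+p. indicator {..<ennreal (real Q / real r)} (x p) * f (cell r (x p)) p \<partial>N) =
   (\<integral>\<^sup>+p. (\<Sum>c<Q. f c p * indicator {..<ennreal (real (Suc c) / real r)} (x p) - f c p * indicator {..<ennreal (real c / real r)} (x p)) \<partial>N)"
  by (intro nn_integral_cong cell_sum[OF r] f)
 also have "\<dots> = (\<Sum>c<Q. \<integral>\<^sup>+p. (f c p * indicator {..<ennreal (real (Suc c) / real r)} (x p) - f c p * indicator {..<ennreal (real c / real r)} (x p)) \<partial>N)"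
  by (rule nn_integral_sum) measurable
 also have "\<dots> = (\<Sum>c<Q. (\<integral>\<^sup>+p. f c p * indicator {..<ennreal (real (Suc c) / real r)} (x p) \<partial>N)
     - (\<integral>\<^sup>+p. f c p * indicator {..<ennreal (real c / real r)} (x p) \<partial>N))"
 proof (rule sum.cong[OF refl], rule nn_integral_diff)
  fix c
  have "(\<integral>\<^sup>+p. f c p * indicator {..<ennreal (real c / real r)} (x p) \<partial>N) \<le> (\<integral>\<^sup>+p. 1 \<partial>N)"
   using f by (intro nn_integral_mono) (auto split: split_indicator)
  then show "(\<integral>\<^sup>+p. f c p * indicator {..<ennreal (real c / real r)} (x p) \<partial>N) \<noteq> \<infinity>"
   by (auto simp: emeasure_space_1 top_unique)
  have "y < ennreal (real c / real r) \<Longrightarrow> y < ennreal (real (Suc c) / real r)" for y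
   by (erule order.strict_trans2) (intro ennreal_leI divide_right_mono, auto)
  then show "AE p in N. f c p * indicator {..<ennreal (real c / real r)} (x p) \<le> f c p * indicator {..<ennreal (real (Suc c) / real r)} (x p)"
   by (intro AE_I2 mult_left_mono) (auto split: split_indicator simp del: of_nat_Suc)
 qed measurable
 finally show ?thesis .
qed

text \<open>A record \<open>p\<close> of the past, updated at each jump by the index of the finished piece and its rounded length.\<close>

primrec prun :: "('p \<Rightarrow> 'i \<Rightarrow> nat \<Rightarrow> 'p) \<Rightarrow> 'p \<Rightarrow> nat \<Rightarrow> (nat \<Rightarrow> 'w \<Rightarrow> 'i) \<Rightarrow> (nat \<Rightarrow> 'w \<Rightarrow> ennreal) \<Rightarrow> nat \<Rightarrow> 'w \<Rightarrow> 'p" where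
 "prun upd p0 r J S 0 w = p0"
| "prun upd p0 r J S (Suc l) w = upd (prun upd p0 r J S l w) (J l w) (cell r (S l w))"

text \<open>A bound on each single holding time, rather than on their sum, makes the restriction multiplicative
 and therefore compatible with the recursion over jumps.\<close>

definition adm :: "nat \<Rightarrow> nat \<Rightarrow> (nat \<Rightarrow> 'w \<Rightarrow> ennreal) \<Rightarrow> nat \<Rightarrow> 'w \<Rightarrow> bool" where
 "adm Q r S l w \<longleftrightarrow> (\<forall>i<l. S i w < ennreal (real Q / real r))"

lemma adm_Suc: "adm Q r S (Suc l) w \<longleftrightarrow> adm Q r S l w \<and> S l w < ennreal (real Q / real r)"
 by (auto simp: adm_def less_Suc_eq)

lemma adm_finite: "adm Q r S l w \<Longrightarrow> jump_time S l w < \<infinity>"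
 unfolding adm_def jump_time_def by (auto simp: ennreal_sum_less_top intro: less_trans[OF _ ennreal_less_top])

lemma jump_time_adm: "jump_time S l w < ennreal (real Q / real r) \<Longrightarrow> adm Q r S l w"
proof -
 have "S i w \<le> jump_time S l w" if "i < l" for i
  unfolding jump_time_def using that by (intro member_le_sum) auto
 then show "jump_time S l w < ennreal (real Q / real r) \<Longrightarrow> adm Q r S l w"
  unfolding adm_def by (meson order.strict_trans1)
qed

lemma cond_law_on_subset:
 "cond_law_on M H Q R N \<kappa> \<Longrightarrow> (\<And>w. Q' w \<Longrightarrow> Q w) \<Longrightarrow> cond_law_on M H Q' R N \<kappa>"
 unfolding cond_law_on_def by (auto elim!: eventually_mono)

lemma measurable_update_cell:
 assumes upd: "\<And>q. (\<lambda>(p, j). upd p j q) \<in> PP \<Otimes>\<^sub>M I \<rightarrow>\<^sub>M PP"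
  and P1: "P1 \<in> N \<rightarrow>\<^sub>M PP" and J1: "J1 \<in> N \<rightarrow>\<^sub>M I" and c1: "c1 \<in> N \<rightarrow>\<^sub>M count_space UNIV"
 shows "(\<lambda>z. upd (P1 z) (J1 z) (c1 z :: nat)) \<in> N \<rightarrow>\<^sub>M PP"
proof (rule measurable_compose_countable[where f="\<lambda>q z. upd (P1 z) (J1 z) q", OF _ c1])
 show "(\<lambda>z. upd (P1 z) (J1 z) q) \<in> N \<rightarrow>\<^sub>M PP" for q
  using measurable_compose[OF measurable_Pair[OF P1 J1] upd[of q]] by simp
qed

lemma prun_measurable:
 assumes upd: "\<And>q. (\<lambda>(p, j). upd p j q) \<in> PP \<Otimes>\<^sub>M I \<rightarrow>\<^sub>M PP" and p0: "p0 \<in> space PP"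
  and J: "\<And>i. i < l \<Longrightarrow> J i \<in> H \<rightarrow>\<^sub>M I" and S: "\<And>i. i < l \<Longrightarrow> S i \<in> borel_measurable H"
 shows "prun upd p0 r J S l \<in> H \<rightarrow>\<^sub>M PP"
 using J S
proof (induction l)
 case 0 then show ?case using p0 by simp
next
 case (Suc l)
 have IH: "prun upd p0 r J S l \<in> H \<rightarrow>\<^sub>M PP" using Suc by auto
 have "(\<lambda>w. upd (prun upd p0 r J S l w) (J l w) (cell r (S l w))) \<in> H \<rightarrow>\<^sub>M PP"
 proof (rule measurable_compose_countable[where f="\<lambda>q w. upd (prun upd p0 r J S l w) (J l w) q"])
  show "(\<lambda>w. upd (prun upd p0 r J S l w) (J l w) q) \<in> H \<rightarrow>\<^sub>M PP" for q
   using measurable_compose[OF measurable_Pair[OF IH Suc(2)[of l]] upd[of q]] by simp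
  show "(\<lambda>w. cell r (S l w)) \<in> H \<rightarrow>\<^sub>M count_space UNIV"
   by (rule measurable_compose[OF Suc(3) cell_measurable]) simp
 qed
 then show ?case by simp
qed

context base_model begin

text \<open>\<open>kappa j q / \<beta> j\<close> is the limiting mean of \<open>q\<close> at the position from which a piece in \<open>j\<close> jumps.\<close>

definition kappa :: "'i \<Rightarrow> ('e \<Rightarrow> ennreal) \<Rightarrow> real" where
 "kappa j q = (\<integral>e. b e * enn2real (q e) \<partial>\<mu> j)"

definition step :: "nat \<Rightarrow> nat \<Rightarrow> nat \<Rightarrow> (nat \<Rightarrow> 'e \<Rightarrow> ennreal) \<Rightarrow> 'e \<Rightarrow> ennreal" where
 "step Q r n g y = (\<integral>\<^sup>+p. indicator {..<ennreal (real Q / real r)} (\<sigma> n (fst p) (snd p))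
   * g (cell r (\<sigma> n (fst p) (snd p))) (XX (real n * enn2real (\<sigma> n (fst p) (snd p))) (fst p)) \<partial>law y)"

definition step_lim :: "nat \<Rightarrow> nat \<Rightarrow> (nat \<Rightarrow> 'e \<Rightarrow> ennreal) \<Rightarrow> 'i \<Rightarrow> ennreal" where
 "step_lim Q r g j = (\<Sum>c<Q. ennreal (kappa j (g c) / \<beta> j * G (real (Suc c) / real r * \<beta> j))
   - ennreal (kappa j (g c) / \<beta> j * G (real c / real r * \<beta> j)))"

lemma step_limit:
 assumes r: "0 < r" and y: "y \<in> space E"
  and gn[measurable]: "\<And>n c. gn n c \<in> borel_measurable E" and gn1: "\<And>n c e. e \<in> space E \<Longrightarrow> gn n c e \<le> 1"
  and lim: "\<And>c e. e \<in> space E \<Longrightarrow> (\<lambda>n. gn n c e) \<longlonglongrightarrow> g c e"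
 shows "(\<lambda>n. step Q r n (gn n) y) \<longlonglongrightarrow> step_lim Q r g (\<phi> y)"
proof -
 let ?i = "\<phi> y"
 have i: "?i \<in> space I" and yi: "y \<in> space (Ei ?i)" using y by (auto intro: phi_space in_Ei)
 have fin: "gn n c e < \<top>" if "e \<in> space E" for n c e using gn1[OF that, of n c] by (auto intro: le_less_trans)
 have g1: "g c e \<le> 1" if "e \<in> space E" for c e
  using gn1[OF that] by (intro LIMSEQ_le_const2[OF lim[OF that, of c]]) auto
 have g_meas[measurable]: "g c \<in> borel_measurable E" for c
  by (rule borel_measurable_LIMSEQ_order[OF lim gn])
 have [measurable_cong]: "sets (law y) = sets (Om \<Otimes>\<^sub>M borel)" by (rule sets_law[OF y])
 have pm: "prob_space (law y)" by (rule prob_law[OF y])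
 define A where "A n c t = (\<integral>\<^sup>+p. gn n c (XX (real n * enn2real (\<sigma> n (fst p) (snd p))) (fst p)) * indicator {..<ennreal t} (\<sigma> n (fst p) (snd p)) \<partial>law y)" for n c t
 have A_lim: "(\<lambda>n. A n c t) \<longlonglongrightarrow> ennreal (kappa ?i (g c) / \<beta> ?i * G (t * \<beta> ?i))" if t: "0 \<le> t" for c t
 proof -
  have "(\<lambda>n. \<integral>\<^sup>+p. ennreal (enn2real (gn n c (XX (real n * enn2real (\<sigma> n (fst p) (snd p))) (fst p)))) * indicator {p. \<sigma> n (fst p) (snd p) < ennreal t} p \<partial>law y)
   \<longlonglongrightarrow> ennreal ((\<integral>e. b e * enn2real (g c e) \<partial>\<mu> ?i) / \<beta> ?i * G (t * \<beta> ?i))"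
  proof (rule firing_limit[OF i yi _ _ _ _ t])
   show "0 \<le> enn2real (gn n c e) \<and> enn2real (gn n c e) \<le> 1" if "e \<in> space E" for n e
    using gn1[OF that, of n c] by (auto intro: enn2real_leI)
   show "(\<lambda>n. enn2real (gn n c e)) \<longlonglongrightarrow> enn2real (g c e)" if "e \<in> space E" for e
   proof -
    have "g c e < \<top>" using g1[OF that, of c] by (auto intro: le_less_trans)
    then have "ennreal (enn2real (g c e)) = g c e" by simp
    with lim[OF that, of c] show ?thesis by (intro tendsto_enn2real) auto
   qed
  qed measurable
  moreover have "(\<integral>\<^sup>+p. ennreal (enn2real (gn n c (XX (real n * enn2real (\<sigma> n (fst p) (snd p))) (fst p)))) * indicator {p. \<sigma> n (fst p) (snd p) < ennreal t} p \<partial>law y) = A n c t" for n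
   unfolding A_def
  proof (rule nn_integral_cong)
   fix p assume "p \<in> space (law y)"
   then have "fst p \<in> space Om" by (auto simp: space_law[OF y] space_pair_measure)
   then have "gn n c (XX (real n * enn2real (\<sigma> n (fst p) (snd p))) (fst p)) < \<top>" by (intro fin XX_space)
   then show "ennreal (enn2real (gn n c (XX (real n * enn2real (\<sigma> n (fst p) (snd p))) (fst p)))) * indicator {p. \<sigma> n (fst p) (snd p) < ennreal t} p
     = gn n c (XX (real n * enn2real (\<sigma> n (fst p) (snd p))) (fst p)) * indicator {..<ennreal t} (\<sigma> n (fst p) (snd p))"
    by (simp add: indicator_def)
  qed
  ultimately show ?thesis by (simp add: kappa_def)
 qed
 have "step Q r n (gn n) y = (\<Sum>c<Q. A n c (real (Suc c) / real r) - A n c (real c / real r))" for n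
  unfolding step_def A_def
 proof (rule nn_integral_cell[OF r pm, where f="\<lambda>c p. gn n c (XX (real n * enn2real (\<sigma> n (fst p) (snd p))) (fst p))"])
  show "gn n c (XX (real n * enn2real (\<sigma> n (fst p) (snd p))) (fst p)) \<le> 1" if "p \<in> space (law y)" for c p
   using that by (intro gn1 XX_space) (auto simp: space_law[OF y] space_pair_measure)
 qed measurable
 moreover have "(\<lambda>n. \<Sum>c<Q. A n c (real (Suc c) / real r) - A n c (real c / real r)) \<longlonglongrightarrow> step_lim Q r g ?i"
  unfolding step_lim_def by (intro tendsto_sum tendsto_diff_ennreal A_lim) auto
 ultimately show ?thesis by simp
qed

lemma accelerated_facts:
 assumes acc: "accelerated E Om X P G b \<pi> n x M Y W U"
 shows "prob_space M" "\<And>k. Y k \<in> M \<rightarrow>\<^sub>M E" "AE w in M. Y 0 w = x"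
  "\<And>k. W k \<in> M \<rightarrow>\<^sub>M Om" "\<And>k. U k \<in> borel_measurable M"
  "\<And>k. cond_law_on M (history M E Y (Suc k) (Om \<Otimes>\<^sub>M borel) (\<lambda>k w. (W k w, U k w)) k)
        (\<lambda>w. jump_time (piece_len G b X n W U) k w < \<infinity>) (\<lambda>w. (W k w, U k w)) (Om \<Otimes>\<^sub>M borel)
        (\<lambda>w. emeasure (P (Y k w) \<Otimes>\<^sub>M unif01))"
  "\<And>k. cond_law_on M (history M E Y (Suc k) (Om \<Otimes>\<^sub>M borel) (\<lambda>k w. (W k w, U k w)) (Suc k))
        (\<lambda>w. jump_time (piece_len G b X n W U) (Suc k) w < \<infinity>) (Y (Suc k)) E
        (\<lambda>w. emeasure (\<pi> (X (real n * enn2real (piece_len G b X n W U k w)) (W k w))))"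
proof -
 show c: "\<And>k. cond_law_on M (history M E Y (Suc k) (Om \<Otimes>\<^sub>M borel) (\<lambda>k w. (W k w, U k w)) k)
        (\<lambda>w. jump_time (piece_len G b X n W U) k w < \<infinity>) (\<lambda>w. (W k w, U k w)) (Om \<Otimes>\<^sub>M borel)
        (\<lambda>w. emeasure (P (Y k w) \<Otimes>\<^sub>M unif01))"
  using acc unfolding accelerated_def Let_def by blast
 have R: "(\<lambda>w. (W k w, U k w)) \<in> M \<rightarrow>\<^sub>M Om \<Otimes>\<^sub>M borel" for k using c[of k] by (simp add: cond_law_on_def)
 show "W k \<in> M \<rightarrow>\<^sub>M Om" for k using measurable_compose[OF R[of k] measurable_fst] by simp
 show "U k \<in> borel_measurable M" for k using measurable_compose[OF R[of k] measurable_snd] by simp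
qed (use acc in \<open>unfold accelerated_def Let_def, blast+\<close>)

lemma position_kernel_measurable:
 "(\<lambda>a. \<pi> (XX (real n * enn2real (\<sigma> n (fst (snd a)) (snd (snd a)))) (fst (snd a))))
  \<in> (E \<Otimes>\<^sub>M PP) \<Otimes>\<^sub>M (Om \<Otimes>\<^sub>M borel) \<rightarrow>\<^sub>M subprob_algebra E"
 by (rule measurable_compose[OF _ measurable_prob_algebraD[OF pi_measurable]]) measurable

lemma update_measurable:
 fixes r :: nat
 assumes upd: "\<And>q. (\<lambda>(p, j). upd p j q) \<in> PP \<Otimes>\<^sub>M I \<rightarrow>\<^sub>M PP"
  and g[measurable]: "g \<in> borel_measurable (E \<Otimes>\<^sub>M PP)"
 shows "(\<lambda>(a, y'). g (y', upd (snd (fst a)) (\<phi> (fst (fst a))) (cell r (\<sigma> n (fst (snd a)) (snd (snd a))))))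
  \<in> borel_measurable (((E \<Otimes>\<^sub>M PP) \<Otimes>\<^sub>M (Om \<Otimes>\<^sub>M borel)) \<Otimes>\<^sub>M E)"
proof -
 let ?A2 = "(E \<Otimes>\<^sub>M PP) \<Otimes>\<^sub>M (Om \<Otimes>\<^sub>M borel)"
 let ?sg = "\<lambda>a. \<sigma> n (fst (snd a)) (snd (snd a))"
 have "(\<lambda>z. upd (snd (fst (fst z))) (\<phi> (fst (fst (fst z)))) (cell r (?sg (fst z)))) \<in> ?A2 \<Otimes>\<^sub>M E \<rightarrow>\<^sub>M PP"
  by (rule measurable_update_cell[where I=I, OF upd]) measurable
 then have "(\<lambda>z. (snd z, upd (snd (fst (fst z))) (\<phi> (fst (fst (fst z)))) (cell r (?sg (fst z))))) \<in> ?A2 \<Otimes>\<^sub>M E \<rightarrow>\<^sub>M E \<Otimes>\<^sub>M PP"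
  by (intro measurable_Pair measurable_snd)
 from measurable_compose[OF this g] show ?thesis by (simp add: split_beta')
qed

lemma step_integrand_measurable:
 fixes r Q :: nat
 assumes upd: "\<And>q. (\<lambda>(p, j). upd p j q) \<in> PP \<Otimes>\<^sub>M I \<rightarrow>\<^sub>M PP"
  and g: "g \<in> borel_measurable (E \<Otimes>\<^sub>M PP)"
 shows "(\<lambda>(a, q). indicator {..<ennreal (real Q / real r)} (\<sigma> n (fst q) (snd q)) *
   (\<integral>\<^sup>+y'. g (y', upd (snd (fst (a, q))) (\<phi> (fst (fst (a, q)))) (cell r (\<sigma> n (fst (snd (a, q))) (snd (snd (a, q))))))
    \<partial>\<pi> (XX (real n * enn2real (\<sigma> n (fst (snd (a, q))) (snd (snd (a, q))))) (fst (snd (a, q))))))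
  \<in> borel_measurable ((E \<Otimes>\<^sub>M PP) \<Otimes>\<^sub>M (Om \<Otimes>\<^sub>M borel))"
proof -
 let ?A2 = "(E \<Otimes>\<^sub>M PP) \<Otimes>\<^sub>M (Om \<Otimes>\<^sub>M borel)"
 let ?sg = "\<lambda>a. \<sigma> n (fst (snd a)) (snd (snd a))"
 let ?K2 = "\<lambda>a. \<pi> (XX (real n * enn2real (?sg a)) (fst (snd a)))"
 let ?Phi2 = "\<lambda>a y'. g (y', upd (snd (fst a)) (\<phi> (fst (fst a))) (cell r (?sg a)))"
 have Hm: "(\<lambda>a. \<integral>\<^sup>+y'. ?Phi2 a y' \<partial>?K2 a) \<in> borel_measurable ?A2"
  by (rule nn_integral_measurable_subprob_algebra2[OF update_measurable[OF upd g] position_kernel_measurable])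
 have "(\<lambda>a. indicator {..<ennreal (real Q / real r)} (?sg a) * (\<integral>\<^sup>+y'. ?Phi2 a y' \<partial>?K2 a)) \<in> borel_measurable ?A2"
  by (rule borel_measurable_times_ennreal[OF _ Hm]) measurable
 then show ?thesis by (simp add: split_beta')
qed

lemma step_measurable:
 fixes r Q :: nat
 assumes upd: "\<And>q. (\<lambda>(p, j). upd p j q) \<in> PP \<Otimes>\<^sub>M I \<rightarrow>\<^sub>M PP"
  and g: "g \<in> borel_measurable (E \<Otimes>\<^sub>M PP)"
 shows "(\<lambda>(y, p). step Q r n (\<lambda>c e. \<integral>\<^sup>+y'. g (y', upd p (\<phi> y) c) \<partial>\<pi> e) y) \<in> borel_measurable (E \<Otimes>\<^sub>M PP)"
proof -
 have K1: "(\<lambda>a. law (fst a)) \<in> E \<Otimes>\<^sub>M PP \<rightarrow>\<^sub>M subprob_algebra (Om \<Otimes>\<^sub>M borel)"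
  by (rule measurable_compose[OF measurable_fst measurable_prob_algebraD[OF law_measurable]])
 from nn_integral_measurable_subprob_algebra2[OF step_integrand_measurable[where Q=Q and n=n and r=r, OF upd g] K1]
 show ?thesis by (simp add: step_def split_beta')
qed

text \<open>Integrates out the new position given the last piece, then the last piece given its starting point.\<close>

lemma accelerated_step:
 fixes r Q :: nat
 assumes acc: "accelerated E Om X P G b \<pi> n x M Y W U"
  and upd: "\<And>q. (\<lambda>(p, j). upd p j q) \<in> PP \<Otimes>\<^sub>M I \<rightarrow>\<^sub>M PP" and p0: "p0 \<in> space PP"
  and g[measurable]: "g \<in> borel_measurable (E \<Otimes>\<^sub>M PP)"
 defines "S \<equiv> piece_len G b X n W U"
 defines "p \<equiv> prun upd p0 r (\<lambda>l w. \<phi> (Y l w)) S"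
 shows "(\<integral>\<^sup>+w. indicator {w\<in>space M. adm Q r S (Suc l) w} w * g (Y (Suc l) w, p (Suc l) w) \<partial>M) =
  (\<integral>\<^sup>+w. indicator {w\<in>space M. adm Q r S l w} w *
    step Q r n (\<lambda>c e. \<integral>\<^sup>+y'. g (y', upd (p l w) (\<phi> (Y l w)) c) \<partial>\<pi> e) (Y l w) \<partial>M)"
proof -
 note a = accelerated_facts[OF acc]
 interpret M: prob_space M by (rule a(1))
 let ?R = "\<lambda>k w. (W k w, U k w)"
 let ?H1 = "history M E Y (Suc l) (Om \<Otimes>\<^sub>M borel) ?R l"
 let ?H2 = "history M E Y (Suc l) (Om \<Otimes>\<^sub>M borel) ?R (Suc l)"
 have Rm: "?R k \<in> M \<rightarrow>\<^sub>M Om \<Otimes>\<^sub>M borel" for k by (intro measurable_Pair a)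
 have S_eq: "S k w = \<sigma> n (W k w) (U k w)" for k w by (simp add: S_def piece_len_def \<sigma>_def)
 have sub1: "subalgebra M ?H1" and sub2: "subalgebra M ?H2"
  by (rule subalgebra_history; rule a Rm)+
 have Y1: "Y i \<in> ?H1 \<rightarrow>\<^sub>M E" and Y2: "Y i \<in> ?H2 \<rightarrow>\<^sub>M E" if "i \<le> l" for i
  using that by (auto intro!: measurable_history_state a Rm)
 have R1: "?R i \<in> ?H1 \<rightarrow>\<^sub>M Om \<Otimes>\<^sub>M borel" if "i < l" for i
  using that by (intro measurable_history_mark a Rm)
 have R2: "?R i \<in> ?H2 \<rightarrow>\<^sub>M Om \<Otimes>\<^sub>M borel" if "i \<le> l" for i
  using that by (intro measurable_history_mark a Rm) auto
 have S1: "S i \<in> borel_measurable ?H1" if "i < l" for i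
  using measurable_compose[OF R1[OF that] sigma_measurable[of n]] by (simp add: S_eq[abs_def])
 have S2: "S i \<in> borel_measurable ?H2" if "i \<le> l" for i
  using measurable_compose[OF R2[OF that] sigma_measurable[of n]] by (simp add: S_eq[abs_def])
 have phi1: "(\<lambda>w. \<phi> (Y i w)) \<in> ?H1 \<rightarrow>\<^sub>M I" and phi2: "(\<lambda>w. \<phi> (Y i w)) \<in> ?H2 \<rightarrow>\<^sub>M I" if "i \<le> l" for i
  by (rule measurable_compose[OF Y1[OF that] phi_measurable] measurable_compose[OF Y2[OF that] phi_measurable])+
 have p1: "p l \<in> ?H1 \<rightarrow>\<^sub>M PP" unfolding p_def
 proof (rule prun_measurable[where I=I, OF upd p0])
  fix i assume "i < l"
  then have i: "i \<le> l" by simp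
  show "(\<lambda>w. \<phi> (Y i w)) \<in> ?H1 \<rightarrow>\<^sub>M I" by (rule phi1[OF i])
  show "S i \<in> borel_measurable ?H1" by (rule S1[OF \<open>i < l\<close>])
 qed
 have p2: "p l \<in> ?H2 \<rightarrow>\<^sub>M PP" unfolding p_def
 proof (rule prun_measurable[where I=I, OF upd p0])
  fix i assume "i < l"
  then have i: "i \<le> l" by simp
  show "(\<lambda>w. \<phi> (Y i w)) \<in> ?H2 \<rightarrow>\<^sub>M I" by (rule phi2[OF i])
  show "S i \<in> borel_measurable ?H2" by (rule S2[OF i])
 qed
 have sp1: "space ?H1 = space M" and sp2: "space ?H2 = space M" using sub1 sub2 by (auto simp: subalgebra_def)
 have adm1: "{w\<in>space M. adm Q r S l w} \<in> sets ?H1"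
 proof -
  have "{w\<in>space ?H1. \<forall>i\<in>{..<l}. S i w < ennreal (real Q / real r)} \<in> sets ?H1"
  proof (rule sets.sets_Collect_finite_All)
   fix i assume "i \<in> {..<l}"
   then have i: "i < l" by simp
   show "{w \<in> space ?H1. S i w < ennreal (real Q / real r)} \<in> sets ?H1"
    by (rule borel_measurable_less[OF S1[OF i]]) simp
  qed simp
  then show ?thesis by (simp only: adm_def sp1 Ball_def lessThan_iff)
 qed
 have adm2: "{w\<in>space M. adm Q r S (Suc l) w} \<in> sets ?H2"
 proof -
  have "{w\<in>space ?H2. \<forall>i\<in>{..l}. S i w < ennreal (real Q / real r)} \<in> sets ?H2"
  proof (rule sets.sets_Collect_finite_All)
   fix i assume "i \<in> {..l}"
   then have i: "i \<le> l" by simp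
   show "{w \<in> space ?H2. S i w < ennreal (real Q / real r)} \<in> sets ?H2"
    by (rule borel_measurable_less[OF S2[OF i]]) simp
  qed simp
  then show ?thesis by (simp only: adm_def sp2 Ball_def atMost_iff less_Suc_eq_le)
 qed
 let ?A2 = "(E \<Otimes>\<^sub>M PP) \<Otimes>\<^sub>M (Om \<Otimes>\<^sub>M borel)"
 let ?sg = "\<lambda>a. \<sigma> n (fst (snd a)) (snd (snd a))"
 let ?K2 = "\<lambda>a. \<pi> (XX (real n * enn2real (?sg a)) (fst (snd a)))"
 let ?Phi2 = "\<lambda>a y'. g (y', upd (snd (fst a)) (\<phi> (fst (fst a))) (cell r (?sg a)))"
 have K2: "?K2 \<in> ?A2 \<rightarrow>\<^sub>M subprob_algebra E" and Phi2: "(\<lambda>(a, y'). ?Phi2 a y') \<in> borel_measurable (?A2 \<Otimes>\<^sub>M E)"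
  by (rule position_kernel_measurable, rule update_measurable[OF upd g])
 have V2: "(\<lambda>w. ((Y l w, p l w), (W l w, U l w))) \<in> ?H2 \<rightarrow>\<^sub>M ?A2"
  by (intro measurable_Pair[OF measurable_Pair] Y2 p2 R2) auto
 let ?F = "\<lambda>w. \<integral>\<^sup>+y'. g (y', upd (p l w) (\<phi> (Y l w)) (cell r (S l w))) \<partial>\<pi> (XX (real n * enn2real (S l w)) (W l w))"
 have "(\<integral>\<^sup>+w. indicator {w\<in>space M. adm Q r S (Suc l) w} w * g (Y (Suc l) w, p (Suc l) w) \<partial>M)
   = (\<integral>\<^sup>+w. indicator {w\<in>space M. adm Q r S (Suc l) w} w * ?Phi2 ((Y l w, p l w), (W l w, U l w)) (Y (Suc l) w) \<partial>M)"
  by (simp add: p_def S_eq)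
 also have "\<dots> = (\<integral>\<^sup>+w. indicator {w\<in>space M. adm Q r S (Suc l) w} w *
   (\<integral>\<^sup>+y'. ?Phi2 ((Y l w, p l w), (W l w, U l w)) y' \<partial>?K2 ((Y l w, p l w), (W l w, U l w))) \<partial>M)"
 proof (rule cond_law_on_nn_integral[OF a(1) sub2 adm2 V2 K2 cond_law_on_subset[OF a(7)] _ Phi2])
  show "adm Q r S (Suc l) w \<Longrightarrow> jump_time (piece_len G b X n W U) (Suc l) w < \<infinity>" for w
   using adm_finite[of Q r S "Suc l" w] by (simp add: S_def)
 qed (simp add: S_eq[unfolded S_def] XX_eq)
 also have "\<dots> = (\<integral>\<^sup>+w. indicator {w\<in>space M. adm Q r S l w} w *
   (indicator {..<ennreal (real Q / real r)} (\<sigma> n (W l w) (U l w)) * ?F w) \<partial>M)"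
  by (intro nn_integral_cong) (auto simp: S_eq adm_Suc split: split_indicator)
 also have "\<dots> = (\<integral>\<^sup>+w. indicator {w\<in>space M. adm Q r S l w} w *
   (\<integral>\<^sup>+q. indicator {..<ennreal (real Q / real r)} (\<sigma> n (fst q) (snd q)) *
    (\<integral>\<^sup>+y'. g (y', upd (p l w) (\<phi> (Y l w)) (cell r (\<sigma> n (fst q) (snd q)))) \<partial>\<pi> (XX (real n * enn2real (\<sigma> n (fst q) (snd q))) (fst q)))
   \<partial>law (Y l w)) \<partial>M)"
 proof -
  let ?G = "\<lambda>a q. indicator {..<ennreal (real Q / real r)} (\<sigma> n (fst q) (snd q)) *
    (\<integral>\<^sup>+y'. ?Phi2 (a, q) y' \<partial>?K2 (a, q))"
  have Gm: "(\<lambda>(a, q). ?G a q) \<in> borel_measurable ((E \<Otimes>\<^sub>M PP) \<Otimes>\<^sub>M (Om \<Otimes>\<^sub>M borel))"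
   by (rule step_integrand_measurable[OF upd g])
  have V1: "(\<lambda>w. (Y l w, p l w)) \<in> ?H1 \<rightarrow>\<^sub>M E \<Otimes>\<^sub>M PP" by (intro measurable_Pair Y1 p1) simp
  have K1: "(\<lambda>a. law (fst a)) \<in> E \<Otimes>\<^sub>M PP \<rightarrow>\<^sub>M subprob_algebra (Om \<Otimes>\<^sub>M borel)"
   by (rule measurable_compose[OF measurable_fst measurable_prob_algebraD[OF law_measurable]])
  have "(\<integral>\<^sup>+w. indicator {w\<in>space M. adm Q r S l w} w * ?G (Y l w, p l w) (?R l w) \<partial>M)
   = (\<integral>\<^sup>+w. indicator {w\<in>space M. adm Q r S l w} w * (\<integral>\<^sup>+q. ?G (Y l w, p l w) q \<partial>law (fst (Y l w, p l w))) \<partial>M)"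
  proof (rule cond_law_on_nn_integral[OF a(1) sub1 adm1 V1 K1 cond_law_on_subset[OF a(6)] _ Gm])
   show "adm Q r S l w \<Longrightarrow> jump_time (piece_len G b X n W U) l w < \<infinity>" for w
    using adm_finite[of Q r S l w] by (simp add: S_def)
  qed (simp add: law_def)
  then show ?thesis by (simp add: S_eq)
 qed
 finally show ?thesis unfolding step_def .
qed

end

section \<open>The limiting kernels\<close>

locale limit_model = base_model I Ei E \<phi> Om \<F> X P G b \<pi> \<mu>
 for I :: "'i measure" and Ei :: "'i \<Rightarrow> 'e measure" and E :: "'e measure" and \<phi> :: "'e \<Rightarrow> 'i"
  and Om :: "'o measure" and \<F> :: "real \<Rightarrow> 'o measure"
  and X :: "real \<Rightarrow> 'o \<Rightarrow> 'e" and P :: "'e \<Rightarrow> 'o measure"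
  and G :: "real \<Rightarrow> real" and b :: "'e \<Rightarrow> real" and \<pi> :: "'e \<Rightarrow> 'e measure"
  and \<mu> :: "'i \<Rightarrow> 'e measure" +
 assumes mean_rate_measurable[measurable]: "mean_rate \<mu> b \<in> borel_measurable I"
  and jump_prob_measurable: "\<And>B. B \<in> sets I \<Longrightarrow> (\<lambda>j. jump_prob E \<phi> \<mu> b \<pi> j B) \<in> borel_measurable I"
begin

lemma beta_measurable[measurable]: "\<beta> \<in> borel_measurable I"
 unfolding \<beta>_def[abs_def] by measurable

text \<open>the law of the next index, given that the index is \<open>j\<close>; the null measure if \<open>\<beta> j = 0\<close>\<close>

definition KJ :: "'i \<Rightarrow> 'i measure" where
 "KJ j = density (\<mu> j) (\<lambda>e. ennreal (b e / \<beta> j)) \<bind> (\<lambda>e. distr (\<pi> e) I \<phi>)"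

definition KT :: "'i \<Rightarrow> ennreal measure" where
 "KT j = distr unif01 borel (holding_time G (\<beta> j))"

lemma index_kernel_measurable: "(\<lambda>e. distr (\<pi> e) I \<phi>) \<in> E \<rightarrow>\<^sub>M subprob_algebra I"
 by (rule measurable_compose[OF pi_measurable measurable_prob_algebraD[OF measurable_distr_prob_space]]) measurable

lemma
 assumes j: "j \<in> space I"
 shows sets_KJ: "sets (KJ j) = sets I"
  and nn_integral_KJ: "f \<in> borel_measurable I \<Longrightarrow>
   (\<integral>\<^sup>+i. f i \<partial>KJ j) = (\<integral>\<^sup>+e. ennreal (b e / \<beta> j) * (\<integral>\<^sup>+y. f (\<phi> y) \<partial>\<pi> e) \<partial>\<mu> j)"
proof -
 note [measurable] = mu_measurable[OF j b_measurable]
 let ?D = "density (\<mu> j) (\<lambda>e. ennreal (b e / \<beta> j))"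
 have K: "(\<lambda>e. distr (\<pi> e) I \<phi>) \<in> ?D \<rightarrow>\<^sub>M subprob_algebra I"
  using mu_measurable[OF j index_kernel_measurable] by (simp cong: measurable_cong_sets)
 have ne: "space ?D \<noteq> {}" using prob_space.not_empty[OF mu_prob[OF j]] by simp
 show "sets (KJ j) = sets I" unfolding KJ_def by (rule sets_bind[OF _ ne]) simp
 assume f[measurable]: "f \<in> borel_measurable I"
 have sE: "e \<in> space E" if "e \<in> space (\<mu> j)" for e using that Ei_subset[OF j] by (auto simp: space_mu[OF j])
 have inner: "(\<integral>\<^sup>+i. f i \<partial>distr (\<pi> e) I \<phi>) = (\<integral>\<^sup>+y. f (\<phi> y) \<partial>\<pi> e)" if "e \<in> space (\<mu> j)" for e
  using phi_measurable sets_pi[OF sE[OF that]] by (subst nn_integral_distr) (auto cong: measurable_cong_sets)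
 have m: "(\<lambda>e. \<integral>\<^sup>+i. f i \<partial>distr (\<pi> e) I \<phi>) \<in> borel_measurable (\<mu> j)"
  by (rule measurable_compose[OF mu_measurable[OF j index_kernel_measurable] nn_integral_measurable_subprob_algebra[OF f]])
 have "(\<integral>\<^sup>+i. f i \<partial>KJ j) = (\<integral>\<^sup>+e. (\<integral>\<^sup>+i. f i \<partial>distr (\<pi> e) I \<phi>) \<partial>?D)"
  unfolding KJ_def by (rule nn_integral_bind[OF f K])
 also have "\<dots> = (\<integral>\<^sup>+e. ennreal (b e / \<beta> j) * (\<integral>\<^sup>+i. f i \<partial>distr (\<pi> e) I \<phi>) \<partial>\<mu> j)"
  by (intro nn_integral_density m measurable_compose[OF _ measurable_ennreal] borel_measurable_divide
    mu_measurable[OF j b_measurable] borel_measurable_const)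
 also have "\<dots> = (\<integral>\<^sup>+e. ennreal (b e / \<beta> j) * (\<integral>\<^sup>+y. f (\<phi> y) \<partial>\<pi> e) \<partial>\<mu> j)"
  by (intro nn_integral_cong) (simp add: inner)
 finally show "(\<integral>\<^sup>+i. f i \<partial>KJ j) = (\<integral>\<^sup>+e. ennreal (b e / \<beta> j) * (\<integral>\<^sup>+y. f (\<phi> y) \<partial>\<pi> e) \<partial>\<mu> j)" .
qed

lemma emeasure_KJ:
 assumes j: "j \<in> space I" and B: "B \<in> sets I"
 shows "emeasure (KJ j) B = jump_prob E \<phi> \<mu> b \<pi> j B"
proof -
 have "emeasure (KJ j) B = (\<integral>\<^sup>+i. indicator B i \<partial>KJ j)"
  using B by (simp add: sets_KJ[OF j])
 also have "\<dots> = (\<integral>\<^sup>+e. ennreal (b e / \<beta> j) * (\<integral>\<^sup>+y. indicator B (\<phi> y) \<partial>\<pi> e) \<partial>\<mu> j)"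
  by (intro nn_integral_KJ[OF j] borel_measurable_indicator B)
 also have "\<dots> = jump_prob E \<phi> \<mu> b \<pi> j B"
  unfolding jump_prob_def \<beta>_def[symmetric]
 proof (rule nn_integral_cong)
  fix e assume "e \<in> space (\<mu> j)"
  then have e: "e \<in> space E" using Ei_subset[OF j] by (auto simp: space_mu[OF j])
  have sp: "space (\<pi> e) = space E" using sets_pi[OF e] by (rule sets_eq_imp_space_eq)
  have "(\<integral>\<^sup>+y. indicator B (\<phi> y) \<partial>\<pi> e) = (\<integral>\<^sup>+y. indicator (\<phi> -` B \<inter> space E) y \<partial>\<pi> e)"
   by (intro nn_integral_cong) (auto simp: sp split: split_indicator)
  also have "\<dots> = emeasure (\<pi> e) (\<phi> -` B \<inter> space E)"
   using measurable_sets[OF phi_measurable B] by (intro nn_integral_indicator) (simp add: sets_pi[OF e])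
  finally show "ennreal (b e / \<beta> j) * (\<integral>\<^sup>+y. indicator B (\<phi> y) \<partial>\<pi> e) = ennreal (b e / \<beta> j) * emeasure (\<pi> e) (\<phi> -` B \<inter> space E)"
   by simp
 qed
 finally show ?thesis .
qed

lemma nn_integral_KJ_kappa:
 assumes j: "j \<in> space I" and f[measurable]: "f \<in> borel_measurable I" and f1: "\<And>i. i \<in> space I \<Longrightarrow> f i \<le> 1"
 shows "(\<integral>\<^sup>+i. f i \<partial>KJ j) = ennreal (kappa j (\<lambda>e. \<integral>\<^sup>+y. f (\<phi> y) \<partial>\<pi> e) / \<beta> j)"
proof -
 let ?q = "\<lambda>e. \<integral>\<^sup>+y. f (\<phi> y) \<partial>\<pi> e"
 have qm: "?q \<in> borel_measurable E"
  by (rule measurable_compose[OF measurable_prob_algebraD[OF pi_measurable] nn_integral_measurable_subprob_algebra]) measurable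
 note [measurable] = mu_measurable[OF j b_measurable] mu_measurable[OF j qm]
 have sE: "e \<in> space E" if "e \<in> space (\<mu> j)" for e using that Ei_subset[OF j] by (auto simp: space_mu[OF j])
 have q1: "?q e \<le> 1" if e: "e \<in> space E" for e
 proof -
  interpret prob_space "\<pi> e" by (rule pi_prob[OF e])
  have "space (\<pi> e) = space E" using sets_pi[OF e] by (rule sets_eq_imp_space_eq)
  then have "?q e \<le> (\<integral>\<^sup>+y. 1 \<partial>\<pi> e)" using f1 phi_space by (intro nn_integral_mono) auto
  then show ?thesis by (simp add: emeasure_space_1)
 qed
 have qr: "?q e = ennreal (enn2real (?q e))" if "e \<in> space E" for e
  using q1[OF that] by (metis ennreal_enn2real ennreal_one_less_top order.strict_trans1)
 have qr1: "enn2real (?q e) \<le> 1" if "e \<in> space E" for e using q1[OF that] by (auto intro: enn2real_leI)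
 have int: "integrable (\<mu> j) (\<lambda>e. b e * enn2real (?q e))"
 proof (rule Bochner_Integration.integrable_bound[OF mu_b_integrable[OF j]])
  show "AE e in \<mu> j. norm (b e * enn2real (?q e)) \<le> norm (b e)"
   using qr1 sE by (intro AE_I2) (auto simp: abs_mult intro!: mult_left_le)
 qed measurable
 have "(\<integral>\<^sup>+i. f i \<partial>KJ j) = (\<integral>\<^sup>+e. ennreal (b e * enn2real (?q e) / \<beta> j) \<partial>\<mu> j)"
  unfolding nn_integral_KJ[OF j f]
 proof (rule nn_integral_cong)
  fix e assume "e \<in> space (\<mu> j)"
  then have e: "e \<in> space E" by (rule sE)
  have "ennreal (b e / \<beta> j) * ?q e = ennreal (b e / \<beta> j) * ennreal (enn2real (?q e))"
   using qr[OF e] by simp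
  also have "\<dots> = ennreal (b e * enn2real (?q e) / \<beta> j)"
   using b_nonneg[OF e] beta_nonneg[OF j] by (simp add: ennreal_mult[symmetric])
  finally show "ennreal (b e / \<beta> j) * ?q e = ennreal (b e * enn2real (?q e) / \<beta> j)" .
 qed
 also have "\<dots> = ennreal (\<integral>e. b e * enn2real (?q e) / \<beta> j \<partial>\<mu> j)"
  using int b_nonneg sE beta_nonneg[OF j] by (intro nn_integral_eq_integral AE_I2) auto
 finally show ?thesis by (simp add: kappa_def)
qed

lemma KJ_measurable: "KJ \<in> I \<rightarrow>\<^sub>M subprob_algebra I"
proof (rule measurable_subprob_algebra)
 fix j assume j: "j \<in> space I"
 have sp: "space (KJ j) = space I" using sets_KJ[OF j] by (rule sets_eq_imp_space_eq)
 show "subprob_space (KJ j)"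
 proof
  have "emeasure (KJ j) (space (KJ j)) = (\<integral>\<^sup>+i. 1 \<partial>KJ j)" by simp
  also have "\<dots> = ennreal (kappa j (\<lambda>e. \<integral>\<^sup>+y. 1 \<partial>\<pi> e) / \<beta> j)" by (rule nn_integral_KJ_kappa[OF j]) auto
  also have "kappa j (\<lambda>e. \<integral>\<^sup>+y. 1 \<partial>\<pi> e) = \<beta> j"
   unfolding kappa_def beta_eq
  proof (rule Bochner_Integration.integral_cong[OF refl])
   fix e assume "e \<in> space (\<mu> j)"
   then have e: "e \<in> space E" using Ei_subset[OF j] by (auto simp: space_mu[OF j])
   interpret prob_space "\<pi> e" by (rule pi_prob[OF e])
   show "b e * enn2real (\<integral>\<^sup>+y. 1 \<partial>\<pi> e) = b e" by (simp add: emeasure_space_1)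
  qed
  also have "ennreal (\<beta> j / \<beta> j) \<le> 1" by simp
  finally show "emeasure (KJ j) (space (KJ j)) \<le> 1" .
  show "space (KJ j) \<noteq> {}" using j sp by auto
 qed
 show "sets (KJ j) = sets I" by (rule sets_KJ[OF j])
next
 fix B assume B: "B \<in> sets I"
 show "(\<lambda>j. emeasure (KJ j) B) \<in> borel_measurable I"
  using jump_prob_measurable[OF B] by (rule measurable_cong[THEN iffD1, rotated]) (simp add: emeasure_KJ B)
qed

text \<open>Joint measurability in the rate and the level, so that the holding times form a kernel.\<close>

lemma holding_time_measurable:
 "(\<lambda>(j, u). holding_time G (\<beta> j) u) \<in> borel_measurable (I \<Otimes>\<^sub>M borel)"
proof -
 obtain g where "jump_cdf G g" using abs_cont_cdf_jump_cdf[OF acG] ..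
 then interpret jump_cdf G g .
 show ?thesis
 proof (rule borel_measurableI_less)
  fix c :: ennreal
  have iff: "holding_time G (\<beta> j) u < c \<longleftrightarrow> \<beta> j \<noteq> 0 \<and> (\<exists>q::rat. 0 < q \<and> ennreal (real_of_rat q) < c \<and> u \<le> cum g' (real_of_rat q * \<beta> j))"
   if j: "j \<in> space I" for j u
  proof (cases "\<beta> j = 0")
   case True then show ?thesis by (simp add: holding_time_def)
  next
   case False
   then have b0: "0 < \<beta> j" using beta_nonneg[OF j] by simp
   have "holding_time G (\<beta> j) u < c \<longleftrightarrow> (\<exists>t>0. u \<le> cum g' (t * \<beta> j) \<and> ennreal t < c)"
    using b0 by (auto simp: holding_time_def INF_less_iff G_eq_cum)
   also have "\<dots> \<longleftrightarrow> (\<exists>q::rat. 0 < q \<and> ennreal (real_of_rat q) < c \<and> u \<le> cum g' (real_of_rat q * \<beta> j))"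
   proof
    assume "\<exists>t>0. u \<le> cum g' (t * \<beta> j) \<and> ennreal t < c"
    then obtain t where t: "0 < t" "u \<le> cum g' (t * \<beta> j)" "ennreal t < c" by blast
    obtain d where d: "ennreal t < d" "d < c" using dense[OF t(3)] by blast
    then have d': "d = ennreal (enn2real d)" by (metis ennreal_enn2real top.extremum_strict less_top)
    then have "t < enn2real d" using d(1) t(1) by (metis ennreal_less_iff less_imp_le)
    then obtain q where q: "t < real_of_rat q" "real_of_rat q < enn2real d" using of_rat_dense by blast
    have "ennreal (real_of_rat q) < c"
     using q t d(2) d' by (metis ennreal_leI less_imp_le order.strict_trans1)
    moreover have "t * \<beta> j \<le> real_of_rat q * \<beta> j" using q(1) b0 by simp
    then have "u \<le> cum g' (real_of_rat q * \<beta> j)"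
     using t(2) monoD[OF g'.mono_cum] by (meson order_trans)
    moreover have "0 < q" using q t by (metis less_trans zero_less_of_rat_iff)
    ultimately show "\<exists>q::rat. 0 < q \<and> ennreal (real_of_rat q) < c \<and> u \<le> cum g' (real_of_rat q * \<beta> j)" by blast
   next
    assume "\<exists>q::rat. 0 < q \<and> ennreal (real_of_rat q) < c \<and> u \<le> cum g' (real_of_rat q * \<beta> j)"
    then obtain q :: rat where "0 < q" "ennreal (real_of_rat q) < c" "u \<le> cum g' (real_of_rat q * \<beta> j)" by blast
    then show "\<exists>t>0. u \<le> cum g' (t * \<beta> j) \<and> ennreal t < c"
     by (intro exI[of _ "real_of_rat q"]) auto
   qed
   finally show ?thesis using False by simp
  qed
  have "{p\<in>space (I \<Otimes>\<^sub>M borel). \<beta> (fst p) \<noteq> 0 \<and> (\<exists>q::rat. 0 < q \<and> ennreal (real_of_rat q) < c \<and> snd p \<le> cum g' (real_of_rat q * \<beta> (fst p)))} \<in> sets (I \<Otimes>\<^sub>M borel)"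
   by measurable
  also have "{p\<in>space (I \<Otimes>\<^sub>M borel). \<beta> (fst p) \<noteq> 0 \<and> (\<exists>q::rat. 0 < q \<and> ennreal (real_of_rat q) < c \<and> snd p \<le> cum g' (real_of_rat q * \<beta> (fst p)))}
   = {p\<in>space (I \<Otimes>\<^sub>M borel). (case p of (j, u) \<Rightarrow> holding_time G (\<beta> j) u) < c}"
   by (intro Collect_cong conj_cong refl) (auto simp: iff space_pair_measure)
  finally show "{p\<in>space (I \<Otimes>\<^sub>M borel). (case p of (j, u) \<Rightarrow> holding_time G (\<beta> j) u) < c} \<in> sets (I \<Otimes>\<^sub>M borel)" .
 qed
qed

lemma KT_measurable: "KT \<in> I \<rightarrow>\<^sub>M prob_algebra borel"
 unfolding KT_def[abs_def]
proof (rule measurable_distr_prob_space2[where M=borel])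
 show "(\<lambda>_. unif01) \<in> I \<rightarrow>\<^sub>M prob_algebra borel"
  by (intro measurable_const) (simp add: space_prob_algebra prob_space_unif01)
qed (rule holding_time_measurable)

lemma sets_KT[simp, measurable_cong]: "sets (KT j) = sets borel" and space_KT[simp]: "space (KT j) = UNIV"
 by (simp_all add: KT_def)

lemma holding_time_measurable1: "j \<in> space I \<Longrightarrow> holding_time G (\<beta> j) \<in> borel_measurable unif01"
 using measurable_compose[OF measurable_Pair1' holding_time_measurable, of j] by (simp cong: measurable_cong_sets)

lemma prob_KT: "j \<in> space I \<Longrightarrow> prob_space (KT j)"
 unfolding KT_def by (intro prob_space.prob_space_distr prob_space_unif01 holding_time_measurable1)

lemma emeasure_KT_less:
 assumes j: "j \<in> space I" and t: "0 \<le> t"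
 shows "emeasure (KT j) {..<ennreal t} = ennreal (G (t * \<beta> j))"
proof -
 obtain g where "jump_cdf G g" using abs_cont_cdf_jump_cdf[OF acG] ..
 then interpret jump_cdf G g .
 have b0: "0 \<le> \<beta> j" by (rule beta_nonneg[OF j])
 have e: "emeasure (KT j) {..<ennreal t} = emeasure unif01 {u. holding_time G (\<beta> j) u < ennreal t}"
  unfolding KT_def using holding_time_measurable1[OF j] by (subst emeasure_distr) (auto simp: vimage_def)
 show ?thesis
 proof (cases "\<beta> j = 0")
  case True then show ?thesis unfolding e by (simp add: holding_time_def G_0)
 next
  case False
  then have b1: "0 < \<beta> j" using b0 by simp
  let ?C = "\<lambda>t. cum g' (t * \<beta> j)"
  have C: "mono ?C" "\<And>t. isCont ?C t" "\<And>t. 0 \<le> ?C t" "\<And>t. ?C t \<le> 1" "?C 0 = 0"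
  proof -
   show "mono ?C" using monoD[OF g'.mono_cum] b0 by (intro monoI) (simp add: mult_right_mono)
   show "isCont ?C t" for t
    using isCont_o2[of t "\<lambda>t. t * \<beta> j" "cum g'"] g'.isCont_cum by simp
   show "?C t \<le> 1" for t
    using G_le_1[of "t * \<beta> j"] G_eq_cum[of "t * \<beta> j"] g'.cum_nonpos[of "t * \<beta> j"] by (cases "0 \<le> t * \<beta> j") auto
  qed simp_all
  have "AE u in unif01. (u \<in> {u. holding_time G (\<beta> j) u < ennreal t}) = (u \<in> {u. hit ?C u < ennreal t})"
   using AE_unif01
  proof eventually_elim
   case (elim u)
   have "{t. 0 < t \<and> u \<le> G (t * \<beta> j)} = {t. 0 \<le> t \<and> u \<le> ?C t}"
   proof (intro Collect_cong iffI)
    fix t assume "0 < t \<and> u \<le> G (t * \<beta> j)"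
    then show "0 \<le> t \<and> u \<le> ?C t" using b0 G_eq_cum[of "t * \<beta> j"] by (simp add: zero_le_mult_iff)
   next
    fix t assume "0 \<le> t \<and> u \<le> ?C t"
    then show "0 < t \<and> u \<le> G (t * \<beta> j)" using b0 elim C(5) by (cases "t = 0") (auto simp: G_eq_cum)
   qed
   then have "holding_time G (\<beta> j) u = hit ?C u" using False by (simp add: holding_time_def hit_def)
   then show ?case by simp
  qed
  moreover have "{u. holding_time G (\<beta> j) u < ennreal t} \<in> sets unif01"
   using measurable_sets[OF holding_time_measurable1[OF j], of "{..<ennreal t}"] by (simp add: vimage_def)
  moreover have "{u. hit ?C u < ennreal t} \<in> sets unif01" unfolding sets_unif01 by measurable
  ultimately have "emeasure unif01 {u. holding_time G (\<beta> j) u < ennreal t} = emeasure unif01 {u. hit ?C u < ennreal t}"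
   by (rule emeasure_eq_AE)
  also have "\<dots> = ennreal (?C t)" by (rule emeasure_hit_less[OF C t])
  finally show ?thesis unfolding e using t b0 by (simp add: G_eq_cum)
 qed
qed

text \<open>The distribution function \<open>t \<mapsto> G(t \<beta>)\<close> is continuous.\<close>

lemma emeasure_KT_singleton:
 assumes j: "j \<in> space I" and t: "0 \<le> t"
 shows "emeasure (KT j) {ennreal t} = 0"
proof -
 obtain g where "jump_cdf G g" using abs_cont_cdf_jump_cdf[OF acG] ..
 then interpret jump_cdf G g .
 interpret K: prob_space "KT j" by (rule prob_KT[OF j])
 have b0: "0 \<le> \<beta> j" by (rule beta_nonneg[OF j])
 have m: "measure (KT j) {..<ennreal s} = cum g' (s * \<beta> j)" if "0 \<le> s" for s
  using emeasure_KT_less[OF j that] that b0 by (simp add: measure_def G_eq_cum)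
 have le: "measure (KT j) {ennreal t} \<le> cum g' ((t + 1 / real (Suc n)) * \<beta> j) - cum g' (t * \<beta> j)" for n
 proof -
  have "measure (KT j) {ennreal t} + measure (KT j) {..<ennreal t} = measure (KT j) ({ennreal t} \<union> {..<ennreal t})"
   by (rule K.finite_measure_Union[symmetric]) auto
  also have "\<dots> \<le> measure (KT j) {..<ennreal (t + 1 / real (Suc n))}"
  proof (rule K.finite_measure_mono)
   have "ennreal t < ennreal (t + 1 / real (Suc n))" using t by (simp add: ennreal_less_iff)
   then show "{ennreal t} \<union> {..<ennreal t} \<subseteq> {..<ennreal (t + 1 / real (Suc n))}" by auto
  qed simp
  finally show ?thesis using t m[of t] m[of "t + 1 / real (Suc n)"] by (simp del: of_nat_Suc ennreal_plus)
 qed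
 have "(\<lambda>n. (t + 1 / real (Suc n)) * \<beta> j) \<longlonglongrightarrow> (t + 0) * \<beta> j"
  by (intro tendsto_intros LIMSEQ_Suc[OF lim_1_over_n])
 then have "(\<lambda>n. cum g' ((t + 1 / real (Suc n)) * \<beta> j)) \<longlonglongrightarrow> cum g' ((t + 0) * \<beta> j)"
  by (rule isCont_tendsto_compose[OF g'.isCont_cum])
 then have "(\<lambda>n. cum g' ((t + 1 / real (Suc n)) * \<beta> j) - cum g' (t * \<beta> j)) \<longlonglongrightarrow> cum g' (t * \<beta> j) - cum g' (t * \<beta> j)"
  by (intro tendsto_diff tendsto_const) simp
 then have "measure (KT j) {ennreal t} \<le> 0"
  using le by (intro LIMSEQ_le_const) auto
 then show ?thesis using measure_nonneg[of "KT j" "{ennreal t}"] by (simp add: K.emeasure_eq_measure)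
qed

definition step_limT :: "nat \<Rightarrow> nat \<Rightarrow> (nat \<Rightarrow> 'i \<Rightarrow> ennreal) \<Rightarrow> 'i \<Rightarrow> ennreal" where
 "step_limT Q r g j = (\<integral>\<^sup>+s. indicator {..<ennreal (real Q / real r)} s * (\<integral>\<^sup>+i. g (cell r s) i \<partial>KJ j) \<partial>KT j)"

text \<open>The limit of one step of the accelerated chain, which averages over positions, agrees with one step of the
 semi-Markov chain, which only knows indices: independence of holding time and next index is used here.\<close>

lemma step_limT_eq:
 assumes r: "0 < r" and j: "j \<in> space I"
  and g: "\<And>c. g c \<in> borel_measurable I" and g1: "\<And>c i. i \<in> space I \<Longrightarrow> g c i \<le> 1"
 shows "step_limT Q r g j = step_lim Q r (\<lambda>c e. \<integral>\<^sup>+y. g c (\<phi> y) \<partial>\<pi> e) j"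
proof -
 interpret KJ: subprob_space "KJ j" using measurable_space[OF KJ_measurable j] by (simp add: space_subprob_algebra)
 have sp: "space (KJ j) = space I" using sets_KJ[OF j] by (rule sets_eq_imp_space_eq)
 let ?F = "\<lambda>c. \<integral>\<^sup>+i. g c i \<partial>KJ j"
 have F1: "?F c \<le> 1" for c
 proof -
  have "?F c \<le> (\<integral>\<^sup>+i. 1 \<partial>KJ j)" using g1 by (intro nn_integral_mono) (auto simp: sp)
  also have "\<dots> \<le> 1" using KJ.emeasure_space_le_1 by simp
  finally show ?thesis .
 qed
 have F: "?F c = ennreal (kappa j (\<lambda>e. \<integral>\<^sup>+y. g c (\<phi> y) \<partial>\<pi> e) / \<beta> j)" for c
  by (rule nn_integral_KJ_kappa[OF j g g1])
 have k0: "0 \<le> kappa j q / \<beta> j" for q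
  unfolding kappa_def using b_nonneg Ei_subset[OF j] beta_nonneg[OF j]
  by (intro divide_nonneg_nonneg Bochner_Integration.integral_nonneg_AE AE_I2) (auto simp: space_mu[OF j])
 obtain gg where "jump_cdf G gg" using abs_cont_cdf_jump_cdf[OF acG] ..
 then interpret jump_cdf G gg .
 have *: "(\<integral>\<^sup>+s. ?F c * indicator {..<ennreal t} s \<partial>KT j)
   = ennreal (kappa j (\<lambda>e. \<integral>\<^sup>+y. g c (\<phi> y) \<partial>\<pi> e) / \<beta> j * G (t * \<beta> j))" if t: "0 \<le> t" for c t
 proof -
  have "(\<integral>\<^sup>+s. ?F c * indicator {..<ennreal t} s \<partial>KT j) = ?F c * ennreal (G (t * \<beta> j))"
   using emeasure_KT_less[OF j t] by (subst nn_integral_cmult_indicator) auto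
  then show ?thesis using k0 G_nonneg[of "t * \<beta> j"] t beta_nonneg[OF j] by (simp add: F ennreal_mult[symmetric])
 qed
 have "step_limT Q r g j = (\<Sum>c<Q. (\<integral>\<^sup>+s. ?F c * indicator {..<ennreal (real (Suc c) / real r)} s \<partial>KT j)
     - (\<integral>\<^sup>+s. ?F c * indicator {..<ennreal (real c / real r)} s \<partial>KT j))"
  unfolding step_limT_def by (rule nn_integral_cell[OF r prob_KT[OF j], where f="\<lambda>c _. ?F c"]) (use F1 in auto)
 also have "\<dots> = step_lim Q r (\<lambda>c e. \<integral>\<^sup>+y. g c (\<phi> y) \<partial>\<pi> e) j"
  unfolding step_lim_def by (intro sum.cong refl arg_cong2[where f="(-)"] *) auto
 finally show ?thesis .
qed

end

context limit_model begin

section \<open>Convergence of the chain with rounded holding times\<close>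

lemma semi_markov_facts:
 assumes sm: "semi_markov I E \<phi> G b \<pi> \<mu> x M J T"
 shows "prob_space M" "\<And>k. J k \<in> M \<rightarrow>\<^sub>M I" "AE v in M. J 0 v = \<phi> x" "\<And>k. T k \<in> borel_measurable M"
  "\<And>k. cond_law_on M (history M I J (Suc k) borel T k)
      (\<lambda>v. jump_time T k v < \<infinity>) (T k) borel
      (\<lambda>v. emeasure (distr unif01 borel (holding_time G (mean_rate \<mu> b (J k v)))))"
  "\<And>k. cond_law_on M (history M I J (Suc k) borel T (Suc k))
      (\<lambda>v. jump_time T k v < \<infinity> \<and> mean_rate \<mu> b (J k v) > 0) (J (Suc k)) I
      (\<lambda>v. jump_prob E \<phi> \<mu> b \<pi> (J k v))"
 using sm by (auto simp: semi_markov_def cond_law_on_def)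

lemma semi_markov_history:
 assumes sm: "semi_markov I E \<phi> G b \<pi> \<mu> x M J T"
 shows "subalgebra M (history M I J p borel T q)"
  and "l < p \<Longrightarrow> J l \<in> history M I J p borel T q \<rightarrow>\<^sub>M I"
  and "l < q \<Longrightarrow> T l \<in> borel_measurable (history M I J p borel T q)"
 using semi_markov_facts(2,4)[OF sm]
 by (auto intro!: subalgebra_history measurable_history_state measurable_history_mark)

lemma adm_set:
 assumes "\<And>i. i < l \<Longrightarrow> S i \<in> borel_measurable H"
 shows "{w\<in>space H. adm Q r S l w} \<in> sets H"
proof -
 have "{w\<in>space H. \<forall>i\<in>{..<l}. S i w < ennreal (real Q / real r)} \<in> sets H"
 proof (rule sets.sets_Collect_finite_All)
  fix i assume "i \<in> {..<l}"
  then have i: "i < l" by simp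
  show "{w \<in> space H. S i w < ennreal (real Q / real r)} \<in> sets H"
   by (rule borel_measurable_less[OF assms[OF i]]) simp
 qed simp
 then show ?thesis by (simp only: adm_def Ball_def lessThan_iff)
qed

lemma semi_markov_holding:
 assumes sm: "semi_markov I E \<phi> G b \<pi> \<mu> x M J T"
  and V: "V \<in> history M I J (Suc l) borel T l \<rightarrow>\<^sub>M A"
  and Q: "{v\<in>space M. Q v} \<in> sets (history M I J (Suc l) borel T l)"
  and Qf: "\<And>v. Q v \<Longrightarrow> jump_time T l v < \<infinity>"
  and f: "(\<lambda>(a, s). f a s) \<in> borel_measurable ((I \<Otimes>\<^sub>M A) \<Otimes>\<^sub>M borel)"
 shows "(\<integral>\<^sup>+v. indicator {v\<in>space M. Q v} v * f (J l v, V v) (T l v) \<partial>M) =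
  (\<integral>\<^sup>+v. indicator {v\<in>space M. Q v} v * (\<integral>\<^sup>+s. f (J l v, V v) s \<partial>KT (J l v)) \<partial>M)"
proof -
 note a = semi_markov_facts[OF sm]
 have JV: "(\<lambda>v. (J l v, V v)) \<in> history M I J (Suc l) borel T l \<rightarrow>\<^sub>M I \<Otimes>\<^sub>M A"
  by (intro measurable_Pair V semi_markov_history(2)[OF sm]) simp
 have K: "(\<lambda>a. KT (fst a)) \<in> I \<Otimes>\<^sub>M A \<rightarrow>\<^sub>M subprob_algebra borel"
  by (rule measurable_compose[OF measurable_fst measurable_prob_algebraD[OF KT_measurable]])
 have "(\<integral>\<^sup>+v. indicator {v\<in>space M. Q v} v * f (J l v, V v) (T l v) \<partial>M) =
  (\<integral>\<^sup>+v. indicator {v\<in>space M. Q v} v * (\<integral>\<^sup>+s. f (J l v, V v) s \<partial>KT (fst (J l v, V v))) \<partial>M)"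
  by (rule cond_law_on_nn_integral[OF a(1) semi_markov_history(1)[OF sm] Q JV K cond_law_on_subset[OF a(5) Qf] _ f])
   (assumption | simp add: KT_def \<beta>_def)+
 then show ?thesis by simp
qed

text \<open>The last holding time has no atoms at finite times, conditionally on the earlier ones.\<close>

lemma AE_jump_time_neq:
 assumes sm: "semi_markov I E \<phi> G b \<pi> \<mu> x M J T" and t: "0 < t"
 shows "AE v in M. jump_time T m v \<noteq> ennreal t"
proof (cases m)
 case 0
 then show ?thesis using t by (simp add: jump_time_def)
next
 case (Suc l)
 note a = semi_markov_facts[OF sm]
 let ?H = "history M I J (Suc l) borel T l"
 have jm: "jump_time T l \<in> borel_measurable ?H"
  unfolding jump_time_def[abs_def] by (intro borel_measurable_sum semi_markov_history(3)[OF sm]) simp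
 have sp: "space ?H = space M" using semi_markov_history(1)[OF sm] by (auto simp: subalgebra_def)
 have Q: "{v\<in>space M. jump_time T l v < \<infinity>} \<in> sets ?H"
  using borel_measurable_less[OF jm, of "\<lambda>_. \<infinity>"] by (simp add: sp)
 let ?f = "\<lambda>(a :: 'i \<times> ennreal) s. indicator {ennreal t} (snd a + s) :: ennreal"
 have f: "(\<lambda>(a, s). ?f a s) \<in> borel_measurable ((I \<Otimes>\<^sub>M borel) \<Otimes>\<^sub>M borel)"
  unfolding split_beta' by (rule measurable_compose[OF _ borel_measurable_indicator]) measurable
 have "(\<integral>\<^sup>+v. indicator {v\<in>space M. jump_time T l v < \<infinity>} v * ?f (J l v, jump_time T l v) (T l v) \<partial>M) =
  (\<integral>\<^sup>+v. indicator {v\<in>space M. jump_time T l v < \<infinity>} v * (\<integral>\<^sup>+s. ?f (J l v, jump_time T l v) s \<partial>KT (J l v)) \<partial>M)"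
  by (rule semi_markov_holding[OF sm jm Q _ f])
 also have "\<dots> = (\<integral>\<^sup>+v. 0 \<partial>M)"
 proof (rule nn_integral_cong)
  fix v assume v: "v \<in> space M"
  then have j: "J l v \<in> space I" using measurable_space[OF a(2)] by simp
  show "indicator {v\<in>space M. jump_time T l v < \<infinity>} v * (\<integral>\<^sup>+s. ?f (J l v, jump_time T l v) s \<partial>KT (J l v)) = 0"
  proof (cases "jump_time T l v < \<infinity>")
   case True
   then have tau: "jump_time T l v = ennreal (enn2real (jump_time T l v))" by simp
   define \<tau> where "\<tau> = enn2real (jump_time T l v)"
   have sing: "s = ennreal (t - \<tau>) \<and> 0 \<le> t - \<tau>" if "jump_time T l v + s = ennreal t" for s
   proof -
    have "s \<le> ennreal t" using that by (metis add_increasing zero_le le_iff_add add.commute)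
    then have "s < top" using ennreal_less_top by (rule order.strict_trans1)
    then have s: "s = ennreal (enn2real s)" by simp
    have "ennreal (\<tau> + enn2real s) = ennreal t"
     using that tau s by (simp add: \<tau>_def ennreal_plus)
    then have "\<tau> + enn2real s = t" using t by (simp add: \<tau>_def del: ennreal_plus)
    then have "enn2real s = t - \<tau>" by simp
    then show ?thesis using s by (metis enn2real_nonneg)
   qed
   have "(\<integral>\<^sup>+s. ?f (J l v, jump_time T l v) s \<partial>KT (J l v)) \<le> (\<integral>\<^sup>+s. indicator {ennreal (max 0 (t - \<tau>))} s \<partial>KT (J l v))"
    using sing by (intro nn_integral_mono) (auto split: split_indicator simp: max_def)
   also have "\<dots> = 0" using emeasure_KT_singleton[OF j, of "max 0 (t - \<tau>)"] by simp
   finally show ?thesis by simp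
  qed simp
 qed
 finally have "(\<integral>\<^sup>+v. indicator {v\<in>space M. jump_time T l v < \<infinity>} v * ?f (J l v, jump_time T l v) (T l v) \<partial>M) = 0" by simp
 moreover have "(\<lambda>v. indicator {v\<in>space M. jump_time T l v < \<infinity>} v * ?f (J l v, jump_time T l v) (T l v)) \<in> borel_measurable M"
 proof (rule borel_measurable_times_ennreal)
  have jM: "jump_time T l \<in> borel_measurable M" by (rule measurable_from_subalg[OF semi_markov_history(1)[OF sm] jm])
  show "indicator {v\<in>space M. jump_time T l v < \<infinity>} \<in> borel_measurable M"
   by (rule borel_measurable_indicator) (rule borel_measurable_less[OF jM], simp)
  show "(\<lambda>v. ?f (J l v, jump_time T l v) (T l v)) \<in> borel_measurable M"
   unfolding snd_conv
   by (rule measurable_compose[OF _ borel_measurable_indicator[of "{ennreal t}" borel]]) (auto intro!: borel_measurable_add jM a(4))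
 qed
 ultimately have "AE v in M. indicator {v\<in>space M. jump_time T l v < \<infinity>} v * ?f (J l v, jump_time T l v) (T l v) = 0"
  by (simp add: nn_integral_0_iff_AE)
 with AE_space show ?thesis
 proof eventually_elim
  case (elim v)
  show ?case
  proof
   assume eq: "jump_time T m v = ennreal t"
   have js: "jump_time T m v = jump_time T l v + T l v" by (simp add: jump_time_def Suc)
   then have "jump_time T l v \<le> ennreal t" using eq by (metis le_iff_add)
   then have "jump_time T l v < \<infinity>" using ennreal_less_top by (metis infinity_ennreal_def order.strict_trans1)
   then show False using elim eq js by simp
  qed
 qed
qed

lemma semi_markov_step:
 fixes r Q :: nat
 assumes sm: "semi_markov I E \<phi> G b \<pi> \<mu> x M J T"
  and upd: "\<And>q. (\<lambda>(p, j). upd p j q) \<in> PP \<Otimes>\<^sub>M I \<rightarrow>\<^sub>M PP" and p0: "p0 \<in> space PP"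
  and g[measurable]: "g \<in> borel_measurable (I \<Otimes>\<^sub>M PP)"
 defines "p \<equiv> prun upd p0 r J T"
 shows "(\<integral>\<^sup>+v. indicator {v\<in>space M. adm Q r T (Suc l) v} v * g (J (Suc l) v, p (Suc l) v) \<partial>M) =
  (\<integral>\<^sup>+v. indicator {v\<in>space M. adm Q r T l v} v * step_limT Q r (\<lambda>c i. g (i, upd (p l v) (J l v) c)) (J l v) \<partial>M)"
proof -
 note a = semi_markov_facts[OF sm]
 note h = semi_markov_history[OF sm]
 let ?H1 = "history M I J (Suc l) borel T l" and ?H2 = "history M I J (Suc l) borel T (Suc l)"
 have sp1: "space ?H1 = space M" and sp2: "space ?H2 = space M" using h(1) by (auto simp: subalgebra_def)
 have p1: "p l \<in> ?H1 \<rightarrow>\<^sub>M PP" and p2: "p l \<in> ?H2 \<rightarrow>\<^sub>M PP"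
  unfolding p_def by (rule prun_measurable[where I=I, OF upd p0]; rule h; simp)+
 have T2: "T i \<in> borel_measurable ?H2" if "i \<le> l" for i using that by (intro h(3)) simp
 have adm1: "{v\<in>space M. adm Q r T l v} \<in> sets ?H1"
  using adm_set[of l T ?H1 Q r] h(3) by (simp add: sp1)
 have adm2: "{v\<in>space M. adm Q r T (Suc l) v} \<in> sets ?H2"
  using adm_set[of "Suc l" T ?H2 Q r] T2 by (simp add: sp2)
 have adm2M: "{v\<in>space M. adm Q r T (Suc l) v} \<in> sets M" using adm2 h(1)[of "Suc l" "Suc l"] by (auto simp: subalgebra_def)
 have J2: "J l \<in> ?H2 \<rightarrow>\<^sub>M I" by (intro h(2)) simp
 let ?A = "(I \<Otimes>\<^sub>M PP) \<Otimes>\<^sub>M (borel :: ennreal measure)"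
 let ?F = "\<lambda>a i. g (i, upd (snd (fst a)) (fst (fst a)) (cell r (snd a)))"
 have Fm: "(\<lambda>(a, i). ?F a i) \<in> borel_measurable (?A \<Otimes>\<^sub>M I)"
 proof -
  have "(\<lambda>z. upd (snd (fst (fst z))) (fst (fst (fst z))) (cell r (snd (fst z)))) \<in> ?A \<Otimes>\<^sub>M I \<rightarrow>\<^sub>M PP"
   by (rule measurable_update_cell[where I=I, OF upd]) measurable
  then have "(\<lambda>z. (snd z, upd (snd (fst (fst z))) (fst (fst (fst z))) (cell r (snd (fst z))))) \<in> ?A \<Otimes>\<^sub>M I \<rightarrow>\<^sub>M I \<Otimes>\<^sub>M PP"
   by (intro measurable_Pair measurable_snd)
  from measurable_compose[OF this g] show ?thesis by (simp add: split_beta')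
 qed
 have KJA: "(\<lambda>a. KJ (fst (fst a))) \<in> ?A \<rightarrow>\<^sub>M subprob_algebra I"
  by (rule measurable_compose[OF _ KJ_measurable]) measurable
 have FI: "(\<lambda>a. \<integral>\<^sup>+i. ?F a i \<partial>KJ (fst (fst a))) \<in> borel_measurable ?A"
  by (rule nn_integral_measurable_subprob_algebra2[OF Fm KJA])
 let ?f = "\<lambda>a s. indicator {..<ennreal (real Q / real r)} s * (\<integral>\<^sup>+i. ?F (a, s) i \<partial>KJ (fst a))"
 have fm: "(\<lambda>(a, s). ?f a s) \<in> borel_measurable ?A"
 proof -
  have "(\<lambda>a. indicator {..<ennreal (real Q / real r)} (snd a) * (\<integral>\<^sup>+i. ?F a i \<partial>KJ (fst (fst a)))) \<in> borel_measurable ?A"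
   by (rule borel_measurable_times_ennreal[OF _ FI]) measurable
  then show ?thesis by (simp add: split_beta')
 qed
 \<comment> \<open>a component with vanishing rate is never left\<close>
 have AEb: "AE v in M. adm Q r T (Suc l) v \<longrightarrow> 0 < \<beta> (J l v)"
 proof -
  let ?z = "\<lambda>(a :: 'i \<times> _) s. indicator {..<ennreal (real Q / real r)} s * (if \<beta> (fst a) = 0 then 1 else 0) :: ennreal"
  have zm: "(\<lambda>(a, s). ?z a s) \<in> borel_measurable ?A"
  proof -
   have "(\<lambda>a. indicator {..<ennreal (real Q / real r)} (snd a) * (if \<beta> (fst (fst a)) = 0 then 1 else 0) :: ennreal) \<in> borel_measurable ?A"
    by measurable
   then show ?thesis by (simp add: split_beta')
  qed
  have "(\<integral>\<^sup>+v. indicator {v\<in>space M. adm Q r T l v} v * ?z (J l v, p l v) (T l v) \<partial>M) =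
   (\<integral>\<^sup>+v. indicator {v\<in>space M. adm Q r T l v} v * (\<integral>\<^sup>+s. ?z (J l v, p l v) s \<partial>KT (J l v)) \<partial>M)"
   by (rule semi_markov_holding[OF sm p1 adm1 adm_finite zm])
  also have "\<dots> = (\<integral>\<^sup>+v. 0 \<partial>M)"
  proof (rule nn_integral_cong)
   fix v assume v: "v \<in> space M"
   then have j: "J l v \<in> space I" using measurable_space[OF a(2)] by simp
   obtain gg where "jump_cdf G gg" using abs_cont_cdf_jump_cdf[OF acG] ..
   then have G0: "G 0 = 0" by (rule jump_cdf.G_0)
   have "(\<integral>\<^sup>+s. ?z (J l v, p l v) s \<partial>KT (J l v)) = 0"
   proof (cases "\<beta> (J l v) = 0")
    case True
    then show ?thesis using emeasure_KT_less[OF j, of "real Q / real r"] by (simp add: G0)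
   qed simp
   then show "indicator {v\<in>space M. adm Q r T l v} v * (\<integral>\<^sup>+s. ?z (J l v, p l v) s \<partial>KT (J l v)) = 0" by simp
  qed
  finally have "(\<integral>\<^sup>+v. indicator {v\<in>space M. adm Q r T l v} v * ?z (J l v, p l v) (T l v) \<partial>M) = 0" by simp
  moreover have "(\<lambda>v. indicator {v\<in>space M. adm Q r T l v} v * ?z (J l v, p l v) (T l v)) \<in> borel_measurable M"
  proof (rule borel_measurable_times_ennreal)
   show "indicator {v\<in>space M. adm Q r T l v} \<in> borel_measurable M"
    using adm1 h(1)[of "Suc l" l] by (intro borel_measurable_indicator) (auto simp: subalgebra_def)
   have "(\<lambda>v. ((J l v, p l v), T l v)) \<in> M \<rightarrow>\<^sub>M ?A"
    by (intro measurable_Pair a measurable_from_subalg[OF h(1) p1])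
   from measurable_compose[OF this zm] show "(\<lambda>v. ?z (J l v, p l v) (T l v)) \<in> borel_measurable M" by simp
  qed
  ultimately have "AE v in M. indicator {v\<in>space M. adm Q r T l v} v * ?z (J l v, p l v) (T l v) = 0"
   by (simp add: nn_integral_0_iff_AE)
  with AE_space show ?thesis
  proof eventually_elim
   case (elim v)
   then have "J l v \<in> space I" using measurable_space[OF a(2)] by simp
   with elim show ?case using beta_nonneg[of "J l v"]
    by (cases "\<beta> (J l v) = 0") (auto simp: adm_Suc)
  qed
 qed
 let ?Q' = "\<lambda>v. adm Q r T (Suc l) v \<and> 0 < \<beta> (J l v)"
 have Q': "{v\<in>space M. ?Q' v} \<in> sets ?H2"
 proof -
  have "{v\<in>space ?H2. 0 < \<beta> (J l v)} \<in> sets ?H2"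
   by (rule borel_measurable_less[OF _ measurable_compose[OF J2 beta_measurable]]) simp
  from sets.Int[OF adm2 this] show ?thesis by (simp add: sp2 Int_def conj_ac)
 qed
 have V2: "(\<lambda>v. ((J l v, p l v), T l v)) \<in> ?H2 \<rightarrow>\<^sub>M ?A"
  by (intro measurable_Pair J2 p2 T2) simp
 have "(\<integral>\<^sup>+v. indicator {v\<in>space M. adm Q r T (Suc l) v} v * g (J (Suc l) v, p (Suc l) v) \<partial>M)
   = (\<integral>\<^sup>+v. indicator {v\<in>space M. ?Q' v} v * ?F ((J l v, p l v), T l v) (J (Suc l) v) \<partial>M)"
  by (rule nn_integral_cong_AE, use AEb in eventually_elim) (auto simp: p_def split: split_indicator)
 also have "\<dots> = (\<integral>\<^sup>+v. indicator {v\<in>space M. ?Q' v} v *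
   (\<integral>\<^sup>+i. ?F ((J l v, p l v), T l v) i \<partial>KJ (fst (fst ((J l v, p l v), T l v)))) \<partial>M)"
 proof (rule cond_law_on_nn_integral[OF a(1) h(1) Q' V2 KJA cond_law_on_subset[OF a(6)] _ Fm])
  show "?Q' v \<Longrightarrow> jump_time T l v < \<infinity> \<and> 0 < mean_rate \<mu> b (J l v)" for v
   using adm_finite[of Q r T l v] by (simp add: \<beta>_def adm_Suc)
  show "jump_prob E \<phi> \<mu> b \<pi> (J l v) D = emeasure (KJ (fst (fst ((J l v, p l v), T l v)))) D"
   if "v \<in> space M" "D \<in> sets I" for v D
   using that measurable_space[OF a(2)] by (simp add: emeasure_KJ)
 qed
 also have "\<dots> = (\<integral>\<^sup>+v. indicator {v\<in>space M. adm Q r T l v} v * ?f (J l v, p l v) (T l v) \<partial>M)"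
  by (rule nn_integral_cong_AE, use AEb in eventually_elim) (auto simp: adm_Suc split: split_indicator)
 also have "\<dots> = (\<integral>\<^sup>+v. indicator {v\<in>space M. adm Q r T l v} v * (\<integral>\<^sup>+s. ?f (J l v, p l v) s \<partial>KT (J l v)) \<partial>M)"
  by (rule semi_markov_holding[OF sm p1 adm1 adm_finite fm])
 finally show ?thesis unfolding step_limT_def by simp
qed

lemma step_limT_measurable:
 fixes r Q :: nat
 assumes upd: "\<And>q. (\<lambda>(p, j). upd p j q) \<in> PP \<Otimes>\<^sub>M I \<rightarrow>\<^sub>M PP"
  and g: "g \<in> borel_measurable (I \<Otimes>\<^sub>M PP)"
 shows "(\<lambda>(j, p). step_limT Q r (\<lambda>c i. g (i, upd p j c)) j) \<in> borel_measurable (I \<Otimes>\<^sub>M PP)"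
proof -
 let ?A = "(I \<Otimes>\<^sub>M PP) \<Otimes>\<^sub>M (borel :: ennreal measure)"
 let ?F = "\<lambda>a i. g (i, upd (snd (fst a)) (fst (fst a)) (cell r (snd a)))"
 have "(\<lambda>z. upd (snd (fst (fst z))) (fst (fst (fst z))) (cell r (snd (fst z)))) \<in> ?A \<Otimes>\<^sub>M I \<rightarrow>\<^sub>M PP"
  by (rule measurable_update_cell[where I=I, OF upd]) measurable
 then have "(\<lambda>z. (snd z, upd (snd (fst (fst z))) (fst (fst (fst z))) (cell r (snd (fst z))))) \<in> ?A \<Otimes>\<^sub>M I \<rightarrow>\<^sub>M I \<Otimes>\<^sub>M PP"
  by (intro measurable_Pair measurable_snd)
 from measurable_compose[OF this g] have Fm: "(\<lambda>(a, i). ?F a i) \<in> borel_measurable (?A \<Otimes>\<^sub>M I)"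
  by (simp add: split_beta')
 have KJA: "(\<lambda>a. KJ (fst (fst a))) \<in> ?A \<rightarrow>\<^sub>M subprob_algebra I"
  by (rule measurable_compose[OF _ KJ_measurable]) measurable
 have FI: "(\<lambda>a. \<integral>\<^sup>+i. ?F a i \<partial>KJ (fst (fst a))) \<in> borel_measurable ?A"
  by (rule nn_integral_measurable_subprob_algebra2[OF Fm KJA])
 have "(\<lambda>a. indicator {..<ennreal (real Q / real r)} (snd a) * (\<integral>\<^sup>+i. ?F a i \<partial>KJ (fst (fst a)))) \<in> borel_measurable ?A"
  by (rule borel_measurable_times_ennreal[OF _ FI]) measurable
 then have "(\<lambda>(a, s). indicator {..<ennreal (real Q / real r)} s * (\<integral>\<^sup>+i. ?F (a, s) i \<partial>KJ (fst a))) \<in> borel_measurable ?A"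
  by (simp add: split_beta')
 moreover have "(\<lambda>a. KT (fst a)) \<in> I \<Otimes>\<^sub>M PP \<rightarrow>\<^sub>M subprob_algebra borel"
  by (rule measurable_compose[OF measurable_fst measurable_prob_algebraD[OF KT_measurable]])
 ultimately have "(\<lambda>a. \<integral>\<^sup>+s. indicator {..<ennreal (real Q / real r)} s * (\<integral>\<^sup>+i. ?F (a, s) i \<partial>KJ (fst a)) \<partial>KT (fst a)) \<in> borel_measurable (I \<Otimes>\<^sub>M PP)"
  by (rule nn_integral_measurable_subprob_algebra2)
 then show ?thesis by (simp add: step_limT_def split_beta')
qed

text \<open>Induction on the number of jumps, for test functions depending on \<open>n\<close>: integrating out the last jump produces
 a test function of the same kind with one jump less, whose pointwise limit is given by \<open>step_limit\<close>.\<close>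

theorem chain_limit:
 fixes r Q :: nat
 assumes acc: "\<And>n. 1 \<le> n \<Longrightarrow> accelerated E Om X P G b \<pi> n x (M n) (Y n) (W n) (U n)"
  and x: "x \<in> space E"
  and sm: "semi_markov I E \<phi> G b \<pi> \<mu> x Mb J T"
  and upd: "\<And>q. (\<lambda>(p, j). upd p j q) \<in> PP \<Otimes>\<^sub>M I \<rightarrow>\<^sub>M PP" and p0: "p0 \<in> space PP" and r: "0 < r"
  and gn: "\<And>n. gn n \<in> borel_measurable (E \<Otimes>\<^sub>M PP)" and g: "g \<in> borel_measurable (I \<Otimes>\<^sub>M PP)"
  and gn1: "\<And>n y p. y \<in> space E \<Longrightarrow> p \<in> space PP \<Longrightarrow> gn n (y, p) \<le> 1"
  and lim: "\<And>y p. y \<in> space E \<Longrightarrow> p \<in> space PP \<Longrightarrow> (\<lambda>n. gn n (y, p)) \<longlonglongrightarrow> g (\<phi> y, p)"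
 shows "(\<lambda>n. \<integral>\<^sup>+w. indicator {w\<in>space (M n). adm Q r (piece_len G b X n (W n) (U n)) l w} w *
   gn n (Y n l w, prun upd p0 r (\<lambda>l w. \<phi> (Y n l w)) (piece_len G b X n (W n) (U n)) l w) \<partial>M n)
  \<longlonglongrightarrow> (\<integral>\<^sup>+v. indicator {v\<in>space Mb. adm Q r T l v} v * g (J l v, prun upd p0 r J T l v) \<partial>Mb)"
 using gn g gn1 lim
proof (induction l arbitrary: gn g)
 case 0
 note a = semi_markov_facts[OF sm]
 interpret Mb: prob_space Mb by (rule a(1))
 have R: "(\<integral>\<^sup>+v. indicator {v\<in>space Mb. adm Q r T 0 v} v * g (J 0 v, prun upd p0 r J T 0 v) \<partial>Mb) = g (\<phi> x, p0)"
 proof -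
  have "(\<integral>\<^sup>+v. indicator {v\<in>space Mb. adm Q r T 0 v} v * g (J 0 v, prun upd p0 r J T 0 v) \<partial>Mb) = (\<integral>\<^sup>+v. g (\<phi> x, p0) \<partial>Mb)"
   by (rule nn_integral_cong_AE, use a(3) AE_space in eventually_elim) (simp add: adm_def)
  then show ?thesis by (simp add: Mb.emeasure_space_1)
 qed
 have "\<forall>\<^sub>F n in sequentially. gn n (x, p0) = (\<integral>\<^sup>+w. indicator {w\<in>space (M n). adm Q r (piece_len G b X n (W n) (U n)) 0 w} w *
   gn n (Y n 0 w, prun upd p0 r (\<lambda>l w. \<phi> (Y n l w)) (piece_len G b X n (W n) (U n)) 0 w) \<partial>M n)"
  using eventually_ge_at_top[of 1]
 proof eventually_elim
  case (elim n)
  note f = accelerated_facts[OF acc[OF elim]]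
  interpret Mn: prob_space "M n" by (rule f(1))
  have "(\<integral>\<^sup>+w. indicator {w\<in>space (M n). adm Q r (piece_len G b X n (W n) (U n)) 0 w} w *
   gn n (Y n 0 w, prun upd p0 r (\<lambda>l w. \<phi> (Y n l w)) (piece_len G b X n (W n) (U n)) 0 w) \<partial>M n) = (\<integral>\<^sup>+w. gn n (x, p0) \<partial>M n)"
   by (rule nn_integral_cong_AE, use f(3) AE_space in eventually_elim) (simp add: adm_def)
  then show ?case by (simp add: Mn.emeasure_space_1)
 qed
 from Lim_transform_eventually[OF "0.prems"(4)[OF x p0] this] show ?case unfolding R .
next
 case (Suc l)
 note gnm = Suc.prems(1) and gm = Suc.prems(2) and gn1 = Suc.prems(3) and lim = Suc.prems(4)
 define Dn where "Dn n = (\<lambda>(y, p). step Q r n (\<lambda>c e. \<integral>\<^sup>+y'. gn n (y', upd p (\<phi> y) c) \<partial>\<pi> e) y)" for n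
 define D where "D = (\<lambda>(j, p). step_limT Q r (\<lambda>c i. g (i, upd p j c)) j)"
 have updsp: "upd p j c \<in> space PP" if "p \<in> space PP" "j \<in> space I" for p j c
  using measurable_space[OF upd[of c], of "(p, j)"] that by (simp add: space_pair_measure)
 have g1: "g (j, p) \<le> 1" if j: "j \<in> space I" and p: "p \<in> space PP" for j p
 proof -
  obtain y where y: "y \<in> space (Ei j)" using Ei_nonempty[OF j] by auto
  then have yE: "y \<in> space E" using Ei_subset[OF j] by auto
  show ?thesis
   using LIMSEQ_le_const2[OF lim[OF yE p], of 1] gn1[OF yE p] phi_eq[OF j y] by auto
 qed
 have sp_pi: "space (\<pi> e) = space E" if "e \<in> space E" for e
  using sets_pi[OF that] by (rule sets_eq_imp_space_eq)
 have inner_m: "(\<lambda>e. \<integral>\<^sup>+y'. gn n (y', p) \<partial>\<pi> e) \<in> borel_measurable E" if p: "p \<in> space PP" for n p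
 proof -
  have "(\<lambda>y'. gn n (y', p)) \<in> borel_measurable E"
   using measurable_compose[OF measurable_Pair2'[OF p] gnm[of n]] by simp
  then show ?thesis
   by (rule measurable_compose[OF measurable_prob_algebraD[OF pi_measurable] nn_integral_measurable_subprob_algebra])
 qed
 have inner_1: "(\<integral>\<^sup>+y'. gn n (y', p) \<partial>\<pi> e) \<le> 1" if p: "p \<in> space PP" and e: "e \<in> space E" for n p e
 proof -
  interpret prob_space "\<pi> e" by (rule pi_prob[OF e])
  have "(\<integral>\<^sup>+y'. gn n (y', p) \<partial>\<pi> e) \<le> (\<integral>\<^sup>+y'. 1 \<partial>\<pi> e)"
   using gn1 p by (intro nn_integral_mono) (simp add: sp_pi[OF e])
  then show ?thesis by (simp add: emeasure_space_1)
 qed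
 have Dnm: "Dn n \<in> borel_measurable (E \<Otimes>\<^sub>M PP)" for n
  unfolding Dn_def by (rule step_measurable[OF upd gnm])
 have Dm: "D \<in> borel_measurable (I \<Otimes>\<^sub>M PP)"
  unfolding D_def by (rule step_limT_measurable[OF upd gm])
 have Dn1: "Dn n (y, p) \<le> 1" if y: "y \<in> space E" and p: "p \<in> space PP" for n y p
 proof -
  interpret prob_space "law y" by (rule prob_law[OF y])
  have "Dn n (y, p) \<le> (\<integral>\<^sup>+q. 1 \<partial>law y)"
   unfolding Dn_def step_def prod.case
  proof (rule nn_integral_mono)
   fix q assume "q \<in> space (law y)"
   then have "fst q \<in> space Om" by (auto simp: space_law[OF y] space_pair_measure)
   then have "(\<integral>\<^sup>+y'. gn n (y', upd p (\<phi> y) (cell r (\<sigma> n (fst q) (snd q)))) \<partial>\<pi> (XX (real n * enn2real (\<sigma> n (fst q) (snd q))) (fst q))) \<le> 1"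
    by (intro inner_1 updsp p phi_space y XX_space)
   then show "indicator {..<ennreal (real Q / real r)} (\<sigma> n (fst q) (snd q)) *
    (\<integral>\<^sup>+y'. gn n (y', upd p (\<phi> y) (cell r (\<sigma> n (fst q) (snd q)))) \<partial>\<pi> (XX (real n * enn2real (\<sigma> n (fst q) (snd q))) (fst q))) \<le> 1"
    by (auto split: split_indicator)
  qed
  then show ?thesis by (simp add: emeasure_space_1)
 qed
 have Dlim: "(\<lambda>n. Dn n (y, p)) \<longlonglongrightarrow> D (\<phi> y, p)" if y: "y \<in> space E" and p: "p \<in> space PP" for y p
 proof -
  have up: "upd p (\<phi> y) c \<in> space PP" for c by (intro updsp p phi_space y)
  have gI: "(\<lambda>i. g (i, upd p (\<phi> y) c)) \<in> borel_measurable I" for c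
   using measurable_compose[OF measurable_Pair2'[OF up] gm] by simp
  have "(\<lambda>n. step Q r n (\<lambda>c e. \<integral>\<^sup>+y'. gn n (y', upd p (\<phi> y) c) \<partial>\<pi> e) y) \<longlonglongrightarrow>
    step_lim Q r (\<lambda>c e. \<integral>\<^sup>+y'. g (\<phi> y', upd p (\<phi> y) c) \<partial>\<pi> e) (\<phi> y)"
  proof (rule step_limit[OF r y inner_m[OF up] inner_1[OF up]])
   show "(\<lambda>n. \<integral>\<^sup>+y'. gn n (y', upd p (\<phi> y) c) \<partial>\<pi> e) \<longlonglongrightarrow> (\<integral>\<^sup>+y'. g (\<phi> y', upd p (\<phi> y) c) \<partial>\<pi> e)"
    if e: "e \<in> space E" for c e
   proof (rule nn_integral_dominated_convergence[where w="\<lambda>_. 1"])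
    interpret prob_space "\<pi> e" by (rule pi_prob[OF e])
    have [measurable_cong]: "sets (\<pi> e) = sets E" by (rule sets_pi[OF e])
    show "(\<lambda>y'. gn i (y', upd p (\<phi> y) c)) \<in> borel_measurable (\<pi> e)" for i
     using measurable_compose[OF measurable_Pair2'[OF up] gnm[of i]] by (simp cong: measurable_cong_sets)
    show "(\<lambda>y'. g (\<phi> y', upd p (\<phi> y) c)) \<in> borel_measurable (\<pi> e)"
     using measurable_compose[OF phi_measurable gI] by (simp cong: measurable_cong_sets)
    show "AE y' in \<pi> e. gn j (y', upd p (\<phi> y) c) \<le> 1" for j
     using gn1 up by (intro AE_I2) (simp add: sp_pi[OF e])
    show "AE y' in \<pi> e. (\<lambda>n. gn n (y', upd p (\<phi> y) c)) \<longlonglongrightarrow> g (\<phi> y', upd p (\<phi> y) c)"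
     using lim up by (intro AE_I2) (simp add: sp_pi[OF e])
    show "(\<integral>\<^sup>+y'. 1 \<partial>\<pi> e) < \<infinity>" by (simp add: emeasure_space_1)
   qed simp
  qed
  also have "step_lim Q r (\<lambda>c e. \<integral>\<^sup>+y'. g (\<phi> y', upd p (\<phi> y) c) \<partial>\<pi> e) (\<phi> y) = D (\<phi> y, p)"
   unfolding D_def prod.case
   by (rule step_limT_eq[symmetric, OF r phi_space[OF y] gI]) (intro g1 up)
  finally show ?thesis by (simp add: Dn_def)
 qed
 from Suc.IH[of Dn D, OF Dnm Dm Dn1 Dlim]
 have IH: "(\<lambda>n. \<integral>\<^sup>+w. indicator {w\<in>space (M n). adm Q r (piece_len G b X n (W n) (U n)) l w} w *
   Dn n (Y n l w, prun upd p0 r (\<lambda>l w. \<phi> (Y n l w)) (piece_len G b X n (W n) (U n)) l w) \<partial>M n)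
  \<longlonglongrightarrow> (\<integral>\<^sup>+v. indicator {v\<in>space Mb. adm Q r T l v} v * D (J l v, prun upd p0 r J T l v) \<partial>Mb)" .
 have R: "(\<integral>\<^sup>+v. indicator {v\<in>space Mb. adm Q r T l v} v * D (J l v, prun upd p0 r J T l v) \<partial>Mb)
   = (\<integral>\<^sup>+v. indicator {v\<in>space Mb. adm Q r T (Suc l) v} v * g (J (Suc l) v, prun upd p0 r J T (Suc l) v) \<partial>Mb)"
  unfolding semi_markov_step[OF sm upd p0 gm] D_def by simp
 show ?case unfolding R[symmetric]
 proof (rule Lim_transform_eventually[OF IH])
  show "\<forall>\<^sub>F n in sequentially.
   (\<integral>\<^sup>+w. indicator {w\<in>space (M n). adm Q r (piece_len G b X n (W n) (U n)) l w} w *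
    Dn n (Y n l w, prun upd p0 r (\<lambda>l w. \<phi> (Y n l w)) (piece_len G b X n (W n) (U n)) l w) \<partial>M n)
  = (\<integral>\<^sup>+w. indicator {w\<in>space (M n). adm Q r (piece_len G b X n (W n) (U n)) (Suc l) w} w *
    gn n (Y n (Suc l) w, prun upd p0 r (\<lambda>l w. \<phi> (Y n l w)) (piece_len G b X n (W n) (U n)) (Suc l) w) \<partial>M n)"
   using eventually_ge_at_top[of 1]
  proof eventually_elim
   case (elim n)
   show ?case unfolding accelerated_step[OF acc[OF elim] upd p0 gnm] Dn_def by simp
  qed
 qed
qed

end

section \<open>Comparison of an ordinary differential equation with an Euler polygon\<close>

lemma norm_set_integral_le:
 fixes f :: "real \<Rightarrow> 'a::euclidean_space"
 assumes ab: "\<alpha> \<le> \<beta>" and f: "set_integrable lborel {\<alpha>..\<beta>} f"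
  and le: "AE s in lborel. s \<in> {\<alpha>..\<beta>} \<longrightarrow> norm (f s) \<le> C"
 shows "norm (set_lebesgue_integral lborel {\<alpha>..\<beta>} f) \<le> C * (\<beta> - \<alpha>)"
proof -
 have "norm (set_lebesgue_integral lborel {\<alpha>..\<beta>} f) \<le> (\<integral>s. norm (indicator {\<alpha>..\<beta>} s *\<^sub>R f s) \<partial>lborel)"
  unfolding set_lebesgue_integral_def by (rule integral_norm_bound)
 also have "\<dots> \<le> (\<integral>s. C * indicator {\<alpha>..\<beta>} s \<partial>lborel)"
 proof (rule integral_mono_AE)
  show "integrable lborel (\<lambda>s. norm (indicator {\<alpha>..\<beta>} s *\<^sub>R f s))"
   using f unfolding set_integrable_def by (rule integrable_norm)
  show "integrable lborel (\<lambda>s. C * indicator {\<alpha>..\<beta>} s)" using ab by simp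
  show "AE s in lborel. norm (indicator {\<alpha>..\<beta>} s *\<^sub>R f s) \<le> C * indicator {\<alpha>..\<beta>} s"
   using le by eventually_elim (auto split: split_indicator)
 qed
 also have "\<dots> = C * (\<beta> - \<alpha>)" using ab by simp
 finally show ?thesis .
qed

lemma last_index_such_that:
 assumes "P (0::nat)" shows "\<exists>i\<le>l. P i \<and> (i < l \<longrightarrow> \<not> P (Suc i))"
proof (induction l)
 case (Suc l)
 then obtain i where i: "i \<le> l" "P i" "i < l \<longrightarrow> \<not> P (Suc i)" by blast
 show ?case
 proof (cases "P (Suc l)")
  case False
  then have "i < Suc l \<longrightarrow> \<not> P (Suc i)" using i by (cases "i = l") auto
  then show ?thesis using i by (intro exI[of _ i]) auto
 qed auto
qed (use assms in auto)

text \<open>The three contributions are the discretisation error, the averaging error \<open>\<eta>\<close> committed in each of the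
 \<open>T/h\<close> cells, and the misalignment by at most one cell per jump.\<close>

definition euler_error_bound :: "real \<Rightarrow> real \<Rightarrow> real \<Rightarrow> real \<Rightarrow> 'a::real_normed_vector \<Rightarrow> nat \<Rightarrow> real" where
 "euler_error_bound K h \<eta> T z l = exp (2 * K * (T + (real l + 1) * h)) *
   (2 * K\<^sup>2 * h * ((1 + norm z) * exp (K * T)) * T + \<eta> * T / h + (real l + 1) * (2 * K * h * ((1 + norm z) * exp (K * T))))
  + (real l + 1) * (K * h * ((1 + norm z) * exp (K * T)))"

text \<open>The solution \<open>Z\<close> switches field at the times \<open>\<tau> i\<close>, the polygon \<open>u\<close> at the grid indices \<open>a i\<close>
 obtained by rounding down each duration separately, so that \<open>a i * h\<close> lags behind \<open>\<tau> i\<close> by at most \<open>i\<close> cells.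
 The averaging bound is required only at the velocities that the polygon visits, on cells counted from the
 last jump.\<close>

locale euler_comparison =
 fixes K h \<eta> T :: real and z :: "'a::euclidean_space" and l :: nat
  and \<tau> s :: "nat \<Rightarrow> real" and a q :: "nat \<Rightarrow> nat"
  and V :: "real \<Rightarrow> 'a \<Rightarrow> 'a" and Z :: "real \<Rightarrow> 'a" and u :: "nat \<Rightarrow> 'a" and w :: "nat \<Rightarrow> 'a \<Rightarrow> 'a"
 assumes K: "0 \<le> K" and h: "0 < h" "2 * K * h \<le> 1" and eta: "0 \<le> \<eta>"
  and tau_0: "\<tau> 0 = 0" and tau_Suc: "\<And>i. i < l \<Longrightarrow> \<tau> (Suc i) = \<tau> i + s i" and s_nonneg: "\<And>i. i < l \<Longrightarrow> 0 \<le> s i"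
  and tau_l: "\<tau> l \<le> T"
  and a_0: "a 0 = 0" and a_Suc: "\<And>i. i < l \<Longrightarrow> a (Suc i) = a i + q i"
  and q: "\<And>i. i < l \<Longrightarrow> real (q i) * h \<le> s i" "\<And>i. i < l \<Longrightarrow> s i < (real (q i) + 1) * h"
  and u_0: "u 0 = z"
  and u_Suc: "\<And>i k. i \<le> l \<Longrightarrow> a i \<le> k \<Longrightarrow> (i < l \<Longrightarrow> k < a (Suc i)) \<Longrightarrow> u (Suc k) = u k + h *\<^sub>R w i (u k)"
  and w_bound: "\<And>i v. i \<le> l \<Longrightarrow> norm (w i v) \<le> K * (1 + norm v)"
  and Z_cont: "continuous_on {0..T} Z"
  and Z_int: "\<And>t. 0 \<le> t \<Longrightarrow> t \<le> T \<Longrightarrow> set_integrable lborel {0..t} (\<lambda>s. V s (Z s))"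
  and Z_eq: "\<And>t. 0 \<le> t \<Longrightarrow> t \<le> T \<Longrightarrow> Z t = z + set_lebesgue_integral lborel {0..t} (\<lambda>s. V s (Z s))"
  and V_int: "\<And>v. set_integrable lborel {0..T} (\<lambda>s. V s v)"
  and V_Lip: "AE s in lborel. s \<in> {0..T} \<longrightarrow> (\<forall>v v'. norm (V s v - V s v') \<le> K * norm (v - v')) \<and> norm (V s 0) \<le> K"
  and avg: "\<And>i c. i \<le> l \<Longrightarrow> \<tau> i + (real c + 1) * h \<le> (if i < l then \<tau> (Suc i) else T) \<Longrightarrow>
   norm (set_lebesgue_integral lborel {\<tau> i + real c * h..\<tau> i + (real c + 1) * h} (\<lambda>s. V s (u (a i + c)))
    - h *\<^sub>R w i (u (a i + c))) \<le> \<eta>"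
begin

lemma V_growth: "AE s in lborel. s \<in> {0..T} \<longrightarrow> (\<forall>v. norm (V s v) \<le> K * (1 + norm v))"
 using V_Lip
proof eventually_elim
 case (elim s)
 show ?case
 proof (intro impI allI)
  fix v assume "s \<in> {0..T}"
  then have "norm (V s v - V s 0) \<le> K * norm (v - 0)" "norm (V s 0) \<le> K" using elim by blast+
  moreover have "norm (V s v) \<le> norm (V s v - V s 0) + norm (V s 0)" using norm_triangle_ineq[of "V s v - V s 0" "V s 0"] by simp
  ultimately show "norm (V s v) \<le> K * (1 + norm v)" by (simp add: algebra_simps)
 qed
qed

lemma Z_increment:
 assumes "0 \<le> \<alpha>" "\<alpha> \<le> \<beta>" "\<beta> \<le> T"
 shows "set_integrable lborel {\<alpha>..\<beta>} (\<lambda>s. V s (Z s))"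
  and "Z \<beta> - Z \<alpha> = set_lebesgue_integral lborel {\<alpha>..\<beta>} (\<lambda>s. V s (Z s))"
proof -
 let ?f = "\<lambda>s. V s (Z s)"
 have i: "set_integrable lborel {0..\<alpha>} ?f" "set_integrable lborel {0..\<beta>} ?f" using assms by (auto intro!: Z_int)
 show i2: "set_integrable lborel {\<alpha>..\<beta>} ?f"
  by (rule set_integrable_subset[OF i(2)]) (use assms in auto)
 have "AE s in lborel. \<not> (s \<in> {0..\<alpha>} \<and> s \<in> {\<alpha>..\<beta>})"
  using AE_lborel_singleton[of \<alpha>] by eventually_elim auto
 from set_integral_Un_AE[OF this _ _ i(1) i2]
 have "set_lebesgue_integral lborel ({0..\<alpha>} \<union> {\<alpha>..\<beta>}) ?f = set_lebesgue_integral lborel {0..\<alpha>} ?f + set_lebesgue_integral lborel {\<alpha>..\<beta>} ?f"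
  by simp
 moreover have "{0..\<alpha>} \<union> {\<alpha>..\<beta>} = {0..\<beta>}" using assms by auto
 ultimately show "Z \<beta> - Z \<alpha> = set_lebesgue_integral lborel {\<alpha>..\<beta>} ?f"
  using Z_eq[of \<alpha>] Z_eq[of \<beta>] assms by simp
qed

lemma Z_short_time:
 assumes ab: "0 \<le> \<alpha>" "\<alpha> \<le> \<beta>" "\<beta> \<le> T" "\<beta> - \<alpha> \<le> h"
 shows "norm (Z \<beta> - Z \<alpha>) \<le> 2 * K * h * (1 + norm (Z \<alpha>))"
proof -
 have c: "continuous_on {\<alpha>..\<beta>} (\<lambda>s. norm (Z s - Z \<alpha>))"
  by (intro continuous_intros continuous_on_subset[OF Z_cont]) (use ab in auto)
 obtain m where m: "m \<in> {\<alpha>..\<beta>}" "\<And>s. s \<in> {\<alpha>..\<beta>} \<Longrightarrow> norm (Z s - Z \<alpha>) \<le> norm (Z m - Z \<alpha>)"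
  using continuous_attains_sup[OF compact_Icc _ c] ab by fastforce
 define D where "D = norm (Z m - Z \<alpha>)"
 have "norm (Z m - Z \<alpha>) \<le> K * (1 + norm (Z \<alpha>) + D) * (m - \<alpha>)"
  unfolding Z_increment(2)[of \<alpha> m, OF ab(1)] using m ab
 proof (subst Z_increment(2), simp_all, intro norm_set_integral_le Z_increment(1))
  show "AE s in lborel. s \<in> {\<alpha>..m} \<longrightarrow> norm (V s (Z s)) \<le> K * (1 + norm (Z \<alpha>) + D)"
   using V_growth
  proof eventually_elim
   case (elim s)
   show ?case
   proof
    assume s: "s \<in> {\<alpha>..m}"
    then have "norm (Z s - Z \<alpha>) \<le> D" using m by (auto simp: D_def)
    then have "norm (Z s) \<le> norm (Z \<alpha>) + D" using norm_triangle_ineq[of "Z s - Z \<alpha>" "Z \<alpha>"] by simp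
    then have "K * (1 + norm (Z s)) \<le> K * (1 + norm (Z \<alpha>) + D)" using K by (intro mult_left_mono) auto
    moreover have "s \<in> {0..T}" using s m ab by auto
    ultimately show "norm (V s (Z s)) \<le> K * (1 + norm (Z \<alpha>) + D)" using elim by (meson order_trans)
   qed
  qed
 qed (use m ab in auto)
 also have "\<dots> \<le> K * (1 + norm (Z \<alpha>) + D) * h"
  using m ab K by (intro mult_left_mono) (auto simp: D_def)
 finally have "D \<le> K * h * (1 + norm (Z \<alpha>)) + (K * h) * D" unfolding D_def[symmetric] by (simp add: algebra_simps)
 moreover have "(K * h) * D \<le> 1/2 * D" using h by (intro mult_right_mono) (auto simp: D_def)
 ultimately have "D \<le> 2 * K * h * (1 + norm (Z \<alpha>))" by simp
 then show ?thesis using m(2)[of \<beta>] ab unfolding D_def by simp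
qed

text \<open>On one cell, \<open>Z\<close> is frozen at \<open>v\<close>, which costs the Lipschitz constant times the distance, and the field at
 \<open>v\<close> is averaged. Short steps make Gronwall's inequality unnecessary.\<close>

lemma euler_step:
 assumes al: "0 \<le> \<alpha>" "\<alpha> + h \<le> T"
  and avg: "norm (set_lebesgue_integral lborel {\<alpha>..\<alpha> + h} (\<lambda>s. V s v) - h *\<^sub>R y) \<le> \<eta>"
 shows "norm (Z (\<alpha> + h) - (v + h *\<^sub>R y)) \<le> (1 + 2 * K * h) * norm (Z \<alpha> - v) + 2 * K\<^sup>2 * h\<^sup>2 * (1 + norm v) + \<eta>"
proof -
 define e where "e = norm (Z \<alpha> - v)"
 have e0: "0 \<le> e" by (simp add: e_def)
 have Za: "norm (Z \<alpha>) \<le> norm v + e" unfolding e_def using norm_triangle_ineq[of "Z \<alpha> - v" v] by simp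
 let ?A = "{\<alpha>..\<alpha> + h}"
 have i1: "set_integrable lborel ?A (\<lambda>s. V s (Z s))" using al h by (intro Z_increment) auto
 have i2: "set_integrable lborel ?A (\<lambda>s. V s v)" by (rule set_integrable_subset[OF V_int]) (use al in auto)
 have "norm (set_lebesgue_integral lborel ?A (\<lambda>s. V s (Z s) - V s v)) \<le> K * (2 * K * h * (1 + norm v + e) + e) * (\<alpha> + h - \<alpha>)"
 proof (rule norm_set_integral_le)
  show "set_integrable lborel ?A (\<lambda>s. V s (Z s) - V s v)" using i1 i2 by (rule set_integral_diff)
  show "AE s in lborel. s \<in> ?A \<longrightarrow> norm (V s (Z s) - V s v) \<le> K * (2 * K * h * (1 + norm v + e) + e)"
   using V_Lip
  proof eventually_elim
   case (elim s)
   show ?case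
   proof
    assume s: "s \<in> ?A"
    then have "s \<in> {0..T}" using al by auto
    then have "norm (V s (Z s) - V s v) \<le> K * norm (Z s - v)" using elim by blast
    also have "norm (Z s - v) \<le> norm (Z s - Z \<alpha>) + e"
     unfolding e_def using norm_triangle_ineq[of "Z s - Z \<alpha>" "Z \<alpha> - v"] by simp
    also have "norm (Z s - Z \<alpha>) \<le> 2 * K * h * (1 + norm (Z \<alpha>))" using s al by (intro Z_short_time) auto
    also have "\<dots> \<le> 2 * K * h * (1 + norm v + e)" using Za K h by (intro mult_left_mono) auto
    finally show "norm (V s (Z s) - V s v) \<le> K * (2 * K * h * (1 + norm v + e) + e)"
     using K by (simp add: mult_left_mono)
   qed
  qed
 qed (use h in auto)
 moreover have "set_lebesgue_integral lborel ?A (\<lambda>s. V s (Z s) - V s v) =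
   (Z (\<alpha> + h) - Z \<alpha>) - set_lebesgue_integral lborel ?A (\<lambda>s. V s v)"
  using set_integral_diff(2)[OF i1 i2] Z_increment(2)[of \<alpha> "\<alpha> + h"] al h by simp
 ultimately have b1: "norm ((Z (\<alpha> + h) - Z \<alpha>) - set_lebesgue_integral lborel ?A (\<lambda>s. V s v)) \<le> K * h * (2 * K * h * (1 + norm v + e) + e)"
  by (simp add: algebra_simps)
 have "K * h * (2 * K * h * (1 + norm v + e) + e) = 2 * K\<^sup>2 * h\<^sup>2 * (1 + norm v) + K * h * e + (2 * K * h) * (K * h * e)"
  by (simp add: algebra_simps power2_eq_square)
 also have "(2 * K * h) * (K * h * e) \<le> 1 * (K * h * e)"
  using h K e0 by (intro mult_right_mono) auto
 finally have b2: "K * h * (2 * K * h * (1 + norm v + e) + e) \<le> 2 * K\<^sup>2 * h\<^sup>2 * (1 + norm v) + 2 * K * h * e" by (simp add: mult_ac)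
 have "Z (\<alpha> + h) - (v + h *\<^sub>R y) = (Z \<alpha> - v) + (((Z (\<alpha> + h) - Z \<alpha>) - set_lebesgue_integral lborel ?A (\<lambda>s. V s v))
   + (set_lebesgue_integral lborel ?A (\<lambda>s. V s v) - h *\<^sub>R y))" by simp
 also have "norm \<dots> \<le> e + (norm ((Z (\<alpha> + h) - Z \<alpha>) - set_lebesgue_integral lborel ?A (\<lambda>s. V s v))
   + norm (set_lebesgue_integral lborel ?A (\<lambda>s. V s v) - h *\<^sub>R y))"
  unfolding e_def by (intro norm_triangle_le add_mono order_refl norm_triangle_ineq)
 finally show ?thesis using b1 b2 avg unfolding e_def[symmetric] by (simp add: algebra_simps)
qed

lemma tau_mono: "i \<le> k \<Longrightarrow> k \<le> l \<Longrightarrow> \<tau> i \<le> \<tau> k"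
proof (induction k)
 case (Suc k)
 then show ?case using tau_Suc[of k] s_nonneg[of k] by (cases "i = Suc k") auto
qed simp

lemma tau_nonneg: "i \<le> l \<Longrightarrow> 0 \<le> \<tau> i"
 using tau_mono[of 0 i] tau_0 by simp

lemma tau_le_T: "i \<le> l \<Longrightarrow> \<tau> i \<le> T"
 using tau_mono[of i l] tau_l by simp

lemma a_tau: "i \<le> l \<Longrightarrow> real (a i) * h \<le> \<tau> i \<and> \<tau> i \<le> (real (a i) + real i) * h"
proof (induction i)
 case 0 then show ?case by (simp add: tau_0 a_0)
next
 case (Suc i)
 then have "real (a (Suc i)) * h = real (a i) * h + real (q i) * h" by (simp add: a_Suc algebra_simps)
 moreover have "(real (a (Suc i)) + real (Suc i)) * h = (real (a i) + real i) * h + (real (q i) + 1) * h"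
  using Suc by (simp add: a_Suc algebra_simps)
 ultimately show ?case using Suc q[of i] tau_Suc[of i] by simp
qed

lemma u_increment: "norm (u (Suc k) - u k) \<le> K * h * (1 + norm (u k))"
proof -
 obtain i where i: "i \<le> l" "a i \<le> k" "i < l \<longrightarrow> \<not> a (Suc i) \<le> k"
  using last_index_such_that[of "\<lambda>i. a i \<le> k" l] by (auto simp: a_0)
 then have "u (Suc k) - u k = h *\<^sub>R w i (u k)" using u_Suc[of i k] by (simp add: not_le)
 also have "norm \<dots> \<le> h * (K * (1 + norm (u k)))" using h w_bound[of i "u k"] i by (simp add: mult_left_mono)
 finally show ?thesis by (simp add: mult_ac)
qed

definition R :: real where "R = (1 + norm z) * exp (K * T)"

lemma u_bound:
 assumes "real k * h \<le> T" shows "1 + norm (u k) \<le> R"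
proof -
 have "1 + norm (u k) \<le> (1 + norm z) * (1 + K * h) ^ k"
 proof (induction k)
  case (Suc k)
  have "norm (u (Suc k)) \<le> norm (u k) + norm (u (Suc k) - u k)" using norm_triangle_ineq[of "u k" "u (Suc k) - u k"] by simp
  then have "1 + norm (u (Suc k)) \<le> (1 + K * h) * (1 + norm (u k))" using u_increment[of k] by (simp add: algebra_simps)
  also have "\<dots> \<le> (1 + K * h) * ((1 + norm z) * (1 + K * h) ^ k)" using Suc K h by (intro mult_left_mono) auto
  finally show ?case by (simp add: mult_ac)
 qed (simp add: u_0)
 also have "(1 + K * h) ^ k \<le> exp (K * h) ^ k" using K h exp_ge_add_one_self[of "K * h"] by (intro power_mono) auto
 also have "exp (K * h) ^ k = exp (K * (real k * h))" by (simp add: exp_of_nat_mult[symmetric] mult_ac)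
 also have "\<dots> \<le> exp (K * T)" using assms K by (simp add: mult_left_mono)
 finally show ?thesis unfolding R_def by (simp add: mult_left_mono)
qed

lemma R_pos: "0 \<le> R" by (simp add: R_def)

definition \<rho> :: real where "\<rho> = 1 + 2 * K * h"
definition \<epsilon>1 :: real where "\<epsilon>1 = 2 * K\<^sup>2 * h\<^sup>2 * R + \<eta>"
definition \<epsilon>2 :: real where "\<epsilon>2 = 2 * K * h * R"

lemma step_consts: "1 \<le> \<rho>" "0 \<le> \<epsilon>1" "0 \<le> \<epsilon>2"
 using K h eta R_pos by (auto simp: \<rho>_def \<epsilon>1_def \<epsilon>2_def)

definition bd :: "nat \<Rightarrow> nat \<Rightarrow> real" where "bd k i = \<rho> ^ (k + i) * (real k * \<epsilon>1 + real i * \<epsilon>2)"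

lemma bd_step1: "\<rho> * bd k i + \<epsilon>1 \<le> bd (Suc k) i"
proof -
 have "1 * \<epsilon>1 \<le> \<rho> ^ (Suc k + i) * \<epsilon>1" using step_consts by (intro mult_right_mono one_le_power) auto
 then show ?thesis by (simp add: bd_def algebra_simps)
qed

lemma bd_step2: "\<rho> * bd k i + \<epsilon>2 \<le> bd k (Suc i)"
proof -
 have "1 * \<epsilon>2 \<le> \<rho> ^ (k + Suc i) * \<epsilon>2" using step_consts by (intro mult_right_mono one_le_power) auto
 then show ?thesis by (simp add: bd_def algebra_simps)
qed

text \<open>The polygon index advances together with the cells of the piece, so each step is an instance of
 \<open>euler_step\<close>.\<close>

lemma within_piece:
 assumes i: "i \<le> l" and start: "norm (Z (\<tau> i) - u (a i)) \<le> bd (a i) i"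
  and c: "\<tau> i + real c * h \<le> (if i < l then \<tau> (Suc i) else T)" and cq: "i < l \<Longrightarrow> c \<le> q i"
 shows "norm (Z (\<tau> i + real c * h) - u (a i + c)) \<le> bd (a i + c) i"
 using c cq
proof (induction c)
 case 0 then show ?case using start by simp
next
 case (Suc c)
 have endT: "(if i < l then \<tau> (Suc i) else T) \<le> T" using tau_le_T[of "Suc i"] by auto
 have le: "\<tau> i + (real c + 1) * h \<le> (if i < l then \<tau> (Suc i) else T)" using Suc.prems(1) by (simp add: add.commute)
 have "\<tau> i + real c * h \<le> \<tau> i + (real c + 1) * h" using h by simp
 then have IH: "norm (Z (\<tau> i + real c * h) - u (a i + c)) \<le> bd (a i + c) i"
  using le Suc.prems(2) by (intro Suc.IH) auto
 have kT: "real (a i + c) * h \<le> T"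
 proof -
  have "real (a i + c) * h \<le> \<tau> i + real c * h" using a_tau[OF i] by (simp add: algebra_simps)
  also have "\<dots> \<le> T" using le endT h by (simp add: algebra_simps)
  finally show ?thesis .
 qed
 have us: "u (Suc (a i + c)) = u (a i + c) + h *\<^sub>R w i (u (a i + c))"
  using Suc.prems(2) i by (intro u_Suc) (auto simp: a_Suc)
 have eq: "\<tau> i + real (Suc c) * h = (\<tau> i + real c * h) + h" by (simp add: algebra_simps)
 have eq': "\<tau> i + (real c + 1) * h = (\<tau> i + real c * h) + h" by (simp add: algebra_simps)
 have "norm (Z ((\<tau> i + real c * h) + h) - (u (a i + c) + h *\<^sub>R w i (u (a i + c))))
   \<le> (1 + 2 * K * h) * norm (Z (\<tau> i + real c * h) - u (a i + c)) + 2 * K\<^sup>2 * h\<^sup>2 * (1 + norm (u (a i + c))) + \<eta>"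
  using avg[OF i le] tau_nonneg[OF i] h le endT unfolding eq' by (intro euler_step) auto
 also have "\<dots> \<le> \<rho> * bd (a i + c) i + 2 * K\<^sup>2 * h\<^sup>2 * R + \<eta>"
  unfolding \<rho>_def using IH u_bound[OF kT] K h by (intro add_mono mult_left_mono order_refl) auto
 also have "\<dots> \<le> bd (a i + Suc c) i" using bd_step1[of "a i + c" i] by (simp add: \<epsilon>1_def)
 finally show ?case unfolding eq using us by simp
qed

text \<open>The incomplete last cell of a piece is skipped by the polygon: time passes but the index stays.\<close>

lemma short_time_error:
 assumes t: "0 \<le> t" "t \<le> t'" "t' \<le> T" "t' - t \<le> h" and e: "norm (Z t - u k) \<le> bd k i" and k: "real k * h \<le> T"
 shows "norm (Z t' - u k) \<le> bd k (Suc i)"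
proof -
 have Zt: "norm (Z t) \<le> norm (u k) + bd k i" using e norm_triangle_ineq[of "Z t - u k" "u k"] by simp
 have "norm (Z t' - u k) \<le> norm (Z t' - Z t) + norm (Z t - u k)" using norm_triangle_ineq[of "Z t' - Z t" "Z t - u k"] by simp
 also have "\<dots> \<le> 2 * K * h * (1 + norm (Z t)) + bd k i" using Z_short_time[OF t] e by simp
 also have "\<dots> \<le> 2 * K * h * (R + bd k i) + bd k i"
 proof -
  have "1 + norm (Z t) \<le> R + bd k i" using Zt u_bound[OF k] by linarith
  then show ?thesis using K h by (intro add_right_mono mult_left_mono) auto
 qed
 also have "\<dots> = \<rho> * bd k i + \<epsilon>2" by (simp add: \<rho>_def \<epsilon>2_def algebra_simps)
 also have "\<dots> \<le> bd k (Suc i)" by (rule bd_step2)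
 finally show ?thesis .
qed

lemma at_jump: "i \<le> l \<Longrightarrow> norm (Z (\<tau> i) - u (a i)) \<le> bd (a i) i"
proof (induction i)
 case 0
 have "0 \<le> T" using tau_nonneg[of l] tau_l by simp
 moreover have "set_lebesgue_integral lborel {0..0} (\<lambda>s. V s (Z s)) = 0"
  unfolding set_lebesgue_integral_def
 proof (rule integral_eq_zero_AE)
  show "AE s in lborel. indicat_real {0..0} s *\<^sub>R V s (Z s) = 0"
   using AE_lborel_singleton[of 0] by eventually_elim simp
 qed
 ultimately show ?case using Z_eq[of 0] by (simp add: tau_0 a_0 u_0 bd_def)
next
 case (Suc i)
 then have i: "i < l" "i \<le> l" by auto
 have step: "norm (Z (\<tau> i + real (q i) * h) - u (a i + q i)) \<le> bd (a i + q i) i"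
  using Suc i q(1)[OF i(1)] by (intro within_piece) (auto simp: tau_Suc)
 have "norm (Z (\<tau> (Suc i)) - u (a i + q i)) \<le> bd (a i + q i) (Suc i)"
 proof (rule short_time_error[OF _ _ _ _ step])
  show "real (a i + q i) * h \<le> T"
   using a_tau[OF Suc.prems] tau_le_T[OF Suc.prems] by (simp add: a_Suc[OF i(1)])
 qed (use q[OF i(1)] tau_nonneg[OF i(2)] tau_le_T[OF Suc.prems] h tau_Suc[OF i(1)] in \<open>auto simp: algebra_simps\<close>)
 then show ?case using a_Suc[OF i(1)] by simp
qed

lemma bd_le:
 assumes k: "real k * h \<le> T" and i: "i \<le> l + 1"
 shows "bd k i \<le> exp (2 * K * (T + (real l + 1) * h)) * (2 * K\<^sup>2 * h * R * T + \<eta> * T / h + (real l + 1) * (2 * K * h * R))"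
 unfolding bd_def
proof (rule mult_mono)
 have "\<rho> ^ (k + i) \<le> exp (2 * K * h) ^ (k + i)"
  unfolding \<rho>_def using K h exp_ge_add_one_self[of "2 * K * h"] by (intro power_mono) auto
 also have "\<dots> = exp (2 * K * (real k * h + real i * h))" by (simp add: exp_of_nat_mult[symmetric] algebra_simps)
 also have "\<dots> \<le> exp (2 * K * (T + (real l + 1) * h))"
  using k i K h by (auto intro!: mult_left_mono add_mono mult_right_mono)
 finally show "\<rho> ^ (k + i) \<le> exp (2 * K * (T + (real l + 1) * h))" .
 have kT: "real k \<le> T / h" using k h by (simp add: field_simps)
 have "real k * \<epsilon>1 \<le> T / h * \<epsilon>1" using kT step_consts by (intro mult_right_mono) auto
 also have "\<dots> = 2 * K\<^sup>2 * h * R * T + \<eta> * T / h" using h by (simp add: \<epsilon>1_def field_simps power2_eq_square)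
 finally have "real k * \<epsilon>1 \<le> 2 * K\<^sup>2 * h * R * T + \<eta> * T / h" .
 moreover have "real i * \<epsilon>2 \<le> (real l + 1) * \<epsilon>2" using i step_consts by (intro mult_right_mono) auto
 ultimately show "real k * \<epsilon>1 + real i * \<epsilon>2 \<le> 2 * K\<^sup>2 * h * R * T + \<eta> * T / h + (real l + 1) * (2 * K * h * R)"
  by (simp add: \<epsilon>2_def)
qed (use step_consts in auto)

lemma u_lipschitz:
 assumes "real (k + m) * h \<le> T" shows "norm (u (k + m) - u k) \<le> real m * (K * h * R)"
 using assms
proof (induction m)
 case (Suc m)
 have le: "real (k + m) * h \<le> T" using Suc.prems h by (simp add: algebra_simps)
 have "norm (u (Suc (k + m)) - u (k + m)) \<le> K * h * R"
  using u_increment[of "k + m"] u_bound[OF le] K h by (meson mult_left_mono mult_nonneg_nonneg less_imp_le order_trans)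
 moreover have "norm (u (Suc (k + m)) - u k) \<le> norm (u (Suc (k + m)) - u (k + m)) + norm (u (k + m) - u k)"
  using norm_triangle_ineq[of "u (Suc (k + m)) - u (k + m)" "u (k + m) - u k"] by simp
 ultimately show ?case using Suc.IH[OF le] by (simp add: algebra_simps)
qed simp

theorem euler_error:
 assumes t: "0 \<le> t" "t \<le> T"
 shows "norm (Z t - u (nat \<lfloor>t / h\<rfloor>)) \<le> euler_error_bound K h \<eta> T z l"
proof -
 obtain i where i: "i \<le> l" "\<tau> i \<le> t" and t_less: "i < l \<Longrightarrow> t < \<tau> (Suc i)"
  using last_index_such_that[of "\<lambda>i. \<tau> i \<le> t" l] t by (auto simp: tau_0 not_le)
 define c where "c = nat \<lfloor>(t - \<tau> i) / h\<rfloor>"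
 have ti: "0 \<le> (t - \<tau> i) / h" using i h by simp
 then have fl: "real c \<le> (t - \<tau> i) / h" "(t - \<tau> i) / h < real c + 1" unfolding c_def by linarith+
 then have c: "\<tau> i + real c * h \<le> t" "t < \<tau> i + (real c + 1) * h" using h by (simp_all add: field_simps)
 have cq: "c \<le> q i" if "i < l"
 proof -
  have "real c * h < (real (q i) + 1) * h" using c(1) t_less[OF that] tau_Suc[OF that] q(2)[OF that] by linarith
  then show ?thesis using h by simp
 qed
 have end_le: "\<tau> i + real c * h \<le> (if i < l then \<tau> (Suc i) else T)" using c t t_less by auto
 have e1: "norm (Z (\<tau> i + real c * h) - u (a i + c)) \<le> bd (a i + c) i"
  using i by (intro within_piece at_jump end_le cq) auto
 have at: "real (a i) * h \<le> \<tau> i" "\<tau> i \<le> (real (a i) + real i) * h" using a_tau[of i] i by auto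
 have kt: "real (a i + c) * h \<le> t" using at(1) c(1) by (simp add: algebra_simps)
 have e2: "norm (Z t - u (a i + c)) \<le> bd (a i + c) (Suc i)"
  by (rule short_time_error[OF _ _ _ _ e1]) (use c kt t tau_nonneg[of i] i h in \<open>auto simp: algebra_simps\<close>)
 define k where "k = nat \<lfloor>t / h\<rfloor>"
 have "0 \<le> t / h" using t h by simp
 then have fk: "real k \<le> t / h" "t / h < real k + 1" unfolding k_def by linarith+
 then have k: "real k * h \<le> t" using h by (simp add: field_simps)
 have "real (a i + c) \<le> t / h" using kt h by (simp add: field_simps)
 then have le: "a i + c \<le> k" using fk by linarith
 have "t < (real (a i + c) + real i + 1) * h" using c(2) at(2) by (simp add: algebra_simps)
 then have "t / h < real (a i + c) + real i + 1" using h by (simp add: field_simps)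
 then have m: "k - (a i + c) \<le> Suc i" using fk by linarith
 have "norm (u (a i + c + (k - (a i + c))) - u (a i + c)) \<le> real (k - (a i + c)) * (K * h * R)"
  using k t le by (intro u_lipschitz) simp
 also have "\<dots> \<le> (real l + 1) * (K * h * R)"
  using m i K h R_pos by (intro mult_right_mono) auto
 finally have "norm (u k - u (a i + c)) \<le> (real l + 1) * (K * h * R)" using le by simp
 moreover have "norm (Z t - u k) \<le> norm (Z t - u (a i + c)) + norm (u k - u (a i + c))"
  using norm_triangle_ineq4[of "Z t - u (a i + c)" "u k - u (a i + c)"] by simp
 moreover have "bd (a i + c) (Suc i) \<le> exp (2 * K * (T + (real l + 1) * h)) * (2 * K\<^sup>2 * h * R * T + \<eta> * T / h + (real l + 1) * (2 * K * h * R))"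
  using kt t i by (intro bd_le) auto
 ultimately show ?thesis using e2 unfolding k_def[symmetric] euler_error_bound_def R_def[symmetric] by linarith
qed

end

section \<open>The Euler polygon as a measurable record of the chain\<close>

text \<open>A Caratheodory argument: approximate the second argument by simple functions.\<close>

lemma measurable_continuous_section:
 fixes f :: "'i \<Rightarrow> 'a::{second_countable_topology, real_normed_vector} \<Rightarrow> 'b::{second_countable_topology, real_normed_vector}"
 assumes f: "\<And>y. (\<lambda>j. f j y) \<in> borel_measurable I" and cont: "\<And>j. j \<in> space I \<Longrightarrow> continuous_on UNIV (f j)"
  and j: "j \<in> N \<rightarrow>\<^sub>M I" and u: "u \<in> borel_measurable N"
 shows "(\<lambda>x. f (j x) (u x)) \<in> borel_measurable N"
proof -
 obtain U where U: "\<And>i. simple_function N (U i)" "\<And>x. x \<in> space N \<Longrightarrow> (\<lambda>i. U i x) \<longlonglongrightarrow> u x"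
  using borel_measurable_implies_sequence_metric[OF u, of 0] by auto
 show ?thesis
 proof (rule borel_measurable_LIMSEQ_metric)
  show "(\<lambda>x. f (j x) (U i x)) \<in> borel_measurable N" for i
  proof (rule measurable_compose_countable'[where f="\<lambda>c x. f (j x) c" and I="U i ` space N"])
   show "(\<lambda>x. f (j x) c) \<in> borel_measurable N" for c
    by (rule measurable_compose[OF j f])
   show "U i \<in> N \<rightarrow>\<^sub>M count_space (U i ` space N)"
    using simple_functionD(2)[OF U(1)[of i]] by (intro measurableI) auto
   show "countable (U i ` space N)"
    using U(1)[of i] by (auto simp: simple_function_def intro: countable_finite)
  qed
  show "(\<lambda>i. f (j x) (U i x)) \<longlonglongrightarrow> f (j x) (u x)" if x: "x \<in> space N" for x
  proof (rule isCont_tendsto_compose[OF _ U(2)[OF x]])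
   show "isCont (f (j x)) (u x)"
    using cont[OF measurable_space[OF j x]] by (simp add: continuous_on_eq_continuous_at)
  qed
 qed
qed

text \<open>The polygon is frozen up to index \<open>a\<close> and continued beyond it by the current field as if no further
 jump occurred; the next jump overwrites the tail. Thus a record with \<open>m\<close> jumps is defined for all times.\<close>

definition advance :: "real \<Rightarrow> ('a::real_vector \<Rightarrow> 'a) \<Rightarrow> nat \<Rightarrow> (nat \<Rightarrow> 'a) \<Rightarrow> nat \<Rightarrow> 'a" where
 "advance h v a pth k = (if k \<le> a then pth k else ((\<lambda>y. y + h *\<^sub>R v y) ^^ (k - a)) (pth a))"

lemma advance_Suc: "a \<le> k \<Longrightarrow> advance h v a pth (Suc k) = advance h v a pth k + h *\<^sub>R v (advance h v a pth k)"
 by (auto simp: advance_def Suc_diff_le le_Suc_eq)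

definition pupd :: "real \<Rightarrow> ('i \<Rightarrow> 'a::real_vector \<Rightarrow> 'a) \<Rightarrow> nat \<times> (nat \<Rightarrow> 'a) \<Rightarrow> 'i \<Rightarrow> nat \<Rightarrow> nat \<times> (nat \<Rightarrow> 'a)" where
 "pupd h G p j q = (fst p + q, advance h (G j) (fst p) (snd p))"

definition PPm :: "(nat \<times> (nat \<Rightarrow> 'a::{second_countable_topology, real_normed_vector})) measure" where
 "PPm = count_space UNIV \<Otimes>\<^sub>M (\<Pi>\<^sub>M k\<in>UNIV. borel)"

lemma space_PPm[simp]: "space PPm = UNIV"
 by (simp add: PPm_def space_pair_measure space_PiM)

lemma fst_PPm[measurable]: "fst \<in> PPm \<rightarrow>\<^sub>M count_space UNIV"
 unfolding PPm_def by simp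

lemma snd_PPm[measurable]: "(\<lambda>p. snd p k) \<in> borel_measurable PPm"
 unfolding PPm_def by (rule measurable_compose[OF measurable_snd measurable_component_singleton]) simp

lemma advance_measurable:
 fixes G :: "'i \<Rightarrow> 'a::{second_countable_topology, real_normed_vector} \<Rightarrow> 'a"
 assumes G: "\<And>y. (\<lambda>j. G j y) \<in> borel_measurable I" and cont: "\<And>j. j \<in> space I \<Longrightarrow> continuous_on UNIV (G j)"
  and p: "p \<in> N \<rightarrow>\<^sub>M PPm" and j: "j \<in> N \<rightarrow>\<^sub>M I"
 shows "(\<lambda>x. advance h (G (j x)) (fst (p x)) (snd (p x)) k) \<in> borel_measurable N"
proof (rule measurable_compose_countable[where f="\<lambda>a x. advance h (G (j x)) a (snd (p x)) k"])
 show "(\<lambda>x. fst (p x)) \<in> N \<rightarrow>\<^sub>M count_space UNIV" by (rule measurable_compose[OF p fst_PPm])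
 have s: "(\<lambda>x. snd (p x) k) \<in> borel_measurable N" for k by (rule measurable_compose[OF p snd_PPm])
 have "(\<lambda>x. ((\<lambda>y. y + h *\<^sub>R G (j x) y) ^^ m) (snd (p x) a)) \<in> borel_measurable N" for m a
 proof (induction m)
  case 0 then show ?case using s by simp
 next
  case (Suc m)
  show ?case unfolding funpow.simps comp_def
   by (intro borel_measurable_add borel_measurable_scaleR borel_measurable_const Suc
     measurable_continuous_section[OF G cont j Suc])
 qed
 then show "(\<lambda>x. advance h (G (j x)) a (snd (p x)) k) \<in> borel_measurable N" for a
  unfolding advance_def using s by (cases "k \<le> a") auto
qed

lemma pupd_measurable:
 fixes G :: "'i \<Rightarrow> 'a::{second_countable_topology, real_normed_vector} \<Rightarrow> 'a"
 assumes G: "\<And>y. (\<lambda>j. G j y) \<in> borel_measurable I" and cont: "\<And>j. j \<in> space I \<Longrightarrow> continuous_on UNIV (G j)"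
 shows "(\<lambda>(p, j). pupd h G p j q) \<in> PPm \<Otimes>\<^sub>M I \<rightarrow>\<^sub>M PPm"
proof -
 have 1: "(\<lambda>x. fst (fst x) + q) \<in> PPm \<Otimes>\<^sub>M I \<rightarrow>\<^sub>M count_space UNIV"
  by (rule measurable_compose[OF measurable_compose[OF measurable_fst fst_PPm]]) simp
 have 2: "(\<lambda>x k. advance h (G (snd x)) (fst (fst x)) (snd (fst x)) k) \<in> PPm \<Otimes>\<^sub>M I \<rightarrow>\<^sub>M (\<Pi>\<^sub>M k\<in>UNIV. borel)"
  by (rule measurable_PiM_single') (auto intro!: advance_measurable[OF G cont])
 have "(\<lambda>x. (fst (fst x) + q, advance h (G (snd x)) (fst (fst x)) (snd (fst x)))) \<in> PPm \<Otimes>\<^sub>M I \<rightarrow>\<^sub>M count_space UNIV \<Otimes>\<^sub>M (\<Pi>\<^sub>M k\<in>UNIV. borel)"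
  by (rule measurable_Pair[OF 1 2])
 then show ?thesis by (simp add: pupd_def split_beta' PPm_def[symmetric])
qed

lemma jump_time_mono: "i \<le> k \<Longrightarrow> jump_time S i w \<le> jump_time S k w"
 unfolding jump_time_def by (intro sum_mono2) auto

lemma jump_time_le_lifetime: "jump_time S k w \<le> lifetime S w"
 unfolding lifetime_def by (rule SUP_upper) simp

lemma pieced_eq:
 assumes "jump_time S i w \<le> ennreal t" "ennreal t < jump_time S (Suc i) w"
 shows "pieced S pc t w = Some (pc i (t - enn2real (jump_time S i w)) w)"
proof -
 have "(LEAST k. ennreal t < jump_time S (Suc k) w) = i"
 proof (rule Least_equality)
  fix k assume k: "ennreal t < jump_time S (Suc k) w"
  show "i \<le> k"
  proof (rule ccontr)
   assume "\<not> i \<le> k"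
   then have "jump_time S (Suc k) w \<le> jump_time S i w" by (intro jump_time_mono) simp
   then show False using assms(1) k by (meson leD order_trans)
  qed
 qed (rule assms)
 moreover have "ennreal t < lifetime S w" using assms(2) jump_time_le_lifetime by (rule order.strict_trans2)
 ultimately show ?thesis by (simp add: pieced_def)
qed

lemma AE_lborel_shift:
 assumes "AE s in lborel. P (s :: real)" shows "AE s in lborel. P (s - c)"
proof -
 have "AE s in distr lborel borel ((+) (- c)). P s" using assms by (subst lborel_distr_plus)
 from AE_distrD[OF _ this] show ?thesis by simp
qed

lemma set_lebesgue_integral_shift:
 fixes f :: "real \<Rightarrow> 'a::euclidean_space"
 shows "set_lebesgue_integral lborel {c + \<alpha>..c + \<beta>} (\<lambda>s. f (s - c)) = set_lebesgue_integral lborel {\<alpha>..\<beta>} f"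
proof -
 have "set_lebesgue_integral lborel {c + \<alpha>..c + \<beta>} (\<lambda>s. f (s - c))
   = (\<integral>s. indicator {c + \<alpha>..c + \<beta>} (c + 1 * s) *\<^sub>R f (c + 1 * s - c) \<partial>lborel)"
  unfolding set_lebesgue_integral_def by (subst lborel_integral_real_affine[of 1 _ c]) simp_all
 also have "\<dots> = set_lebesgue_integral lborel {\<alpha>..\<beta>} f"
  unfolding set_lebesgue_integral_def by (intro Bochner_Integration.integral_cong) (auto split: split_indicator)
 finally show ?thesis .
qed

text \<open>The Euler comparison for one sample point of a process glued from pieces: the field on the \<open>i\<close>-th piece is
 \<open>f i\<close> in the time elapsed since the jump, and averaging is assumed for every velocity in the ball that the
 polygon cannot leave.\<close>

lemma piecewise_euler_error:
 fixes Z :: "real \<Rightarrow> 'a::euclidean_space" and V :: "real \<Rightarrow> 'a \<Rightarrow> 'a" and f :: "nat \<Rightarrow> 'a \<Rightarrow> real \<Rightarrow> 'a"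
  and S :: "nat \<Rightarrow> 'w \<Rightarrow> ennreal" and j :: "nat \<Rightarrow> 'w \<Rightarrow> 'i"
 assumes T: "jump_time S l w < ennreal T" "ennreal T < jump_time S (Suc l) w"
  and r: "0 < r" and K: "0 \<le> K" "2 * K * (1 / real r) \<le> 1" and eta: "0 \<le> \<eta>"
  and Z_cont: "continuous_on {0..T} Z"
  and Z_int: "\<And>t. 0 \<le> t \<Longrightarrow> t \<le> T \<Longrightarrow> set_integrable lborel {0..t} (\<lambda>s. V s (Z s))"
  and Z_eq: "\<And>t. 0 \<le> t \<Longrightarrow> t \<le> T \<Longrightarrow> Z t = z + set_lebesgue_integral lborel {0..t} (\<lambda>s. V s (Z s))"
  and V: "\<And>i s v. i \<le> l \<Longrightarrow> 0 \<le> s \<Longrightarrow> jump_time S i w \<le> ennreal s \<Longrightarrow> ennreal s < jump_time S (Suc i) w \<Longrightarrow>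
   V s v = f i v (s - enn2real (jump_time S i w))"
  and f_meas: "\<And>i v. i \<le> l \<Longrightarrow> f i v \<in> borel_measurable borel"
  and f_Lip: "\<And>i. i \<le> l \<Longrightarrow> AE s in lborel. 0 \<le> s \<longrightarrow> (\<forall>v v'. norm (f i v s - f i v' s) \<le> K * norm (v - v')) \<and> norm (f i 0 s) \<le> K"
  and G: "\<And>i v. i \<le> l \<Longrightarrow> norm (G (j i w) v) \<le> K * (1 + norm v)"
  and avg: "\<And>i c v. i \<le> l \<Longrightarrow> (real c + 1) / real r \<le> T \<Longrightarrow> norm v \<le> (1 + norm z) * exp (K * T) \<Longrightarrow>
   norm (set_lebesgue_integral lborel {real c / real r..(real c + 1) / real r} (f i v) - (1 / real r) *\<^sub>R G (j i w) v) \<le> \<eta>"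
  and t: "0 \<le> t" "t \<le> T"
 shows "norm (Z t - snd (prun (pupd (1 / real r) G) (0, \<lambda>_. z) r j S (Suc l) w) (nat \<lfloor>t * real r\<rfloor>))
  \<le> euler_error_bound K (1 / real r) \<eta> T z l"
proof -
 let ?p = "\<lambda>i. prun (pupd (1 / real r) G) (0, \<lambda>_. z) r j S i w"
 define \<tau> where "\<tau> i = enn2real (jump_time S i w)" for i
 define s where "s i = enn2real (S i w)" for i
 define a where "a i = fst (?p i)" for i
 define q where "q i = cell r (S i w)" for i
 define u where "u = snd (?p (Suc l))"
 let ?h = "1 / real r"
 have T0: "0 < T" using T(1) by (metis ennreal_neg not_less_zero linorder_not_less)
 have tau_fin: "jump_time S i w = ennreal (\<tau> i)" if "i \<le> l" for i
 proof -
  have "jump_time S i w < \<top>" using jump_time_mono[OF that, of S w] T(1) by (meson ennreal_less_top order.strict_trans1 order.strict_trans)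
  then show ?thesis by (simp add: \<tau>_def)
 qed
 have tau0: "0 \<le> \<tau> i" for i by (simp add: \<tau>_def)
 have tau_0: "\<tau> 0 = 0" by (simp add: \<tau>_def jump_time_def)
 have S_fin: "S i w = ennreal (s i)" if "i < l" for i
 proof -
  have "S i w \<le> jump_time S l w" unfolding jump_time_def using that by (intro member_le_sum) auto
  then have "S i w < \<top>" using T(1) by (meson ennreal_less_top order.strict_trans1 order.strict_trans)
  then show ?thesis by (simp add: s_def)
 qed
 have s0: "0 \<le> s i" for i by (simp add: s_def)
 have tau_Suc: "\<tau> (Suc i) = \<tau> i + s i" if "i < l" for i
 proof -
  have "jump_time S (Suc i) w = jump_time S i w + S i w" by (simp add: jump_time_def)
  then have "ennreal (\<tau> (Suc i)) = ennreal (\<tau> i + s i)"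
   using that tau_fin[of i] tau_fin[of "Suc i"] S_fin[of i] tau0 s0 by simp
  then show ?thesis using tau0[of "Suc i"] tau0[of i] s0[of i] by (simp del: ennreal_plus)
 qed
 have tau_l: "\<tau> l \<le> T" using T(1) tau_fin[of l] tau0 by (simp add: ennreal_less_iff)
 have q: "real (q i) * ?h \<le> s i" "s i < (real (q i) + 1) * ?h" if "i < l" for i
 proof -
  have "0 \<le> real r * s i" using s0 by simp
  then have "real (q i) \<le> real r * s i" "real r * s i < real (q i) + 1"
   unfolding q_def cell_def s_def by linarith+
  then show "real (q i) * ?h \<le> s i" "s i < (real (q i) + 1) * ?h" using r by (simp_all add: field_simps)
 qed
 have a_Suc: "a (Suc i) = a i + q i" for i by (simp add: a_def q_def pupd_def)
 have a_mono: "i \<le> k \<Longrightarrow> a i \<le> a k" for i k by (rule lift_Suc_mono_le) (auto simp: a_Suc)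
 have path_Suc: "snd (?p (Suc i)) = advance ?h (G (j i w)) (a i) (snd (?p i))" for i
  by (simp add: a_def pupd_def)
 have keep: "snd (?p m) k = snd (?p i) k" if "i \<le> m" "k \<le> a i" for i m k
  using that
 proof (induction m)
  case (Suc m)
  show ?case
  proof (cases "i = Suc m")
   case False
   then have "i \<le> m" using Suc.prems by simp
   then show ?thesis using Suc a_mono[of i m] unfolding path_Suc by (simp add: advance_def)
  qed simp
 qed simp
 have u_Suc: "u (Suc k) = u k + ?h *\<^sub>R G (j i w) (u k)"
  if i: "i \<le> l" and k: "a i \<le> k" "i < l \<Longrightarrow> k < a (Suc i)" for i k
 proof -
  have eq: "u k' = snd (?p (Suc i)) k'" if "k' \<le> Suc k" for k'
  proof (cases "i < l")
   case True
   then show ?thesis unfolding u_def using k(2) that by (intro keep) auto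
  qed (use i in \<open>auto simp: u_def\<close>)
  show ?thesis using advance_Suc[OF k(1)] by (simp only: eq order_refl le_SucI path_Suc)
 qed
 \<comment> \<open>the field is measurable and locally bounded because it is so on each of the finitely many pieces\<close>
 define \<tau>' where "\<tau>' i = (if i < l then \<tau> (Suc i) else T + 1)" for i
 have piece: "V r' v = f i v (r' - \<tau> i)" if "i \<le> l" "\<tau> i \<le> r'" "r' < \<tau>' i" "0 \<le> r'" "r' \<le> T" for i r' v
 proof -
  have "jump_time S i w \<le> ennreal r'" using tau_fin[OF that(1)] that(2) by (simp add: ennreal_leI)
  moreover have "ennreal r' < jump_time S (Suc i) w"
  proof (cases "i < l")
   case True
   then have "jump_time S (Suc i) w = ennreal (\<tau> (Suc i))" by (intro tau_fin) simp
   then show ?thesis using True that by (simp add: \<tau>'_def ennreal_less_iff)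
  next
   case False
   then have "i = l" using that by simp
   have "ennreal r' \<le> ennreal T" using that by (intro ennreal_leI)
   then have "ennreal r' < jump_time S (Suc l) w" using T(2) by (rule order.strict_trans1)
   then show ?thesis by (simp only: \<open>i = l\<close>)
  qed
  ultimately show ?thesis using V[of i r' v] that by (simp add: \<tau>_def)
 qed
 have cover: "\<exists>i\<le>l. \<tau> i \<le> r' \<and> r' < \<tau>' i" if r': "0 \<le> r'" "r' \<le> T" for r'
 proof -
  obtain i where i: "i \<le> l" "\<tau> i \<le> r'" "i < l \<longrightarrow> \<not> \<tau> (Suc i) \<le> r'"
   using last_index_such_that[of "\<lambda>i. \<tau> i \<le> r'" l] tau_0 r'(1) by auto
  have "r' < \<tau>' i" using i(3) r'(2) by (cases "i < l") (simp_all add: \<tau>'_def not_le)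
  then show ?thesis using i by blast
 qed
 have V_Lip: "AE r' in lborel. r' \<in> {0..T} \<longrightarrow> (\<forall>v v'. norm (V r' v - V r' v') \<le> K * norm (v - v')) \<and> norm (V r' 0) \<le> K"
 proof -
  have "AE r' in lborel. \<forall>i\<in>{..l}. 0 \<le> r' - \<tau> i \<longrightarrow>
    (\<forall>v v'. norm (f i v (r' - \<tau> i) - f i v' (r' - \<tau> i)) \<le> K * norm (v - v')) \<and> norm (f i 0 (r' - \<tau> i)) \<le> K"
  proof (rule AE_finite_allI)
   fix i assume "i \<in> {..l}"
   then show "AE r' in lborel. 0 \<le> r' - \<tau> i \<longrightarrow>
    (\<forall>v v'. norm (f i v (r' - \<tau> i) - f i v' (r' - \<tau> i)) \<le> K * norm (v - v')) \<and> norm (f i 0 (r' - \<tau> i)) \<le> K"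
    using AE_lborel_shift[OF f_Lip[of i], of "\<tau> i"] by simp
  qed simp
  then show ?thesis
  proof eventually_elim
   case (elim r')
   show ?case
   proof
    assume r': "r' \<in> {0..T}"
    then obtain i where i: "i \<le> l" "\<tau> i \<le> r'" "r' < \<tau>' i" using cover[of r'] by auto
    have eq: "V r' v = f i v (r' - \<tau> i)" for v by (rule piece[OF i]) (use r' in auto)
    have "0 \<le> r' - \<tau> i" "i \<in> {..l}" using i by auto
    then show "(\<forall>v v'. norm (V r' v - V r' v') \<le> K * norm (v - v')) \<and> norm (V r' 0) \<le> K"
     using elim unfolding eq by blast
   qed
  qed
 qed
 have V_meas: "(\<lambda>r'. indicator {0..T} r' *\<^sub>R V r' v) \<in> borel_measurable lborel" for v
 proof -
  have fs: "(\<lambda>r'. f i v (r' - \<tau> i)) \<in> borel_measurable borel" if "i \<le> l" for i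
   by (rule measurable_compose[OF _ f_meas[OF that]]) simp
  have "(\<lambda>r'. \<Sum>i\<le>l. indicator ({\<tau> i..<\<tau>' i} \<inter> {0..T}) r' *\<^sub>R f i v (r' - \<tau> i)) \<in> borel_measurable borel"
   by (intro borel_measurable_sum borel_measurable_scaleR borel_measurable_indicator fs) auto
  moreover have "(\<Sum>i\<le>l. indicator ({\<tau> i..<\<tau>' i} \<inter> {0..T}) r' *\<^sub>R f i v (r' - \<tau> i)) = indicator {0..T} r' *\<^sub>R V r' v" for r'
  proof (cases "r' \<in> {0..T}")
   case True
   then obtain i where i: "i \<le> l" "\<tau> i \<le> r'" "r' < \<tau>' i" using cover[of r'] by auto
   have uniq: "k = i" if "k \<le> l" "\<tau> k \<le> r'" "r' < \<tau>' k" for k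
   proof (rule ccontr)
    have mono: "\<tau> m \<le> \<tau> m'" if "m \<le> m'" "m' \<le> l" for m m'
     using jump_time_mono[OF that(1), of S w] that tau_fin[of m] tau_fin[of m'] tau0 by simp
    assume "k \<noteq> i"
    then consider "Suc k \<le> i" | "Suc i \<le> k" by linarith
    then show False
    proof cases
     case 1
     then have "\<tau> (Suc k) \<le> \<tau> i" "k < l" using i mono[OF 1] by linarith+
     then show False using that i by (simp add: \<tau>'_def)
    next
     case 2
     then have "\<tau> (Suc i) \<le> \<tau> k" "i < l" using that mono[OF 2] by linarith+
     then show False using that i by (simp add: \<tau>'_def)
    qed
   qed
   have "(\<Sum>k\<le>l. indicator ({\<tau> k..<\<tau>' k} \<inter> {0..T}) r' *\<^sub>R f k v (r' - \<tau> k)) = (\<Sum>k\<le>l. if k = i then f i v (r' - \<tau> i) else 0)"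
   proof (rule sum.cong[OF refl])
    fix k assume k: "k \<in> {..l}"
    show "indicator ({\<tau> k..<\<tau>' k} \<inter> {0..T}) r' *\<^sub>R f k v (r' - \<tau> k) = (if k = i then f i v (r' - \<tau> i) else 0)"
    proof (cases "k = i")
     case False
     have "r' \<notin> {\<tau> k..<\<tau>' k}"
     proof
      assume "r' \<in> {\<tau> k..<\<tau>' k}"
      then have "k = i" using k by (intro uniq) simp_all
      with False show False by contradiction
     qed
     then have "r' \<notin> {\<tau> k..<\<tau>' k} \<inter> {0..T}" by blast
     then have "indicator ({\<tau> k..<\<tau>' k} \<inter> {0..T}) r' = (0 :: real)" by (rule indicator_simps(2))
     then show ?thesis using False by (simp only: scaleR_zero_left if_False)
    qed (use True i in simp)
   qed
   also have "\<dots> = f i v (r' - \<tau> i)" using i by simp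
   finally show ?thesis using piece[OF i] True by simp
  qed simp
  ultimately show ?thesis by simp
 qed
 have growth: "AE r' in lborel. r' \<in> {0..T} \<longrightarrow> norm (V r' v) \<le> K * (1 + norm v)" for v
  using V_Lip
 proof eventually_elim
  case (elim r')
  show ?case
  proof
   assume "r' \<in> {0..T}"
   then have "norm (V r' v - V r' 0) \<le> K * norm (v - 0)" "norm (V r' 0) \<le> K" using elim by blast+
   moreover have "norm (V r' v) \<le> norm (V r' v - V r' 0) + norm (V r' 0)"
    using norm_triangle_ineq[of "V r' v - V r' 0" "V r' 0"] by simp
   ultimately show "norm (V r' v) \<le> K * (1 + norm v)" by (simp add: algebra_simps)
  qed
 qed
 have V_int: "set_integrable lborel {0..T} (\<lambda>r'. V r' v)" for v
  unfolding set_integrable_def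
 proof (rule Bochner_Integration.integrable_bound[OF _ V_meas])
  show "integrable lborel (\<lambda>r'. K * (1 + norm v) * indicator {0..T} r')" using T0 by simp
  show "AE r' in lborel. norm (indicator {0..T} r' *\<^sub>R V r' v) \<le> norm (K * (1 + norm v) * indicator {0..T} r')"
   using growth[of v] by eventually_elim (use K(1) in \<open>auto split: split_indicator\<close>)
 qed
 have Gw: "norm (G (j i w) v) \<le> K * (1 + norm v)" if "i \<le> l" for i v by (rule G[OF that])
 have tmult: "nat \<lfloor>t / ?h\<rfloor> = nat \<lfloor>t * real r\<rfloor>" by simp
 \<comment> \<open>a first instance of the comparison, with a trivial averaging bound, to control the Euler scheme\<close>
 have u_0: "u 0 = z"
  using keep[of 0 "Suc l" 0] by (simp add: u_def a_def)
 have u_inc: "1 + norm (u k) \<le> (1 + norm z) * (1 + K * ?h) ^ k" for k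
 proof (induction k)
  case (Suc k)
  have "\<exists>i\<le>l. a i \<le> k \<and> (i < l \<longrightarrow> \<not> a (Suc i) \<le> k)"
   by (rule last_index_such_that) (simp add: a_def)
  then obtain i where i: "i \<le> l" "u (Suc k) = u k + ?h *\<^sub>R G (j i w) (u k)"
   using u_Suc by (metis not_le)
  have "norm (u (Suc k)) \<le> norm (u k) + ?h * (K * (1 + norm (u k)))"
   unfolding i(2) using i(1) Gw[of i "u k"] r norm_triangle_ineq[of "u k" "?h *\<^sub>R G (j i w) (u k)"]
    mult_left_mono[of "norm (G (j i w) (u k))" "K * (1 + norm (u k))" ?h] by simp
  then have "1 + norm (u (Suc k)) \<le> (1 + K * ?h) * (1 + norm (u k))" by (simp add: algebra_simps)
  also have "\<dots> \<le> (1 + K * ?h) * ((1 + norm z) * (1 + K * ?h) ^ k)" using Suc K by (intro mult_left_mono) auto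
  finally show ?case by (simp add: mult_ac)
 qed (simp add: u_0)
 have u_R: "norm (u k) \<le> (1 + norm z) * exp (K * T)" if k: "real k * ?h \<le> T" for k
 proof -
  have "(1 + K * ?h) ^ k \<le> exp (K * ?h) ^ k" using K exp_ge_add_one_self[of "K * ?h"] by (intro power_mono) auto
  also have "exp (K * ?h) ^ k = exp (K * (real k * ?h))" by (simp add: exp_of_nat_mult[symmetric] mult_ac)
  also have "\<dots> \<le> exp (K * T)" using mult_left_mono[OF k K(1)] by simp
  finally have "(1 + norm z) * (1 + K * ?h) ^ k \<le> (1 + norm z) * exp (K * T)" by (intro mult_left_mono) auto
  then show ?thesis using u_inc[of k] by linarith
 qed
 have a_tau: "real (a i) * ?h \<le> \<tau> i" if "i \<le> l" for i
  using that
 proof (induction i)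
  case (Suc i)
  then show ?case using q(1)[of i] tau_Suc[of i] by (simp add: a_Suc add_divide_distrib)
 qed (simp add: a_def \<tau>_def jump_time_def)
 interpret euler_comparison K ?h \<eta> T z l \<tau> s a q V Z u "\<lambda>i. G (j i w)"
 proof
  show "\<tau> 0 = 0" by (simp add: \<tau>_def jump_time_def)
  show "a 0 = 0" by (simp add: a_def)
  show "u (Suc k) = u k + ?h *\<^sub>R G (j i w) (u k)" if "i \<le> l" "a i \<le> k" "i < l \<Longrightarrow> k < a (Suc i)" for i k
   using that by (rule u_Suc)
  fix i c assume i: "i \<le> l" and le: "\<tau> i + (real c + 1) * ?h \<le> (if i < l then \<tau> (Suc i) else T)"
  have endT: "(if i < l then \<tau> (Suc i) else T) \<le> T"
   using jump_time_mono[of "Suc i" l S w] tau_fin[of "Suc i"] tau_fin[of l] tau_l tau0 by auto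
  have cT: "(real c + 1) / real r \<le> T" using le endT tau0[of i] by simp
  let ?v = "u (a i + c)" and ?A = "{\<tau> i + real c * ?h..\<tau> i + (real c + 1) * ?h}"
  have "real (a i + c) * ?h = real (a i) * ?h + real c * ?h" by (simp add: add_divide_distrib)
  also have "\<dots> \<le> \<tau> i + real c * ?h" using a_tau[OF i] by (rule add_right_mono)
  also have "\<dots> \<le> \<tau> i + (real c + 1) * ?h" by (simp add: divide_right_mono)
  also have "\<dots> \<le> T" using le endT by (rule order_trans)
  finally have "real (a i + c) * ?h \<le> T" .
  then have v: "norm ?v \<le> (1 + norm z) * exp (K * T)" by (rule u_R)
  have "set_lebesgue_integral lborel ?A (\<lambda>s. V s ?v) = set_lebesgue_integral lborel ?A (\<lambda>s. f i ?v (s - \<tau> i))"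
   unfolding set_lebesgue_integral_def
  proof (rule integral_cong_AE)
   show "(\<lambda>r'. indicator ?A r' *\<^sub>R f i ?v (r' - \<tau> i)) \<in> borel_measurable lborel"
    using f_meas[OF i, of ?v] by measurable
   have "set_integrable lborel ?A (\<lambda>s. V s ?v)"
    by (rule set_integrable_subset[OF V_int]) (use le endT tau0[of i] in auto)
   then show "(\<lambda>r'. indicator ?A r' *\<^sub>R V r' ?v) \<in> borel_measurable lborel"
    unfolding set_integrable_def by (rule borel_measurable_integrable)
   show "AE r' in lborel. indicator ?A r' *\<^sub>R V r' ?v = indicator ?A r' *\<^sub>R f i ?v (r' - \<tau> i)"
    using AE_lborel_singleton[of "\<tau> i + (real c + 1) * ?h"]
   proof eventually_elim
    case (elim r')
    show ?case
    proof (cases "r' \<in> ?A")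
     case True
     have "0 \<le> real c * ?h" by simp
     moreover have "\<tau> i + real c * ?h \<le> r'" using True by (simp only: atLeastAtMost_iff)
     ultimately have "\<tau> i \<le> r'" by linarith
     moreover have "r' < \<tau>' i" using True elim le by (auto simp: \<tau>'_def split: if_splits)
     ultimately have "V r' ?v = f i ?v (r' - \<tau> i)"
      using i tau0[of i] True le endT by (intro piece) auto
     then show ?thesis by simp
    qed simp
   qed
  qed
  also have "\<dots> = set_lebesgue_integral lborel {real c * ?h..(real c + 1) * ?h} (f i ?v)"
   by (rule set_lebesgue_integral_shift)
  finally show "norm (set_lebesgue_integral lborel ?A (\<lambda>s. V s ?v) - ?h *\<^sub>R G (j i w) ?v) \<le> \<eta>"
   using avg[OF i cT v] by simp
 qed (use K r eta s0 tau_l tau_Suc a_Suc q u_0 Gw Z_cont Z_int Z_eq V_int V_Lip in auto)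
 show ?thesis using euler_error[OF t] unfolding u_def tmult .
qed

section \<open>Averaging along one piece\<close>

text \<open>Tightness in the form in which convergence results deliver it: if no single \<open>K\<close> worked, indices \<open>n\<close>
 violating the bound for \<open>K = 0, 1, 2, \<dots>\<close> would define a sequence \<open>k\<close> along which the limit fails.\<close>

lemma diagonal_tendsto_0:
 fixes a :: "nat \<Rightarrow> nat \<Rightarrow> ennreal"
 assumes lim: "\<And>k. filterlim k at_top sequentially \<Longrightarrow> (\<lambda>n. a n (k n)) \<longlonglongrightarrow> 0" and e: "0 < \<epsilon>"
 shows "\<exists>K. \<forall>\<^sub>F n in sequentially. a n K < \<epsilon>"
proof (rule ccontr)
 assume "\<not> ?thesis"
 then have ex: "\<exists>n\<ge>m. \<epsilon> \<le> a n K" for K m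
  by (auto simp: eventually_sequentially not_less)
 obtain f where f: "\<And>K. \<epsilon> \<le> a (f K) K" and f_Suc: "\<And>K. f K < f (Suc K)"
 proof -
  have "\<exists>f. \<forall>K. \<epsilon> \<le> a (f K) K \<and> f K < f (Suc K)"
  proof (rule dependent_nat_choice[where P="\<lambda>K n. \<epsilon> \<le> a n K" and Q="\<lambda>K n n'. n < n'"])
   show "\<exists>n. \<epsilon> \<le> a n 0" using ex[of 0 0] by blast
   show "\<exists>n'. \<epsilon> \<le> a n' (Suc K) \<and> n < n'" for n K using ex[of "Suc n" "Suc K"] by (auto simp: Suc_le_eq)
  qed
  then show ?thesis using that by blast
 qed
 have sm: "strict_mono f" using f_Suc by (rule strict_mono_Suc_iff[THEN iffD2, rule_format])
 define k where "k n = (if n \<in> range f then inv f n else n)" for n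
 have kf: "k (f K) = K" for K
  using inv_f_f[OF strict_mono_imp_inj_on[OF sm]] by (simp add: k_def)
 have "filterlim k at_top sequentially"
  unfolding filterlim_at_top
 proof
  fix B
  show "\<forall>\<^sub>F n in sequentially. B \<le> k n"
   using eventually_gt_at_top[of "f B"]
  proof eventually_elim
   case (elim n)
   show ?case
   proof (cases "n \<in> range f")
    case True
    then obtain K where n: "n = f K" by auto
    then have "B < K" using elim sm by (simp add: strict_mono_less)
    then show ?thesis using n kf by simp
   next
    case False
    have "B \<le> f B" using sm by (rule strict_mono_imp_increasing)
    then show ?thesis using elim False by (simp add: k_def)
   qed
  qed
 qed
 from order_tendstoD(2)[OF lim[OF this] e]
 obtain n0 where n0: "\<And>n. n \<ge> n0 \<Longrightarrow> a n (k n) < \<epsilon>" by (auto simp: eventually_sequentially)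
 have "n0 \<le> f n0" using sm by (rule strict_mono_imp_increasing)
 from n0[OF this] f[of n0] show False by (simp add: kf)
qed

locale slow_model = limit_model I Ei E \<phi> Om \<F> X P G b \<pi> \<mu>
 for I :: "'i measure" and Ei :: "'i \<Rightarrow> 'e measure" and E :: "'e measure" and \<phi> :: "'e \<Rightarrow> 'i"
  and Om :: "'o measure" and \<F> :: "real \<Rightarrow> 'o measure"
  and X :: "real \<Rightarrow> 'o \<Rightarrow> 'e" and P :: "'e \<Rightarrow> 'o measure"
  and G :: "real \<Rightarrow> real" and b :: "'e \<Rightarrow> real" and \<pi> :: "'e \<Rightarrow> 'e measure"
  and \<mu> :: "'i \<Rightarrow> 'e measure" +
 fixes F :: "'i \<Rightarrow> real^'d \<Rightarrow> 'e \<Rightarrow> real^'d"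
 assumes F_measurable: "\<And>i. i \<in> space I \<Longrightarrow> (\<lambda>(y, e). F i y e) \<in> borel_measurable (borel \<Otimes>\<^sub>M E)"
  and avg_measurable: "\<And>y. (\<lambda>j. avg_field F \<mu> j y) \<in> borel_measurable I"
  and H3: "\<And>j y xj S. j \<in> space I \<Longrightarrow> xj \<in> space (Ei j) \<Longrightarrow> 0 < S \<Longrightarrow>
   (\<lambda>n. SUP r\<in>{0<..}. \<integral>\<^sup>+\<omega>. ennreal (norm
     ((1 / S) *\<^sub>R set_lebesgue_integral lborel {r..r + S} (\<lambda>s. F j y (X (real n * s) \<omega>))
      - avg_field F \<mu> j y)) \<partial>P xj) \<longlonglongrightarrow> 0"
  and H4: "\<And>j. j \<in> space I \<Longrightarrow> bdd_above ((\<lambda>e. norm (F j 0 e)) ` space (Ei j))"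
  and H5: "\<And>j. j \<in> space I \<Longrightarrow> \<exists>L. \<forall>e\<in>space (Ei j). L-lipschitz_on UNIV (\<lambda>y. F j y e)"
begin

text \<open>a common bound for \<open>M\<^sub>j\<close> and \<open>L\<^sub>j\<close>\<close>

definition cK :: "'i \<Rightarrow> real" where
 "cK j = (SOME C. 0 \<le> C \<and> (\<forall>e\<in>space (Ei j). norm (F j 0 e) \<le> C \<and> C-lipschitz_on UNIV (\<lambda>y. F j y e)))"

lemma
 assumes j: "j \<in> space I"
 shows cK_nonneg: "0 \<le> cK j"
  and F_0: "e \<in> space (Ei j) \<Longrightarrow> norm (F j 0 e) \<le> cK j"
  and F_Lip: "e \<in> space (Ei j) \<Longrightarrow> norm (F j v e - F j v' e) \<le> cK j * norm (v - v')"
proof -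
 obtain B where B: "\<And>e. e \<in> space (Ei j) \<Longrightarrow> norm (F j 0 e) \<le> B" using H4[OF j] by (auto simp: bdd_above_def)
 obtain L where L: "\<And>e. e \<in> space (Ei j) \<Longrightarrow> L-lipschitz_on UNIV (\<lambda>y. F j y e)" using H5[OF j] by blast
 define C where "C = max 0 (max B L)"
 have "0 \<le> C \<and> (\<forall>e\<in>space (Ei j). norm (F j 0 e) \<le> C \<and> C-lipschitz_on UNIV (\<lambda>y. F j y e))"
  using B by (auto simp: C_def le_max_iff_disj intro: lipschitz_on_le[OF L])
 from someI[of "\<lambda>C. 0 \<le> C \<and> (\<forall>e\<in>space (Ei j). norm (F j 0 e) \<le> C \<and> C-lipschitz_on UNIV (\<lambda>y. F j y e))", OF this]
 have *: "0 \<le> cK j" "\<And>e. e \<in> space (Ei j) \<Longrightarrow> norm (F j 0 e) \<le> cK j \<and> (cK j)-lipschitz_on UNIV (\<lambda>y. F j y e)"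
  unfolding cK_def[symmetric] by auto
 show "0 \<le> cK j" by (rule *)
 show "norm (F j 0 e) \<le> cK j" if "e \<in> space (Ei j)" using *(2)[OF that] by simp
 show "norm (F j v e - F j v' e) \<le> cK j * norm (v - v')" if "e \<in> space (Ei j)"
  using lipschitz_onD[of "cK j" UNIV "\<lambda>y. F j y e" v v'] *(2)[OF that] by (simp add: dist_norm)
qed

lemma norm_growth:
 fixes f :: "real^'d \<Rightarrow> real^'d"
 assumes "norm (f v - f 0) \<le> K * norm (v - 0)" "norm (f 0) \<le> K"
 shows "norm (f v) \<le> K * (1 + norm v)"
 using assms norm_triangle_ineq[of "f v - f 0" "f 0"] by (simp add: algebra_simps)

lemma F_growth: "j \<in> space I \<Longrightarrow> e \<in> space (Ei j) \<Longrightarrow> norm (F j v e) \<le> cK j * (1 + norm v)"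
 using norm_growth[of "\<lambda>v. F j v e" v "cK j"] F_0[of j e] F_Lip[of j e v 0] by simp

lemma F_section[measurable]: "j \<in> space I \<Longrightarrow> F j v \<in> borel_measurable E"
 using measurable_compose[OF measurable_Pair1'[of v borel E] F_measurable[of j]] by simp

text \<open>The fields glued along \<open>\<phi>\<close>. Gluing is needed because "the path at time \<open>s\<close> has the same index as at
 time 0" need not be a measurable event: the diagonal of \<open>I\<close> need not be measurable.\<close>

definition Ft :: "real^'d \<Rightarrow> 'e \<Rightarrow> real^'d" where "Ft v e = F (\<phi> e) v e"

definition cF :: "'e \<Rightarrow> real" where "cF e = cK (\<phi> e)"

lemma Ft_measurable[measurable]: "Ft v \<in> borel_measurable E"
 unfolding Ft_def[abs_def] using glue_measurable[of "\<lambda>i. F i v" borel] F_section by simp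

lemma cF_measurable[measurable]: "cF \<in> borel_measurable E"
 unfolding cF_def[abs_def] using glue_measurable[of "\<lambda>i e. cK i" borel] by simp

lemma Ft_Lip: "e \<in> space E \<Longrightarrow> norm (Ft v e - Ft v' e) \<le> cF e * norm (v - v')"
 and Ft_0: "e \<in> space E \<Longrightarrow> norm (Ft 0 e) \<le> cF e"
 unfolding Ft_def cF_def by (auto intro!: F_Lip F_0 phi_space in_Ei)

abbreviation "Gb \<equiv> avg_field F \<mu>"

lemma
 assumes j: "j \<in> space I"
 shows F_integrable: "integrable (\<mu> j) (F j v)"
  and Gb_Lip: "norm (Gb j v - Gb j v') \<le> cK j * norm (v - v')"
  and Gb_0: "norm (Gb j 0) \<le> cK j"
  and Gb_growth: "norm (Gb j v) \<le> cK j * (1 + norm v)"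
  and Gb_continuous: "continuous_on UNIV (Gb j)"
proof -
 interpret m: prob_space "\<mu> j" by (rule mu_prob[OF j])
 show int: "integrable (\<mu> j) (F j v)" for v
  by (intro m.integrable_const_bound[where B="cK j * (1 + norm v)"] AE_I2 mu_measurable[OF j] F_section[OF j])
   (simp add: space_mu[OF j] F_growth[OF j])
 have bound: "norm (\<integral>e. f e \<partial>\<mu> j) \<le> C" if f: "integrable (\<mu> j) f" and C: "\<And>e. e \<in> space (\<mu> j) \<Longrightarrow> norm (f e) \<le> C"
  for f :: "'e \<Rightarrow> real^'d" and C
 proof -
  have "norm (\<integral>e. f e \<partial>\<mu> j) \<le> (\<integral>e. norm (f e) \<partial>\<mu> j)" by (rule integral_norm_bound)
  also have "\<dots> \<le> (\<integral>e. C \<partial>\<mu> j)" using f C by (intro integral_mono) auto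
  finally show ?thesis by (simp add: m.prob_space)
 qed
 show Lip: "norm (Gb j v - Gb j v') \<le> cK j * norm (v - v')" for v v'
  unfolding avg_field_def Bochner_Integration.integral_diff[OF int int, symmetric]
  by (rule bound) (auto intro!: Bochner_Integration.integrable_diff int F_Lip[OF j] simp: space_mu[OF j])
 show G0: "norm (Gb j 0) \<le> cK j"
  unfolding avg_field_def by (rule bound[OF int]) (auto intro!: F_0[OF j] simp: space_mu[OF j])
 show "norm (Gb j v) \<le> cK j * (1 + norm v)"
  using norm_growth[of "Gb j" v "cK j"] Lip[of v 0] G0 by simp
 have "(cK j)-lipschitz_on UNIV (Gb j)"
  using Lip cK_nonneg[OF j] by (intro lipschitz_onI) (auto simp: dist_norm)
 then show "continuous_on UNIV (Gb j)" by (rule lipschitz_on_continuous_on)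
qed

definition piece_error :: "nat \<Rightarrow> real \<Rightarrow> real \<Rightarrow> real^'d \<Rightarrow> 'i \<Rightarrow> 'o \<Rightarrow> real" where
 "piece_error n \<alpha> h v j \<omega> =
  norm (set_lebesgue_integral lborel {\<alpha>..\<alpha> + h} (\<lambda>s. Ft v (XX (real n * s) \<omega>)) - h *\<^sub>R Gb j v)"

lemma set_integral_Ft_measurable[measurable]:
 "(\<lambda>\<omega>. set_lebesgue_integral lborel A (\<lambda>s. Ft v (XX (real n * s) \<omega>))) \<in> borel_measurable Om"
 if [measurable]: "A \<in> sets borel"
 unfolding set_lebesgue_integral_def
 by (rule sigma_finite_measure.borel_measurable_lebesgue_integral[OF sigma_finite_lborel]) measurable

lemma piece_error_measurable[measurable]: "piece_error n \<alpha> h v j \<in> borel_measurable Om"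
 unfolding piece_error_def[abs_def] by measurable

lemma Ft_path:
 assumes j: "j \<in> space I" and y: "y \<in> space (Ei j)"
 shows "AE \<omega> in P y. \<omega> \<in> space Om \<and> (\<forall>s v. Ft v (XX s \<omega>) = F j v (XX s \<omega>) \<and> norm (Ft v (XX s \<omega>)) \<le> cK j * (1 + norm v) \<and> cF (XX s \<omega>) = cK j)"
proof -
 have yE: "y \<in> space E" using y Ei_subset[OF j] by auto
 from AE_XX_in_Ei[OF j y] AE_space show ?thesis
 proof eventually_elim
  case (elim \<omega>)
  then have "XX s \<omega> \<in> space (Ei j)" for s by blast
  then show ?case using elim(2) F_growth[OF j] by (auto simp: Ft_def cF_def phi_eq[OF j] space_P[OF yE])
 qed
qed

text \<open>The averaging hypothesis holds uniformly over positive starting times; the starting time 0 follows by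
 dominated convergence and Fatou's lemma.\<close>

lemma piece_error_L1:
 assumes j: "j \<in> space I" and y: "y \<in> space (Ei j)" and h: "0 < h" and \<alpha>: "0 \<le> \<alpha>"
 shows "(\<lambda>n. \<integral>\<^sup>+\<omega>. ennreal (piece_error n \<alpha> h v j \<omega>) \<partial>P y) \<longlonglongrightarrow> 0"
proof -
 have yE: "y \<in> space E" using y Ei_subset[OF j] by auto
 have [measurable_cong]: "sets (P y) = sets Om" by (rule sets_P[OF yE])
 define A where "A n = (SUP r\<in>{0<..}. \<integral>\<^sup>+\<omega>. ennreal (norm
     ((1 / h) *\<^sub>R set_lebesgue_integral lborel {r..r + h} (\<lambda>s. F j v (X (real n * s) \<omega>))
      - Gb j v)) \<partial>P y)" for n
 have A0: "A \<longlonglongrightarrow> 0" unfolding A_def[abs_def] by (rule H3[OF j y h])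
 have pos: "(\<integral>\<^sup>+\<omega>. ennreal (piece_error n r h v j \<omega>) \<partial>P y) \<le> ennreal h * A n" if r: "0 < r" for n r
 proof -
  let ?N = "\<lambda>\<omega>. norm ((1 / h) *\<^sub>R set_lebesgue_integral lborel {r..r + h} (\<lambda>s. Ft v (XX (real n * s) \<omega>)) - Gb j v)"
  have "piece_error n r h v j \<omega> = h * ?N \<omega>" for \<omega>
  proof -
   have "h *\<^sub>R ((1 / h) *\<^sub>R set_lebesgue_integral lborel {r..r + h} (\<lambda>s. Ft v (XX (real n * s) \<omega>)) - Gb j v)
    = set_lebesgue_integral lborel {r..r + h} (\<lambda>s. Ft v (XX (real n * s) \<omega>)) - h *\<^sub>R Gb j v"
    using h by (simp add: scaleR_diff_right)
   then have "piece_error n r h v j \<omega> = norm (h *\<^sub>R ((1 / h) *\<^sub>R set_lebesgue_integral lborel {r..r + h} (\<lambda>s. Ft v (XX (real n * s) \<omega>)) - Gb j v))"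
    by (simp add: piece_error_def)
   also have "\<dots> = h * ?N \<omega>" using h by (simp only: norm_scaleR abs_of_pos)
   finally show ?thesis .
  qed
  then have "(\<integral>\<^sup>+\<omega>. ennreal (piece_error n r h v j \<omega>) \<partial>P y) = (\<integral>\<^sup>+\<omega>. ennreal h * ennreal (?N \<omega>) \<partial>P y)"
   using h by (simp add: ennreal_mult)
  also have "\<dots> = ennreal h * (\<integral>\<^sup>+\<omega>. ennreal (?N \<omega>) \<partial>P y)" by (rule nn_integral_cmult) measurable
  also have "(\<integral>\<^sup>+\<omega>. ennreal (?N \<omega>) \<partial>P y) = (\<integral>\<^sup>+\<omega>. ennreal (norm
     ((1 / h) *\<^sub>R set_lebesgue_integral lborel {r..r + h} (\<lambda>s. F j v (X (real n * s) \<omega>)) - Gb j v)) \<partial>P y)"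
  proof (rule nn_integral_cong_AE)
   show "AE \<omega> in P y. ennreal (?N \<omega>) = ennreal (norm ((1 / h) *\<^sub>R set_lebesgue_integral lborel {r..r + h} (\<lambda>s. F j v (X (real n * s) \<omega>)) - Gb j v))"
    using Ft_path[OF j y]
   proof eventually_elim
    case (elim \<omega>)
    have "set_lebesgue_integral lborel {r..r + h} (\<lambda>s. Ft v (XX (real n * s) \<omega>)) = set_lebesgue_integral lborel {r..r + h} (\<lambda>s. F j v (X (real n * s) \<omega>))"
     unfolding set_lebesgue_integral_def
    proof (rule Bochner_Integration.integral_cong[OF refl])
     fix s
     show "indicat_real {r..r + h} s *\<^sub>R Ft v (XX (real n * s) \<omega>) = indicat_real {r..r + h} s *\<^sub>R F j v (X (real n * s) \<omega>)"
     proof (cases "s \<in> {r..r + h}")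
      case True
      then have "XX (real n * s) \<omega> = X (real n * s) \<omega>" using r by (intro XX_eq) auto
      moreover have "Ft v (XX (real n * s) \<omega>) = F j v (XX (real n * s) \<omega>)" using elim by blast
      ultimately show ?thesis by simp
     qed simp
    qed
    then show ?case by simp
   qed
  qed
  also have "\<dots> \<le> A n" unfolding A_def using r by (intro SUP_upper) auto
  finally show ?thesis by (simp add: mult_left_mono)
 qed
 \<comment> \<open>the supremum in the averaging hypothesis leaves out the starting time 0, which is reached by a limit\<close>
 have all: "(\<integral>\<^sup>+\<omega>. ennreal (piece_error n \<alpha> h v j \<omega>) \<partial>P y) \<le> ennreal h * A n" for n
 proof -
  define \<rho> where "\<rho> m = \<alpha> + 1 / real (Suc m)" for m
  have \<rho>: "\<rho> \<longlonglongrightarrow> \<alpha>"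
   unfolding \<rho>_def using tendsto_add[OF tendsto_const[of \<alpha>] LIMSEQ_Suc[OF lim_1_over_n]] by simp
  have \<rho>_pos: "0 < \<rho> m" "\<alpha> < \<rho> m" "\<rho> m \<le> \<alpha> + 1" for m using \<alpha> by (auto simp: \<rho>_def add_nonneg_pos)
  have "(\<integral>\<^sup>+\<omega>. ennreal (piece_error n \<alpha> h v j \<omega>) \<partial>P y) \<le> (\<integral>\<^sup>+\<omega>. liminf (\<lambda>m. ennreal (piece_error n (\<rho> m) h v j \<omega>)) \<partial>P y)"
  proof (rule nn_integral_mono_AE)
   show "AE \<omega> in P y. ennreal (piece_error n \<alpha> h v j \<omega>) \<le> liminf (\<lambda>m. ennreal (piece_error n (\<rho> m) h v j \<omega>))"
    using Ft_path[OF j y]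
   proof eventually_elim
    case (elim \<omega>)
    then have \<omega>: "\<omega> \<in> space Om" by blast
    let ?f = "\<lambda>s. Ft v (XX (real n * s) \<omega>)"
    have fm[measurable]: "?f \<in> borel_measurable borel"
     by (rule measurable_compose[OF _ Ft_measurable]) (use \<omega> in measurable)
    have "(\<lambda>m. set_lebesgue_integral lborel {\<rho> m..\<rho> m + h} ?f) \<longlonglongrightarrow> set_lebesgue_integral lborel {\<alpha>..\<alpha> + h} ?f"
     unfolding set_lebesgue_integral_def
    proof (rule integral_dominated_convergence[where w="\<lambda>s. cK j * (1 + norm v) * indicator {\<alpha>..\<alpha> + 1 + h} s"])
     show "integrable lborel (\<lambda>s. cK j * (1 + norm v) * indicator {\<alpha>..\<alpha> + 1 + h} s)"
      using h by simp
     show "AE s in lborel. (\<lambda>m. indicat_real {\<rho> m..\<rho> m + h} s *\<^sub>R ?f s) \<longlonglongrightarrow> indicat_real {\<alpha>..\<alpha> + h} s *\<^sub>R ?f s"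
      using AE_lborel_singleton[of \<alpha>]
     proof eventually_elim
      case (elim s)
      have "\<forall>\<^sub>F m in sequentially. indicat_real {\<rho> m..\<rho> m + h} s = indicat_real {\<alpha>..\<alpha> + h} s"
      proof -
       consider "s < \<alpha>" | "\<alpha> < s" "s \<le> \<alpha> + h" | "\<alpha> + h < s" using elim by linarith
       then show ?thesis
       proof cases
        case 1
        have "indicat_real {\<rho> m..\<rho> m + h} s = indicat_real {\<alpha>..\<alpha> + h} s" for m
         using 1 \<rho>_pos(2)[of m] by (simp add: indicator_def)
        then show ?thesis by simp
       next
        case 2
        have "\<forall>\<^sub>F m in sequentially. \<rho> m < s" using \<rho> 2(1) by (rule order_tendstoD)
        then show ?thesis
        proof eventually_elim
         case (elim m)
         have "s \<in> {\<rho> m..\<rho> m + h}" using elim 2 \<rho>_pos(2)[of m] by simp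
         then show ?case using 2 by simp
        qed
       next
        case 3
        then have "\<alpha> < s - h" by simp
        then have "\<forall>\<^sub>F m in sequentially. \<rho> m < s - h" using \<rho> by (intro order_tendstoD(2))
        then show ?thesis
        proof eventually_elim
         case (elim m)
         then show ?case using 3 by (simp add: indicator_def)
        qed
       qed
      qed
      then have "\<forall>\<^sub>F m in sequentially. indicat_real {\<alpha>..\<alpha> + h} s *\<^sub>R ?f s = indicat_real {\<rho> m..\<rho> m + h} s *\<^sub>R ?f s"
       by eventually_elim simp
      then show ?case by (rule Lim_transform_eventually[OF tendsto_const])
     qed
     show "AE s in lborel. norm (indicat_real {\<rho> m..\<rho> m + h} s *\<^sub>R ?f s) \<le> cK j * (1 + norm v) * indicator {\<alpha>..\<alpha> + 1 + h} s" for m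
     proof (rule AE_I2)
      fix s
      have "norm (?f s) \<le> cK j * (1 + norm v)" using elim by blast
      then show "norm (indicat_real {\<rho> m..\<rho> m + h} s *\<^sub>R ?f s) \<le> cK j * (1 + norm v) * indicator {\<alpha>..\<alpha> + 1 + h} s"
       using \<rho>_pos(2,3)[of m] cK_nonneg[OF j] by (auto simp: indicator_def)
     qed
    qed measurable
    then have "(\<lambda>m. piece_error n (\<rho> m) h v j \<omega>) \<longlonglongrightarrow> piece_error n \<alpha> h v j \<omega>"
     unfolding piece_error_def by (intro tendsto_intros)
    then have "(\<lambda>m. ennreal (piece_error n (\<rho> m) h v j \<omega>)) \<longlonglongrightarrow> ennreal (piece_error n \<alpha> h v j \<omega>)"
     by (rule tendsto_ennrealI)
    from lim_imp_Liminf[OF sequentially_bot this] show ?case by simp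
   qed
  qed
  also have "\<dots> \<le> liminf (\<lambda>m. \<integral>\<^sup>+\<omega>. ennreal (piece_error n (\<rho> m) h v j \<omega>) \<partial>P y)"
   by (rule nn_integral_liminf) measurable
  also have "\<dots> \<le> liminf (\<lambda>m. ennreal h * A n)"
   using pos \<rho>_pos by (intro Liminf_mono always_eventually) auto
  also have "\<dots> = ennreal h * A n" by (simp add: Liminf_const)
  finally show ?thesis .
 qed
 have "(\<lambda>n. ennreal h * A n) \<longlonglongrightarrow> ennreal h * 0" by (rule ennreal_tendsto_cmult[OF _ A0]) simp
 then have lim: "(\<lambda>n. ennreal h * A n) \<longlonglongrightarrow> 0" by simp
 show ?thesis by (rule tendsto_sandwich[OF _ _ tendsto_const lim]) (use all in auto)
qed

text \<open>The piece driven by \<open>\<omega>\<close> is bad for the index \<open>j\<close> if it leaves the components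
 with constant at most \<open>K\<close>, or if an average over a grid cell deviates for some velocity in \<open>A\<close>.\<close>

definition bad :: "nat \<Rightarrow> real \<Rightarrow> nat \<Rightarrow> nat \<Rightarrow> real \<Rightarrow> (real^'d) set \<Rightarrow> 'i \<Rightarrow> 'o \<Rightarrow> bool" where
 "bad n K r Q \<eta> A j \<omega> \<longleftrightarrow>
  (\<integral>\<^sup>+s. indicator {0..} s * indicator {K<..} (cF (XX (real n * s) \<omega>)) \<partial>lborel) \<noteq> 0 \<or>
  (\<exists>c\<in>{..<Q}. \<exists>v\<in>A. \<eta> < piece_error n (real c / real r) (1 / real r) v j \<omega>)"

definition badE :: "nat \<Rightarrow> real \<Rightarrow> nat \<Rightarrow> nat \<Rightarrow> real \<Rightarrow> (real^'d) set \<Rightarrow> ('e \<times> 'o) set" where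
 "badE n K r Q \<eta> A = {p\<in>space (E \<Otimes>\<^sub>M Om). cF (fst p) \<le> K \<and> bad n K r Q \<eta> A (\<phi> (fst p)) (snd p)}"

lemma piece_error_measurable2:
 "(\<lambda>p. piece_error n \<alpha> h v (\<phi> (fst p)) (snd p)) \<in> borel_measurable (E \<Otimes>\<^sub>M Om)"
proof -
 have 1: "(\<lambda>p. Gb (\<phi> (fst p)) v) \<in> borel_measurable (E \<Otimes>\<^sub>M Om)"
  by (rule measurable_compose[OF measurable_compose[OF measurable_fst phi_measurable] avg_measurable])
 have 2: "(\<lambda>p. set_lebesgue_integral lborel {\<alpha>..\<alpha> + h} (\<lambda>s. Ft v (XX (real n * s) (snd p)))) \<in> borel_measurable (E \<Otimes>\<^sub>M Om)"
  by (rule measurable_compose[OF measurable_snd set_integral_Ft_measurable]) simp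
 have "(\<lambda>p. set_lebesgue_integral lborel {\<alpha>..\<alpha> + h} (\<lambda>s. Ft v (XX (real n * s) (snd p))) - h *\<^sub>R Gb (\<phi> (fst p)) v) \<in> borel_measurable (E \<Otimes>\<^sub>M Om)"
  by (intro borel_measurable_diff borel_measurable_scaleR borel_measurable_const 1 2)
 from measurable_compose[OF this borel_measurable_norm] show ?thesis by (simp add: piece_error_def)
qed

lemma badE_sets: "finite A \<Longrightarrow> badE n K r Q \<eta> A \<in> sets (E \<Otimes>\<^sub>M Om)"
proof -
 assume A: "finite A"
 have 1: "{p\<in>space (E \<Otimes>\<^sub>M Om). cF (fst p) \<le> K} \<in> sets (E \<Otimes>\<^sub>M Om)" by measurable
 have "(\<lambda>p. \<integral>\<^sup>+s. indicator {0..} s * indicator {K<..} (cF (XX (real n * s) (snd p))) \<partial>lborel) \<in> borel_measurable (E \<Otimes>\<^sub>M Om)"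
  by measurable
 then have 2: "{p\<in>space (E \<Otimes>\<^sub>M Om). (\<integral>\<^sup>+s. indicator {0..} s * indicator {K<..} (cF (XX (real n * s) (snd p))) \<partial>lborel) \<noteq> 0} \<in> sets (E \<Otimes>\<^sub>M Om)"
  by measurable
 have "{p\<in>space (E \<Otimes>\<^sub>M Om). \<eta> < piece_error n \<alpha> h v (\<phi> (fst p)) (snd p)} \<in> sets (E \<Otimes>\<^sub>M Om)" for \<alpha> h v
  by (rule borel_measurable_less[OF _ piece_error_measurable2]) simp
 then have 3: "{p\<in>space (E \<Otimes>\<^sub>M Om). \<exists>c\<in>{..<Q}. \<exists>v\<in>A. \<eta> < piece_error n (real c / real r) (1 / real r) v (\<phi> (fst p)) (snd p)} \<in> sets (E \<Otimes>\<^sub>M Om)"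
  using A by (intro sets.sets_Collect_finite_Ex) auto
 have "badE n K r Q \<eta> A = {p\<in>space (E \<Otimes>\<^sub>M Om). cF (fst p) \<le> K} \<inter>
  ({p\<in>space (E \<Otimes>\<^sub>M Om). (\<integral>\<^sup>+s. indicator {0..} s * indicator {K<..} (cF (XX (real n * s) (snd p))) \<partial>lborel) \<noteq> 0} \<union>
   {p\<in>space (E \<Otimes>\<^sub>M Om). \<exists>c\<in>{..<Q}. \<exists>v\<in>A. \<eta> < piece_error n (real c / real r) (1 / real r) v (\<phi> (fst p)) (snd p)})"
  unfolding badE_def bad_def by blast
 then show ?thesis using 1 2 3 by auto
qed

lemma nn_integral_law_fst:
 assumes y: "y \<in> space E" and f: "f \<in> borel_measurable Om"
 shows "(\<integral>\<^sup>+q. f (fst q) \<partial>law y) = (\<integral>\<^sup>+\<omega>. f \<omega> \<partial>P y)"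
proof -
 interpret U: prob_space unif01 by (rule prob_space_unif01)
 have "f \<in> borel_measurable (P y)" using f sets_P[OF y] by (simp cong: measurable_cong_sets)
 then have "(\<lambda>q. f (fst q)) \<in> borel_measurable (P y \<Otimes>\<^sub>M unif01)" by (rule measurable_compose[OF measurable_fst])
 from U.nn_integral_fst[OF this, symmetric]
 have "(\<integral>\<^sup>+q. f (fst q) \<partial>law y) = (\<integral>\<^sup>+\<omega>. (\<integral>\<^sup>+u. f \<omega> \<partial>unif01) \<partial>P y)" by (simp add: law_def)
 also have "(\<lambda>\<omega>. \<integral>\<^sup>+u. f \<omega> \<partial>unif01) = f"
  by (rule ext) (simp only: nn_integral_const U.emeasure_space_1 mult_1_right)
 finally show ?thesis .
qed

text \<open>Markov's inequality for each of the finitely many cells and velocities.\<close>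

lemma bad_tendsto_0:
 assumes y: "y \<in> space E" and r: "0 < r" and eta: "0 < \<eta>" and A: "finite A"
 shows "(\<lambda>n. \<integral>\<^sup>+q. indicator (badE n K r Q \<eta> A) (y, fst q) \<partial>law y) \<longlonglongrightarrow> 0"
proof -
 let ?j = "\<phi> y"
 have j: "?j \<in> space I" and yj: "y \<in> space (Ei ?j)" using y by (auto intro: phi_space in_Ei)
 have [measurable_cong]: "sets (P y) = sets Om" by (rule sets_P[OF y])
 have m: "(\<lambda>\<omega>. indicator (badE n K r Q \<eta> A) (y, \<omega>) :: ennreal) \<in> borel_measurable Om" for n
  by (rule measurable_compose[OF measurable_Pair1'[OF y] borel_measurable_indicator[OF badE_sets[OF A]]])
 let ?S = "\<lambda>n. \<Sum>c<Q. \<Sum>v\<in>A. (\<integral>\<^sup>+\<omega>. ennreal (1 / \<eta>) * ennreal (piece_error n (real c / real r) (1 / real r) v ?j \<omega>) \<partial>P y)"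
 have up: "(\<integral>\<^sup>+q. indicator (badE n K r Q \<eta> A) (y, fst q) \<partial>law y) \<le> ?S n" for n
 proof -
  have "(\<integral>\<^sup>+q. indicator (badE n K r Q \<eta> A) (y, fst q) \<partial>law y) = (\<integral>\<^sup>+\<omega>. indicator (badE n K r Q \<eta> A) (y, \<omega>) \<partial>P y)"
   by (rule nn_integral_law_fst[OF y m])
  also have "\<dots> \<le> (\<integral>\<^sup>+\<omega>. (\<Sum>c<Q. \<Sum>v\<in>A. ennreal (1 / \<eta>) * ennreal (piece_error n (real c / real r) (1 / real r) v ?j \<omega>)) \<partial>P y)"
  proof (rule nn_integral_mono_AE)
   show "AE \<omega> in P y. indicator (badE n K r Q \<eta> A) (y, \<omega>) \<le> (\<Sum>c<Q. \<Sum>v\<in>A. ennreal (1 / \<eta>) * ennreal (piece_error n (real c / real r) (1 / real r) v ?j \<omega>))"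
    using Ft_path[OF j yj]
   proof eventually_elim
    case (elim \<omega>)
    show ?case
    proof (cases "(y, \<omega>) \<in> badE n K r Q \<eta> A")
     case True
     then have K: "cK ?j \<le> K" and bd: "bad n K r Q \<eta> A ?j \<omega>" by (auto simp: badE_def cF_def)
     have "cF (XX (real n * s) \<omega>) = cK ?j" for s using elim by blast
     then have "indicator {K<..} (cF (XX (real n * s) \<omega>)) = (0 :: ennreal)" for s
      using K by simp
     then obtain c v where cv: "c < Q" "v \<in> A" "\<eta> < piece_error n (real c / real r) (1 / real r) v ?j \<omega>"
      using bd by (auto simp: bad_def)
     have "1 \<le> (1 / \<eta>) * piece_error n (real c / real r) (1 / real r) v ?j \<omega>" using cv(3) eta by simp
     then have "1 \<le> ennreal ((1 / \<eta>) * piece_error n (real c / real r) (1 / real r) v ?j \<omega>)" by simp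
     also have "\<dots> = ennreal (1 / \<eta>) * ennreal (piece_error n (real c / real r) (1 / real r) v ?j \<omega>)"
      using eta by (intro ennreal_mult) (auto simp: piece_error_def)
     also have "\<dots> \<le> (\<Sum>v\<in>A. ennreal (1 / \<eta>) * ennreal (piece_error n (real c / real r) (1 / real r) v ?j \<omega>))"
      using cv A by (intro member_le_sum[of v A "\<lambda>v. ennreal (1 / \<eta>) * ennreal (piece_error n (real c / real r) (1 / real r) v ?j \<omega>)"]) auto
     also have "\<dots> \<le> (\<Sum>c<Q. \<Sum>v\<in>A. ennreal (1 / \<eta>) * ennreal (piece_error n (real c / real r) (1 / real r) v ?j \<omega>))"
      using cv by (intro member_le_sum[of c "{..<Q}" "\<lambda>c. \<Sum>v\<in>A. ennreal (1 / \<eta>) * ennreal (piece_error n (real c / real r) (1 / real r) v ?j \<omega>)"]) auto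
     finally show ?thesis using True by simp
    qed simp
   qed
  qed
  also have "\<dots> = ?S n"
   by (subst nn_integral_sum, measurable, intro sum.cong refl nn_integral_sum) measurable
  finally show ?thesis .
 qed
 have "?S \<longlonglongrightarrow> (\<Sum>c<Q. \<Sum>v\<in>A. ennreal (1 / \<eta>) * 0)"
 proof (intro tendsto_sum)
  fix c v
  have "(\<lambda>n. ennreal (1 / \<eta>) * (\<integral>\<^sup>+\<omega>. ennreal (piece_error n (real c / real r) (1 / real r) v ?j \<omega>) \<partial>P y)) \<longlonglongrightarrow> ennreal (1 / \<eta>) * 0"
   using r by (intro ennreal_tendsto_cmult piece_error_L1[OF j yj]) auto
  also have "(\<lambda>n. ennreal (1 / \<eta>) * (\<integral>\<^sup>+\<omega>. ennreal (piece_error n (real c / real r) (1 / real r) v ?j \<omega>) \<partial>P y))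
   = (\<lambda>n. \<integral>\<^sup>+\<omega>. ennreal (1 / \<eta>) * ennreal (piece_error n (real c / real r) (1 / real r) v ?j \<omega>) \<partial>P y)"
   by (rule ext, rule nn_integral_cmult[symmetric]) measurable
  finally show "(\<lambda>n. \<integral>\<^sup>+\<omega>. ennreal (1 / \<eta>) * ennreal (piece_error n (real c / real r) (1 / real r) v ?j \<omega>) \<partial>P y) \<longlonglongrightarrow> ennreal (1 / \<eta>) * 0" .
 qed
 then have lim: "?S \<longlonglongrightarrow> 0" by simp
 show ?thesis by (rule tendsto_sandwich[OF _ _ tendsto_const lim]) (use up in auto)
qed

end

section \<open>Bad pieces and large constants are rare\<close>

lemma jump_time_measurable:
 assumes "\<And>i. i < m \<Longrightarrow> S i \<in> borel_measurable H"
 shows "jump_time S m \<in> borel_measurable H"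
 unfolding jump_time_def[abs_def] by (intro borel_measurable_sum assms) simp

context slow_model begin

lemma piece_len_measurable:
 assumes acc: "accelerated E Om X P G b \<pi> n x M Y W U"
 shows "piece_len G b X n W U k \<in> borel_measurable M"
proof -
 note a = accelerated_facts[OF acc]
 have "(\<lambda>w. \<sigma> n (W k w) (U k w)) \<in> borel_measurable M" by (rule sigma_compose[OF a(4,5)])
 then show ?thesis by (simp add: piece_len_def[abs_def] \<sigma>_def)
qed

lemma accelerated_piece:
 assumes acc: "accelerated E Om X P G b \<pi> n x M Y W U"
  and B: "B \<in> borel_measurable (E \<Otimes>\<^sub>M Om)"
 defines "S \<equiv> piece_len G b X n W U"
 shows "(\<integral>\<^sup>+w. indicator {w\<in>space M. jump_time S i w < ennreal T} w * B (Y i w, W i w) \<partial>M) =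
  (\<integral>\<^sup>+w. indicator {w\<in>space M. jump_time S i w < ennreal T} w * (\<integral>\<^sup>+q. B (Y i w, fst q) \<partial>law (Y i w)) \<partial>M)"
proof -
 note a = accelerated_facts[OF acc]
 let ?R = "\<lambda>k w. (W k w, U k w)"
 let ?H = "history M E Y (Suc i) (Om \<Otimes>\<^sub>M borel) ?R i"
 have Rm: "?R k \<in> M \<rightarrow>\<^sub>M Om \<Otimes>\<^sub>M borel" for k by (intro measurable_Pair a)
 have sub: "subalgebra M ?H" by (rule subalgebra_history; rule a Rm)
 have Y: "Y i \<in> ?H \<rightarrow>\<^sub>M E" by (rule measurable_history_state; (rule a Rm | simp))
 have R: "?R k \<in> ?H \<rightarrow>\<^sub>M Om \<Otimes>\<^sub>M borel" if "k < i" for k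
  by (rule measurable_history_mark; (rule a Rm that))
 have S_eq: "S k w = \<sigma> n (W k w) (U k w)" for k w by (simp add: S_def piece_len_def \<sigma>_def)
 have "S k \<in> borel_measurable ?H" if "k < i" for k
  using measurable_compose[OF R[OF that] sigma_measurable[of n]] by (simp add: S_eq[abs_def])
 then have jm: "jump_time S i \<in> borel_measurable ?H" by (rule jump_time_measurable)
 have sp: "space ?H = space M" using sub by (auto simp: subalgebra_def)
 have Q: "{w\<in>space M. jump_time S i w < ennreal T} \<in> sets ?H"
  using borel_measurable_less[OF jm, of "\<lambda>_. ennreal T"] by (simp add: sp)
 have Bm: "(\<lambda>(y, q). B (y, fst q)) \<in> borel_measurable (E \<Otimes>\<^sub>M (Om \<Otimes>\<^sub>M borel))"
  unfolding split_beta' by (rule measurable_compose[OF _ B]) measurable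
 have "(\<integral>\<^sup>+w. indicator {w\<in>space M. jump_time S i w < ennreal T} w * B (Y i w, fst (?R i w)) \<partial>M) =
  (\<integral>\<^sup>+w. indicator {w\<in>space M. jump_time S i w < ennreal T} w * (\<integral>\<^sup>+q. B (Y i w, fst q) \<partial>law (Y i w)) \<partial>M)"
 proof (rule cond_law_on_nn_integral[OF a(1) sub Q Y measurable_prob_algebraD[OF law_measurable] cond_law_on_subset[OF a(6)] _ Bm])
  show "jump_time S i w < ennreal T \<Longrightarrow> jump_time (piece_len G b X n W U) i w < \<infinity>" for w
   unfolding S_def infinity_ennreal_def by (rule less_trans[OF _ ennreal_less_top])
 qed (simp add: law_def)
 then show ?thesis by simp
qed

text \<open>\<open>chain_limit\<close> with a trivial record and unit mesh.\<close>

lemma chain_vanish: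
 assumes acc: "\<And>n. 1 \<le> n \<Longrightarrow> accelerated E Om X P G b \<pi> n x (M n) (Y n) (W n) (U n)"
  and x: "x \<in> space E" and sm: "semi_markov I E \<phi> G b \<pi> \<mu> x Mb J T"
  and gn: "\<And>n. gn n \<in> borel_measurable E" and gn1: "\<And>n y. y \<in> space E \<Longrightarrow> gn n y \<le> 1"
  and lim: "\<And>y. y \<in> space E \<Longrightarrow> (\<lambda>n. gn n y) \<longlonglongrightarrow> 0"
 shows "(\<lambda>n. \<integral>\<^sup>+w. indicator {w\<in>space (M n). jump_time (piece_len G b X n (W n) (U n)) i w < ennreal c} w * gn n (Y n i w) \<partial>M n) \<longlonglongrightarrow> 0"
proof -
 let ?PP = "count_space UNIV :: unit measure" and ?Q = "nat \<lceil>c\<rceil>"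
 have "(\<lambda>n. \<integral>\<^sup>+w. indicator {w\<in>space (M n). adm ?Q 1 (piece_len G b X n (W n) (U n)) i w} w *
   (\<lambda>(y, p). gn n y) (Y n i w, prun (\<lambda>_ _ _. ()) () 1 (\<lambda>l w. \<phi> (Y n l w)) (piece_len G b X n (W n) (U n)) i w) \<partial>M n)
  \<longlonglongrightarrow> (\<integral>\<^sup>+v. indicator {v\<in>space Mb. adm ?Q 1 T i v} v * (\<lambda>_. 0) (J i v, prun (\<lambda>_ _ _. ()) () 1 J T i v) \<partial>Mb)"
 proof (rule chain_limit[OF acc x sm, where PP="?PP" and gn="\<lambda>n (y, p). gn n y"])
  show "(\<lambda>(y, p). gn n y) \<in> borel_measurable (E \<Otimes>\<^sub>M ?PP)" for n
   unfolding split_beta' by (rule measurable_compose[OF measurable_fst gn])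
 qed (use gn1 lim in auto)
 then have lim': "(\<lambda>n. \<integral>\<^sup>+w. indicator {w\<in>space (M n). adm ?Q 1 (piece_len G b X n (W n) (U n)) i w} w * gn n (Y n i w) \<partial>M n) \<longlonglongrightarrow> 0"
  by simp
 have "ennreal c \<le> ennreal (real ?Q / real 1)"
  by (intro ennreal_leI) (simp add: of_nat_nat order_trans[OF le_of_int_ceiling])
 then have "jump_time S i w < ennreal c \<Longrightarrow> adm ?Q 1 S i w" for S :: "nat \<Rightarrow> _ \<Rightarrow> ennreal" and w
  by (intro jump_time_adm) (rule order.strict_trans2)
 then have up: "(\<integral>\<^sup>+w. indicator {w\<in>space (M n). jump_time (piece_len G b X n (W n) (U n)) i w < ennreal c} w * gn n (Y n i w) \<partial>M n)
   \<le> (\<integral>\<^sup>+w. indicator {w\<in>space (M n). adm ?Q 1 (piece_len G b X n (W n) (U n)) i w} w * gn n (Y n i w) \<partial>M n)" for n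
  by (intro nn_integral_mono mult_right_mono) (auto split: split_indicator)
 show ?thesis by (rule tendsto_sandwich[OF _ _ tendsto_const lim']) (use up in auto)
qed

lemma bad_vanish:
 assumes acc: "\<And>n. 1 \<le> n \<Longrightarrow> accelerated E Om X P G b \<pi> n x (M n) (Y n) (W n) (U n)"
  and x: "x \<in> space E" and sm: "semi_markov I E \<phi> G b \<pi> \<mu> x Mb J T"
  and r: "0 < r" and eta: "0 < \<eta>" and A: "finite A"
 shows "(\<lambda>n. \<integral>\<^sup>+w. indicator {w\<in>space (M n). jump_time (piece_len G b X n (W n) (U n)) i w < ennreal c} w
   * indicator (badE n K r Q \<eta> A) (Y n i w, W n i w) \<partial>M n) \<longlonglongrightarrow> 0"
proof -
 let ?g = "\<lambda>n y. \<integral>\<^sup>+q. indicator (badE n K r Q \<eta> A) (y, fst q) \<partial>law y"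
 have lim: "(\<lambda>n. \<integral>\<^sup>+w. indicator {w\<in>space (M n). jump_time (piece_len G b X n (W n) (U n)) i w < ennreal c} w * ?g n (Y n i w) \<partial>M n) \<longlonglongrightarrow> 0"
 proof (rule chain_vanish[OF acc x sm])
  show "?g n \<in> borel_measurable E" for n
  proof (rule nn_integral_measurable_subprob_algebra2[OF _ measurable_prob_algebraD[OF law_measurable]])
   show "(\<lambda>(y, q). indicator (badE n K r Q \<eta> A) (y, fst q)) \<in> borel_measurable (E \<Otimes>\<^sub>M (Om \<Otimes>\<^sub>M borel))"
    unfolding split_beta' by (rule measurable_compose[OF _ borel_measurable_indicator[OF badE_sets[OF A]]]) measurable
  qed
  show "?g n y \<le> 1" if y: "y \<in> space E" for n y
  proof -
   interpret prob_space "law y" by (rule prob_law[OF y])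
   have "?g n y \<le> (\<integral>\<^sup>+q. 1 \<partial>law y)" by (intro nn_integral_mono) (auto split: split_indicator)
   then show ?thesis by (simp add: emeasure_space_1)
  qed
  show "(\<lambda>n. ?g n y) \<longlonglongrightarrow> 0" if "y \<in> space E" for y by (rule bad_tendsto_0[OF that r eta A])
 qed
 show ?thesis
 proof (rule Lim_transform_eventually[OF lim])
  show "\<forall>\<^sub>F n in sequentially. (\<integral>\<^sup>+w. indicator {w\<in>space (M n). jump_time (piece_len G b X n (W n) (U n)) i w < ennreal c} w * ?g n (Y n i w) \<partial>M n)
   = (\<integral>\<^sup>+w. indicator {w\<in>space (M n). jump_time (piece_len G b X n (W n) (U n)) i w < ennreal c} w
   * indicator (badE n K r Q \<eta> A) (Y n i w, W n i w) \<partial>M n)"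
   using eventually_ge_at_top[of 1]
  proof eventually_elim
   case (elim n)
   show ?case by (rule accelerated_piece[OF acc[OF elim] borel_measurable_indicator[OF badE_sets[OF A]], symmetric])
  qed
 qed
qed

text \<open>The constant at the \<open>i\<close>-th position is finite, and functions vanishing pointwise have vanishing
 expectations along the chain, even if the threshold \<open>k n\<close> grows arbitrarily slowly.\<close>

lemma tight:
 assumes acc: "\<And>n. 1 \<le> n \<Longrightarrow> accelerated E Om X P G b \<pi> n x (M n) (Y n) (W n) (U n)"
  and x: "x \<in> space E" and sm: "semi_markov I E \<phi> G b \<pi> \<mu> x Mb J T" and e: "0 < \<epsilon>"
 shows "\<exists>K::nat. \<forall>\<^sub>F n in sequentially.
  (\<integral>\<^sup>+w. indicator {w\<in>space (M n). jump_time (piece_len G b X n (W n) (U n)) i w < ennreal c} w * indicator {real K<..} (cF (Y n i w)) \<partial>M n) < \<epsilon>"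
proof (rule diagonal_tendsto_0[OF _ e])
 fix k :: "nat \<Rightarrow> nat" assume k: "filterlim k at_top sequentially"
 show "(\<lambda>n. \<integral>\<^sup>+w. indicator {w\<in>space (M n). jump_time (piece_len G b X n (W n) (U n)) i w < ennreal c} w * indicator {real (k n)<..} (cF (Y n i w)) \<partial>M n) \<longlonglongrightarrow> 0"
 proof (rule chain_vanish[OF acc x sm, where gn="\<lambda>n y. indicator {real (k n)<..} (cF y)"])
  show "(\<lambda>y. indicator {real (k n)<..} (cF y) :: ennreal) \<in> borel_measurable E" for n by measurable
  show "indicator {real (k n)<..} (cF y) \<le> (1 :: ennreal)" for n y by (auto split: split_indicator)
  show "(\<lambda>n. indicator {real (k n)<..} (cF y) :: ennreal) \<longlonglongrightarrow> 0" for y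
  proof (rule Lim_transform_eventually[OF tendsto_const])
   obtain m where m: "cF y \<le> real m" using real_arch_simple by blast
   have "\<forall>\<^sub>F n in sequentially. m \<le> k n" using k by (simp add: filterlim_at_top)
   then show "\<forall>\<^sub>F n in sequentially. 0 = (indicator {real (k n)<..} (cF y) :: ennreal)"
   proof eventually_elim
    case (elim n)
    then have "cF y \<le> real (k n)" using m by linarith
    then show ?case by simp
   qed
  qed
 qed
qed

lemmas Gb_pupd_measurable = pupd_measurable[where G=Gb and I=I, OF avg_measurable Gb_continuous]

text \<open>\<open>run r z J S m\<close> is the number of grid steps before the \<open>m\<close>-th jump together with the Euler path.\<close>

definition run :: "nat \<Rightarrow> real^'d \<Rightarrow> (nat \<Rightarrow> 'w \<Rightarrow> 'i) \<Rightarrow> (nat \<Rightarrow> 'w \<Rightarrow> ennreal) \<Rightarrow> nat \<Rightarrow> 'w \<Rightarrow> nat \<times> (nat \<Rightarrow> real^'d)" where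
 "run r z J S = prun (pupd (1 / real r) Gb) (0, \<lambda>_. z) r J S"

lemma run_measurable:
 assumes "\<And>k. J k \<in> M \<rightarrow>\<^sub>M I" "\<And>k. S k \<in> borel_measurable M"
 shows "run r z J S m \<in> M \<rightarrow>\<^sub>M PPm"
 unfolding run_def by (rule prun_measurable[where I=I, OF Gb_pupd_measurable]) (simp_all add: assms)

lemma adm_integrable:
 assumes M': "prob_space M'" and J': "\<And>k. J' k \<in> M' \<rightarrow>\<^sub>M I" and S: "\<And>k. S k \<in> borel_measurable M'"
  and f: "f \<in> borel_measurable (I \<Otimes>\<^sub>M PPm)" and f1: "\<And>a. \<bar>f a\<bar> \<le> (1::real)"
 shows "integrable M' (\<lambda>w. indicator {w\<in>space M'. adm Q r S m w} w * f (J' m w, run r z J' S m w))"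
proof -
 interpret prob_space M' by fact
 have m1: "(\<lambda>w. f (J' m w, run r z J' S m w)) \<in> borel_measurable M'"
  by (rule measurable_compose[OF measurable_Pair[OF J' run_measurable[OF J' S]] f])
 have m2: "{w\<in>space M'. adm Q r S m w} \<in> sets M'" by (rule adm_set) (rule S)
 show ?thesis
  using f1 m1 m2 by (intro integrable_const_bound[where B=1] AE_I2) (auto simp: indicator_def)
qed

lemma adm_nn_integral:
 assumes M': "prob_space M'" and J': "\<And>k. J' k \<in> M' \<rightarrow>\<^sub>M I" and S: "\<And>k. S k \<in> borel_measurable M'"
  and f: "f \<in> borel_measurable (I \<Otimes>\<^sub>M PPm)" and f01: "\<And>a. 0 \<le> f a" "\<And>a. f a \<le> (1::real)"
 shows "(\<integral>\<^sup>+w. indicator {w\<in>space M'. adm Q r S m w} w * ennreal (f (J' m w, run r z J' S m w)) \<partial>M') =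
   ennreal (\<integral>w. indicator {w\<in>space M'. adm Q r S m w} w * f (J' m w, run r z J' S m w) \<partial>M')"
proof -
 have i: "integrable M' (\<lambda>w. indicator {w\<in>space M'. adm Q r S m w} w * f (J' m w, run r z J' S m w))"
  using f01 by (intro adm_integrable M' J' S f) (simp add: abs_of_nonneg)
 have "(\<integral>\<^sup>+w. indicator {w\<in>space M'. adm Q r S m w} w * ennreal (f (J' m w, run r z J' S m w)) \<partial>M')
  = (\<integral>\<^sup>+w. ennreal (indicator {w\<in>space M'. adm Q r S m w} w * f (J' m w, run r z J' S m w)) \<partial>M')"
  by (intro nn_integral_cong) (auto split: split_indicator)
 also have "\<dots> = ennreal (\<integral>w. indicator {w\<in>space M'. adm Q r S m w} w * f (J' m w, run r z J' S m w) \<partial>M')"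
  using f01 by (intro nn_integral_eq_integral i AE_I2) (auto split: split_indicator)
 finally show ?thesis .
qed

text \<open>A signed function \<open>g\<close> is reduced to the nonnegative function \<open>(1 + g)/2\<close> with values in \<open>[0, 1]\<close>.\<close>

lemma chain_limit_real:
 assumes acc: "\<And>n. 1 \<le> n \<Longrightarrow> accelerated E Om X P G b \<pi> n x (M n) (Y n) (W n) (U n)"
  and x: "x \<in> space E" and sm: "semi_markov I E \<phi> G b \<pi> \<mu> x Mb J T"
  and r: "0 < r" and g[measurable]: "g \<in> borel_measurable (I \<Otimes>\<^sub>M PPm)" and g1: "\<And>a. \<bar>g a\<bar> \<le> (1::real)"
 shows "(\<lambda>n. \<integral>w. indicator {w\<in>space (M n). adm Q r (piece_len G b X n (W n) (U n)) m w} w *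
   g (\<phi> (Y n m w), run r z (\<lambda>l w. \<phi> (Y n l w)) (piece_len G b X n (W n) (U n)) m w) \<partial>M n)
  \<longlonglongrightarrow> (\<integral>v. indicator {v\<in>space Mb. adm Q r T m v} v * g (J m v, run r z J T m v) \<partial>Mb)"
proof -
 define LHS where "LHS f n = (\<integral>w. indicator {w\<in>space (M n). adm Q r (piece_len G b X n (W n) (U n)) m w} w *
   f (\<phi> (Y n m w), run r z (\<lambda>l w. \<phi> (Y n l w)) (piece_len G b X n (W n) (U n)) m w) \<partial>M n)" for f :: "_ \<Rightarrow> real" and n
 define RHS where "RHS f = (\<integral>v. indicator {v\<in>space Mb. adm Q r T m v} v * f (J m v, run r z J T m v) \<partial>Mb)" for f :: "_ \<Rightarrow> real"
 have fin: "LHS f \<longlonglongrightarrow> RHS f" if f: "f \<in> borel_measurable (I \<Otimes>\<^sub>M PPm)" and f01: "\<And>a. 0 \<le> f a" "\<And>a. f a \<le> 1" for f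
 proof -
  have f1: "\<bar>f a\<bar> \<le> 1" for a using f01[of a] by simp
  have lim: "(\<lambda>n. \<integral>\<^sup>+w. indicator {w\<in>space (M n). adm Q r (piece_len G b X n (W n) (U n)) m w} w *
   (\<lambda>(y, p). ennreal (f (\<phi> y, p))) (Y n m w, run r z (\<lambda>l w. \<phi> (Y n l w)) (piece_len G b X n (W n) (U n)) m w) \<partial>M n)
   \<longlonglongrightarrow> (\<integral>\<^sup>+v. indicator {v\<in>space Mb. adm Q r T m v} v * (\<lambda>a. ennreal (f a)) (J m v, run r z J T m v) \<partial>Mb)"
   unfolding run_def
  proof (rule chain_limit[OF acc x sm Gb_pupd_measurable _ r, where gn="\<lambda>n (y, p). ennreal (f (\<phi> y, p))"])
   have "(\<lambda>a. (\<phi> (fst a), snd a)) \<in> E \<Otimes>\<^sub>M PPm \<rightarrow>\<^sub>M I \<Otimes>\<^sub>M PPm" by measurable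
   from measurable_compose[OF measurable_compose[OF this f] measurable_ennreal]
   show "(\<lambda>(y, p). ennreal (f (\<phi> y, p))) \<in> borel_measurable (E \<Otimes>\<^sub>M PPm)" by (simp add: split_beta')
   show "(\<lambda>a. ennreal (f a)) \<in> borel_measurable (I \<Otimes>\<^sub>M PPm)" by (rule measurable_compose[OF f measurable_ennreal])
  qed (use f01 in auto)
  have "(\<lambda>n. ennreal (LHS f n)) \<longlonglongrightarrow> ennreal (RHS f)"
  proof (rule Lim_transform_eventually)
   show "(\<lambda>n. \<integral>\<^sup>+w. indicator {w\<in>space (M n). adm Q r (piece_len G b X n (W n) (U n)) m w} w *
    ennreal (f (\<phi> (Y n m w), run r z (\<lambda>l w. \<phi> (Y n l w)) (piece_len G b X n (W n) (U n)) m w)) \<partial>M n) \<longlonglongrightarrow> ennreal (RHS f)"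
    using lim unfolding adm_nn_integral[where J'=J and S=T, OF semi_markov_facts(1)[OF sm] semi_markov_facts(2)[OF sm] semi_markov_facts(4)[OF sm] f f01] RHS_def prod.case
    by simp
   show "\<forall>\<^sub>F n in sequentially. (\<integral>\<^sup>+w. indicator {w\<in>space (M n). adm Q r (piece_len G b X n (W n) (U n)) m w} w *
    ennreal (f (\<phi> (Y n m w), run r z (\<lambda>l w. \<phi> (Y n l w)) (piece_len G b X n (W n) (U n)) m w)) \<partial>M n) = ennreal (LHS f n)"
    using eventually_ge_at_top[of 1]
   proof eventually_elim
    case (elim n)
    note a = accelerated_facts[OF acc[OF elim]]
    show ?case unfolding LHS_def
     by (rule adm_nn_integral[where J'="\<lambda>l w. \<phi> (Y n l w)", OF a(1) measurable_compose[OF a(2) phi_measurable] piece_len_measurable[OF acc[OF elim]] f f01])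
   qed
  qed
  moreover have "0 \<le> LHS f n" "0 \<le> RHS f" for n
   unfolding LHS_def RHS_def using f01 by (auto intro!: Bochner_Integration.integral_nonneg_AE AE_I2)
  ultimately show ?thesis by (simp add: tendsto_ennreal_iff)
 qed
 have h: "(\<lambda>a. (1 + g a) / 2) \<in> borel_measurable (I \<Otimes>\<^sub>M PPm)" by measurable
 have h01: "0 \<le> (1 + g a) / 2" "(1 + g a) / 2 \<le> 1" for a using g1[of a] by (auto simp: abs_le_iff)
 have "(\<lambda>n. 2 * LHS (\<lambda>a. (1 + g a) / 2) n - LHS (\<lambda>_. 1) n) \<longlonglongrightarrow> 2 * RHS (\<lambda>a. (1 + g a) / 2) - RHS (\<lambda>_. 1)"
  by (intro tendsto_diff tendsto_mult_left fin h h01) auto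
 also have "2 * RHS (\<lambda>a. (1 + g a) / 2) - RHS (\<lambda>_. 1) = RHS g"
 proof -
  note s = semi_markov_facts[OF sm]
  have i1: "integrable Mb (\<lambda>v. indicator {v\<in>space Mb. adm Q r T m v} v * ((\<lambda>_. 1) (J m v, run r z J T m v) :: real))"
   by (rule adm_integrable[OF s(1) s(2) s(4)]) auto
  have i2: "integrable Mb (\<lambda>v. indicator {v\<in>space Mb. adm Q r T m v} v * g (J m v, run r z J T m v))"
   by (rule adm_integrable[OF s(1) s(2) s(4) g g1])
  have "RHS (\<lambda>a. (1 + g a) / 2) = (\<integral>v. (indicator {v\<in>space Mb. adm Q r T m v} v * 1 + indicator {v\<in>space Mb. adm Q r T m v} v * g (J m v, run r z J T m v)) / 2 \<partial>Mb)"
   unfolding RHS_def by (intro Bochner_Integration.integral_cong refl) (simp add: field_simps)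
  also have "\<dots> = (RHS (\<lambda>_. 1) + RHS g) / 2"
   unfolding RHS_def using i1 i2 by (simp add: Bochner_Integration.integral_add)
  finally show ?thesis by simp
 qed
 finally have lim2: "(\<lambda>n. 2 * LHS (\<lambda>a. (1 + g a) / 2) n - LHS (\<lambda>_. 1) n) \<longlonglongrightarrow> RHS g" .
 have "LHS g \<longlonglongrightarrow> RHS g"
 proof (rule Lim_transform_eventually[OF lim2])
  show "\<forall>\<^sub>F n in sequentially. 2 * LHS (\<lambda>a. (1 + g a) / 2) n - LHS (\<lambda>_. 1) n = LHS g n"
   using eventually_ge_at_top[of 1]
  proof eventually_elim
   case (elim n)
   note a = accelerated_facts[OF acc[OF elim]]
   let ?J = "\<lambda>l w. \<phi> (Y n l w)" and ?S = "piece_len G b X n (W n) (U n)"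
   have i1: "integrable (M n) (\<lambda>v. indicator {v\<in>space (M n). adm Q r ?S m v} v * ((\<lambda>_. 1) (?J m v, run r z ?J ?S m v) :: real))"
    by (rule adm_integrable[where J'="?J", OF a(1) measurable_compose[OF a(2) phi_measurable] piece_len_measurable[OF acc[OF elim]]]) auto
   have i2: "integrable (M n) (\<lambda>v. indicator {v\<in>space (M n). adm Q r ?S m v} v * g (?J m v, run r z ?J ?S m v))"
    by (rule adm_integrable[where J'="?J", OF a(1) measurable_compose[OF a(2) phi_measurable] piece_len_measurable[OF acc[OF elim]] g g1])
   have "LHS (\<lambda>a. (1 + g a) / 2) n = (\<integral>v. (indicator {v\<in>space (M n). adm Q r ?S m v} v * 1 + indicator {v\<in>space (M n). adm Q r ?S m v} v * g (?J m v, run r z ?J ?S m v)) / 2 \<partial>M n)"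
    unfolding LHS_def by (intro Bochner_Integration.integral_cong refl) (simp add: field_simps)
   also have "\<dots> = (LHS (\<lambda>_. 1) n + LHS g n) / 2"
    unfolding LHS_def using i1 i2 by (simp add: Bochner_Integration.integral_add)
   finally show ?case by simp
  qed
 qed
 then show ?thesis unfolding LHS_def RHS_def .
qed

end

section \<open>Observations of the slow variable\<close>

lemma finite_jump_time_enn2real_Suc:
 assumes "jump_time S (Suc m) w < \<top>"
 shows "jump_time S m w < \<top>" "S m w < \<top>"
  "enn2real (jump_time S (Suc m) w) = enn2real (jump_time S m w) + enn2real (S m w)"
proof -
 have *: "jump_time S (Suc m) w = jump_time S m w + S m w" by (simp add: jump_time_def)
 then show a: "jump_time S m w < \<top>" "S m w < \<top>" using assms by (simp_all add: ennreal_add_less_top)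
 show "enn2real (jump_time S (Suc m) w) = enn2real (jump_time S m w) + enn2real (S m w)"
  using a by (simp add: * enn2real_plus)
qed

lemma cell_bounds:
 assumes "0 < r"
 shows "real (cell r s) \<le> real r * enn2real s" "real r * enn2real s < real (cell r s) + 1"
proof -
 have "0 \<le> real r * enn2real s" by simp
 then show "real (cell r s) \<le> real r * enn2real s" "real r * enn2real s < real (cell r s) + 1"
  unfolding cell_def by linarith+
qed

lemma euler_error_bound_eta:
 "euler_error_bound K h \<eta> T z l =
  euler_error_bound K h 0 T z l + exp (2 * K * (T + (real l + 1) * h)) * (T / h) * \<eta>"
 by (simp add: euler_error_bound_def distrib_left distrib_right)

lemma euler_error_bound_tendsto_0: "(\<lambda>r. euler_error_bound K (1 / real r) 0 T z l) \<longlonglongrightarrow> 0"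
proof -
 let ?R = "(1 + norm z) * exp (K * T)"
 have h: "(\<lambda>r. 1 / real r) \<longlonglongrightarrow> 0" by (rule lim_1_over_n)
 have "(\<lambda>r. exp (2 * K * (T + (real l + 1) * (1 / real r))) * (2 * K\<^sup>2 * (1 / real r) * ?R * T + (real l + 1) * (2 * K * (1 / real r) * ?R))
  + (real l + 1) * (K * (1 / real r) * ?R)) \<longlonglongrightarrow> exp (2 * K * (T + (real l + 1) * 0)) * (2 * K\<^sup>2 * 0 * ?R * T + (real l + 1) * (2 * K * 0 * ?R))
  + (real l + 1) * (K * 0 * ?R)"
  by (intro tendsto_intros h)
 then show ?thesis by (simp add: euler_error_bound_def)
qed

text \<open>Observables are normalised to have absolute value at most 1; \<open>H\<close> is a horizon after all observation times.\<close>

locale observed_model = slow_model I Ei E \<phi> Om \<F> X P G b \<pi> \<mu> F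
 for I :: "'i measure" and Ei :: "'i \<Rightarrow> 'e measure" and E :: "'e measure" and \<phi> :: "'e \<Rightarrow> 'i"
  and Om :: "'o measure" and \<F> :: "real \<Rightarrow> 'o measure"
  and X :: "real \<Rightarrow> 'o \<Rightarrow> 'e" and P :: "'e \<Rightarrow> 'o measure"
  and G :: "real \<Rightarrow> real" and b :: "'e \<Rightarrow> real" and \<pi> :: "'e \<Rightarrow> 'e measure"
  and \<mu> :: "'i \<Rightarrow> 'e measure" and F :: "'i \<Rightarrow> real^'d \<Rightarrow> 'e \<Rightarrow> real^'d" +
 fixes f :: "nat \<Rightarrow> real^'d \<Rightarrow> real" and t :: "nat \<Rightarrow> real" and N :: nat and H L :: real and z :: "real^'d"
 assumes H_pos: "0 < H" and t_range: "\<And>i. i \<in> {1..N} \<Longrightarrow> 0 \<le> t i \<and> t i \<le> H"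
  and f_bound: "\<And>i v. i \<in> {1..N} \<Longrightarrow> \<bar>f i v\<bar> \<le> 1"
  and f_Lip: "\<And>i v v'. i \<in> {1..N} \<Longrightarrow> \<bar>f i v - f i v'\<bar> \<le> L * norm (v - v')" and L_nonneg: "0 \<le> L"
begin

lemma f_measurable: "i \<in> {1..N} \<Longrightarrow> f i \<in> borel_measurable borel"
proof (rule borel_measurable_continuous_onI[OF lipschitz_on_continuous_on[of L]])
 show "L-lipschitz_on UNIV (f i)" if "i \<in> {1..N}"
  using f_Lip[OF that] L_nonneg by (auto simp: lipschitz_on_def dist_norm)
qed

definition obs :: "(nat \<Rightarrow> real^'d) \<Rightarrow> real" where
 "obs c = (\<Prod>i=1..N. f i (c i))"

lemma obs_bound: "\<bar>obs c\<bar> \<le> 1"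
 unfolding obs_def abs_prod by (rule prod_le_1) (simp add: f_bound)

lemma obs_diff:
 assumes "\<And>i. i \<in> {1..N} \<Longrightarrow> norm (c i - c' i) \<le> e"
 shows "\<bar>obs c - obs c'\<bar> \<le> real N * L * e"
proof -
 have "\<bar>obs c - obs c'\<bar> \<le> (\<Sum>i=1..N. \<bar>f i (c i) - f i (c' i)\<bar>)"
  using norm_prod_diff[of "{1..N}" "\<lambda>i. f i (c i)" "\<lambda>i. f i (c' i)"] f_bound by (simp add: obs_def)
 also have "\<dots> \<le> (\<Sum>i=1..N. L * e)"
  using f_Lip L_nonneg assms by (intro sum_mono) (meson mult_left_mono order_trans)
 finally show ?thesis by simp
qed

lemma obs_measurable:
 assumes "\<And>i. i \<in> {1..N} \<Longrightarrow> (\<lambda>w. c w i) \<in> borel_measurable M'"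
 shows "(\<lambda>w. obs (c w)) \<in> borel_measurable M'"
 unfolding obs_def by (intro borel_measurable_prod measurable_compose[OF assms f_measurable])

text \<open>the grid point below \<open>t i\<close>\<close>

definition grid :: "nat \<Rightarrow> nat \<Rightarrow> nat" where "grid r i = nat \<lfloor>t i * real r\<rfloor>"

definition polygon_obs :: "nat \<Rightarrow> (nat \<Rightarrow> 'w \<Rightarrow> 'i) \<Rightarrow> (nat \<Rightarrow> 'w \<Rightarrow> ennreal) \<Rightarrow> nat \<Rightarrow> 'w \<Rightarrow> real" where
 "polygon_obs r J S m w = obs (\<lambda>i. snd (run r z J S m w) (grid r i))"

definition clock :: "nat \<Rightarrow> (nat \<Rightarrow> 'w \<Rightarrow> 'i) \<Rightarrow> (nat \<Rightarrow> 'w \<Rightarrow> ennreal) \<Rightarrow> nat \<Rightarrow> 'w \<Rightarrow> nat" where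
 "clock r J S m w = fst (run r z J S m w)"

lemma clock_Suc: "clock r J S (Suc m) w = clock r J S m w + cell r (S m w)"
 by (simp add: clock_def run_def pupd_def)

lemma clock_0: "clock r J S 0 w = 0"
 by (simp add: clock_def run_def)

lemma clock_bounds:
 assumes r: "0 < r" and fin: "jump_time S m w < \<top>"
 shows "real (clock r J S m w) \<le> real r * enn2real (jump_time S m w)"
  "real r * enn2real (jump_time S m w) \<le> real (clock r J S m w) + real m"
proof -
 have "real (clock r J S m w) \<le> real r * enn2real (jump_time S m w) \<and>
  real r * enn2real (jump_time S m w) \<le> real (clock r J S m w) + real m"
  using fin
 proof (induction m)
  case 0 show ?case by (simp add: clock_0 jump_time_def)
 next
  case (Suc m)
  note j = finite_jump_time_enn2real_Suc[OF Suc.prems]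
  show ?case using Suc.IH[OF j(1)] cell_bounds[OF r, of "S m w"]
   by (simp add: j(3) clock_Suc algebra_simps)
 qed
 then show "real (clock r J S m w) \<le> real r * enn2real (jump_time S m w)"
  "real r * enn2real (jump_time S m w) \<le> real (clock r J S m w) + real m" by auto
qed

lemma clock_adm:
 assumes r: "0 < r" and fin: "jump_time S m w < \<top>" and le: "real (clock r J S m w) \<le> H * real r"
 shows "adm (nat \<lceil>H * real r\<rceil> + 2) r S m w"
 using fin le
proof (induction m)
 case 0 show ?case by (simp add: adm_def)
next
 case (Suc m)
 note j = finite_jump_time_enn2real_Suc[OF Suc.prems(1)]
 have le: "real (clock r J S m w) \<le> H * real r" "real (cell r (S m w)) \<le> H * real r"
  using Suc.prems(2) by (simp_all add: clock_Suc)
 have "S m w < ennreal (real (Suc (cell r (S m w))) / real r)"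
  using cell_eq_iff[OF r j(2), of "cell r (S m w)"] by simp
 also have "\<dots> \<le> ennreal (real (nat \<lceil>H * real r\<rceil> + 2) / real r)"
  using le(2) r by (intro ennreal_leI divide_right_mono) linarith+
 finally show ?case using Suc.IH[OF j(1) le(1)] by (simp add: adm_Suc)
qed

text \<open>\<open>before\<close> says that the \<open>m\<close>-th jump happens before the horizon, \<open>early\<close> is the same event for the rounded jump time,
 and \<open>edge\<close> covers all cases in which the two can differ.\<close>

definition before :: "(nat \<Rightarrow> 'w \<Rightarrow> ennreal) \<Rightarrow> nat \<Rightarrow> 'w \<Rightarrow> real" where
 "before S m w = indicator {..<ennreal H} (jump_time S m w)"

definition early :: "nat \<Rightarrow> (nat \<Rightarrow> 'w \<Rightarrow> 'i) \<Rightarrow> (nat \<Rightarrow> 'w \<Rightarrow> ennreal) \<Rightarrow> nat \<Rightarrow> 'w \<Rightarrow> real" where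
 "early r J S m w = indicator {..<\<top>} (jump_time S m w) * indicator {..<H * real r} (real (clock r J S m w))"

definition edge :: "nat \<Rightarrow> (nat \<Rightarrow> 'w \<Rightarrow> 'i) \<Rightarrow> (nat \<Rightarrow> 'w \<Rightarrow> ennreal) \<Rightarrow> nat \<Rightarrow> 'w \<Rightarrow> real" where
 "edge r J S m w = indicator {..<\<top>} (jump_time S m w) * indicator {H * real r - real m..H * real r} (real (clock r J S m w))"

lemma edge_nonneg: "0 \<le> edge r J S m w"
 by (simp add: edge_def)

lemma early_before:
 assumes r: "0 < r"
 shows "\<bar>before S m w - early r J S m w\<bar> \<le> edge r J S m w"
  and "jump_time S m w = ennreal H \<Longrightarrow> edge r J S m w = 1"
proof -
 have *: "jump_time S m w < ennreal H \<longleftrightarrow> jump_time S m w < \<top> \<and> enn2real (jump_time S m w) < H"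
 proof (cases "jump_time S m w < \<top>")
  case True
  then have "jump_time S m w = ennreal (enn2real (jump_time S m w))" by simp
  then have "jump_time S m w < ennreal H \<longleftrightarrow> enn2real (jump_time S m w) < H"
   by (metis enn2real_nonneg ennreal_less_iff)
  then show ?thesis using True by simp
 next
  case False
  then show ?thesis using less_trans[OF _ ennreal_less_top] by blast
 qed
 show "\<bar>before S m w - early r J S m w\<bar> \<le> edge r J S m w"
 proof (cases "jump_time S m w < \<top>")
  case True
  note c = clock_bounds[OF r True, of J]
  show ?thesis
  proof (cases "enn2real (jump_time S m w) < H")
   case lt: True
   then have "real r * enn2real (jump_time S m w) < H * real r" using r by (simp add: mult.commute)
   then have "real (clock r J S m w) < H * real r" using c by linarith
   then have "before S m w = early r J S m w" using * True lt by (simp add: before_def early_def)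
   then show ?thesis using edge_nonneg[of r J S m w] by simp
  next
   case ge: False
   then have "H * real r \<le> real r * enn2real (jump_time S m w)" using r by (simp add: mult.commute)
   then have "H * real r - real m \<le> real (clock r J S m w)" using c by linarith
   moreover have "before S m w = 0" using * ge by (simp add: before_def)
   ultimately show ?thesis using True by (auto simp: early_def edge_def split: split_indicator)
  qed
 next
  case False
  then show ?thesis using * by (simp add: before_def early_def edge_def)
 qed
 assume eq: "jump_time S m w = ennreal H"
 then have fin: "jump_time S m w < \<top>" by simp
 show "edge r J S m w = 1"
  using clock_bounds[OF r fin, of J] eq H_pos by (simp add: edge_def indicator_def mult.commute)
qed

lemma before_antimono: "before S (Suc m) w \<le> before S m w"
proof -
 have le: "jump_time S m w \<le> jump_time S (Suc m) w" by (intro jump_time_mono) simp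
 show ?thesis
 proof (cases "jump_time S (Suc m) w < ennreal H")
  case True
  then have "jump_time S m w < ennreal H" by (rule order.strict_trans1[OF le])
  then show ?thesis by (simp add: before_def)
 qed (simp add: before_def)
qed

lemma clock_measurable:
 assumes "\<And>k. J k \<in> M' \<rightarrow>\<^sub>M I" "\<And>k. S k \<in> borel_measurable M'"
 shows "(\<lambda>w. real (clock r J S m w)) \<in> borel_measurable M'"
proof -
 have "clock r J S m \<in> M' \<rightarrow>\<^sub>M count_space UNIV"
  unfolding clock_def[abs_def] by (rule measurable_compose[OF run_measurable[OF assms] fst_PPm])
 then show ?thesis by (rule measurable_compose) simp
qed

lemma indicators_measurable:
 assumes J: "\<And>k. J k \<in> M' \<rightarrow>\<^sub>M I" and S: "\<And>k. S k \<in> borel_measurable M'"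
 shows "before S m \<in> borel_measurable M'" "early r J S m \<in> borel_measurable M'" "edge r J S m \<in> borel_measurable M'"
  "polygon_obs r J S m \<in> borel_measurable M'"
proof -
 have [measurable]: "jump_time S m \<in> borel_measurable M'" by (rule jump_time_measurable) (rule S)
 have [measurable]: "(\<lambda>w. real (clock r J S m w)) \<in> borel_measurable M'" by (rule clock_measurable[OF J S])
 show "before S m \<in> borel_measurable M'" "early r J S m \<in> borel_measurable M'" "edge r J S m \<in> borel_measurable M'"
  unfolding before_def[abs_def] early_def[abs_def] edge_def[abs_def] by measurable
 show "polygon_obs r J S m \<in> borel_measurable M'" unfolding polygon_obs_def[abs_def]
  by (rule obs_measurable) (rule measurable_compose[OF run_measurable[OF J S] snd_PPm])
qed

definition gap :: "'w measure \<Rightarrow> (real \<Rightarrow> 'w \<Rightarrow> real^'d) \<Rightarrow> nat \<Rightarrow> (nat \<Rightarrow> 'w \<Rightarrow> 'i) \<Rightarrow> (nat \<Rightarrow> 'w \<Rightarrow> ennreal) \<Rightarrow> nat \<Rightarrow> real" where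
 "gap M' \<zeta> r J S l = (\<integral>w. \<bar>obs (\<lambda>i. \<zeta> (t i) w) - polygon_obs r J S (Suc l) w\<bar> *
  (before S l w * indicator {ennreal H<..} (jump_time S (Suc l) w)) \<partial>M')"

lemma integrable_bounded:
 assumes "prob_space M'" "g \<in> borel_measurable M'" "\<And>w. w \<in> space M' \<Longrightarrow> \<bar>g w\<bar> \<le> (B::real)"
 shows "integrable M' g"
proof -
 interpret prob_space M' by fact
 show ?thesis using assms by (intro integrable_const_bound[where B=B] AE_I2) auto
qed

text \<open>The price of replacing solution and jump times by polygon and rounded jump times. The solution is compared
 only when the horizon lies strictly inside the piece; the boundary case \<open>\<tau>\<^sub>l\<^sub>+\<^sub>1 = H\<close> is charged to the edge term.\<close>

lemma comparison:
 assumes M': "prob_space M'" and J: "\<And>k. J k \<in> M' \<rightarrow>\<^sub>M I" and S: "\<And>k. S k \<in> borel_measurable M'"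
  and \<zeta>: "\<And>i. i \<in> {1..N} \<Longrightarrow> \<zeta> (t i) \<in> borel_measurable M'" and r: "0 < r"
 shows "\<bar>(\<integral>w. obs (\<lambda>i. \<zeta> (t i) w) * (before S l w - before S (Suc l) w) \<partial>M')
   - (\<integral>w. polygon_obs r J S (Suc l) w * (early r J S l w - early r J S (Suc l) w) \<partial>M')\<bar>
  \<le> gap M' \<zeta> r J S l + (\<integral>w. edge r J S l w \<partial>M') + 3 * (\<integral>w. edge r J S (Suc l) w \<partial>M')"
proof -
 let ?o = "\<lambda>w. obs (\<lambda>i. \<zeta> (t i) w)" and ?p = "polygon_obs r J S (Suc l)"
 let ?A = "\<lambda>w. before S l w * indicator {ennreal H<..} (jump_time S (Suc l) w)"
 have o[measurable]: "?o \<in> borel_measurable M'" by (rule obs_measurable) (rule \<zeta>)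
 note [measurable] = indicators_measurable[OF J S]
 have [measurable]: "jump_time S m \<in> borel_measurable M'" for m by (rule jump_time_measurable) (rule S)
 have ob: "\<bar>?o w\<bar> \<le> 1" "\<bar>?p w\<bar> \<le> 1" for w unfolding polygon_obs_def by (rule obs_bound)+
 have b01: "0 \<le> before S m w" "before S m w \<le> 1" "0 \<le> early r J S m w" "early r J S m w \<le> 1" "0 \<le> edge r J S m w" "edge r J S m w \<le> 1" for m w
  by (auto simp: before_def early_def edge_def split: split_indicator)
 have A01: "0 \<le> ?A w" "?A w \<le> 1" for w by (auto simp: before_def split: split_indicator)
 have prod1: "\<bar>x * y\<bar> \<le> c" if "\<bar>x\<bar> \<le> c" "\<bar>y\<bar> \<le> 1" for x y c :: real
  using mult_mono[of "\<bar>x\<bar>" c "\<bar>y\<bar>" 1] that by (simp add: abs_mult)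
 have i1: "integrable M' (\<lambda>w. ?o w * (before S l w - before S (Suc l) w))"
 proof (rule integrable_bounded[OF M', where B=1])
  show "\<bar>?o w * (before S l w - before S (Suc l) w)\<bar> \<le> 1" for w
   using b01[of l w] b01[of "Suc l" w] by (intro prod1 ob) (auto simp: abs_le_iff)
 qed measurable
 have i2: "integrable M' (\<lambda>w. ?p w * (early r J S l w - early r J S (Suc l) w))"
 proof (rule integrable_bounded[OF M', where B=1])
  show "\<bar>?p w * (early r J S l w - early r J S (Suc l) w)\<bar> \<le> 1" for w
   using b01[of l w] b01[of "Suc l" w] by (intro prod1 ob) (auto simp: abs_le_iff)
 qed measurable
 have i3: "integrable M' (\<lambda>w. \<bar>?o w - ?p w\<bar> * ?A w)"
 proof (rule integrable_bounded[OF M', where B=2])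
  show "\<bar>\<bar>?o w - ?p w\<bar> * ?A w\<bar> \<le> 2" for w
  proof (rule prod1)
   show "\<bar>\<bar>?o w - ?p w\<bar>\<bar> \<le> 2" using ob[of w] by linarith
   show "\<bar>?A w\<bar> \<le> 1" using A01[of w] by linarith
  qed
 qed measurable
 have i4: "integrable M' (edge r J S m)" for m
  by (rule integrable_bounded[OF M', where B=1]) (use b01 in \<open>auto simp: abs_le_iff intro: order_trans[of _ 0]\<close>)
 have pw: "\<bar>?o w * (before S l w - before S (Suc l) w) - ?p w * (early r J S l w - early r J S (Suc l) w)\<bar>
  \<le> \<bar>?o w - ?p w\<bar> * ?A w + edge r J S l w + 3 * edge r J S (Suc l) w" for w
 proof -
  let ?d = "before S l w - before S (Suc l) w"
  have d: "\<bar>?o w - ?p w\<bar> * ?d \<le> \<bar>?o w - ?p w\<bar> * ?A w + 2 * edge r J S (Suc l) w"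
  proof (cases "jump_time S (Suc l) w = ennreal H")
   case True
   then have "edge r J S (Suc l) w = 1" by (rule early_before(2)[OF r])
   moreover have "\<bar>\<bar>?o w - ?p w\<bar> * ?d\<bar> \<le> 2"
   proof (rule prod1)
    show "\<bar>\<bar>?o w - ?p w\<bar>\<bar> \<le> 2" using ob[of w] by linarith
    show "\<bar>?d\<bar> \<le> 1" using b01[of l w] b01[of "Suc l" w] by linarith
   qed
   moreover have "0 \<le> \<bar>?o w - ?p w\<bar> * ?A w" using A01[of w] by simp
   ultimately show ?thesis by linarith
  next
   case False
   then have "?d \<le> ?A w" by (auto simp: before_def indicator_def not_less)
   then have "\<bar>?o w - ?p w\<bar> * ?d \<le> \<bar>?o w - ?p w\<bar> * ?A w" by (rule mult_left_mono) simp
   then show ?thesis using edge_nonneg[of r J S "Suc l" w] by linarith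
  qed
  have d0: "0 \<le> ?d" using before_antimono[of S l w] by simp
  let ?e = "(before S l w - early r J S l w) - (before S (Suc l) w - early r J S (Suc l) w)"
  have e: "\<bar>?e\<bar> \<le> edge r J S l w + edge r J S (Suc l) w"
   using early_before(1)[OF r, of S l w J] early_before(1)[OF r, of S "Suc l" w J] by linarith
  have "\<bar>?p w * ?e\<bar> \<le> 1 * \<bar>?e\<bar>" unfolding abs_mult using ob(2)[of w] by (rule mult_right_mono) simp
  moreover have "?o w * ?d - ?p w * (early r J S l w - early r J S (Suc l) w) = (?o w - ?p w) * ?d + ?p w * ?e"
   by (simp add: algebra_simps)
  then have "\<bar>?o w * ?d - ?p w * (early r J S l w - early r J S (Suc l) w)\<bar> \<le> \<bar>(?o w - ?p w) * ?d\<bar> + \<bar>?p w * ?e\<bar>"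
   using abs_triangle_ineq[of "(?o w - ?p w) * ?d" "?p w * ?e"] by (simp only:)
  moreover have "\<bar>(?o w - ?p w) * ?d\<bar> = \<bar>?o w - ?p w\<bar> * ?d" using d0 by (simp add: abs_mult)
  moreover have "X \<le> a + c + 3 * b" if "Q \<le> 1 * e'" "X \<le> D' + Q" "D' = D" "D \<le> a + 2 * b" "e' \<le> c + b"
   for X D D' Q a b c e' :: real using that by linarith
  ultimately show ?thesis using d e by blast
 qed
 have "\<bar>(\<integral>w. ?o w * (before S l w - before S (Suc l) w) \<partial>M') - (\<integral>w. ?p w * (early r J S l w - early r J S (Suc l) w) \<partial>M')\<bar>
  = \<bar>\<integral>w. ?o w * (before S l w - before S (Suc l) w) - ?p w * (early r J S l w - early r J S (Suc l) w) \<partial>M'\<bar>"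
  using i1 i2 by simp
 also have "\<dots> \<le> (\<integral>w. \<bar>?o w * (before S l w - before S (Suc l) w) - ?p w * (early r J S l w - early r J S (Suc l) w)\<bar> \<partial>M')"
  by (rule integral_abs_bound)
 also have "\<dots> \<le> (\<integral>w. \<bar>?o w - ?p w\<bar> * ?A w + edge r J S l w + 3 * edge r J S (Suc l) w \<partial>M')"
  using pw i1 i2 i3 i4 by (intro integral_mono) auto
 also have "\<dots> = gap M' \<zeta> r J S l + (\<integral>w. edge r J S l w \<partial>M') + 3 * (\<integral>w. edge r J S (Suc l) w \<partial>M')"
  unfolding gap_def using i3 i4 by simp
 finally show ?thesis .
qed

lemma adm_clock_integral:
 fixes g :: "'i \<times> nat \<times> (nat \<Rightarrow> real^'d) \<Rightarrow> real"
 assumes r: "0 < r" and g0: "\<And>j p. H * real r < real (fst p) \<Longrightarrow> g (j, p) = 0"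
 shows "(\<integral>w. indicator {w\<in>space M'. adm (nat \<lceil>H * real r\<rceil> + 2) r S m w} w * g (J' m w, run r z J' S m w) \<partial>M')
   = (\<integral>w. indicator {..<\<top>} (jump_time S m w) * g (J' m w, run r z J' S m w) \<partial>M')"
 proof (rule Bochner_Integration.integral_cong[OF refl])
  fix w assume w: "w \<in> space M'"
  have "g (J' m w, run r z J' S m w) = 0"
   if "jump_time S m w < \<top>" "\<not> adm (nat \<lceil>H * real r\<rceil> + 2) r S m w"
  proof (rule g0)
   have "\<not> real (clock r J' S m w) \<le> H * real r" using clock_adm[OF r that(1)] that(2) by blast
   then show "H * real r < real (fst (run r z J' S m w))" by (simp add: clock_def)
  qed
  moreover have "adm (nat \<lceil>H * real r\<rceil> + 2) r S m w \<Longrightarrow> jump_time S m w < \<top>" using adm_finite[of "nat \<lceil>H * real r\<rceil> + 2" r S m w] by simp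
  ultimately show "indicator {w\<in>space M'. adm (nat \<lceil>H * real r\<rceil> + 2) r S m w} w * g (J' m w, run r z J' S m w)
   = indicator {..<\<top>} (jump_time S m w) * g (J' m w, run r z J' S m w)"
   using w by (auto simp: indicator_def)
 qed

lemma clock_limit:
 assumes acc: "\<And>n. 1 \<le> n \<Longrightarrow> accelerated E Om X P G b \<pi> n x (M n) (Y n) (W n) (U n)"
  and x: "x \<in> space E" and sm: "semi_markov I E \<phi> G b \<pi> \<mu> x Mb J T"
  and r: "0 < r" and g: "g \<in> borel_measurable (I \<Otimes>\<^sub>M PPm)" and g1: "\<And>a. \<bar>g a\<bar> \<le> (1::real)"
  and g0: "\<And>j p. H * real r < real (fst p) \<Longrightarrow> g (j, p) = 0"
 shows "(\<lambda>n. \<integral>w. indicator {..<\<top>} (jump_time (piece_len G b X n (W n) (U n)) m w) *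
   g (\<phi> (Y n m w), run r z (\<lambda>l w. \<phi> (Y n l w)) (piece_len G b X n (W n) (U n)) m w) \<partial>M n)
  \<longlonglongrightarrow> (\<integral>v. indicator {..<\<top>} (jump_time T m v) * g (J m v, run r z J T m v) \<partial>Mb)"
proof -
 have "(\<lambda>n. \<integral>w. indicator {w\<in>space (M n). adm (nat \<lceil>H * real r\<rceil> + 2) r (piece_len G b X n (W n) (U n)) m w} w *
   g (\<phi> (Y n m w), run r z (\<lambda>l w. \<phi> (Y n l w)) (piece_len G b X n (W n) (U n)) m w) \<partial>M n)
  \<longlonglongrightarrow> (\<integral>v. indicator {v\<in>space Mb. adm (nat \<lceil>H * real r\<rceil> + 2) r T m v} v * g (J m v, run r z J T m v) \<partial>Mb)"
  by (rule chain_limit_real[OF acc x sm r g g1])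
 moreover have "(\<integral>w. indicator {w\<in>space (M n). adm (nat \<lceil>H * real r\<rceil> + 2) r (piece_len G b X n (W n) (U n)) m w} w *
   g (\<phi> (Y n m w), run r z (\<lambda>l w. \<phi> (Y n l w)) (piece_len G b X n (W n) (U n)) m w) \<partial>M n)
  = (\<integral>w. indicator {..<\<top>} (jump_time (piece_len G b X n (W n) (U n)) m w) *
   g (\<phi> (Y n m w), run r z (\<lambda>l w. \<phi> (Y n l w)) (piece_len G b X n (W n) (U n)) m w) \<partial>M n)" for n
  by (rule adm_clock_integral[of r g "M n" "piece_len G b X n (W n) (U n)" m "\<lambda>l w. \<phi> (Y n l w)"]) (rule r g0, assumption?)+
 moreover have "(\<integral>v. indicator {v\<in>space Mb. adm (nat \<lceil>H * real r\<rceil> + 2) r T m v} v * g (J m v, run r z J T m v) \<partial>Mb)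
  = (\<integral>v. indicator {..<\<top>} (jump_time T m v) * g (J m v, run r z J T m v) \<partial>Mb)"
  by (rule adm_clock_integral[of r g Mb T m J]) (rule r g0, assumption?)+
 ultimately show ?thesis by simp
qed

lemma obs_bound1: "0 \<le> x \<Longrightarrow> x \<le> 1 \<Longrightarrow> \<bar>x * obs c\<bar> \<le> 1"
 using mult_mono[of x 1 "\<bar>obs c\<bar>" 1] obs_bound[of c] by (simp add: abs_mult)

text \<open>The observation multiplied by \<open>early\<close> at the start of the \<open>l\<close>-th piece and at its end. The first must not
 look at the length of the piece, hence the explicit advance.\<close>

definition before_obs :: "nat \<Rightarrow> 'i \<times> nat \<times> (nat \<Rightarrow> real^'d) \<Rightarrow> real" where
 "before_obs r a = indicator {..<H * real r} (real (fst (snd a))) *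
  obs (\<lambda>i. advance (1 / real r) (Gb (fst a)) (fst (snd a)) (snd (snd a)) (grid r i))"

definition after_obs :: "nat \<Rightarrow> 'i \<times> nat \<times> (nat \<Rightarrow> real^'d) \<Rightarrow> real" where
 "after_obs r a = indicator {..<H * real r} (real (fst (snd a))) * obs (\<lambda>i. snd (snd a) (grid r i))"

lemma state_measurable:
 "(\<lambda>a. real (fst (snd a))) \<in> borel_measurable (I \<Otimes>\<^sub>M (PPm :: (nat \<times> (nat \<Rightarrow> real^'d)) measure))"
 "(\<lambda>a. snd (snd a) k) \<in> borel_measurable (I \<Otimes>\<^sub>M (PPm :: (nat \<times> (nat \<Rightarrow> real^'d)) measure))"
proof -
 have "(\<lambda>a. fst (snd a)) \<in> I \<Otimes>\<^sub>M (PPm :: (nat \<times> (nat \<Rightarrow> real^'d)) measure) \<rightarrow>\<^sub>M count_space UNIV"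
  by (rule measurable_compose[OF measurable_snd fst_PPm])
 then show "(\<lambda>a. real (fst (snd a))) \<in> borel_measurable (I \<Otimes>\<^sub>M (PPm :: (nat \<times> (nat \<Rightarrow> real^'d)) measure))"
  by (rule measurable_compose) simp
 show "(\<lambda>a. snd (snd a) k) \<in> borel_measurable (I \<Otimes>\<^sub>M (PPm :: (nat \<times> (nat \<Rightarrow> real^'d)) measure))"
  by (rule measurable_compose[OF measurable_snd snd_PPm])
qed

lemma before_after_obs_measurable:
 "before_obs r \<in> borel_measurable (I \<Otimes>\<^sub>M PPm)" "after_obs r \<in> borel_measurable (I \<Otimes>\<^sub>M PPm)"
proof -
 note [measurable] = state_measurable
 have 1[measurable]: "(\<lambda>a. obs (\<lambda>i. advance (1 / real r) (Gb (fst a)) (fst (snd a)) (snd (snd a)) (grid r i))) \<in> borel_measurable (I \<Otimes>\<^sub>M PPm)"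
  by (rule obs_measurable) (rule advance_measurable[OF avg_measurable Gb_continuous measurable_snd measurable_fst])
 have 2[measurable]: "(\<lambda>a. obs (\<lambda>i. snd (snd a) (grid r i))) \<in> borel_measurable (I \<Otimes>\<^sub>M (PPm :: (nat \<times> (nat \<Rightarrow> real^'d)) measure))"
  by (rule obs_measurable) (rule state_measurable)
 show "before_obs r \<in> borel_measurable (I \<Otimes>\<^sub>M PPm)" "after_obs r \<in> borel_measurable (I \<Otimes>\<^sub>M PPm)"
  unfolding before_obs_def[abs_def] after_obs_def[abs_def] by measurable
qed

lemma polygon_split:
 assumes M': "prob_space M'" and J: "\<And>k. J k \<in> M' \<rightarrow>\<^sub>M I" and S: "\<And>k. S k \<in> borel_measurable M'"
 shows "(\<integral>w. polygon_obs r J S (Suc l) w * (early r J S l w - early r J S (Suc l) w) \<partial>M') =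
  (\<integral>w. indicator {..<\<top>} (jump_time S l w) * before_obs r (J l w, run r z J S l w) \<partial>M') -
  (\<integral>w. indicator {..<\<top>} (jump_time S (Suc l) w) * after_obs r (J (Suc l) w, run r z J S (Suc l) w) \<partial>M')"
proof -
 note [measurable] = indicators_measurable[OF J S]
 have i: "integrable M' (\<lambda>w. early r J S m w * polygon_obs r J S (Suc l) w)" for m
 proof (rule integrable_bounded[OF M', where B=1])
  show "\<bar>early r J S m w * polygon_obs r J S (Suc l) w\<bar> \<le> 1" for w
   unfolding polygon_obs_def by (rule obs_bound1) (auto simp: early_def split: split_indicator)
 qed measurable
 have 1: "indicator {..<\<top>} (jump_time S l w) * before_obs r (J l w, run r z J S l w) = early r J S l w * polygon_obs r J S (Suc l) w" for w
  by (simp add: before_obs_def early_def polygon_obs_def clock_def run_def pupd_def)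
 have 2: "indicator {..<\<top>} (jump_time S (Suc l) w) * after_obs r (J (Suc l) w, run r z J S (Suc l) w) = early r J S (Suc l) w * polygon_obs r J S (Suc l) w" for w
  by (simp add: after_obs_def early_def polygon_obs_def clock_def)
 show ?thesis unfolding 1 2 Bochner_Integration.integral_diff[OF i i, symmetric] by (simp add: algebra_simps)
qed

lemma polygon_limit:
 assumes acc: "\<And>n. 1 \<le> n \<Longrightarrow> accelerated E Om X P G b \<pi> n x (M n) (Y n) (W n) (U n)"
  and x: "x \<in> space E" and sm: "semi_markov I E \<phi> G b \<pi> \<mu> x Mb J T" and r: "0 < r"
 shows "(\<lambda>n. \<integral>w. polygon_obs r (\<lambda>k w. \<phi> (Y n k w)) (piece_len G b X n (W n) (U n)) (Suc l) w *
   (early r (\<lambda>k w. \<phi> (Y n k w)) (piece_len G b X n (W n) (U n)) l w - early r (\<lambda>k w. \<phi> (Y n k w)) (piece_len G b X n (W n) (U n)) (Suc l) w) \<partial>M n)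
  \<longlonglongrightarrow> (\<integral>v. polygon_obs r J T (Suc l) v * (early r J T l v - early r J T (Suc l) v) \<partial>Mb)"
proof -
 note s = semi_markov_facts[OF sm]
 have b1: "\<bar>before_obs r a\<bar> \<le> 1" "\<bar>after_obs r a\<bar> \<le> 1" for a
  unfolding before_obs_def after_obs_def by (rule obs_bound1; simp split: split_indicator)+
 have b0: "before_obs r (j, p) = 0" "after_obs r (j, p) = 0" if "H * real r < real (fst p)" for j p
  using that by (simp_all add: before_obs_def after_obs_def)
 note lim = tendsto_diff[OF
   clock_limit[OF acc x sm r before_after_obs_measurable(1) b1(1) b0(1), where m=l]
   clock_limit[OF acc x sm r before_after_obs_measurable(2) b1(2) b0(2), where m="Suc l"]]
 show ?thesis unfolding polygon_split[where J=J and S=T, OF s(1) s(2) s(4)]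
 proof (rule Lim_transform_eventually[OF lim])
  show "\<forall>\<^sub>F n in sequentially.
   (\<integral>w. indicator {..<\<top>} (jump_time (piece_len G b X n (W n) (U n)) l w) * before_obs r (\<phi> (Y n l w), run r z (\<lambda>k w. \<phi> (Y n k w)) (piece_len G b X n (W n) (U n)) l w) \<partial>M n) -
   (\<integral>w. indicator {..<\<top>} (jump_time (piece_len G b X n (W n) (U n)) (Suc l) w) * after_obs r (\<phi> (Y n (Suc l) w), run r z (\<lambda>k w. \<phi> (Y n k w)) (piece_len G b X n (W n) (U n)) (Suc l) w) \<partial>M n)
   = (\<integral>w. polygon_obs r (\<lambda>k w. \<phi> (Y n k w)) (piece_len G b X n (W n) (U n)) (Suc l) w *
   (early r (\<lambda>k w. \<phi> (Y n k w)) (piece_len G b X n (W n) (U n)) l w - early r (\<lambda>k w. \<phi> (Y n k w)) (piece_len G b X n (W n) (U n)) (Suc l) w) \<partial>M n)"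
   using eventually_ge_at_top[of 1]
  proof eventually_elim
   case (elim n)
   note a = accelerated_facts[OF acc[OF elim]]
   show ?case
    by (rule polygon_split[symmetric, where J="\<lambda>k w. \<phi> (Y n k w)", OF a(1) measurable_compose[OF a(2) phi_measurable] piece_len_measurable[OF acc[OF elim]]])
  qed
 qed simp_all
qed

lemma edge_limit:
 assumes acc: "\<And>n. 1 \<le> n \<Longrightarrow> accelerated E Om X P G b \<pi> n x (M n) (Y n) (W n) (U n)"
  and x: "x \<in> space E" and sm: "semi_markov I E \<phi> G b \<pi> \<mu> x Mb J T" and r: "0 < r"
 shows "(\<lambda>n. \<integral>w. edge r (\<lambda>k w. \<phi> (Y n k w)) (piece_len G b X n (W n) (U n)) m w \<partial>M n)
  \<longlonglongrightarrow> (\<integral>v. edge r J T m v \<partial>Mb)"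
proof -
 let ?g = "\<lambda>a::'i \<times> nat \<times> (nat \<Rightarrow> real^'d). indicator {H * real r - real m..H * real r} (real (fst (snd a))) :: real"
 have e: "edge r J S m w = indicator {..<\<top>} (jump_time S m w) * ?g (J m w, run r z J S m w)" for J S and w
  by (simp add: edge_def clock_def)
 note [measurable] = state_measurable
 have "(\<lambda>n. \<integral>w. indicator {..<\<top>} (jump_time (piece_len G b X n (W n) (U n)) m w) *
   ?g (\<phi> (Y n m w), run r z (\<lambda>l w. \<phi> (Y n l w)) (piece_len G b X n (W n) (U n)) m w) \<partial>M n)
  \<longlonglongrightarrow> (\<integral>v. indicator {..<\<top>} (jump_time T m v) * ?g (J m v, run r z J T m v) \<partial>Mb)"
 proof (rule clock_limit[OF acc x sm r])
  show "?g \<in> borel_measurable (I \<Otimes>\<^sub>M PPm)" by measurable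
 qed (auto split: split_indicator)
 then show ?thesis unfolding edge_def clock_def by simp
qed

text \<open>The averaged field is constant in time on each piece, so the averaging error is zero. The constant \<open>K\<close> may depend
 on the sample point.\<close>

lemma limit_polygon_tendsto:
 assumes J: "\<And>i. J i v \<in> space I"
  and \<tau>: "jump_time T l v < ennreal H" "ennreal H < jump_time T (Suc l) v"
  and Zc: "continuous_on {s. 0 \<le> s \<and> ennreal s < lifetime T v} (\<lambda>s. Zb s v)"
  and Zi: "\<And>s. 0 \<le> s \<Longrightarrow> ennreal s < lifetime T v \<Longrightarrow> set_integrable lborel {0..s} (\<lambda>u. Gb (the (index_path J T u v)) (Zb u v))"
  and Ze: "\<And>s. 0 \<le> s \<Longrightarrow> ennreal s < lifetime T v \<Longrightarrow> Zb s v = z + set_lebesgue_integral lborel {0..s} (\<lambda>u. Gb (the (index_path J T u v)) (Zb u v))"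
 shows "(\<lambda>r. \<bar>obs (\<lambda>i. Zb (t i) v) - polygon_obs r J T (Suc l) v\<bar>) \<longlonglongrightarrow> 0"
proof -
 define K where "K = (\<Sum>i\<le>l. cK (J i v))"
 have K0: "0 \<le> K" unfolding K_def by (intro sum_nonneg cK_nonneg J)
 have Ki: "cK (J i v) \<le> K" if "i \<le> l" for i
  unfolding K_def using that by (intro member_le_sum) (auto intro: cK_nonneg J)
 have life: "ennreal s < lifetime T v" if "s \<le> H" for s
  using ennreal_leI[OF that] order.strict_trans2[OF \<tau>(2) jump_time_le_lifetime] by (rule order.strict_trans1)
 have bound: "norm (Zb s v - snd (run r z J T (Suc l) v) (nat \<lfloor>s * real r\<rfloor>)) \<le> euler_error_bound K (1 / real r) 0 H z l"
  if r: "0 < r" "2 * K * (1 / real r) \<le> 1" and s: "0 \<le> s" "s \<le> H" for r s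
  unfolding run_def
 proof (rule piecewise_euler_error[where f="\<lambda>i u s. Gb (J i v) u" and V="\<lambda>s u. Gb (the (index_path J T s v)) u", OF \<tau> r(1) K0 r(2) order_refl])
  show "continuous_on {0..H} (\<lambda>s. Zb s v)" by (rule continuous_on_subset[OF Zc]) (auto intro: life)
  show "set_integrable lborel {0..t} (\<lambda>s. Gb (the (index_path J T s v)) (Zb s v))" if "0 \<le> t" "t \<le> H" for t
   using that by (intro Zi life)
  show "Zb t v = z + set_lebesgue_integral lborel {0..t} (\<lambda>s. Gb (the (index_path J T s v)) (Zb s v))" if "0 \<le> t" "t \<le> H" for t
   using that by (intro Ze life)
  show "Gb (the (index_path J T s v)) u = Gb (J i v) u" if "jump_time T i v \<le> ennreal s" "ennreal s < jump_time T (Suc i) v" for i s u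
   using pieced_eq[OF that, of "\<lambda>k s. J k"] by (simp add: index_path_def)
  show "AE s in lborel. 0 \<le> s \<longrightarrow> (\<forall>u u'. norm (Gb (J i v) u - Gb (J i v) u') \<le> K * norm (u - u')) \<and> norm (Gb (J i v) 0) \<le> K" if "i \<le> l" for i
  proof (intro AE_I2 impI conjI allI)
   show "norm (Gb (J i v) u - Gb (J i v) u') \<le> K * norm (u - u')" for u u'
    using Gb_Lip[OF J] mult_right_mono[OF Ki[OF that]] by (rule order_trans) simp
   show "norm (Gb (J i v) 0) \<le> K" using Gb_0[OF J] Ki[OF that] by (rule order_trans)
  qed
  show "norm (Gb (J i v) u) \<le> K * (1 + norm u)" if "i \<le> l" for i u
   using Gb_growth[OF J] mult_right_mono[OF Ki[OF that]] by (rule order_trans) simp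
  show "norm (set_lebesgue_integral lborel {real c / real r..(real c + 1) / real r} (\<lambda>s. Gb (J i v) u) - (1 / real r) *\<^sub>R Gb (J i v) u) \<le> 0" for i c u
  proof -
   have "real c / real r \<le> (real c + 1) / real r" by (intro divide_right_mono) auto
   moreover have "(real c + 1) / real r - real c / real r = 1 / real r" by (simp add: add_divide_distrib)
   ultimately show ?thesis by (simp add: set_integral_const)
  qed
 qed (use s in auto)
 obtain r0 :: nat where r0: "2 * K < real r0" using reals_Archimedean2 by blast
 show ?thesis
 proof (rule tendsto_sandwich[OF _ _ tendsto_const])
  show "(\<lambda>r. real N * L * euler_error_bound K (1 / real r) 0 H z l) \<longlonglongrightarrow> 0"
   using tendsto_mult_left[OF euler_error_bound_tendsto_0] by simp
  show "\<forall>\<^sub>F r in sequentially. \<bar>obs (\<lambda>i. Zb (t i) v) - polygon_obs r J T (Suc l) v\<bar> \<le> real N * L * euler_error_bound K (1 / real r) 0 H z l"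
   using eventually_ge_at_top[of "Suc r0"]
  proof eventually_elim
   case (elim r)
   then have "real r0 \<le> real r" "0 < real r" by auto
   then have "2 * K * (1 / real r) \<le> 1" using r0 by (simp add: divide_le_eq)
   then show ?case unfolding polygon_obs_def using elim t_range by (intro obs_diff) (auto simp: grid_def intro!: bound)
  qed
 qed simp
qed

lemma limit_gap:
 assumes sm: "semi_markov I E \<phi> G b \<pi> \<mu> x Mb J T"
  and Zm: "\<And>s. 0 \<le> s \<Longrightarrow> Zb s \<in> borel_measurable Mb"
  and Zs: "solves_upto Mb (lifetime T) (\<lambda>r v. Gb (the (index_path J T r v))) z Zb"
 shows "(\<lambda>r. gap Mb Zb r J T l) \<longlonglongrightarrow> 0"
proof -
 note s = semi_markov_facts[OF sm]
 interpret prob_space Mb by (rule s(1))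
 note [measurable] = indicators_measurable[where J=J and S=T and M'=Mb, OF s(2) s(4)]
 have [measurable]: "jump_time T m \<in> borel_measurable Mb" for m by (rule jump_time_measurable) (rule s(4))
 have [measurable]: "(\<lambda>v. obs (\<lambda>i. Zb (t i) v)) \<in> borel_measurable Mb" by (rule obs_measurable) (use t_range Zm in auto)
 let ?h = "\<lambda>r v. \<bar>obs (\<lambda>i. Zb (t i) v) - polygon_obs r J T (Suc l) v\<bar> * (before T l v * indicator {ennreal H<..} (jump_time T (Suc l) v))"
 have "(\<lambda>r. \<integral>v. ?h r v \<partial>Mb) \<longlonglongrightarrow> (\<integral>v. 0 \<partial>Mb)"
 proof (rule integral_dominated_convergence[where w="\<lambda>_. 2"])
  show "AE v in Mb. norm (?h r v) \<le> 2" for r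
  proof (rule AE_I2)
   fix v
   have "\<bar>obs (\<lambda>i. Zb (t i) v) - polygon_obs r J T (Suc l) v\<bar> \<le> 2"
    using obs_bound[of "\<lambda>i. Zb (t i) v"] obs_bound[of "\<lambda>i. snd (run r z J T (Suc l) v) (grid r i)"] unfolding polygon_obs_def by linarith
   moreover have "before T l v * indicator {ennreal H<..} (jump_time T (Suc l) v) \<le> (1::real)" "0 \<le> before T l v * (indicator {ennreal H<..} (jump_time T (Suc l) v) :: real)"
    by (auto simp: before_def split: split_indicator)
   ultimately show "norm (?h r v) \<le> 2" using mult_mono[of "\<bar>obs (\<lambda>i. Zb (t i) v) - polygon_obs r J T (Suc l) v\<bar>" 2 "before T l v * indicator {ennreal H<..} (jump_time T (Suc l) v)" 1]
    by (simp add: abs_mult before_def)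
  qed
  show "AE v in Mb. (\<lambda>r. ?h r v) \<longlonglongrightarrow> 0"
   using Zs[unfolded solves_upto_def] AE_space
  proof eventually_elim
   case (elim v)
   show ?case
   proof (cases "jump_time T l v < ennreal H \<and> ennreal H < jump_time T (Suc l) v")
    case True
    have "(\<lambda>r. \<bar>obs (\<lambda>i. Zb (t i) v) - polygon_obs r J T (Suc l) v\<bar>) \<longlonglongrightarrow> 0"
     by (rule limit_polygon_tendsto) (use True elim measurable_space[OF s(2)] in auto)
    then show ?thesis by (rule tendsto_mult_left_zero)
   next
    case False
    then have "before T l v * indicator {ennreal H<..} (jump_time T (Suc l) v) = (0::real)" by (auto simp: before_def)
    then show ?thesis by (simp only: mult_zero_right tendsto_const)
   qed
  qed
 qed simp_all
 then show ?thesis by (simp add: gap_def)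
qed

text \<open>If \<open>\<tau>\<^sub>m \<noteq> H\<close>, the distance from \<open>\<tau>\<^sub>m\<close> to \<open>H\<close> eventually exceeds \<open>m\<close> cells.\<close>

lemma limit_edge:
 assumes sm: "semi_markov I E \<phi> G b \<pi> \<mu> x Mb J T"
 shows "(\<lambda>r. \<integral>v. edge r J T m v \<partial>Mb) \<longlonglongrightarrow> 0"
proof -
 note s = semi_markov_facts[OF sm]
 interpret prob_space Mb by (rule s(1))
 note [measurable] = indicators_measurable[where J=J and S=T and M'=Mb, OF s(2) s(4)]
 have "(\<lambda>r. \<integral>v. edge r J T m v \<partial>Mb) \<longlonglongrightarrow> (\<integral>v. 0 \<partial>Mb)"
 proof (rule integral_dominated_convergence[where w="\<lambda>_. 1"])
  show "AE v in Mb. norm (edge r J T m v) \<le> 1" for r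
   by (rule AE_I2) (simp add: edge_def split: split_indicator)
  show "AE v in Mb. (\<lambda>r. edge r J T m v) \<longlonglongrightarrow> 0"
   using AE_jump_time_neq[OF sm H_pos, of m]
  proof eventually_elim
   case (elim v)
   show ?case
   proof (cases "jump_time T m v < \<top>")
    case True
    define y where "y = enn2real (jump_time T m v)"
    have "jump_time T m v = ennreal y" using True by (simp add: y_def)
    then have yH: "0 < \<bar>y - H\<bar>" using elim by auto
    obtain r0 :: nat where r0: "real m / \<bar>y - H\<bar> < real r0" using reals_Archimedean2 by blast
    have "\<forall>\<^sub>F r in sequentially. 0 = edge r J T m v"
     using eventually_ge_at_top[of "Suc r0"]
    proof eventually_elim
     case (elim r)
     then have r: "0 < r" "real m / \<bar>y - H\<bar> < real r" using r0 by auto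
     then have "real m < real r * \<bar>y - H\<bar>" using yH by (simp add: divide_less_eq)
     moreover have "real r * \<bar>y - H\<bar> = \<bar>real r * y - H * real r\<bar>"
     proof -
      have "real r * \<bar>y - H\<bar> = \<bar>real r * (y - H)\<bar>" by (simp add: abs_mult)
      then show ?thesis by (simp only: right_diff_distrib mult.commute[of H])
     qed
     ultimately have "real m < \<bar>real r * y - H * real r\<bar>" by simp
     then have "real (clock r J T m v) \<notin> {H * real r - real m..H * real r}"
      using clock_bounds[OF r(1) True, of J] unfolding y_def[symmetric] by auto
     then show ?case by (simp add: edge_def)
    qed
    then show ?thesis by (rule Lim_transform_eventually[OF tendsto_const])
   qed (simp add: edge_def)
  qed
 qed simp_all
 then show ?thesis by simp
qed

end

context observed_model begin

text \<open>A velocity is replaced by the nearest point of the net \<open>A\<close>, which costs at most \<open>2 K \<delta> / r \<le> \<eta>\<close> by the Lipschitz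
 property of both the field and its average.\<close>

lemma accelerated_polygon_error:
 fixes n :: nat and Y :: "nat \<Rightarrow> 'w \<Rightarrow> 'e" and W :: "nat \<Rightarrow> 'w \<Rightarrow> 'o" and U :: "nat \<Rightarrow> 'w \<Rightarrow> real"
 defines "S \<equiv> piece_len G b X n W U" and "\<xi> \<equiv> accel_path G b X n W U"
 assumes Y: "\<And>i. Y i w \<in> space E" and W: "\<And>i. W i w \<in> space Om"
  and cFK: "\<And>i. i \<le> l \<Longrightarrow> cF (Y i w) \<le> K" and good: "\<And>i. i \<le> l \<Longrightarrow> (Y i w, W i w) \<notin> badE n K r Q \<eta> A"
  and Q: "H * real r \<le> real Q"
  and A: "\<And>v. norm v \<le> (1 + norm z) * exp (K * H) \<Longrightarrow> \<exists>a\<in>A. norm (v - a) \<le> \<delta>" and \<delta>: "2 * K * (1 / real r) * \<delta> \<le> \<eta>"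
  and r: "0 < r" and K: "0 \<le> K" "2 * K * (1 / real r) \<le> 1" and eta: "0 \<le> \<eta>"
  and \<tau>: "jump_time S l w < ennreal H" "ennreal H < jump_time S (Suc l) w"
  and Zc: "continuous_on {s. 0 \<le> s \<and> ennreal s < lifetime S w} (\<lambda>s. Z s w)"
  and Zi: "\<And>s. 0 \<le> s \<Longrightarrow> ennreal s < lifetime S w \<Longrightarrow> set_integrable lborel {0..s} (\<lambda>u. slow_field F \<phi> \<xi> u w (Z u w))"
  and Ze: "\<And>s. 0 \<le> s \<Longrightarrow> ennreal s < lifetime S w \<Longrightarrow> Z s w = z + set_lebesgue_integral lborel {0..s} (\<lambda>u. slow_field F \<phi> \<xi> u w (Z u w))"
  and s: "0 \<le> s" "s \<le> H"
 shows "norm (Z s w - snd (run r z (\<lambda>k w. \<phi> (Y k w)) S (Suc l) w) (nat \<lfloor>s * real r\<rfloor>))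
  \<le> euler_error_bound K (1 / real r) (2 * \<eta>) H z l"
proof -
 define f where "f i v u = Ft v (XX (real n * u) (W i w))" for i v u
 have m[measurable]: "(\<lambda>u. XX (real n * u) (W i w)) \<in> borel \<rightarrow>\<^sub>M E" for i
  by (rule XX_compose) (use W in auto)
 have fm[measurable]: "f i v \<in> borel_measurable borel" for i v
  unfolding f_def[abs_def] by measurable
 have nb: "\<not> bad n K r Q \<eta> A (\<phi> (Y i w)) (W i w)" if "i \<le> l" for i
  using good[OF that] cFK[OF that] Y W by (auto simp: badE_def space_pair_measure)
 have small: "AE u in lborel. 0 \<le> u \<longrightarrow> cF (XX (real n * u) (W i w)) \<le> K" if "i \<le> l" for i
 proof -
  have "(\<integral>\<^sup>+u. indicator {0..} u * indicator {K<..} (cF (XX (real n * u) (W i w))) \<partial>lborel) = 0"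
   using nb[OF that] by (simp add: bad_def)
  moreover have "(\<lambda>u. indicator {0..} u * indicator {K<..} (cF (XX (real n * u) (W i w))) :: ennreal) \<in> borel_measurable lborel"
   by measurable
  ultimately have "AE u in lborel. indicator {0..} u * indicator {K<..} (cF (XX (real n * u) (W i w))) = (0::ennreal)"
   by (simp add: nn_integral_0_iff_AE)
  then show ?thesis by eventually_elim (auto simp: indicator_def not_less split: if_splits)
 qed
 have Lip: "AE u in lborel. 0 \<le> u \<longrightarrow> (\<forall>v v'. norm (f i v u - f i v' u) \<le> K * norm (v - v')) \<and> norm (f i 0 u) \<le> K" if "i \<le> l" for i
  using small[OF that]
 proof eventually_elim
  case (elim u)
  show ?case
  proof (intro impI conjI allI)
   assume u: "0 \<le> u"
   have e: "XX (real n * u) (W i w) \<in> space E" by (rule XX_space[OF W])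
   show "norm (f i v u - f i v' u) \<le> K * norm (v - v')" for v v'
    using Ft_Lip[OF e, of v v'] mult_right_mono[of "cF (XX (real n * u) (W i w))" K "norm (v - v')"] elim u
    unfolding f_def by auto
   show "norm (f i 0 u) \<le> K" using Ft_0[OF e] elim u unfolding f_def by auto
  qed
 qed
 have cKi: "cK (\<phi> (Y i w)) \<le> K" if "i \<le> l" for i using cFK[OF that] by (simp add: cF_def)
 have life: "ennreal u < lifetime S w" if "u \<le> H" for u
  using ennreal_leI[OF that] order.strict_trans2[OF \<tau>(2) jump_time_le_lifetime] by (rule order.strict_trans1)
 have int: "set_integrable lborel {\<alpha>..\<beta>} (f i v)" if "i \<le> l" "0 \<le> \<alpha>" "\<alpha> \<le> \<beta>" for i v \<alpha> \<beta>
  unfolding set_integrable_def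
 proof (rule Bochner_Integration.integrable_bound[where f="\<lambda>u. K * (1 + norm v) * indicator {\<alpha>..\<beta>} u"])
  show "integrable lborel (\<lambda>u. K * (1 + norm v) * indicator {\<alpha>..\<beta>} u)" using that by simp
  show "AE u in lborel. norm (indicator {\<alpha>..\<beta>} u *\<^sub>R f i v u) \<le> norm (K * (1 + norm v) * indicator {\<alpha>..\<beta>} u)"
   using Lip[OF that(1)]
  proof eventually_elim
   case (elim u)
   show ?case
   proof (cases "u \<in> {\<alpha>..\<beta>}")
    case True
    then have "0 \<le> u" using that by auto
    then have "norm (f i v u - f i 0 u) \<le> K * norm (v - 0)" "norm (f i 0 u) \<le> K" using elim by blast+
    then have "norm (f i v u) \<le> K * (1 + norm v)" by (rule norm_growth[of "\<lambda>v. f i v u"])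
    then show ?thesis using True K by simp
   qed simp
  qed
 qed measurable
 show ?thesis unfolding run_def
 proof (rule piecewise_euler_error[where f=f and V="\<lambda>s v. slow_field F \<phi> \<xi> s w v", OF \<tau> r K _ _ _ _ _ _ _ _ _ s])
  show "0 \<le> 2 * \<eta>" using eta by simp
  show "continuous_on {0..H} (\<lambda>s. Z s w)" by (rule continuous_on_subset[OF Zc]) (auto intro: life)
  show "set_integrable lborel {0..t} (\<lambda>s. slow_field F \<phi> \<xi> s w (Z s w))" if "0 \<le> t" "t \<le> H" for t
   using that by (intro Zi life)
  show "Z t w = z + set_lebesgue_integral lborel {0..t} (\<lambda>s. slow_field F \<phi> \<xi> s w (Z s w))" if "0 \<le> t" "t \<le> H" for t
   using that by (intro Ze life)
  show "slow_field F \<phi> \<xi> u w v = f i v (u - enn2real (jump_time S i w))"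
   if "0 \<le> u" "jump_time S i w \<le> ennreal u" "ennreal u < jump_time S (Suc i) w" for i u v
  proof -
   have "enn2real (jump_time S i w) \<le> u" using that by (intro enn2real_leI) auto
   then have "XX (real n * (u - enn2real (jump_time S i w))) (W i w) = X (real n * (u - enn2real (jump_time S i w))) (W i w)"
    by (intro XX_eq) auto
   moreover have "\<xi> u w = Some (X (real n * (u - enn2real (jump_time S i w))) (W i w))"
    unfolding \<xi>_def accel_path_def S_def[symmetric] by (rule pieced_eq[OF that(2,3)])
   ultimately show ?thesis by (simp add: slow_field_def f_def Ft_def)
  qed
  show "f i v \<in> borel_measurable borel" for i v by (rule fm)
  show "AE u in lborel. 0 \<le> u \<longrightarrow> (\<forall>v v'. norm (f i v u - f i v' u) \<le> K * norm (v - v')) \<and> norm (f i 0 u) \<le> K" if "i \<le> l" for i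
   by (rule Lip[OF that])
  show "norm (Gb (\<phi> (Y i w)) v) \<le> K * (1 + norm v)" if "i \<le> l" for i v
   using Gb_growth[OF phi_space[OF Y]] mult_right_mono[OF cKi[OF that]] by (rule order_trans) simp
  show "norm (set_lebesgue_integral lborel {real c / real r..(real c + 1) / real r} (f i v) - (1 / real r) *\<^sub>R Gb (\<phi> (Y i w)) v) \<le> 2 * \<eta>"
   if i: "i \<le> l" and c: "(real c + 1) / real r \<le> H" and v: "norm v \<le> (1 + norm z) * exp (K * H)" for i c v
  proof -
   let ?j = "\<phi> (Y i w)" and ?\<alpha> = "real c / real r" and ?h = "1 / real r"
   have \<beta>: "(real c + 1) / real r = ?\<alpha> + ?h" by (simp add: add_divide_distrib)
   have h: "0 < ?h" "0 \<le> ?\<alpha>" "?\<alpha> \<le> ?\<alpha> + ?h" using r by auto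
   from A[OF v] obtain a where a: "a \<in> A" "norm (v - a) \<le> \<delta>" by blast
   have "real c + 1 \<le> H * real r" using c r by (simp add: divide_le_eq)
   then have "c < Q" using Q by linarith
   then have pe: "piece_error n ?\<alpha> ?h a ?j (W i w) \<le> \<eta>" using nb[OF i] a by (auto simp: bad_def not_less)
   let ?I = "\<lambda>v. set_lebesgue_integral lborel {?\<alpha>..?\<alpha> + ?h} (f i v)"
   have pe': "norm (?I a - ?h *\<^sub>R Gb ?j a) \<le> \<eta>" using pe unfolding piece_error_def f_def[symmetric] .
   have "norm (set_lebesgue_integral lborel {?\<alpha>..?\<alpha> + ?h} (\<lambda>u. f i v u - f i a u)) \<le> (K * norm (v - a)) * (?\<alpha> + ?h - ?\<alpha>)"
   proof (rule norm_set_integral_le[OF h(3) set_integral_diff(1)[OF int int]])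
    show "AE u in lborel. u \<in> {?\<alpha>..?\<alpha> + ?h} \<longrightarrow> norm (f i v u - f i a u) \<le> K * norm (v - a)"
     using Lip[OF i]
    proof eventually_elim
     case (elim u)
     show ?case
     proof
      assume u: "u \<in> {?\<alpha>..?\<alpha> + ?h}"
      have "0 \<le> u" by (rule order_trans[OF h(2)]) (use u in simp)
      then show "norm (f i v u - f i a u) \<le> K * norm (v - a)" using elim by blast
     qed
    qed
   qed (use i h in auto)
   also have "set_lebesgue_integral lborel {?\<alpha>..?\<alpha> + ?h} (\<lambda>u. f i v u - f i a u) = ?I v - ?I a"
    by (rule set_integral_diff(2)[OF int int]) (use i h in auto)
   finally have d1: "norm (?I v - ?I a) \<le> K * norm (v - a) * ?h" by simp
   have "norm (?h *\<^sub>R Gb ?j a - ?h *\<^sub>R Gb ?j v) = ?h * norm (Gb ?j a - Gb ?j v)"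
    unfolding scaleR_diff_right[symmetric] norm_scaleR using h by simp
   also have "\<dots> \<le> ?h * (K * norm (a - v))"
    using Gb_Lip[OF phi_space[OF Y[of i]], of a v] mult_right_mono[OF cKi[OF i], of "norm (a - v)"] h
    by (intro mult_left_mono) auto
   finally have d2: "norm (?h *\<^sub>R Gb ?j a - ?h *\<^sub>R Gb ?j v) \<le> K * norm (v - a) * ?h"
    by (simp add: norm_minus_commute mult.commute)
   have d3: "K * norm (v - a) * ?h \<le> K * \<delta> * ?h" using a(2) K h by (intro mult_right_mono mult_left_mono) auto
   have "norm (?I v - ?h *\<^sub>R Gb ?j v) = norm ((?I v - ?I a) + (?I a - ?h *\<^sub>R Gb ?j a) + (?h *\<^sub>R Gb ?j a - ?h *\<^sub>R Gb ?j v))"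
    by (rule arg_cong[of _ _ norm]) simp
   also have "\<dots> \<le> norm (?I v - ?I a) + norm (?I a - ?h *\<^sub>R Gb ?j a) + norm (?h *\<^sub>R Gb ?j a - ?h *\<^sub>R Gb ?j v)"
    by (meson norm_triangle_ineq add_right_mono order_trans)
   also have "\<dots> \<le> K * \<delta> * ?h + \<eta> + K * \<delta> * ?h" using d1 d2 d3 pe' by linarith
   also have "\<dots> \<le> 2 * \<eta>"
   proof -
    have "K * \<delta> * ?h + K * \<delta> * ?h = 2 * K * (1 / real r) * \<delta>" by (simp add: algebra_simps)
    then show ?thesis using \<delta> by linarith
   qed
   finally show ?thesis unfolding \<beta> .
  qed
 qed
qed

lemma accelerated_gap_bound:
 assumes acc: "accelerated E Om X P G b \<pi> n x M Y W U"
  and Zm: "\<And>i. i \<in> {1..N} \<Longrightarrow> Z (t i) \<in> borel_measurable M"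
  and Zs: "solves_upto M (lifetime (piece_len G b X n W U)) (slow_field F \<phi> (accel_path G b X n W U)) z Z"
  and Q: "H * real r \<le> real Q"
  and A: "\<And>v. norm v \<le> (1 + norm z) * exp (K * H) \<Longrightarrow> \<exists>a\<in>A. norm (v - a) \<le> \<delta>" and \<delta>: "2 * K * (1 / real r) * \<delta> \<le> \<eta>"
  and finA: "finite A"
  and r: "0 < r" and K: "0 \<le> K" "2 * K * (1 / real r) \<le> 1" and eta: "0 \<le> \<eta>"
 defines "S \<equiv> piece_len G b X n W U"
 shows "ennreal (gap M Z r (\<lambda>k w. \<phi> (Y k w)) S l) \<le>
  ennreal (real N * L * euler_error_bound K (1 / real r) (2 * \<eta>) H z l) +
  2 * (\<Sum>i\<le>l. (\<integral>\<^sup>+w. indicator {w\<in>space M. jump_time S i w < ennreal H} w * indicator {K<..} (cF (Y i w)) \<partial>M)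
   + (\<integral>\<^sup>+w. indicator {w\<in>space M. jump_time S i w < ennreal H} w * indicator (badE n K r Q \<eta> A) (Y i w, W i w) \<partial>M))"
proof -
 note a = accelerated_facts[OF acc]
 interpret M: prob_space M by (rule a(1))
 have Jm: "(\<lambda>w. \<phi> (Y k w)) \<in> M \<rightarrow>\<^sub>M I" for k by (rule measurable_compose[OF a(2) phi_measurable])
 have Sm: "S k \<in> borel_measurable M" for k unfolding S_def by (rule piece_len_measurable[OF acc])
 note [measurable] = indicators_measurable[where J="\<lambda>k w. \<phi> (Y k w)" and S=S and M'=M, OF Jm Sm]
 note [measurable] = a(2,4)
 have jm[measurable]: "jump_time S m \<in> borel_measurable M" for m by (rule jump_time_measurable) (rule Sm)
 have [measurable]: "(\<lambda>w. obs (\<lambda>i. Z (t i) w)) \<in> borel_measurable M" by (rule obs_measurable) (rule Zm)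
 let ?h = "\<lambda>w. \<bar>obs (\<lambda>i. Z (t i) w) - polygon_obs r (\<lambda>k w. \<phi> (Y k w)) S (Suc l) w\<bar> * (before S l w * indicator {ennreal H<..} (jump_time S (Suc l) w))"
 let ?c = "real N * L * euler_error_bound K (1 / real r) (2 * \<eta>) H z l"
 let ?a = "\<lambda>i w. indicator {w\<in>space M. jump_time S i w < ennreal H} w * indicator {K<..} (cF (Y i w)) :: ennreal"
 let ?b = "\<lambda>i w. indicator {w\<in>space M. jump_time S i w < ennreal H} w * indicator (badE n K r Q \<eta> A) (Y i w, W i w) :: ennreal"
 have h0: "0 \<le> ?h w" for w by (simp add: before_def)
 have h2: "?h w \<le> 2" for w
 proof -
  have "\<bar>obs (\<lambda>i. Z (t i) w) - polygon_obs r (\<lambda>k w. \<phi> (Y k w)) S (Suc l) w\<bar> \<le> 2"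
   using obs_bound[of "\<lambda>i. Z (t i) w"] obs_bound[of "\<lambda>i. snd (run r z (\<lambda>k w. \<phi> (Y k w)) S (Suc l) w) (grid r i)"]
   unfolding polygon_obs_def by linarith
  moreover have "before S l w * indicator {ennreal H<..} (jump_time S (Suc l) w) \<le> (1::real)"
   by (auto simp: before_def split: split_indicator)
  ultimately have "?h w \<le> 2 * 1" by (rule mult_mono) (simp_all add: before_def)
  then show ?thesis by simp
 qed
 have am[measurable]: "?a i \<in> borel_measurable M" for i by measurable
 have bm[measurable]: "?b i \<in> borel_measurable M" for i
 proof -
  have "(\<lambda>w. indicator (badE n K r Q \<eta> A) (Y i w, W i w) :: ennreal) \<in> borel_measurable M"
   by (rule measurable_compose[OF measurable_Pair[OF a(2) a(4)] borel_measurable_indicator[OF badE_sets[OF finA]]])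
  then show ?thesis by measurable
 qed
 have i: "integrable M ?h"
 proof (rule integrable_bounded[OF a(1), where B=2])
  show "\<bar>?h w\<bar> \<le> 2" for w using h0[of w] h2[of w] by (simp only: abs_of_nonneg)
 qed measurable
 have "ennreal (gap M Z r (\<lambda>k w. \<phi> (Y k w)) S l) = (\<integral>\<^sup>+w. ennreal (?h w) \<partial>M)"
  unfolding gap_def by (rule nn_integral_eq_integral[OF i, symmetric]) (use h0 in auto)
 also have "\<dots> \<le> (\<integral>\<^sup>+w. ennreal ?c + 2 * (\<Sum>i\<le>l. ?a i w + ?b i w) \<partial>M)"
 proof (rule nn_integral_mono_AE)
  show "AE w in M. ennreal (?h w) \<le> ennreal ?c + 2 * (\<Sum>i\<le>l. ?a i w + ?b i w)"
   using Zs[unfolded solves_upto_def] AE_space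
  proof eventually_elim
   case (elim w)
   have Yw: "Y i w \<in> space E" and Ww: "W i w \<in> space Om" for i
    using elim(2) measurable_space[OF a(2)] measurable_space[OF a(4)] by auto
   show ?case
   proof (cases "jump_time S l w < ennreal H \<and> ennreal H < jump_time S (Suc l) w")
    case False
    then have "before S l w * indicator {ennreal H<..} (jump_time S (Suc l) w) = (0::real)" by (auto simp: before_def)
    then show ?thesis by (simp only: mult_zero_right ennreal_0 zero_le)
   next
    case ev: True
    show ?thesis
    proof (cases "\<exists>i\<le>l. K < cF (Y i w) \<or> (Y i w, W i w) \<in> badE n K r Q \<eta> A")
     case True
     then obtain i where i: "i \<le> l" "K < cF (Y i w) \<or> (Y i w, W i w) \<in> badE n K r Q \<eta> A" by blast
     have "jump_time S i w < ennreal H" using jump_time_mono[OF i(1)] ev by (meson order.strict_trans1)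
     then have "1 \<le> ?a i w + ?b i w" using i(2) elim(2) by (auto simp: indicator_def)
     also have "\<dots> \<le> (\<Sum>i\<le>l. ?a i w + ?b i w)"
      using i(1) by (intro member_le_sum[of i "{..l}" "\<lambda>i. ?a i w + ?b i w"]) auto
     finally have "2 * 1 \<le> 2 * (\<Sum>i\<le>l. ?a i w + ?b i w)" by (rule mult_left_mono) simp
     moreover have "ennreal (?h w) \<le> 2 * 1" using ennreal_leI[OF h2[of w]] by simp
     ultimately have "ennreal (?h w) \<le> 2 * (\<Sum>i\<le>l. ?a i w + ?b i w)" by (rule order_trans[rotated])
     then show ?thesis by (rule order_trans) simp
    next
     case False
     then have g: "\<And>i. i \<le> l \<Longrightarrow> cF (Y i w) \<le> K" "\<And>i. i \<le> l \<Longrightarrow> (Y i w, W i w) \<notin> badE n K r Q \<eta> A"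
      by (auto simp: not_less)
     have err: "norm (Z s w - snd (run r z (\<lambda>k w. \<phi> (Y k w)) S (Suc l) w) (nat \<lfloor>s * real r\<rfloor>))
       \<le> euler_error_bound K (1 / real r) (2 * \<eta>) H z l" if "0 \<le> s" "s \<le> H" for s
      unfolding S_def
      by (rule accelerated_polygon_error[where Y=Y and W=W and U=U and n=n and w=w and A=A and Z=Z and s=s, OF Yw Ww g Q A \<delta> r K eta ev[THEN conjunct1, unfolded S_def] ev[THEN conjunct2, unfolded S_def] _ _ _ that])
       (use elim(1) in auto)
     have "\<bar>obs (\<lambda>i. Z (t i) w) - polygon_obs r (\<lambda>k w. \<phi> (Y k w)) S (Suc l) w\<bar> \<le> ?c"
      unfolding polygon_obs_def by (rule obs_diff) (use t_range err in \<open>simp add: grid_def\<close>)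
     moreover have "before S l w * indicator {ennreal H<..} (jump_time S (Suc l) w) = (1::real)"
      using ev by (simp add: before_def)
     ultimately have "?h w \<le> ?c" by (simp only: mult_1_right)
     then have "ennreal (?h w) \<le> ennreal ?c" by (rule ennreal_leI)
     then show ?thesis by (rule order_trans) simp
    qed
   qed
  qed
 qed
 also have "\<dots> = ennreal ?c + 2 * (\<Sum>i\<le>l. (\<integral>\<^sup>+w. ?a i w \<partial>M) + (\<integral>\<^sup>+w. ?b i w \<partial>M))"
 proof -
  have "(\<integral>\<^sup>+w. ennreal ?c + 2 * (\<Sum>i\<le>l. ?a i w + ?b i w) \<partial>M) = (\<integral>\<^sup>+w. ennreal ?c \<partial>M) + (\<integral>\<^sup>+w. 2 * (\<Sum>i\<le>l. ?a i w + ?b i w) \<partial>M)"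
   by (rule nn_integral_add) measurable
  also have "(\<integral>\<^sup>+w. 2 * (\<Sum>i\<le>l. ?a i w + ?b i w) \<partial>M) = 2 * (\<integral>\<^sup>+w. (\<Sum>i\<le>l. ?a i w + ?b i w) \<partial>M)"
   by (rule nn_integral_cmult) measurable
  also have "(\<integral>\<^sup>+w. (\<Sum>i\<le>l. ?a i w + ?b i w) \<partial>M) = (\<Sum>i\<le>l. \<integral>\<^sup>+w. ?a i w + ?b i w \<partial>M)"
   by (rule nn_integral_sum) measurable
  also have "\<dots> = (\<Sum>i\<le>l. (\<integral>\<^sup>+w. ?a i w \<partial>M) + (\<integral>\<^sup>+w. ?b i w \<partial>M))"
   by (intro sum.cong refl nn_integral_add am bm)
  finally show ?thesis by (simp add: M.emeasure_space_1)
 qed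
 finally show ?thesis .
qed

text \<open>Order of choice: first \<open>K\<close> by tightness, then the mesh, which makes the discretisation error small, then \<open>\<eta>\<close> and the
 net, which may depend on both, and last \<open>n\<close>.\<close>

lemma accelerated_gap:
 assumes acc: "\<And>n. 1 \<le> n \<Longrightarrow> accelerated E Om X P G b \<pi> n x (M n) (Y n) (W n) (U n)"
  and x: "x \<in> space E" and sm: "semi_markov I E \<phi> G b \<pi> \<mu> x Mb J T"
  and Zm: "\<And>n i. 1 \<le> n \<Longrightarrow> i \<in> {1..N} \<Longrightarrow> Z n (t i) \<in> borel_measurable (M n)"
  and Zs: "\<And>n. 1 \<le> n \<Longrightarrow> solves_upto (M n) (lifetime (piece_len G b X n (W n) (U n)))
    (slow_field F \<phi> (accel_path G b X n (W n) (U n))) z (Z n)"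
  and e: "0 < e"
 shows "\<forall>\<^sub>F r in sequentially. \<forall>\<^sub>F n in sequentially.
  gap (M n) (Z n) r (\<lambda>k w. \<phi> (Y n k w)) (piece_len G b X n (W n) (U n)) l \<le> e"
proof -
 let ?S = "\<lambda>n. piece_len G b X n (W n) (U n)"
 define e1 where "e1 = e / (8 * real (Suc l))"
 have e10: "0 \<le> e1" using e by (simp add: e1_def)
 have e1: "0 < ennreal e1" using e by (simp add: e1_def)
 have "\<forall>i. \<exists>K::nat. \<forall>\<^sub>F n in sequentially.
  (\<integral>\<^sup>+w. indicator {w\<in>space (M n). jump_time (?S n) i w < ennreal H} w * indicator {real K<..} (cF (Y n i w)) \<partial>M n) < ennreal e1"
  using tight[OF acc x sm e1] by blast
 from choice[OF this] obtain Kf :: "nat \<Rightarrow> nat" where Kf: "\<And>i. \<forall>\<^sub>F n in sequentially.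
  (\<integral>\<^sup>+w. indicator {w\<in>space (M n). jump_time (?S n) i w < ennreal H} w * indicator {real (Kf i)<..} (cF (Y n i w)) \<partial>M n) < ennreal e1"
  by blast
 define K where "K = real (\<Sum>i\<le>l. Kf i)"
 have K0: "0 \<le> K" unfolding K_def by (rule of_nat_0_le_iff)
 have KK: "real (Kf i) \<le> K" if "i \<le> l" for i
  unfolding K_def of_nat_le_iff using that by (intro member_le_sum) auto
 have K: "\<forall>\<^sub>F n in sequentially.
  (\<integral>\<^sup>+w. indicator {w\<in>space (M n). jump_time (?S n) i w < ennreal H} w * indicator {K<..} (cF (Y n i w)) \<partial>M n) < ennreal e1"
  if i: "i \<le> l" for i
  using Kf[of i]
 proof eventually_elim
  case (elim n)
  have "(\<integral>\<^sup>+w. indicator {w\<in>space (M n). jump_time (?S n) i w < ennreal H} w * indicator {K<..} (cF (Y n i w)) \<partial>M n)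
   \<le> (\<integral>\<^sup>+w. indicator {w\<in>space (M n). jump_time (?S n) i w < ennreal H} w * indicator {real (Kf i)<..} (cF (Y n i w)) \<partial>M n)"
   using KK[OF i] by (intro nn_integral_mono mult_left_mono) (auto simp: indicator_def)
  then show ?case using elim by (rule le_less_trans)
 qed
 have te: "(\<lambda>r. real N * L * euler_error_bound K (1 / real r) 0 H z l) \<longlonglongrightarrow> 0"
  using tendsto_mult_left[OF euler_error_bound_tendsto_0] by simp
 obtain r0 :: nat where r0: "2 * K < real r0" using reals_Archimedean2 by blast
 have "0 < e / 4" using e by simp
 from order_tendstoD(2)[OF te this] eventually_ge_at_top[of "Suc r0"]
 show ?thesis
 proof eventually_elim
  case (elim r)
  then have r: "0 < r" and "real r0 \<le> real r" "0 < real r" by auto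
  then have Kr: "2 * K * (1 / real r) \<le> 1" using r0 by (simp add: divide_le_eq)
  define C where "C = real N * L * (exp (2 * K * (H + (real l + 1) * (1 / real r))) * (H / (1 / real r)))"
  have C: "0 \<le> C" unfolding C_def using L_nonneg H_pos by (intro mult_nonneg_nonneg divide_nonneg_nonneg) auto
  define \<eta> where "\<eta> = e / (8 * (C + 1))"
  have eta: "0 < \<eta>" using e C by (simp add: \<eta>_def)
  have "real N * L * euler_error_bound K (1 / real r) (2 * \<eta>) H z l
   = real N * L * euler_error_bound K (1 / real r) 0 H z l + C * (2 * \<eta>)"
   by (subst euler_error_bound_eta) (simp only: C_def distrib_left mult.assoc)
  also have "C * (2 * \<eta>) \<le> e / 4"
  proof -
   have "C * (2 * \<eta>) \<le> (C + 1) * (2 * \<eta>)" using eta by (intro mult_right_mono) auto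
   also have "\<dots> = e / 4" using C by (simp add: \<eta>_def field_simps)
   finally show ?thesis .
  qed
  finally have err: "real N * L * euler_error_bound K (1 / real r) (2 * \<eta>) H z l \<le> e / 2" using elim by linarith
  define \<delta> where "\<delta> = \<eta> / (2 * K * (1 / real r) + 1)"
  have den: "0 \<le> 2 * K * (1 / real r)" using K0 by simp
  have dpos: "0 < \<delta>" unfolding \<delta>_def using eta den by (intro divide_pos_pos) linarith+
  have "(2 * K * (1 / real r) + 1) * \<delta> = \<eta>" proof -
   have "2 * K * (1 / real r) + 1 \<noteq> 0" using den by linarith
   then show ?thesis unfolding \<delta>_def by (simp only: times_divide_eq_right nonzero_mult_div_cancel_left not_False_eq_True)
  qed
  then have "2 * K * (1 / real r) * \<delta> + \<delta> = \<eta>" by (simp only: distrib_right mult_1_left)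
  then have d: "2 * K * (1 / real r) * \<delta> \<le> \<eta>" using dpos by linarith
  have "compact (cball (0::real^'d) ((1 + norm z) * exp (K * H)))" by simp
  then have "\<exists>A. finite A \<and> cball (0::real^'d) ((1 + norm z) * exp (K * H)) \<subseteq> (\<Union>a\<in>A. ball a \<delta>)"
   using dpos by (simp only: compact_eq_totally_bounded)
  then obtain A where A: "finite A" "cball (0::real^'d) ((1 + norm z) * exp (K * H)) \<subseteq> (\<Union>a\<in>A. ball a \<delta>)" by blast
  have net: "\<exists>a\<in>A. norm (v - a) \<le> \<delta>" if "norm v \<le> (1 + norm z) * exp (K * H)" for v
  proof -
   have "v \<in> cball 0 ((1 + norm z) * exp (K * H))" using that by simp
   then obtain a where "a \<in> A" "dist a v < \<delta>" using A(2) by (meson UN_E mem_ball subsetD)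
   then show ?thesis by (intro bexI[of _ a]) (simp_all add: dist_norm norm_minus_commute less_imp_le)
  qed
  define Q where "Q = nat \<lceil>H * real r\<rceil>"
  have Q: "H * real r \<le> real Q" unfolding Q_def by linarith
  have B: "\<forall>\<^sub>F n in sequentially.
   (\<integral>\<^sup>+w. indicator {w\<in>space (M n). jump_time (?S n) i w < ennreal H} w * indicator (badE n K r Q \<eta> A) (Y n i w, W n i w) \<partial>M n) < ennreal e1" for i
   by (rule order_tendstoD(2)[OF bad_vanish[OF acc x sm r eta A(1)] e1])
  have "\<forall>\<^sub>F n in sequentially. \<forall>i\<in>{..l}.
   (\<integral>\<^sup>+w. indicator {w\<in>space (M n). jump_time (?S n) i w < ennreal H} w * indicator {K<..} (cF (Y n i w)) \<partial>M n) < ennreal e1 \<and>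
   (\<integral>\<^sup>+w. indicator {w\<in>space (M n). jump_time (?S n) i w < ennreal H} w * indicator (badE n K r Q \<eta> A) (Y n i w, W n i w) \<partial>M n) < ennreal e1"
   using K B by (intro eventually_ball_finite ballI eventually_conj) auto
  then show ?case using eventually_ge_at_top[of 1]
  proof eventually_elim
   case (elim n)
   have "ennreal (gap (M n) (Z n) r (\<lambda>k w. \<phi> (Y n k w)) (?S n) l) \<le>
    ennreal (real N * L * euler_error_bound K (1 / real r) (2 * \<eta>) H z l) +
    2 * (\<Sum>i\<le>l. (\<integral>\<^sup>+w. indicator {w\<in>space (M n). jump_time (?S n) i w < ennreal H} w * indicator {K<..} (cF (Y n i w)) \<partial>M n)
     + (\<integral>\<^sup>+w. indicator {w\<in>space (M n). jump_time (?S n) i w < ennreal H} w * indicator (badE n K r Q \<eta> A) (Y n i w, W n i w) \<partial>M n))"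
    by (rule accelerated_gap_bound[OF acc[OF elim(2)] Zm[OF elim(2)] Zs[OF elim(2)] Q net d A(1) r K0 Kr less_imp_le[OF eta]])
   also have "\<dots> \<le> ennreal (e / 2) + 2 * (\<Sum>i\<le>l. ennreal e1 + ennreal e1)"
    using elim(1) by (intro add_mono ennreal_leI err mult_left_mono sum_mono) (auto intro: less_imp_le)
   also have "(\<Sum>i\<le>l. ennreal e1 + ennreal e1) = (\<Sum>i\<le>l. ennreal (e1 + e1))"
    by (simp only: ennreal_plus[OF e10 e10])
   also have "\<dots> = ennreal (\<Sum>i\<le>l. e1 + e1)" using e by (intro sum_ennreal) (simp add: e1_def)
   also have "(\<Sum>i\<le>l. e1 + e1) = e / 4"
   proof -
    have "q * (e / (8 * q) + e / (8 * q)) = e / 4" if "0 < q" for q :: real using that by (simp add: field_simps)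
    from this[of "real (Suc l)"] show ?thesis unfolding e1_def by (simp only: sum_constant card_atMost)
   qed
   also have "ennreal (e / 2) + 2 * ennreal (e / 4) = ennreal e"
   proof -
    have "2 * ennreal (e / 4) = ennreal (2 * (e / 4))" using e by (simp only: ennreal_mult'' flip: ennreal_numeral)
    then show ?thesis using e by (simp flip: ennreal_plus)
   qed
   finally show ?case using e by (simp add: ennreal_le_iff)
  qed
 qed
qed

text \<open>The rounded quantities have a limit in \<open>n\<close> for each mesh; errors on either side are small for one fine mesh.\<close>

lemma slot_limit:
 assumes acc: "\<And>n. 1 \<le> n \<Longrightarrow> accelerated E Om X P G b \<pi> n x (M n) (Y n) (W n) (U n)"
  and x: "x \<in> space E" and sm: "semi_markov I E \<phi> G b \<pi> \<mu> x Mb J T"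
  and Zm: "\<And>n i. 1 \<le> n \<Longrightarrow> i \<in> {1..N} \<Longrightarrow> Z n (t i) \<in> borel_measurable (M n)"
  and Zs: "\<And>n. 1 \<le> n \<Longrightarrow> solves_upto (M n) (lifetime (piece_len G b X n (W n) (U n)))
    (slow_field F \<phi> (accel_path G b X n (W n) (U n))) z (Z n)"
  and Zbm: "\<And>s. 0 \<le> s \<Longrightarrow> Zb s \<in> borel_measurable Mb"
  and Zbs: "solves_upto Mb (lifetime T) (\<lambda>r v. Gb (the (index_path J T r v))) z Zb"
 shows "(\<lambda>n. \<integral>w. obs (\<lambda>i. Z n (t i) w) * (before (piece_len G b X n (W n) (U n)) l w - before (piece_len G b X n (W n) (U n)) (Suc l) w) \<partial>M n)
  \<longlonglongrightarrow> (\<integral>v. obs (\<lambda>i. Zb (t i) v) * (before T l v - before T (Suc l) v) \<partial>Mb)"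
  (is "?a \<longlonglongrightarrow> ?A")
proof (rule tendstoI)
 fix e :: real assume e: "0 < e"
 note s = semi_markov_facts[OF sm]
 let ?S = "\<lambda>n. piece_len G b X n (W n) (U n)" and ?J = "\<lambda>n k w. \<phi> (Y n k w)"
 let ?c = "\<lambda>r n. \<integral>w. polygon_obs r (?J n) (?S n) (Suc l) w * (early r (?J n) (?S n) l w - early r (?J n) (?S n) (Suc l) w) \<partial>M n"
 let ?C = "\<lambda>r. \<integral>v. polygon_obs r J T (Suc l) v * (early r J T l v - early r J T (Suc l) v) \<partial>Mb"
 define d where "d = e / 12"
 have d: "0 < d" using e by (simp add: d_def)
 have "\<forall>\<^sub>F r in sequentially. 0 < r \<and> (\<forall>\<^sub>F n in sequentially. gap (M n) (Z n) r (?J n) (?S n) l \<le> d) \<and>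
  gap Mb Zb r J T l < d \<and> (\<integral>v. edge r J T l v \<partial>Mb) < d \<and> (\<integral>v. edge r J T (Suc l) v \<partial>Mb) < d"
  by (intro eventually_conj eventually_gt_at_top accelerated_gap[OF acc x sm Zm Zs d]
   order_tendstoD(2)[OF limit_gap[OF sm Zbm Zbs] d] order_tendstoD(2)[OF limit_edge[OF sm] d])
 from eventually_happens'[OF sequentially_bot this]
 obtain r where r: "0 < r" and gap_n: "\<forall>\<^sub>F n in sequentially. gap (M n) (Z n) r (?J n) (?S n) l \<le> d"
  and small: "gap Mb Zb r J T l < d" "(\<integral>v. edge r J T l v \<partial>Mb) < d" "(\<integral>v. edge r J T (Suc l) v \<partial>Mb) < d"
  by blast
 have lim: "\<bar>?A - ?C r\<bar> \<le> gap Mb Zb r J T l + (\<integral>v. edge r J T l v \<partial>Mb) + 3 * (\<integral>v. edge r J T (Suc l) v \<partial>Mb)"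
  by (rule comparison[OF s(1) s(2) s(4) _ r]) (use t_range Zbm in auto)
 have "\<forall>\<^sub>F n in sequentially. dist (?c r n) (?C r) < d"
  by (rule tendstoD[OF polygon_limit[OF acc x sm r] d])
 moreover have "\<forall>\<^sub>F n in sequentially. (\<integral>w. edge r (?J n) (?S n) l w \<partial>M n) < d"
  by (rule order_tendstoD(2)[OF edge_limit[OF acc x sm r] small(2)])
 moreover have "\<forall>\<^sub>F n in sequentially. (\<integral>w. edge r (?J n) (?S n) (Suc l) w \<partial>M n) < d"
  by (rule order_tendstoD(2)[OF edge_limit[OF acc x sm r] small(3)])
 ultimately show "\<forall>\<^sub>F n in sequentially. dist (?a n) ?A < e"
  using gap_n
   eventually_ge_at_top[of 1]
 proof eventually_elim
  case (elim n)
  note a = accelerated_facts[OF acc[OF \<open>1 \<le> n\<close>]]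
  have "\<bar>?a n - ?c r n\<bar> \<le> gap (M n) (Z n) r (?J n) (?S n) l + (\<integral>w. edge r (?J n) (?S n) l w \<partial>M n) + 3 * (\<integral>w. edge r (?J n) (?S n) (Suc l) w \<partial>M n)"
   by (rule comparison[where J="?J n" and S="?S n" and \<zeta>="Z n" and M'="M n", OF a(1) measurable_compose[OF a(2) phi_measurable] piece_len_measurable[OF acc[OF \<open>1 \<le> n\<close>]] Zm[OF \<open>1 \<le> n\<close>] r])
  then show ?case using elim lim small unfolding dist_real_def d_def by linarith
 qed
qed

lemma before_sum: "indicator {ennreal H..} (jump_time S k w) = (\<Sum>l<k. before S l w - before S (Suc l) w)"
proof -
 have "(\<Sum>l<k. before S l w - before S (Suc l) w) = before S 0 w - before S k w" by (rule sum_lessThan_telescope')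
 also have "before S 0 w = 1" using H_pos by (simp add: before_def jump_time_def)
 finally show ?thesis by (simp add: before_def split: split_indicator)
qed

lemma survival_integral:
 assumes M': "prob_space M'" and S: "\<And>k. S k \<in> borel_measurable M'"
  and \<zeta>: "\<And>i. i \<in> {1..N} \<Longrightarrow> \<zeta> (t i) \<in> borel_measurable M'"
 shows "(\<integral>w. obs (\<lambda>i. \<zeta> (t i) w) * indicator {ennreal H..} (jump_time S k w) \<partial>M') =
  (\<Sum>l<k. \<integral>w. obs (\<lambda>i. \<zeta> (t i) w) * (before S l w - before S (Suc l) w) \<partial>M')"
proof -
 have [measurable]: "jump_time S m \<in> borel_measurable M'" for m by (rule jump_time_measurable) (rule S)
 have [measurable]: "before S m \<in> borel_measurable M'" for m unfolding before_def[abs_def] by measurable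
 have [measurable]: "(\<lambda>w. obs (\<lambda>i. \<zeta> (t i) w)) \<in> borel_measurable M'" by (rule obs_measurable) (rule \<zeta>)
 show ?thesis unfolding before_sum sum_distrib_left
 proof (rule Bochner_Integration.integral_sum, rule integrable_bounded[OF M', where B=1])
  show "\<bar>obs (\<lambda>i. \<zeta> (t i) w) * (before S l w - before S (Suc l) w)\<bar> \<le> 1" for l w
   using obs_bound1[of "before S l w - before S (Suc l) w" "\<lambda>i. \<zeta> (t i) w"] before_antimono[of S l w]
   by (simp add: mult.commute before_def split: split_indicator)
 qed measurable
qed

theorem observed_limit:
 assumes acc: "\<And>n. 1 \<le> n \<Longrightarrow> accelerated E Om X P G b \<pi> n x (M n) (Y n) (W n) (U n)"
  and x: "x \<in> space E" and sm: "semi_markov I E \<phi> G b \<pi> \<mu> x Mb J T"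
  and Zm: "\<And>n i. 1 \<le> n \<Longrightarrow> i \<in> {1..N} \<Longrightarrow> Z n (t i) \<in> borel_measurable (M n)"
  and Zs: "\<And>n. 1 \<le> n \<Longrightarrow> solves_upto (M n) (lifetime (piece_len G b X n (W n) (U n)))
    (slow_field F \<phi> (accel_path G b X n (W n) (U n))) z (Z n)"
  and Zbm: "\<And>s. 0 \<le> s \<Longrightarrow> Zb s \<in> borel_measurable Mb"
  and Zbs: "solves_upto Mb (lifetime T) (\<lambda>r v. Gb (the (index_path J T r v))) z Zb"
 shows "(\<lambda>n. \<integral>w. obs (\<lambda>i. Z n (t i) w) * indicator {ennreal H..} (jump_time (piece_len G b X n (W n) (U n)) k w) \<partial>M n)
  \<longlonglongrightarrow> (\<integral>v. obs (\<lambda>i. Zb (t i) v) * indicator {ennreal H..} (jump_time T k v) \<partial>Mb)"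
proof -
 note s = semi_markov_facts[OF sm]
 have "(\<integral>v. obs (\<lambda>i. Zb (t i) v) * indicator {ennreal H..} (jump_time T k v) \<partial>Mb)
  = (\<Sum>l<k. \<integral>v. obs (\<lambda>i. Zb (t i) v) * (before T l v - before T (Suc l) v) \<partial>Mb)"
  by (rule survival_integral[OF s(1) s(4)]) (use t_range Zbm in auto)
 moreover have "(\<lambda>n. \<Sum>l<k. \<integral>w. obs (\<lambda>i. Z n (t i) w) * (before (piece_len G b X n (W n) (U n)) l w - before (piece_len G b X n (W n) (U n)) (Suc l) w) \<partial>M n)
  \<longlonglongrightarrow> (\<Sum>l<k. \<integral>v. obs (\<lambda>i. Zb (t i) v) * (before T l v - before T (Suc l) v) \<partial>Mb)"
  by (intro tendsto_sum slot_limit[OF acc x sm Zm Zs Zbm Zbs])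
 then have "(\<lambda>n. \<integral>w. obs (\<lambda>i. Z n (t i) w) * indicator {ennreal H..} (jump_time (piece_len G b X n (W n) (U n)) k w) \<partial>M n)
  \<longlonglongrightarrow> (\<Sum>l<k. \<integral>v. obs (\<lambda>i. Zb (t i) v) * (before T l v - before T (Suc l) v) \<partial>Mb)"
 proof (rule Lim_transform_eventually)
  show "\<forall>\<^sub>F n in sequentially. (\<Sum>l<k. \<integral>w. obs (\<lambda>i. Z n (t i) w) * (before (piece_len G b X n (W n) (U n)) l w - before (piece_len G b X n (W n) (U n)) (Suc l) w) \<partial>M n)
   = (\<integral>w. obs (\<lambda>i. Z n (t i) w) * indicator {ennreal H..} (jump_time (piece_len G b X n (W n) (U n)) k w) \<partial>M n)"
   using eventually_ge_at_top[of 1]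
  proof eventually_elim
   case (elim n)
   show ?case
    by (rule survival_integral[where S="piece_len G b X n (W n) (U n)" and \<zeta>="Z n" and M'="M n", symmetric, OF accelerated_facts(1)[OF acc[OF elim]] piece_len_measurable[OF acc[OF elim]] Zm[OF elim]])
  qed
 qed
 ultimately show ?thesis by (simp only:)
qed

end

section \<open>Finite-dimensional convergence\<close>

lemma C_b1_bounded_Lipschitz:
 fixes f :: "real^'d \<Rightarrow> real"
 assumes "f \<in> C_b1"
 shows "\<exists>B L. (\<forall>v. \<bar>f v\<bar> \<le> B) \<and> (\<forall>v v'. \<bar>f v - f v'\<bar> \<le> L * norm (v - v'))"
proof -
 obtain g where b: "bounded (range f)" and g: "\<And>y. GDERIV f y :> g y" "bounded (range g)"
  using assms by (auto simp: C_b1_def)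
 obtain B where B: "\<And>v. \<bar>f v\<bar> \<le> B" using b by (auto simp: bounded_iff)
 obtain L where L: "\<And>v. norm (g v) \<le> L" using g(2) by (auto simp: bounded_iff)
 have "norm (f v - f v') \<le> L * norm (v - v')" for v v'
 proof (rule differentiable_bound[of UNIV f "\<lambda>y h. h \<bullet> g y"])
  show "(f has_derivative (\<lambda>h. h \<bullet> g y)) (at y within UNIV)" for y using g(1)[of y] by (simp add: gderiv_def)
  show "onorm (\<lambda>h. h \<bullet> g y) \<le> L" for y
  proof (rule onorm_le)
   fix h
   have "\<bar>h \<bullet> g y\<bar> \<le> norm h * norm (g y)" by (rule Cauchy_Schwarz_ineq2)
   also have "\<dots> \<le> norm h * L" using L by (intro mult_left_mono) auto
   finally show "norm (h \<bullet> g y) \<le> L * norm h" by (simp add: mult.commute)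
  qed
 qed auto
 then show ?thesis using B by (intro exI[of _ B] exI[of _ L]) simp
qed

lemma indicator_survival: "indicator {w. c \<le> \<tau> w} w = indicator {c..} (\<tau> w)"
 by (simp add: indicator_def)

theorem theorem4:
 fixes I :: "'i measure" and Ei :: "'i \<Rightarrow> 'e measure" and E :: "'e measure" and \<phi> :: "'e \<Rightarrow> 'i"
  and Om :: "'o measure" and \<F> :: "real \<Rightarrow> 'o measure"
  and X :: "real \<Rightarrow> 'o \<Rightarrow> 'e" and P :: "'e \<Rightarrow> 'o measure"
  and G :: "real \<Rightarrow> real" and b :: "'e \<Rightarrow> real" and \<pi> :: "'e \<Rightarrow> 'e measure"
  and F :: "'i \<Rightarrow> real^'d \<Rightarrow> 'e \<Rightarrow> real^'d" and \<mu> :: "'i \<Rightarrow> 'e measure"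
  and x :: 'e and z :: "real^'d" and k N :: nat and t :: "nat \<Rightarrow> real"
  and f :: "nat \<Rightarrow> real^'d \<Rightarrow> real"
  and M :: "nat \<Rightarrow> 'w measure" and \<H> :: "nat \<Rightarrow> real \<Rightarrow> 'w measure"
  and Y :: "nat \<Rightarrow> nat \<Rightarrow> 'w \<Rightarrow> 'e" and W :: "nat \<Rightarrow> nat \<Rightarrow> 'w \<Rightarrow> 'o"
  and U :: "nat \<Rightarrow> nat \<Rightarrow> 'w \<Rightarrow> real" and Z :: "nat \<Rightarrow> real \<Rightarrow> 'w \<Rightarrow> real^'d"
  and Mbar :: "'v measure" and J :: "nat \<Rightarrow> 'v \<Rightarrow> 'i" and T :: "nat \<Rightarrow> 'v \<Rightarrow> ennreal"
  and Zbar :: "real \<Rightarrow> 'v \<Rightarrow> real^'d"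
 assumes state: "state_space I Ei E \<phi>"
  and base: "base_process I Ei E Om \<F> X P"
  and G: "abs_cont_cdf G"
  and b: "b \<in> borel_measurable E" "\<And>y. y \<in> space E \<Longrightarrow> 0 \<le> b y"
   "\<And>y. y \<in> space E \<Longrightarrow>
    AE \<omega> in P y. \<exists>\<epsilon>>0. (\<integral>\<^sup>+s\<in>{0..\<epsilon>}. ennreal (b (X s \<omega>)) \<partial>lborel) < \<infinity>"
  and \<pi>: "\<pi> \<in> E \<rightarrow>\<^sub>M prob_algebra E"
  and F: "\<And>i. i \<in> space I \<Longrightarrow> (\<lambda>(y, e). F i y e) \<in> borel_measurable (borel \<Otimes>\<^sub>M E)"
  and \<mu>: "\<And>i. i \<in> space I \<Longrightarrow> prob_space (\<mu> i)"
   "\<And>i. i \<in> space I \<Longrightarrow> sets (\<mu> i) = sets (Ei i)"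
  and limit_measurable:
   "mean_rate \<mu> b \<in> borel_measurable I"
   "\<And>B. B \<in> sets I \<Longrightarrow> (\<lambda>j. jump_prob E \<phi> \<mu> b \<pi> j B) \<in> borel_measurable I"
   "\<And>y. (\<lambda>j. avg_field F \<mu> j y) \<in> borel_measurable I"
  and H1: "\<And>i h y. i \<in> space I \<Longrightarrow> h \<in> class_A (Ei i) X P (\<mu> i) \<Longrightarrow> y \<in> space (Ei i) \<Longrightarrow>
   AE \<omega> in P y. ((\<lambda>r. 1 / r * (LBINT s:{0..r}. h (X s \<omega>))) \<longlongrightarrow> (\<integral>e. h e \<partial>\<mu> i)) at_top"
  and H2: "\<And>r y. 0 \<le> r \<Longrightarrow> y \<in> space E \<Longrightarrow>
   unif_integrable (P y) {1::nat..}
    (\<lambda>n \<omega>. ennreal (1 / real n) * (\<integral>\<^sup>+s\<in>{0..real n * r}. ennreal (b (X s \<omega>)) \<partial>lborel))"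
  and H3: "\<And>j y xj S. j \<in> space I \<Longrightarrow> xj \<in> space (Ei j) \<Longrightarrow> 0 < S \<Longrightarrow>
   (\<lambda>n. SUP r\<in>{0<..}. \<integral>\<^sup>+\<omega>. ennreal (norm
     ((1 / S) *\<^sub>R set_lebesgue_integral lborel {r..r + S} (\<lambda>s. F j y (X (real n * s) \<omega>))
      - avg_field F \<mu> j y)) \<partial>P xj) \<longlonglongrightarrow> 0"
  and H4: "\<And>j. j \<in> space I \<Longrightarrow> bdd_above ((\<lambda>e. norm (F j 0 e)) ` space (Ei j))"
  and H5: "\<And>j. j \<in> space I \<Longrightarrow> \<exists>L. \<forall>e\<in>space (Ei j). L-lipschitz_on UNIV (\<lambda>y. F j y e)"
  and x: "x \<in> space E"
  and accel: "\<And>n. 1 \<le> n \<Longrightarrow> accelerated E Om X P G b \<pi> n x (M n) (Y n) (W n) (U n)"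
  and Z_adapted: "\<And>n. 1 \<le> n \<Longrightarrow>
   adapted_with (M n) (\<H> n) E (accel_path G b X n (W n) (U n)) (Z n)"
  and Z_solves: "\<And>n. 1 \<le> n \<Longrightarrow>
   solves_upto (M n) (lifetime (piece_len G b X n (W n) (U n)))
    (slow_field F \<phi> (accel_path G b X n (W n) (U n))) z (Z n)"
  and limit: "semi_markov I E \<phi> G b \<pi> \<mu> x Mbar J T"
  and Zbar_measurable: "\<And>r. 0 \<le> r \<Longrightarrow> Zbar r \<in> borel_measurable Mbar"
  and Zbar_solves: "solves_upto Mbar (lifetime T)
   (\<lambda>r v. avg_field F \<mu> (the (index_path J T r v))) z Zbar"
  and N: "1 \<le> N" and t: "0 < t 1" "strict_mono_on {1..N} t"
  and k: "1 \<le> k" and f: "\<And>i. i \<in> {1..N} \<Longrightarrow> f i \<in> C_b1"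
 shows "(\<lambda>n. \<integral>w. (\<Prod>i=1..N. f i (Z n (t i) w)) *
       indicator {w. ennreal (t N) \<le> jump_time (piece_len G b X n (W n) (U n)) k w} w \<partial>M n)
    \<longlonglongrightarrow>
    (\<integral>v. (\<Prod>i=1..N. f i (Zbar (t i) v)) *
       indicator {v. ennreal (t N) \<le> jump_time T k v} v \<partial>Mbar)"
proof -
 have "\<forall>i\<in>{1..N}. \<exists>B. \<forall>v. \<bar>f i v\<bar> \<le> B" using f C_b1_bounded_Lipschitz by blast
 from bchoice[OF this] obtain Bf where Bf: "\<And>i v. i \<in> {1..N} \<Longrightarrow> \<bar>f i v\<bar> \<le> Bf i" by blast
 have "\<forall>i\<in>{1..N}. \<exists>L. \<forall>v v'. \<bar>f i v - f i v'\<bar> \<le> L * norm (v - v')" using f C_b1_bounded_Lipschitz by blast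
 from bchoice[OF this] obtain Lf where Lf: "\<And>i v v'. i \<in> {1..N} \<Longrightarrow> \<bar>f i v - f i v'\<bar> \<le> Lf i * norm (v - v')" by blast
 define B where "B = 1 + (\<Sum>i=1..N. \<bar>Bf i\<bar>)"
 define L where "L = (\<Sum>i=1..N. \<bar>Lf i\<bar>)"
 have B1: "1 \<le> B" unfolding B_def by (simp add: sum_nonneg)
 have L0: "0 \<le> L" unfolding L_def by (simp add: sum_nonneg)
 have fB: "\<bar>f i v\<bar> \<le> B" if "i \<in> {1..N}" for i v
 proof -
  have "\<bar>Bf i\<bar> \<le> (\<Sum>i=1..N. \<bar>Bf i\<bar>)" using that by (intro member_le_sum) auto
  then show ?thesis using Bf[OF that, of v] unfolding B_def by linarith
 qed
 have fL: "\<bar>f i v - f i v'\<bar> \<le> L * norm (v - v')" if "i \<in> {1..N}" for i v v'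
 proof -
  have "\<bar>Lf i\<bar> \<le> L" unfolding L_def using that by (intro member_le_sum) auto
  then have "Lf i * norm (v - v') \<le> L * norm (v - v')" by (intro mult_right_mono) auto
  then show ?thesis using Lf[OF that] by (rule order_trans[rotated])
 qed
 have t_mono: "t i \<le> t j" if "i \<in> {1..N}" "j \<in> {1..N}" "i \<le> j" for i j
 proof (cases "i = j")
  case False
  then have "i < j" using that(3) by simp
  then show ?thesis using strict_mono_onD[OF t(2) that(1,2)] by (intro less_imp_le)
 qed simp
 have t_range: "0 \<le> t i \<and> t i \<le> t N" if "i \<in> {1..N}" for i
  using t_mono[of 1 i] t_mono[of i N] t(1) N that by (simp add: order_trans[OF less_imp_le])
 have H_pos: "0 < t N" using t(1) t_mono[of 1 N] N by (intro less_le_trans[of 0 "t 1" "t N"]) simp_all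
 have fB1: "\<bar>f i v / B\<bar> \<le> 1" if "i \<in> {1..N}" for i v
  using fB[OF that, of v] B1 by (simp add: divide_le_eq_1_pos)
 have fL1: "\<bar>f i v / B - f i v' / B\<bar> \<le> L * norm (v - v')" if "i \<in> {1..N}" for i v v'
 proof -
  have "\<bar>f i v / B - f i v' / B\<bar> = \<bar>f i v - f i v'\<bar> / B" unfolding diff_divide_distrib[symmetric] abs_divide using B1 by simp
  also have "\<dots> \<le> \<bar>f i v - f i v'\<bar> / 1" using B1 by (intro divide_left_mono) auto
  finally show ?thesis using fL[OF that, of v v'] by simp
 qed
 interpret observed_model I Ei E \<phi> Om \<F> X P G b \<pi> \<mu> F "\<lambda>i v. f i v / B" t N "t N" L z
  apply (intro observed_model.intro slow_model.intro limit_model.intro base_model.intro limit_model_axioms.intro slow_model_axioms.intro observed_model_axioms.intro)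
  apply (fact state)
  apply (fact base)
  apply (fact G)
  apply (fact b(1))
  apply (fact b(2))
  apply (fact \<pi>)
  apply (fact \<mu>(1))
  apply (fact \<mu>(2))
  apply (fact H1)
  apply (fact H2)
  apply (fact limit_measurable(1))
  apply (fact limit_measurable(2))
  apply (fact F)
  apply (fact limit_measurable(3))
  apply (fact H3)
  apply (fact H4)
  apply (fact H5)
  apply (fact H_pos)
  apply (fact t_range)
  apply (fact fB1)
  apply (fact fL1)
  apply (fact L0)
  done
 have scale: "(\<Prod>i=1..N. f i (c i)) = B ^ N * obs c" for c
  using B1 by (simp add: obs_def prod_dividef)
 have Zm: "Z n (t i) \<in> borel_measurable (M n)" if "1 \<le> n" "i \<in> {1..N}" for n i
 proof -
  have "subalgebra (M n) (\<H> n (t i))" "Z n (t i) \<in> borel_measurable (\<H> n (t i))"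
   using Z_adapted[OF that(1)] t_range[OF that(2)] by (auto simp: adapted_with_def)
  then show ?thesis by (rule measurable_from_subalg)
 qed
 have "(\<lambda>n. B ^ N * (\<integral>w. obs (\<lambda>i. Z n (t i) w) * indicator {ennreal (t N)..} (jump_time (piece_len G b X n (W n) (U n)) k w) \<partial>M n))
  \<longlonglongrightarrow> B ^ N * (\<integral>v. obs (\<lambda>i. Zbar (t i) v) * indicator {ennreal (t N)..} (jump_time T k v) \<partial>Mbar)"
  by (intro tendsto_mult_left observed_limit[OF accel x limit Zm Z_solves Zbar_measurable Zbar_solves])
 then show ?thesis
  unfolding scale indicator_survival mult.assoc integral_mult_right_zero .
qed

end
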